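(* Let $\mathcal V\to M$ be a smooth real vector bundle with a metric, let $\nabla$ be a connection on $\mathcal V$ compatible with the metric, and let $V\subset\mathcal V$ be a subbundle with the induced metric. Let $V^{\perp}$ be the orthogonal complement of $V$ in $\mathcal V$, and let $\pi_1:\mathcal V=V\oplus V^{\perp}\to V$ be the projection to the first factor. If $\mathcal V$ and $V$ are oriented, then $$\mathrm{TMQ}(V,\nabla|_V)=(\pi_1)_*\,\mathrm{TMQ}(\mathcal V,\nabla),$$ where $\nabla|_V$ is the constrained connection and the fiberwise integration $(\pi_1)_*$ is taken according to the complementary orientation on $V^{\perp}$.
   Context: Constrained connection: let $\mathcal V$ be a metric bundle with connection $\nabla$ and let $V\subset\mathcal V$ be a subbundle. Let $Q$ be the unique orthogonal involution-valued bundle endomorphism of $\mathcal V$ whose $(-1)$-eigenspace bundle is $V$ (so its $(+1)$-eigenspace bundle is $V^\perp$). Put $\nabla_Q=\frac12(\nabla+(Q\cdot)\nabla(Q\cdot))=\nabla+\frac12 Q(\nabla Q)\cdot$ . This connection leaves $V$ and $V^\perp$ invariant, and the constrained connection $\nabla|_V$ is the restriction $\nabla_Q|_V$ of $\nabla_Q$ to $V$. Compatible trivializations: for an oriented real vector bundle $E\to M$ of rank $n$ with a metric, a local trivialization with fiber coordinates $x=[x_i]_{i=1}^n$ (a column vector) is called compatible if $dx_1\wedge\ldots\wedge dx_n$ is the orientation form and $x^2=x^\top x=\sum x_i^2$ is the metric. Connection and curvature forms: if $\nabla$ is a connection on $E$ compatible with the metric, then in such a trivialization $\theta=[\theta_{ij}]$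 denotes the matrix of connection $1$-forms, i.e. $\nabla$ is $d+\theta\,\cdot$ as a covariant differential in the coordinates $x$, and $\Omega=d\theta+\theta\theta=[\Omega_{ij}]$ is the matrix of curvature $2$-forms. Mathai-Quillen form: $\mathrm{TMQ}(E,\nabla)$ is the differential form on the total space of $E$ given in any compatible trivialization by $$\pi^{-n/2}e^{-x^2}\sum_{\substack{I\cup I'=\{1,\ldots, n\},\\ |I'|\text{ even}}}(-1)^{(I,I')}(dx+\theta x)_{i_1}\ldots(dx+\theta x)_{i_{|I|}}\;\frac{1}{2^{|I'|}(|I'|/2)!}\sum_{\sigma\in\Sigma_{|I'|}}(-1)^\sigma\,\Omega_{i'_{\sigma(1)},i'_{\sigma(2)}}\ldots\Omega_{i'_{\sigma(|I'|-1)},i'_{\sigma(|I'|)}}$$ (these local expressions agree, by a theorem of Mathai and Quillen, so the form is globally well-defined). Here products are wedge products; the sum is over disjoint $I,I'$ with union $\{1,\ldots,n\}$; $I=\{i_1,\ldots,i_{|I|}\}$ with elements in increasing order, similarly $I'=\{i'_1,\ldots,i'_{|I'|}\}$; $(-1)^{(I,I')}$ is the sign of the permutation which puts the elements of $I$ in front of the elements of $I'$; $\Sigma_k$ is the symmetric group; $u_i$ denotes the $i$-th entry of a column vector $u$; the scalar $\pi$ in $\pi^{-n/2}$ is the number $\pi$. Complementary orientation: the orientation on $V^\perp$ such that the orientation of $V$ followed by that of $V^\perp$ is the orientation of $\mathcal V$. Fiberwise integration: if locally $x_1,\dots,x_k$ are linear fiber coordinates on $V$ and $x_{k+1},\ldots,x_{k+m}$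 are oriented linear fiber coordinates on $V^\perp$, then $(\pi_1)_*$ sends $f\,\pi_1^*\beta\wedge dx_{k+1}\wedge\ldots\wedge dx_{k+m}$ ($\beta$ a form on $V$, $f$ a function rapidly decreasing along the fibers) to $\left(\int f\,dx_{k+1}\cdots dx_{k+m}\right)\beta$, and sends terms containing fewer than $m$ of the differentials $dx_{k+1},\ldots,dx_{k+m}$ to $0$. *)

theory Defs
  imports
    "HOL-Analysis.Analysis"
    "HOL-Combinatorics.Permutations"
    "Jordan_Normal_Form.Determinant"
begin

section \<open>Smooth manifolds and tangent vectors\<close>

text \<open>For an open subset \<open>S\<close> of a finite-dimensional space, this is the usual class
  \<open>C\<^sup>k\<close>.\<close>

primrec Ck_on :: "nat \<Rightarrow> 'a::real_normed_vector set \<Rightarrow> ('a \<Rightarrow> 'b::real_normed_vector) \<Rightarrow> bool" where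
  "Ck_on 0 S f \<longleftrightarrow> continuous_on S f"
| "Ck_on (Suc k) S f \<longleftrightarrow>
     (\<forall>x\<in>S. f differentiable (at x)) \<and> (\<forall>v. Ck_on k S (\<lambda>x. frechet_derivative f (at x) v))"

definition smooth_on :: "'a::real_normed_vector set \<Rightarrow> ('a \<Rightarrow> 'b::real_normed_vector) \<Rightarrow> bool" where
  "smooth_on S f \<longleftrightarrow> (\<forall>k. Ck_on k S f)"

type_synonym ('m, 'e) chart = "'m set \<times> ('m \<Rightarrow> 'e)"

text \<open>A manifold is a Hausdorff second countable type with a smooth atlas. The model space is any
  finite-dimensional inner product space; the class \<^class>\<open>euclidean_space\<close> is not used because it
  excludes dimension \<open>0\<close>.\<close>

definition smooth_manifold ::
  "('m::{t2_space,second_countable_topology}, 'e::real_inner) chart set \<Rightarrow> bool" where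
  "smooth_manifold A \<longleftrightarrow>
     (\<exists>B::'e set. finite B \<and> span B = UNIV) \<and>
     (\<Union>c\<in>A. fst c) = UNIV \<and>
     (\<forall>(U, \<kappa>)\<in>A. open U \<and> open (\<kappa> ` U) \<and> homeomorphism U (\<kappa> ` U) \<kappa> (inv_into U \<kappa>)) \<and>
     (\<forall>(U, \<kappa>)\<in>A. \<forall>(U', \<kappa>')\<in>A. smooth_on (\<kappa> ` (U \<inter> U')) (\<kappa>' \<circ> inv_into U \<kappa>))"

definition smooth_fun :: "('m, 'e::real_inner) chart set \<Rightarrow> 'm set \<Rightarrow> ('m \<Rightarrow> real) \<Rightarrow> bool" where
  "smooth_fun A W f \<longleftrightarrow> (\<forall>(U, \<kappa>)\<in>A. smooth_on (\<kappa> ` (U \<inter> W)) (f \<circ> inv_into U \<kappa>))"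

text \<open>Tangent vectors act as derivations on the functions that are smooth near the given point; on
  other functions they are \<open>0\<close> by convention, so that equality of tangent vectors is equality of
  derivations of germs. \<open>coord_vec A c u w\<close> is the derivation with coordinate vector \<open>w\<close> in the
  chart \<open>c\<close>. For a smooth \<open>f\<close>, \<open>v f\<close> is \<open>df(v)\<close>.\<close>

type_synonym 'm tvec = "('m \<Rightarrow> real) \<Rightarrow> real"

definition coord_vec ::
  "('m::topological_space, 'e::real_inner) chart set \<Rightarrow> ('m, 'e) chart \<Rightarrow> 'm \<Rightarrow> 'e \<Rightarrow> 'm tvec" where
  "coord_vec A c u w = (\<lambda>f.
     if \<exists>W. open W \<and> u \<in> W \<and> smooth_fun A W f
     then frechet_derivative (f \<circ> inv_into (fst c) (snd c)) (at (snd c u)) w else 0)"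

definition tangent_space ::
  "('m::topological_space, 'e::real_inner) chart set \<Rightarrow> 'm \<Rightarrow> 'm tvec set" where
  "tangent_space A u = {coord_vec A c u w | c w. c \<in> A \<and> u \<in> fst c}"

text \<open>The exterior derivative of a \<open>1\<close>-form \<open>\<alpha>\<close>, by
  \<open>d\<alpha>(X, Y) = X(\<alpha>(Y)) - Y(\<alpha>(X)) - \<alpha>([X, Y])\<close> with \<open>X\<close>, \<open>Y\<close> the extensions of \<open>v\<close>, \<open>w\<close> with
  constant coefficients in a chart, so that \<open>[X, Y] = 0\<close>. It does not depend on the chart.\<close>

definition ext_deriv ::
  "('m::topological_space, 'e::real_inner) chart set \<Rightarrow> ('m \<Rightarrow> 'm tvec \<Rightarrow> real) \<Rightarrow>
    'm \<Rightarrow> 'm tvec \<Rightarrow> 'm tvec \<Rightarrow> real" where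
  "ext_deriv A \<alpha> u v w =
     (let c = (SOME c. c \<in> A \<and> u \<in> fst c);
          a = (THE a. coord_vec A c u a = v);
          b = (THE b. coord_vec A c u b = w)
      in v (\<lambda>y. \<alpha> y (coord_vec A c y b)) - w (\<lambda>y. \<alpha> y (coord_vec A c y a)))"


section \<open>Vector bundles\<close>

text \<open>The fibers are linear subspaces of a real vector space \<open>'v\<close>, which serves only to supply the
  vector space operations of the individual fibers: all of the topology and smooth structure of the
  bundle comes from the trivializations, and no relation between the embeddings of different fibers
  is assumed. The total space is the set of pairs \<open>(u, e)\<close> with \<open>e \<in> fib B u\<close>. A trivialization
  \<open>(U, \<phi>)\<close> has the fiber coordinates \<open>x\<^sub>i(u, e) = \<phi> u e i\<close>, indexed from \<open>0\<close> to \<open>rk B - 1\<close>; the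
  space \<open>\<real>\<^sup>n\<close> is \<open>{x :: nat \<Rightarrow> real. \<forall>i\<ge>n. x i = 0}\<close>, as in \<open>Euclidean_space n\<close>.\<close>

type_synonym ('m, 'v) triv = "'m set \<times> ('m \<Rightarrow> 'v \<Rightarrow> nat \<Rightarrow> real)"

record ('m, 'v) vbundle =
  fib :: "'m \<Rightarrow> 'v set"
  rk :: nat
  trivs :: "('m, 'v) triv set"

definition linear_triv :: "('m::topological_space, 'v::real_vector) vbundle \<Rightarrow> ('m, 'v) triv \<Rightarrow> bool" where
  "linear_triv B \<tau> \<longleftrightarrow> (case \<tau> of (U, \<phi>) \<Rightarrow>
     open U \<and>
     (\<forall>u\<in>U. bij_betw (\<phi> u) (fib B u) {x. \<forall>i\<ge>rk B. x i = 0} \<and>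
       (\<forall>e\<in>fib B u. \<forall>e'\<in>fib B u. \<forall>a i. \<phi> u (a *\<^sub>R e + e') i = a * \<phi> u e i + \<phi> u e' i)))"

definition frame :: "('m, 'v) vbundle \<Rightarrow> ('m, 'v) triv \<Rightarrow> 'm \<Rightarrow> nat \<Rightarrow> 'v" where
  "frame B \<tau> u j = inv_into (fib B u) (snd \<tau> u) (\<lambda>i. if i = j then 1 else 0)"

text \<open>Transition functions: \<open>x'\<^sub>i = (\<Sum>j. transition B \<tau> \<tau>' i j * x\<^sub>j)\<close>.\<close>

definition transition ::
  "('m, 'v) vbundle \<Rightarrow> ('m, 'v) triv \<Rightarrow> ('m, 'v) triv \<Rightarrow> nat \<Rightarrow> nat \<Rightarrow> 'm \<Rightarrow> real" where
  "transition B \<tau> \<tau>' i j = (\<lambda>u. snd \<tau>' u (frame B \<tau> u j) i)"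

definition smoothly_related ::
  "('m, 'e::real_inner) chart set \<Rightarrow> ('m, 'v) vbundle \<Rightarrow> ('m, 'v) triv \<Rightarrow> ('m, 'v) triv \<Rightarrow> bool" where
  "smoothly_related A B \<tau> \<tau>' \<longleftrightarrow>
     (\<forall>i<rk B. \<forall>j<rk B. smooth_fun A (fst \<tau> \<inter> fst \<tau>') (transition B \<tau> \<tau>' i j))"

definition vector_bundle ::
  "('m::topological_space, 'e::real_inner) chart set \<Rightarrow> ('m, 'v::real_vector) vbundle \<Rightarrow> bool" where
  "vector_bundle A B \<longleftrightarrow>
     (\<forall>u. subspace (fib B u)) \<and>
     (\<Union>\<tau>\<in>trivs B. fst \<tau>) = UNIV \<and>
     (\<forall>\<tau>\<in>trivs B. linear_triv B \<tau>) \<and>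
     (\<forall>\<tau>\<in>trivs B. \<forall>\<tau>'\<in>trivs B. smoothly_related A B \<tau> \<tau>')"

text \<open>The members of the maximal atlas of trivializations.\<close>

definition local_triv ::
  "('m::topological_space, 'e::real_inner) chart set \<Rightarrow> ('m, 'v::real_vector) vbundle \<Rightarrow>
    ('m, 'v) triv \<Rightarrow> bool" where
  "local_triv A B \<tau> \<longleftrightarrow>
     linear_triv B \<tau> \<and>
     (\<forall>\<tau>'\<in>trivs B. smoothly_related A B \<tau> \<tau>' \<and> smoothly_related A B \<tau>' \<tau>)"

definition smooth_section ::
  "('m, 'e::real_inner) chart set \<Rightarrow> ('m, 'v) vbundle \<Rightarrow> 'm set \<Rightarrow> ('m \<Rightarrow> 'v) \<Rightarrow> bool" where
  "smooth_section A B W s \<longleftrightarrow>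
     (\<forall>u\<in>W. s u \<in> fib B u) \<and>
     (\<forall>(U, \<phi>)\<in>trivs B. \<forall>i<rk B. smooth_fun A (U \<inter> W) (\<lambda>u. \<phi> u (s u) i))"

text \<open>\<open>V\<close> is a vector bundle whose fiberwise inclusion into \<open>E\<close> is smooth.\<close>

definition subbundle ::
  "('m::topological_space, 'e::real_inner) chart set \<Rightarrow>
    ('m, 'v::real_vector) vbundle \<Rightarrow> ('m, 'v) vbundle \<Rightarrow> bool" where
  "subbundle A V E \<longleftrightarrow>
     vector_bundle A V \<and>
     (\<forall>u. fib V u \<subseteq> fib E u) \<and>
     (\<forall>\<tau>\<in>trivs V. \<forall>j<rk V. smooth_section A E (fst \<tau>) (\<lambda>u. frame V \<tau> u j))"

definition bundle_metric ::
  "('m::topological_space, 'e::real_inner) chart set \<Rightarrow> ('m, 'v::real_vector) vbundle \<Rightarrow>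
    ('m \<Rightarrow> 'v \<Rightarrow> 'v \<Rightarrow> real) \<Rightarrow> bool" where
  "bundle_metric A B g \<longleftrightarrow>
     (\<forall>u. \<forall>e\<in>fib B u. \<forall>e'\<in>fib B u.
        g u e e' = g u e' e \<and>
        (\<forall>a. \<forall>e''\<in>fib B u. g u (a *\<^sub>R e + e') e'' = a * g u e e'' + g u e' e'') \<and>
        (e \<noteq> 0 \<longrightarrow> g u e e > 0)) \<and>
     (\<forall>W s t. open W \<longrightarrow> smooth_section A B W s \<longrightarrow> smooth_section A B W t \<longrightarrow>
        smooth_fun A W (\<lambda>u. g u (s u) (t u)))"

text \<open>An orientation assigns to each list of \<open>rk B\<close> vectors of a fiber \<open>1\<close>, \<open>-1\<close> or \<open>0\<close> when it is
  a positive basis, a negative basis or not a basis, and it is locally the orientation defined by the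
  coordinates of some trivialization. In particular, a bundle of rank \<open>0\<close> has exactly one
  orientation, for which the empty basis is positive.\<close>

type_synonym ('m, 'v) orient = "'m \<Rightarrow> 'v list \<Rightarrow> real"

definition orientation ::
  "('m::topological_space, 'e::real_inner) chart set \<Rightarrow> ('m, 'v::real_vector) vbundle \<Rightarrow>
    ('m, 'v) orient \<Rightarrow> bool" where
  "orientation A B ori \<longleftrightarrow>
     (\<forall>u. \<exists>U \<phi>. local_triv A B (U, \<phi>) \<and> u \<in> U \<and>
        (\<forall>w\<in>U. \<forall>b. length b = rk B \<and> set b \<subseteq> fib B w \<longrightarrow>
           ori w b = sgn (Determinant.det (Matrix.mat (rk B) (rk B) (\<lambda>(i, j). \<phi> w (b ! j) i)))))"

text \<open>The orientation of the orthogonal complement of \<open>V\<close> in \<open>E\<close> such that the orientation of \<open>V\<close>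
  followed by it is the orientation of \<open>E\<close>. If \<open>V = E\<close> then the value at the empty basis may be
  \<open>-1\<close>.\<close>

definition complementary_orientation ::
  "('m, 'v) vbundle \<Rightarrow> ('m, 'v) orient \<Rightarrow> ('m, 'v) orient \<Rightarrow> ('m, 'v) orient" where
  "complementary_orientation V oE oV u ys =
     oE u ((SOME xs. length xs = rk V \<and> set xs \<subseteq> fib V u \<and> oV u xs = 1) @ ys)"

definition orthonormal_triv ::
  "('m, 'v) vbundle \<Rightarrow> ('m \<Rightarrow> 'v \<Rightarrow> 'v \<Rightarrow> real) \<Rightarrow> ('m, 'v) triv \<Rightarrow> bool" where
  "orthonormal_triv B g \<tau> \<longleftrightarrow>
     (\<forall>u\<in>fst \<tau>. \<forall>e\<in>fib B u. g u e e = (\<Sum>i<rk B. (snd \<tau> u e i)\<^sup>2))"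

definition compatible_triv ::
  "('m::topological_space, 'e::real_inner) chart set \<Rightarrow> ('m, 'v::real_vector) vbundle \<Rightarrow>
    ('m \<Rightarrow> 'v \<Rightarrow> 'v \<Rightarrow> real) \<Rightarrow> ('m, 'v) orient \<Rightarrow> ('m, 'v) triv \<Rightarrow> bool" where
  "compatible_triv A B g ori \<tau> \<longleftrightarrow>
     local_triv A B \<tau> \<and> orthonormal_triv B g \<tau> \<and>
     (\<forall>u\<in>fst \<tau>. ori u (map (frame B \<tau> u) [0..<rk B]) = 1)"


section \<open>Connections\<close>

text \<open>\<open>nabla s u v\<close> is the covariant derivative of the section \<open>s\<close> at \<open>u\<close> in the direction \<open>v\<close>. It
  is defined for local sections; the arguments are total functions, of which only the germ at \<open>u\<close>
  matters.\<close>

type_synonym ('m, 'v) covd = "('m \<Rightarrow> 'v) \<Rightarrow> 'm \<Rightarrow> 'm tvec \<Rightarrow> 'v"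

definition connection ::
  "('m::topological_space, 'e::real_inner) chart set \<Rightarrow> ('m, 'v::real_vector) vbundle \<Rightarrow>
    ('m, 'v) covd \<Rightarrow> bool" where
  "connection A B nabla \<longleftrightarrow>
     (\<forall>W s. open W \<longrightarrow> smooth_section A B W s \<longrightarrow>
        (\<forall>c\<in>A. \<forall>w. smooth_section A B (fst c \<inter> W) (\<lambda>y. nabla s y (coord_vec A c y w))) \<and>
        (\<forall>u\<in>W. \<forall>v\<in>tangent_space A u.
           nabla s u v \<in> fib B u \<and>
           (\<forall>v'\<in>tangent_space A u. \<forall>a.
              nabla s u (\<lambda>f. a * v f + v' f) = a *\<^sub>R nabla s u v + nabla s u v') \<and>
           (\<forall>t. smooth_section A B W t \<longrightarrow>
              nabla (\<lambda>y. s y + t y) u v = nabla s u v + nabla t u v \<and>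
              ((\<forall>y\<in>W. s y = t y) \<longrightarrow> nabla s u v = nabla t u v)) \<and>
           (\<forall>f. smooth_fun A W f \<longrightarrow>
              nabla (\<lambda>y. f y *\<^sub>R s y) u v = v f *\<^sub>R s u + f u *\<^sub>R nabla s u v)))"

definition metric_connection ::
  "('m::topological_space, 'e::real_inner) chart set \<Rightarrow> ('m, 'v::real_vector) vbundle \<Rightarrow>
    ('m \<Rightarrow> 'v \<Rightarrow> 'v \<Rightarrow> real) \<Rightarrow> ('m, 'v) covd \<Rightarrow> bool" where
  "metric_connection A B g nabla \<longleftrightarrow>
     connection A B nabla \<and>
     (\<forall>W s t. open W \<longrightarrow> smooth_section A B W s \<longrightarrow> smooth_section A B W t \<longrightarrow>
        (\<forall>u\<in>W. \<forall>v\<in>tangent_space A u.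
           v (\<lambda>y. g y (s y) (t y)) = g u (nabla s u v) (t u) + g u (s u) (nabla t u v)))"

text \<open>The orthogonal involution of the fiber of \<open>E\<close> with \<open>(-1)\<close>-eigenspace the fiber of \<open>V\<close>,
  extended by \<open>0\<close> outside the fiber of \<open>E\<close> to make it unique as a function.\<close>

definition constraint_involution ::
  "('m, 'v::real_vector) vbundle \<Rightarrow> ('m, 'v) vbundle \<Rightarrow> ('m \<Rightarrow> 'v \<Rightarrow> 'v \<Rightarrow> real) \<Rightarrow> 'm \<Rightarrow> 'v \<Rightarrow> 'v" where
  "constraint_involution E V g u = (THE q.
     (\<forall>e\<in>fib E u. q e \<in> fib E u \<and> q (q e) = e) \<and>
     (\<forall>e\<in>fib E u. \<forall>e'\<in>fib E u. \<forall>a. q (a *\<^sub>R e + e') = a *\<^sub>R q e + q e') \<and>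
     (\<forall>e\<in>fib E u. \<forall>e'\<in>fib E u. g u (q e) (q e') = g u e e') \<and>
     {e \<in> fib E u. q e = - e} = fib V u \<and>
     (\<forall>e. e \<notin> fib E u \<longrightarrow> q e = 0))"

text \<open>\<open>\<nabla>\<^sub>Q = (\<nabla> + Q \<nabla> Q) / 2\<close>. Since it leaves \<open>V\<close> invariant, its restriction to \<open>V\<close> is the
  same operator, applied to sections of \<open>V\<close>.\<close>

definition constrained_connection ::
  "('m, 'v::real_vector) vbundle \<Rightarrow> ('m, 'v) vbundle \<Rightarrow> ('m \<Rightarrow> 'v \<Rightarrow> 'v \<Rightarrow> real) \<Rightarrow>
    ('m, 'v) covd \<Rightarrow> ('m, 'v) covd" where
  "constrained_connection E V g nabla s u v =
     (let Q = constraint_involution E V g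
      in (1/2) *\<^sub>R (nabla s u v + Q u (nabla (\<lambda>y. Q y (s y)) u v)))"

text \<open>\<open>\<nabla>(\<Sum>j. x\<^sub>j e\<^sub>j) = (\<Sum>i. (dx\<^sub>i + (\<Sum>j. \<theta>\<^sub>i\<^sub>j x\<^sub>j)) e\<^sub>i)\<close> for the frame \<open>e\<close>, that is,
  \<open>\<theta>\<^sub>i\<^sub>j\<close> is the \<open>i\<close>-th coordinate of \<open>\<nabla>e\<^sub>j\<close>.\<close>

definition conn_form ::
  "('m, 'v) vbundle \<Rightarrow> ('m, 'v) covd \<Rightarrow> ('m, 'v) triv \<Rightarrow> nat \<Rightarrow> nat \<Rightarrow> 'm \<Rightarrow> 'm tvec \<Rightarrow> real" where
  "conn_form B nabla \<tau> i j u v = snd \<tau> u (nabla (\<lambda>y. frame B \<tau> y j) u v) i"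

text \<open>\<open>\<Omega> = d\<theta> + \<theta>\<theta>\<close>, with \<open>(\<alpha> \<and> \<beta>)(v, w) = \<alpha>(v) \<beta>(w) - \<alpha>(w) \<beta>(v)\<close> for \<open>1\<close>-forms.\<close>

definition curv_form ::
  "('m::topological_space, 'e::real_inner) chart set \<Rightarrow> ('m, 'v) vbundle \<Rightarrow> ('m, 'v) covd \<Rightarrow>
    ('m, 'v) triv \<Rightarrow> nat \<Rightarrow> nat \<Rightarrow> 'm \<Rightarrow> 'm tvec \<Rightarrow> 'm tvec \<Rightarrow> real" where
  "curv_form A B nabla \<tau> i j u v w =
     (let \<theta> = conn_form B nabla \<tau>
      in ext_deriv A (\<theta> i j) u v w
         + (\<Sum>l<rk B. \<theta> i l u v * \<theta> l j u w - \<theta> i l u w * \<theta> l j u v))"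


section \<open>Differential forms on the total space\<close>

text \<open>A tangent vector \<open>(v, \<xi>)\<close> to the total space at \<open>(u, e)\<close> consists of its image \<open>v\<close> in the
  tangent space at \<open>u\<close> and of its fiber components \<open>\<xi> \<tau> i = dx\<^sub>i(v, \<xi>)\<close> in all the trivializations
  \<open>\<tau>\<close> around \<open>u\<close>, which are related by the derivative of \<open>x' = g x\<close>, namely
  \<open>dx' = dg x + g dx\<close>. The irrelevant components are set to \<open>0\<close>.\<close>

type_synonym ('m, 'v) ttvec = "'m tvec \<times> (('m, 'v) triv \<Rightarrow> nat \<Rightarrow> real)"

definition total_tangent ::
  "('m::topological_space, 'e::real_inner) chart set \<Rightarrow> ('m, 'v::real_vector) vbundle \<Rightarrow>
    'm \<Rightarrow> 'v \<Rightarrow> ('m, 'v) ttvec set" where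
  "total_tangent A B u e = {(v, \<xi>).
     v \<in> tangent_space A u \<and>
     (\<forall>\<tau> \<tau>'. local_triv A B \<tau> \<and> u \<in> fst \<tau> \<and> local_triv A B \<tau>' \<and> u \<in> fst \<tau>' \<longrightarrow>
        (\<forall>i<rk B. \<xi> \<tau>' i =
           (\<Sum>j<rk B. v (transition B \<tau> \<tau>' i j) * snd \<tau> u e j + transition B \<tau> \<tau>' i j u * \<xi> \<tau> j))) \<and>
     (\<forall>\<tau> i. \<not> (local_triv A B \<tau> \<and> u \<in> fst \<tau> \<and> i < rk B) \<longrightarrow> \<xi> \<tau> i = 0)}"

definition tangent_vec ::
  "('m::topological_space, 'e::real_inner) chart set \<Rightarrow> ('m, 'v::real_vector) vbundle \<Rightarrow>
    'm \<Rightarrow> 'v \<Rightarrow> ('m, 'v) triv \<Rightarrow> 'm tvec \<Rightarrow> (nat \<Rightarrow> real) \<Rightarrow> ('m, 'v) ttvec" where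
  "tangent_vec A B u e \<tau> v x =
     (THE t. t \<in> total_tangent A B u e \<and> fst t = v \<and> (\<forall>i<rk B. snd t \<tau> i = x i))"

text \<open>A (possibly inhomogeneous) exterior form on a space of tangent vectors is a function on lists
  of vectors, the values on lists of length \<open>k\<close> being its component of degree \<open>k\<close>. A differential
  form on the total space assigns such a form to every point \<open>(u, e)\<close>. The normalization of the
  wedge product is \<open>(\<alpha>\<^sub>1 \<and> \<dots> \<and> \<alpha>\<^sub>k)(t\<^sub>1, \<dots>, t\<^sub>k) = det [\<alpha>\<^sub>i(t\<^sub>j)]\<close> for \<open>1\<close>-forms.\<close>

type_synonym 't eform = "'t list \<Rightarrow> real"
type_synonym ('m, 'v) dform = "'m \<Rightarrow> 'v \<Rightarrow> ('m, 'v) ttvec eform"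

text \<open>The sign of the permutation that moves the elements of \<open>I\<close> in front of those of \<open>J\<close>, both in
  increasing order, computed from its number of inversions.\<close>

definition shuffle_sign :: "nat set \<Rightarrow> nat set \<Rightarrow> real" where
  "shuffle_sign I J = (-1) ^ card {(i, j) \<in> I \<times> J. j < i}"

definition wedge :: "'t eform \<Rightarrow> 't eform \<Rightarrow> 't eform" where
  "wedge \<alpha> \<beta> ts =
     (\<Sum>S\<in>Pow {..<length ts}.
        shuffle_sign S ({..<length ts} - S) * \<alpha> (nths ts S) * \<beta> (nths ts (- S)))"

definition wedge_list :: "'t eform list \<Rightarrow> 't eform" where
  "wedge_list \<alpha>s = foldr wedge \<alpha>s (\<lambda>ts. if ts = [] then 1 else 0)"

definition form1 :: "('t \<Rightarrow> real) \<Rightarrow> 't eform" where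
  "form1 \<alpha> ts = (if length ts = 1 then \<alpha> (ts ! 0) else 0)"

definition form2 :: "('t \<Rightarrow> 't \<Rightarrow> real) \<Rightarrow> 't eform" where
  "form2 \<beta> ts = (if length ts = 2 then \<beta> (ts ! 0) (ts ! 1) else 0)"


section \<open>The Mathai-Quillen form\<close>

text \<open>The expression in a given trivialization. Indices run from \<open>0\<close>; the form \<open>\<Omega>\<^sub>i\<^sub>j\<close> is pulled back
  along the projection of the bundle.\<close>

definition TMQ_local ::
  "('m::topological_space, 'e::real_inner) chart set \<Rightarrow> ('m, 'v) vbundle \<Rightarrow> ('m, 'v) covd \<Rightarrow>
    ('m, 'v) triv \<Rightarrow> ('m, 'v) dform" where
  "TMQ_local A B nabla \<tau> u e ts =
     (let n = rk B;
          x = snd \<tau> u e;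
          \<theta> = conn_form B nabla \<tau>;
          Dx = (\<lambda>i. form1 (\<lambda>t. snd t \<tau> i + (\<Sum>j<n. \<theta> i j u (fst t) * x j)));
          \<Omega> = (\<lambda>i j. form2 (\<lambda>s t. curv_form A B nabla \<tau> i j u (fst s) (fst t)))
      in pi powr (- real n / 2) * exp (- (\<Sum>i<n. (x i)\<^sup>2)) *
         (\<Sum>I\<in>{I. I \<subseteq> {..<n} \<and> even (card ({..<n} - I))}.
            let I' = {..<n} - I; l = card I'; i' = (\<lambda>r. sorted_list_of_set I' ! r)
            in shuffle_sign I I' *
               wedge (wedge_list (map Dx (sorted_list_of_set I)))
                 (\<lambda>ts. 1 / (2 ^ l * fact (l div 2)) *
                    (\<Sum>\<sigma> | \<sigma> permutes {..<l}. of_int (sign \<sigma>) *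
                       wedge_list (map (\<lambda>r. \<Omega> (i' (\<sigma> (2 * r))) (i' (\<sigma> (2 * r + 1)))) [0..<l div 2]) ts))
                 ts))"

text \<open>All compatible trivializations around \<open>u\<close> give the same value (Mathai and Quillen), so any one
  of them may be used.\<close>

definition TMQ ::
  "('m::topological_space, 'e::real_inner) chart set \<Rightarrow> ('m, 'v::real_vector) vbundle \<Rightarrow>
    ('m \<Rightarrow> 'v \<Rightarrow> 'v \<Rightarrow> real) \<Rightarrow> ('m, 'v) orient \<Rightarrow> ('m, 'v) covd \<Rightarrow> ('m, 'v) dform" where
  "TMQ A B g ori nabla u =
     TMQ_local A B nabla (SOME \<tau>. compatible_triv A B g ori \<tau> \<and> u \<in> fst \<tau>) u"


section \<open>Fiberwise integration\<close>

text \<open>Orthonormal fiber coordinates on \<open>E\<close> of which the first \<open>rk V\<close> are coordinates on \<open>V\<close> and the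
  others coordinates on its orthogonal complement.\<close>

definition splitting_triv ::
  "('m::topological_space, 'e::real_inner) chart set \<Rightarrow> ('m, 'v::real_vector) vbundle \<Rightarrow>
    ('m, 'v) vbundle \<Rightarrow> ('m \<Rightarrow> 'v \<Rightarrow> 'v \<Rightarrow> real) \<Rightarrow> ('m, 'v) triv \<Rightarrow> bool" where
  "splitting_triv A E V g \<tau> \<longleftrightarrow>
     local_triv A E \<tau> \<and> orthonormal_triv E g \<tau> \<and>
     (\<forall>u\<in>fst \<tau>. fib V u = {e \<in> fib E u. \<forall>i\<in>{rk V..<rk E}. snd \<tau> u e i = 0})"

definition restrict_triv :: "nat \<Rightarrow> ('m, 'v) triv \<Rightarrow> ('m, 'v) triv" where
  "restrict_triv k \<tau> = (fst \<tau>, \<lambda>u e i. if i < k then snd \<tau> u e i else 0)"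

text \<open>Integration along the fibers of the projection of \<open>E\<close> to \<open>V\<close>, at \<open>(u, e)\<close> with
  \<open>e \<in> fib V u\<close>. Put \<open>k = rk V\<close>, \<open>n = rk E\<close>, and let \<open>y\<^sub>k, \<dots>, y\<^sub>n\<^sub>-\<^sub>1\<close> be the coordinates on the
  orthogonal complement. In the expansion of \<open>\<omega>\<close> in these coordinates, the coefficient of
  \<open>dy\<^sub>k \<and> \<dots> \<and> dy\<^sub>n\<^sub>-\<^sub>1\<close> (written on the right) is obtained by inserting the vectors
  \<open>\<partial>/\<partial>y\<^sub>k, \<dots>, \<partial>/\<partial>y\<^sub>n\<^sub>-\<^sub>1\<close> in the last slots, which annihilates all terms with fewer differentials
  \<open>dy\<^sub>j\<close>; its value on tangent vectors of \<open>V\<close> is found by lifting these with zero \<open>y\<close>-components.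
  The result does not depend on the coordinates. Coordinates \<open>y\<close> that are negative for the
  orientation \<open>ori\<close> of the orthogonal complement are admitted and accounted for by a sign, because
  an oriented bundle of rank \<open>0\<close> need not have positive ones.\<close>

definition fiber_integral ::
  "('m::topological_space, 'e::real_inner) chart set \<Rightarrow> ('m, 'v::real_vector) vbundle \<Rightarrow>
    ('m, 'v) vbundle \<Rightarrow> ('m \<Rightarrow> 'v \<Rightarrow> 'v \<Rightarrow> real) \<Rightarrow> ('m, 'v) orient \<Rightarrow> ('m, 'v) dform \<Rightarrow> ('m, 'v) dform" where
  "fiber_integral A E V g ori \<omega> u e ts =
     (let k = rk V; n = rk E;
          \<tau> = (SOME \<tau>. splitting_triv A E V g \<tau> \<and> u \<in> fst \<tau>);
          pt = (\<lambda>y. e + (\<Sum>j\<in>{k..<n}. y j *\<^sub>R frame E \<tau> u j));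
          lift = (\<lambda>y t. tangent_vec A E u (pt y) \<tau> (fst t)
                          (\<lambda>i. if i < k then snd t (restrict_triv k \<tau>) i else 0));
          vert = (\<lambda>y j. tangent_vec A E u (pt y) \<tau> (\<lambda>f. 0) (\<lambda>i. if i = j then 1 else 0))
      in ori u (map (frame E \<tau> u) [k..<n]) *
         (\<integral>y. \<omega> u (pt y) (map (lift y) ts @ map (vert y) [k..<n]) \<partial>(\<Pi>\<^sub>M j\<in>{k..<n}. lborel)))"

end

theory Submission
  imports Defs "HOL-Probability.Distributions"
begin

text \<open>
The theorem is a statement about one point \<open>(u, e)\<close> of \<open>V\<close> and becomes a Gaussian integral once the
right coordinates are chosen. Take an orthonormal trivialization of \<open>E\<close> whose first \<open>k\<close> coordinates
are coordinates on \<open>V\<close> and whose last \<open>m\<close> coordinates \<open>y\<^sub>p\<close> are coordinates on the complement. The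
constrained connection is the orthogonal projection of \<open>\<nabla>\<close> to \<open>V\<close>, so its connection matrix is the
upper left block of \<open>\<theta>\<close>. With \<open>s\<^sub>p\<^sub>i = \<theta>\<^sub>i\<^sub>p\<close> for \<open>i < k \<le> p\<close> (the second fundamental form of \<open>V\<close>), the
antisymmetry of \<open>\<theta>\<close> gives the Gauss equation \<open>\<Omega>\<^sub>i\<^sub>j = \<Omega>\<^sup>V\<^sub>i\<^sub>j - \<Sum>\<^sub>p s\<^sub>p\<^sub>i s\<^sub>p\<^sub>j\<close> (\<open>curv_form_restrict\<close>), and the
first \<open>k\<close> entries of \<open>dx + \<theta>x\<close> become \<open>(dx + \<theta>\<^sup>Vx)\<^sub>i + \<Sum>\<^sub>p y\<^sub>p s\<^sub>p\<^sub>i\<close>.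

Only the entries \<open>(dx + \<theta>x)\<^sub>p\<close> with \<open>p \<ge> k\<close> contain the differentials \<open>dy\<^sub>p\<close>. The coefficient of their
product therefore comes from the terms in which all these entries occur, each contributing just
\<open>dy\<^sub>p\<close> (\<open>mq_vertical\<close>). It is the Mathai-Quillen expression of size \<open>k\<close> in the odd elements
\<open>D\<^sub>i + \<Sum>\<^sub>p y\<^sub>p s\<^sub>p\<^sub>i\<close> and the even elements \<open>\<Omega>\<^sup>V\<^sub>i\<^sub>j - \<Sum>\<^sub>p s\<^sub>p\<^sub>i s\<^sub>p\<^sub>j\<close>, times \<open>exp (- \<Sum>\<^sub>p y\<^sub>p\<^sup>2)\<close>, and it must be
integrated over \<open>y\<close>.

The sum over \<open>I\<close> and \<open>I'\<close> is a Berezin integral: up to a sign, it is the coefficient of \<open>\<psi>\<^sub>1 \<dots> \<psi>\<^sub>k\<close> in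
\<open>exp (\<Sum>\<^sub>i \<psi>\<^sub>i D\<^sub>i - \<Sum>\<^sub>i\<^sub>j \<psi>\<^sub>i \<psi>\<^sub>j \<Omega>\<^sub>i\<^sub>j / 4)\<close>, where the \<open>\<psi>\<^sub>i\<close> are further odd generators (\<open>coef_berezin_top\<close>).
Put \<open>t\<^sub>p = \<Sum>\<^sub>i \<psi>\<^sub>i s\<^sub>p\<^sub>i\<close>, an even nilpotent element. The two corrections multiply the exponential by
\<open>exp (y\<^sub>p t\<^sub>p - t\<^sub>p\<^sup>2 / 4)\<close> for each \<open>p\<close>, and since the integral of \<open>exp (- y\<^sup>2 + y t)\<close> is
\<open>sqrt \<pi> exp (t\<^sup>2 / 4)\<close>, integration over \<open>y\<close> removes them and leaves \<open>\<pi>\<^bsup>m/2\<^esup>\<close> (\<open>mq_gaussian\<close>). This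
factor turns \<open>\<pi>\<^bsup>-n/2\<^esup>\<close> into \<open>\<pi>\<^bsup>-k/2\<^esup>\<close>.

The trivializations that occur in the two sides need not be of this kind, so their independence of
the choices is needed as well. A change of orthonormal coordinates by a matrix \<open>G\<close> transforms \<open>dx + \<theta>x\<close>
and \<open>\<Omega>\<close> linearly, and the change of variables in the Berezin integral multiplies the local
expression by \<open>det G\<close> (\<open>TMQ_local_change\<close>), which is the sign that compares the orientations. The
three signs, for \<open>E\<close>, for \<open>V\<close> and for the complement, cancel (\<open>complementary_orientation_frame\<close>).

Forms here are functions on lists of tangent vectors. To compute with them in a ring, the values of
a form on all sublists of a fixed list of vectors are taken as the coefficients of an element of a
Grassmann algebra with one generator for each position in the list (\<open>emb\<close>); wedge products become
products, and the value on the full list is the top coefficient.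
\<close>

section \<open>Signs of shuffles\<close>

lemma shuffle_sign_empty [simp]: "shuffle_sign {} S = 1" "shuffle_sign S {} = 1"
  by (simp_all add: shuffle_sign_def)

lemma shuffle_sign_nonzero [simp]: "shuffle_sign S T \<noteq> 0"
  by (simp add: shuffle_sign_def)

lemma shuffle_sign_mono_eq_1:
  assumes "\<And>i j. i \<in> S \<Longrightarrow> j \<in> T \<Longrightarrow> i \<le> j"
  shows "shuffle_sign S T = 1"
proof -
  have "{(i, j) \<in> S \<times> T. j < i} = {}" using assms by (auto simp: not_less)
  thus ?thesis by (simp only: shuffle_sign_def card.empty power_0)
qed

lemma shuffle_sign_Un_left:
  assumes "finite A" "finite B" "finite C" "A \<inter> B = {}"
  shows "shuffle_sign (A \<union> B) C = shuffle_sign A C * shuffle_sign B C"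
proof -
  have "{(i, j) \<in> (A \<union> B) \<times> C. j < i} = {(i, j) \<in> A \<times> C. j < i} \<union> {(i, j) \<in> B \<times> C. j < i}"
    by auto
  moreover have "card \<dots> = card {(i, j) \<in> A \<times> C. j < i} + card {(i, j) \<in> B \<times> C. j < i}"
    using assms by (intro card_Un_disjoint) (auto intro: finite_subset[of _ "A \<times> C"] finite_subset[of _ "B \<times> C"])
  ultimately show ?thesis by (simp add: shuffle_sign_def power_add)
qed

lemma shuffle_sign_Un_right:
  assumes "finite A" "finite B" "finite C" "B \<inter> C = {}"
  shows "shuffle_sign A (B \<union> C) = shuffle_sign A B * shuffle_sign A C"
proof -
  have "{(i, j) \<in> A \<times> (B \<union> C). j < i} = {(i, j) \<in> A \<times> B. j < i} \<union> {(i, j) \<in> A \<times> C. j < i}"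
    by auto
  moreover have "card \<dots> = card {(i, j) \<in> A \<times> B. j < i} + card {(i, j) \<in> A \<times> C. j < i}"
    using assms by (intro card_Un_disjoint) (auto intro: finite_subset[of _ "A \<times> B"] finite_subset[of _ "A \<times> C"])
  ultimately show ?thesis by (simp add: shuffle_sign_def power_add)
qed

lemma shuffle_sign_swap:
  assumes "finite A" "finite B" "A \<inter> B = {}"
  shows "shuffle_sign B A = (-1) ^ (card A * card B) * shuffle_sign A B"
proof -
  let ?P = "{(i, j) \<in> A \<times> B. j < i}" and ?Q = "{(i, j) \<in> B \<times> A. j < i}"
  have c1: "A \<times> B = ?P \<union> prod.swap ` ?Q" using assms by (auto simp: image_iff)
  have c2: "card (?P \<union> prod.swap ` ?Q) = card ?P + card (prod.swap ` ?Q)"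
    using assms by (intro card_Un_disjoint) (auto intro: finite_subset[of _ "A \<times> B"] finite_subset[of _ "B \<times> A"])
  have c3: "card (prod.swap ` ?Q) = card ?Q" by (intro card_image) auto
  have "card A * card B = card ?P + card ?Q"
    using trans[OF arg_cong[OF c1, of card] c2] c3 by (simp only: card_cartesian_product)
  hence "(-1 :: real) ^ (card A * card B) * (-1) ^ card ?P = (-1) ^ card ?Q * ((-1) ^ card ?P * (-1) ^ card ?P)"
    by (simp add: power_add)
  thus ?thesis by (simp add: shuffle_sign_def flip: power_mult_distrib)
qed

lemma shuffle_sign_strict_mono_image:
  assumes "strict_mono_on X f" "S \<subseteq> X" "T \<subseteq> X"
  shows "shuffle_sign (f ` S) (f ` T) = shuffle_sign S T"
proof -
  have inj: "inj_on f X" using assms(1) by (rule strict_mono_on_imp_inj_on)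
  have lt: "f j < f i \<longleftrightarrow> j < i" if "i \<in> S" "j \<in> T" for i j
    using strict_mono_on_less[OF assms(1)] that assms(2,3) by blast
  have "{(i, j) \<in> f ` S \<times> f ` T. j < i} = map_prod f f ` {(i, j) \<in> S \<times> T. j < i}"
  proof (intro Set.set_eqI iffI)
    fix p assume "p \<in> {(i, j) \<in> f ` S \<times> f ` T. j < i}"
    then obtain i j where "i \<in> S" "j \<in> T" "f j < f i" "p = map_prod f f (i, j)" by auto
    thus "p \<in> map_prod f f ` {(i, j) \<in> S \<times> T. j < i}" using lt by blast
  next
    fix p assume "p \<in> map_prod f f ` {(i, j) \<in> S \<times> T. j < i}"
    then obtain i j where "i \<in> S" "j \<in> T" "j < i" "p = (f i, f j)" by auto
    thus "p \<in> {(i, j) \<in> f ` S \<times> f ` T. j < i}" using lt by auto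
  qed
  moreover have "inj_on (map_prod f f) {(i, j) \<in> S \<times> T. j < i}"
    by (rule inj_on_subset[OF map_prod_inj_on[OF inj inj]]) (use assms in auto)
  ultimately show ?thesis by (simp add: shuffle_sign_def card_image)
qed

section \<open>The Grassmann algebra\<close>

text \<open>The exterior algebra on generators indexed by the natural numbers: \<open>coef x S\<close> is the coefficient of
the product of the generators in \<open>S\<close>, in increasing order. All finite sets may carry coefficients, so
that no support condition has to be preserved; each coefficient of a product is still a finite sum.
On infinite sets, where that sum would be infinite, the coefficients are \<open>0\<close>.\<close>

typedef grassmann = "{f :: nat set \<Rightarrow> real. \<forall>S. infinite S \<longrightarrow> f S = 0}"
  morphisms coef Abs_grassmann
  by (rule exI[of _ "\<lambda>_. 0"]) simp

setup_lifting type_definition_grassmann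

lemma coef_infinite: "infinite S \<Longrightarrow> coef x S = 0"
  using coef[of x] by simp

lemma grassmann_eqI: "(\<And>S. finite S \<Longrightarrow> coef x S = coef y S) \<Longrightarrow> x = y"
  by (metis coef_infinite coef_inject ext)

instantiation grassmann :: ring_1
begin

lift_definition zero_grassmann :: grassmann is "\<lambda>_. 0" by simp
lift_definition one_grassmann :: grassmann is "\<lambda>S. if S = {} then 1 else 0" by auto
lift_definition plus_grassmann :: "grassmann \<Rightarrow> grassmann \<Rightarrow> grassmann" is "\<lambda>x y S. x S + y S" by simp
lift_definition minus_grassmann :: "grassmann \<Rightarrow> grassmann \<Rightarrow> grassmann" is "\<lambda>x y S. x S - y S" by simp
lift_definition uminus_grassmann :: "grassmann \<Rightarrow> grassmann" is "\<lambda>x S. - x S" by simp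
lift_definition times_grassmann :: "grassmann \<Rightarrow> grassmann \<Rightarrow> grassmann"
  is "\<lambda>x y S. \<Sum>T\<in>Pow S. shuffle_sign T (S - T) * x T * y (S - T)" by (simp add: finite_Pow_iff)

instance
proof
  fix a b c :: grassmann
  show "a * b * c = a * (b * c)"
  proof (rule grassmann_eqI)
    fix S :: "nat set" assume fin: "finite S"
    have "coef (a * b * c) S = (\<Sum>T\<in>Pow S. \<Sum>U\<in>Pow T. shuffle_sign T (S - T) * shuffle_sign U (T - U) * coef a U * coef b (T - U) * coef c (S - T))"
      by (simp add: times_grassmann.rep_eq sum_distrib_left sum_distrib_right mult_ac)
    also have "\<dots> = (\<Sum>(T, U)\<in>Sigma (Pow S) Pow. shuffle_sign T (S - T) * shuffle_sign U (T - U) * coef a U * coef b (T - U) * coef c (S - T))"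
      using fin by (subst sum.Sigma) (auto intro: finite_subset)
    also have "\<dots> = (\<Sum>(U, W)\<in>Sigma (Pow S) (\<lambda>U. Pow (S - U)). shuffle_sign U (S - U) * shuffle_sign W (S - U - W) * coef a U * coef b W * coef c (S - U - W))"
    proof (rule sum.reindex_bij_witness[where i = "\<lambda>(U, W). (U \<union> W, U)" and j = "\<lambda>(T, U). (U, T - U)"])
      fix p assume "p \<in> Sigma (Pow S) Pow"
      then obtain T U where p: "p = (T, U)" "U \<subseteq> T" "T \<subseteq> S" by auto
      hence f: "finite U" "finite (T - U)" "finite (S - T)" using fin by (auto intro: finite_subset)
      have e: "S - U = (T - U) \<union> (S - T)" "T = U \<union> (T - U)" "S - U - (T - U) = S - T" using p by auto
      have "shuffle_sign T (S - T) * shuffle_sign U (T - U) = shuffle_sign U (S - T) * shuffle_sign (T - U) (S - T) * shuffle_sign U (T - U)"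
        using f p by (subst e(2), subst shuffle_sign_Un_left) auto
      moreover have "shuffle_sign U (S - U) = shuffle_sign U (T - U) * shuffle_sign U (S - T)"
        using f p by (subst e(1), subst shuffle_sign_Un_right) auto
      ultimately have "shuffle_sign T (S - T) * shuffle_sign U (T - U) = shuffle_sign U (S - U) * shuffle_sign (T - U) (S - T)"
        by simp
      thus "(case case p of (T, U) \<Rightarrow> (U, T - U) of (U, W) \<Rightarrow> shuffle_sign U (S - U) * shuffle_sign W (S - U - W) * coef a U * coef b W * coef c (S - U - W)) =
            (case p of (T, U) \<Rightarrow> shuffle_sign T (S - T) * shuffle_sign U (T - U) * coef a U * coef b (T - U) * coef c (S - T))"
        using p e(3) by simp
    qed auto
    also have "\<dots> = (\<Sum>U\<in>Pow S. \<Sum>W\<in>Pow (S - U). shuffle_sign U (S - U) * shuffle_sign W (S - U - W) * coef a U * coef b W * coef c (S - U - W))"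
      using fin by (subst sum.Sigma) auto
    also have "\<dots> = coef (a * (b * c)) S"
      by (simp add: times_grassmann.rep_eq sum_distrib_left mult_ac)
    finally show "coef (a * b * c) S = coef (a * (b * c)) S" .
  qed
  show "1 * a = a"
  proof (rule grassmann_eqI)
    fix S :: "nat set" assume fin: "finite S"
    have "coef (1 * a) S = (\<Sum>T\<in>Pow S. if T = {} then coef a S else 0)"
      unfolding times_grassmann.rep_eq one_grassmann.rep_eq by (intro sum.cong) auto
    thus "coef (1 * a) S = coef a S" using fin by simp
  qed
  show "a * 1 = a"
  proof (rule grassmann_eqI)
    fix S :: "nat set" assume fin: "finite S"
    have "coef (a * 1) S = (\<Sum>T\<in>Pow S. if T = S then coef a S else 0)"
      unfolding times_grassmann.rep_eq one_grassmann.rep_eq by (intro sum.cong) auto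
    thus "coef (a * 1) S = coef a S" using fin by simp
  qed
  show "(a + b) * c = a * c + b * c"
    by transfer (auto simp: sum.distrib algebra_simps)
  show "a * (b + c) = a * b + a * c"
    by transfer (auto simp: sum.distrib algebra_simps)
  show "(0::grassmann) \<noteq> 1" by transfer (metis zero_neq_one)
qed (transfer; auto simp: algebra_simps)+

end

instantiation grassmann :: real_algebra_1
begin

lift_definition scaleR_grassmann :: "real \<Rightarrow> grassmann \<Rightarrow> grassmann" is "\<lambda>r x S. r * x S" by simp

instance
  by standard (transfer; auto simp: algebra_simps sum_distrib_left)+

end

lemmas coef_simps [simp] = zero_grassmann.rep_eq plus_grassmann.rep_eq minus_grassmann.rep_eq
  uminus_grassmann.rep_eq scaleR_grassmann.rep_eq

lemma coef_sum [simp]: "coef (sum f I) S = (\<Sum>i\<in>I. coef (f i) S)"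
  by (induction I rule: infinite_finite_induct) auto

lemma coef_one: "coef 1 S = (if S = {} then 1 else 0)"
  by (simp add: one_grassmann.rep_eq)

lemma coef_times: "coef (x * y) S = (\<Sum>T\<in>Pow S. shuffle_sign T (S - T) * coef x T * coef y (S - T))"
  by (simp add: times_grassmann.rep_eq)

lemma coef_times_nonzero:
  assumes "coef (x * y) S \<noteq> 0"
  obtains T where "finite S" "T \<subseteq> S" "coef x T \<noteq> 0" "coef y (S - T) \<noteq> 0"
proof -
  have "finite S" using assms coef_infinite by blast
  moreover from assms obtain T where "T \<in> Pow S" "shuffle_sign T (S - T) * coef x T * coef y (S - T) \<noteq> 0"
    unfolding coef_times by (meson sum.neutral)
  ultimately show thesis using that by auto
qed

definition in_vars :: "nat set \<Rightarrow> grassmann \<Rightarrow> bool" where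
  "in_vars X x \<longleftrightarrow> (\<forall>S. coef x S \<noteq> 0 \<longrightarrow> S \<subseteq> X)"

text \<open>The degree in the generators from \<open>Y\<close> alone.\<close>

definition deg_le :: "nat set \<Rightarrow> nat \<Rightarrow> grassmann \<Rightarrow> bool" where
  "deg_le Y d x \<longleftrightarrow> (\<forall>S. coef x S \<noteq> 0 \<longrightarrow> card (S \<inter> Y) \<le> d)"

definition has_parity :: "bool \<Rightarrow> grassmann \<Rightarrow> bool" where
  "has_parity b x \<longleftrightarrow> (\<forall>S. coef x S \<noteq> 0 \<longrightarrow> odd (card S) = b)"

abbreviation "even_elem \<equiv> has_parity False"
abbreviation "odd_elem \<equiv> has_parity True"

lift_definition gen :: "nat \<Rightarrow> grassmann" is "\<lambda>i S. if S = {i} then 1 else 0" by auto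

lemma coef_gen: "coef (gen i) S = (if S = {i} then 1 else 0)"
  by (simp add: gen.rep_eq)

lemma in_vars_zero [simp, intro]: "in_vars X 0"
  and in_vars_one [simp, intro]: "in_vars X 1"
  and in_vars_gen: "i \<in> X \<Longrightarrow> in_vars X (gen i)"
  and in_vars_add: "in_vars X x \<Longrightarrow> in_vars X y \<Longrightarrow> in_vars X (x + y)"
  and in_vars_diff: "in_vars X x \<Longrightarrow> in_vars X y \<Longrightarrow> in_vars X (x - y)"
  and in_vars_scaleR: "in_vars X x \<Longrightarrow> in_vars X (r *\<^sub>R x)"
  and in_vars_mono: "in_vars X x \<Longrightarrow> X \<subseteq> Y \<Longrightarrow> in_vars Y x"
  unfolding in_vars_def coef_one coef_gen by (auto split: if_splits, force+)

lemma in_vars_mult: "in_vars X x \<Longrightarrow> in_vars X y \<Longrightarrow> in_vars X (x * y)"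
  unfolding in_vars_def by (metis Diff_partition Un_least coef_times_nonzero)

lemma in_vars_sum: "(\<And>i. i \<in> I \<Longrightarrow> in_vars X (f i)) \<Longrightarrow> in_vars X (sum f I)"
  by (induction I rule: infinite_finite_induct) (auto intro: in_vars_add)

lemma in_vars_prod_list: "(\<And>x. x \<in> set xs \<Longrightarrow> in_vars X x) \<Longrightarrow> in_vars X (prod_list xs)"
  by (induction xs) (auto intro: in_vars_mult)

lemma has_parity_zero [simp, intro]: "has_parity b 0"
  and even_one [simp, intro]: "even_elem 1"
  and odd_gen [simp, intro]: "odd_elem (gen i)"
  and has_parity_add: "has_parity b x \<Longrightarrow> has_parity b y \<Longrightarrow> has_parity b (x + y)"
  and has_parity_diff: "has_parity b x \<Longrightarrow> has_parity b y \<Longrightarrow> has_parity b (x - y)"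
  and has_parity_scaleR: "has_parity b x \<Longrightarrow> has_parity b (r *\<^sub>R x)"
  unfolding has_parity_def coef_one coef_gen by (auto split: if_splits, force+)

lemma has_parity_mult:
  assumes "has_parity b x" "has_parity c y"
  shows "has_parity (b \<noteq> c) (x * y)"
  unfolding has_parity_def
proof (intro allI impI)
  fix S assume "coef (x * y) S \<noteq> 0"
  then obtain T where T: "finite S" "T \<subseteq> S" "coef x T \<noteq> 0" "coef y (S - T) \<noteq> 0"
    by (rule coef_times_nonzero)
  hence "card S = card T + card (S - T)"
    by (metis card_Diff_subset card_mono finite_subset le_add_diff_inverse)
  moreover have "odd (card T) = b" "odd (card (S - T)) = c"
    using T assms by (auto simp: has_parity_def)
  ultimately show "odd (card S) = (b \<noteq> c)" by auto
qed

lemma even_mult: "even_elem x \<Longrightarrow> even_elem y \<Longrightarrow> even_elem (x * y)"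
  and odd_mult_odd: "odd_elem x \<Longrightarrow> odd_elem y \<Longrightarrow> even_elem (x * y)"
  using has_parity_mult[of False x False y] has_parity_mult[of True x True y] has_parity_mult[of False x True y]
  by auto

lemma has_parity_sum: "(\<And>i. i \<in> I \<Longrightarrow> has_parity b (f i)) \<Longrightarrow> has_parity b (sum f I)"
  by (induction I rule: infinite_finite_induct) (auto intro: has_parity_add)

lemma parity_prod_list: "(\<And>x. x \<in> set xs \<Longrightarrow> odd_elem x) \<Longrightarrow> has_parity (odd (length xs)) (prod_list xs)"
proof (induction xs)
  case (Cons a xs)
  thus ?case using has_parity_mult[of True a "odd (length xs)" "prod_list xs"] by auto
qed simp

lemma even_power: "even_elem x \<Longrightarrow> even_elem (x ^ k)"
  by (induction k) (auto intro: even_mult)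

text \<open>The shuffle signs of \<open>(T, S - T)\<close> and \<open>(S - T, T)\<close> differ by \<open>-1\<close> to the product of the
cardinalities, which is odd exactly when both cardinalities are.\<close>

lemma parity_commute:
  assumes "has_parity b x" "has_parity c y"
  shows "y * x = (if b \<and> c then -1 else 1) *\<^sub>R (x * y)"
proof (rule grassmann_eqI)
  fix S :: "nat set" assume fin: "finite S"
  have "coef (y * x) S = (\<Sum>T\<in>Pow S. shuffle_sign T (S - T) * coef y T * coef x (S - T))"
    by (rule coef_times)
  also have "\<dots> = (\<Sum>T\<in>Pow S. shuffle_sign (S - T) T * coef y (S - T) * coef x T)"
    by (rule sum.reindex_bij_witness[of _ "\<lambda>T. S - T" "\<lambda>T. S - T"]) (auto simp: double_diff)
  also have "\<dots> = (\<Sum>T\<in>Pow S. (if b \<and> c then -1 else 1) * (shuffle_sign T (S - T) * coef x T * coef y (S - T)))"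
  proof (rule sum.cong)
    fix T assume T: "T \<in> Pow S"
    show "shuffle_sign (S - T) T * coef y (S - T) * coef x T = (if b \<and> c then -1 else 1) * (shuffle_sign T (S - T) * coef x T * coef y (S - T))"
    proof (cases "coef x T = 0 \<or> coef y (S - T) = 0")
      case False
      hence p: "odd (card T) = b" "odd (card (S - T)) = c" using assms by (auto simp: has_parity_def)
      have "shuffle_sign (S - T) T = (-1) ^ (card T * card (S - T)) * shuffle_sign T (S - T)"
        using T fin by (intro shuffle_sign_swap) (auto intro: finite_subset)
      also have "(-1 :: real) ^ (card T * card (S - T)) = (if b \<and> c then -1 else 1)"
        using p by (auto simp: minus_one_power_iff)
      finally show ?thesis by simp
    qed auto
  qed simp
  also have "\<dots> = coef ((if b \<and> c then -1 else 1) *\<^sub>R (x * y)) S"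
    by (simp add: coef_times sum_distrib_left)
  finally show "coef (y * x) S = coef ((if b \<and> c then -1 else 1) *\<^sub>R (x * y)) S" .
qed

lemma even_commute: "even_elem x \<Longrightarrow> has_parity b y \<Longrightarrow> x * y = y * x"
  using parity_commute[of False x b y] by auto

lemma even_commute_all:
  assumes "even_elem x" shows "x * y = y * x"
proof -
  have "\<exists>y0 y1. y = y0 + y1 \<and> even_elem y0 \<and> odd_elem y1"
  proof (intro exI conjI)
    let ?f = "\<lambda>b. Abs_grassmann (\<lambda>S. if odd (card S) = b then coef y S else 0)"
    have c: "coef (?f b) S = (if odd (card S) = b then coef y S else 0)" for b S
      by (subst Abs_grassmann_inverse) (auto simp: coef_infinite)
    show "y = ?f False + ?f True" by (rule grassmann_eqI) (simp only: coef_simps c, simp)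
    show "even_elem (?f False)" "odd_elem (?f True)" by (simp_all only: has_parity_def c, auto)
  qed
  thus ?thesis using even_commute[OF assms] by (metis distrib_left distrib_right)
qed

lemma odd_anticommute: "odd_elem x \<Longrightarrow> odd_elem y \<Longrightarrow> y * x = - (x * y)"
  using parity_commute[of True x True y] by simp

lemma odd_square: "odd_elem x \<Longrightarrow> x * x = 0"
  using odd_anticommute[of x x] by (metis add.right_inverse scaleR_eq_0_iff scaleR_2 zero_neq_numeral)

lemma deg_le_mult:
  assumes "deg_le Y d x" "deg_le Y d' y"
  shows "deg_le Y (d + d') (x * y)"
  unfolding deg_le_def
proof safe
  fix S assume "coef (x * y) S \<noteq> 0"
  then obtain T where T: "finite S" "T \<subseteq> S" "coef x T \<noteq> 0" "coef y (S - T) \<noteq> 0"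
    by (rule coef_times_nonzero)
  have "S \<inter> Y = (T \<inter> Y) \<union> ((S - T) \<inter> Y)" using T by auto
  hence "card (S \<inter> Y) \<le> card (T \<inter> Y) + card ((S - T) \<inter> Y)" by (metis card_Un_le)
  also have "\<dots> \<le> d + d'" using T assms by (intro add_mono) (auto simp: deg_le_def)
  finally show "card (S \<inter> Y) \<le> d + d'" .
qed

lemma deg_le_one: "deg_le Y 0 1"
  by (auto simp: deg_le_def coef_one split: if_splits)

lemma deg_le_0: "in_vars X x \<Longrightarrow> X \<inter> Y = {} \<Longrightarrow> deg_le Y 0 x"
  unfolding deg_le_def in_vars_def by (metis card.empty inf.absorb_iff2 inf_assoc inf_bot_right inf_commute le_zero_eq)

lemma deg_le_sum:
  "(\<And>i. i \<in> I \<Longrightarrow> deg_le Y d (f i)) \<Longrightarrow> deg_le Y d (sum f I)"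
  unfolding deg_le_def by (metis (no_types, lifting) coef_sum sum.neutral)

lemma deg_le_scaleR: "deg_le Y d x \<Longrightarrow> deg_le Y d (r *\<^sub>R x)"
  unfolding deg_le_def by auto

lemma deg_le_gen: "deg_le Y 1 (gen i)"
  unfolding deg_le_def coef_gen using card_mono[of "{i}"] by (auto split: if_splits)

lemma deg_le_prod_list: "(\<And>x. x \<in> set xs \<Longrightarrow> deg_le Y 1 x) \<Longrightarrow> deg_le Y (length xs) (prod_list xs)"
proof (induction xs)
  case (Cons a xs)
  thus ?case using deg_le_mult[of Y 1 a "length xs" "prod_list xs"] by auto
qed (simp add: deg_le_one)

lemma coef_mult_split:
  assumes "in_vars S x" "in_vars T y" "S \<inter> T = {}" "finite S" "finite T"
  shows "coef (x * y) (S \<union> T) = shuffle_sign S T * coef x S * coef y T"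
proof -
  have "coef (x * y) (S \<union> T) = (\<Sum>U\<in>Pow (S \<union> T). if U = S then shuffle_sign S T * coef x S * coef y T else 0)"
    unfolding coef_times
  proof (rule sum.cong)
    fix U assume U: "U \<in> Pow (S \<union> T)"
    have *: "U = S" if "coef x U \<noteq> 0" "coef y ((S \<union> T) - U) \<noteq> 0"
    proof -
      have "U \<subseteq> S" "(S \<union> T) - U \<subseteq> T" using that assms(1,2) unfolding in_vars_def by blast+
      thus ?thesis using assms(3) by auto
    qed
    have "(S \<union> T) - S = T" using assms by auto
    thus "shuffle_sign U (S \<union> T - U) * coef x U * coef y (S \<union> T - U) = (if U = S then shuffle_sign S T * coef x S * coef y T else 0)"
      using * by auto
  qed simp
  thus ?thesis using assms by simp
qed

lemma coef_prod_gen: "coef (prod_list (map gen [a..<a+n])) {a..<a+n} = 1"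
proof (induction n)
  case 0 thus ?case by (simp add: coef_one)
next
  case (Suc n)
  have "coef (prod_list (map gen [a..<a+n]) * gen (a+n)) ({a..<a+n} \<union> {a+n}) =
     shuffle_sign {a..<a+n} {a+n} * coef (prod_list (map gen [a..<a+n])) {a..<a+n} * coef (gen (a+n)) {a+n}"
    by (rule coef_mult_split) (auto intro!: in_vars_prod_list in_vars_gen)
  moreover have "{a..<a+n} \<union> {a+n} = {a..<a + Suc n}" by auto
  moreover have "shuffle_sign {a..<a+n} {a+n} = 1" by (rule shuffle_sign_mono_eq_1) auto
  ultimately show ?case using Suc by (simp add: coef_gen)
qed

section \<open>Forms on lists as elements of the Grassmann algebra\<close>

text \<open>The algebra contains one generator for each position in \<open>ts\<close>, and sets of positions correspond to
sublists. In this way identities between forms, which are mere functions on lists, become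
computations in a ring.\<close>

lift_definition emb :: "'t list \<Rightarrow> 't eform \<Rightarrow> grassmann"
  is "\<lambda>ts \<alpha> S. if S \<subseteq> {..<length ts} then \<alpha> (nths ts S) else 0"
  using finite_subset by auto

lemma coef_emb: "coef (emb ts \<alpha>) S = (if S \<subseteq> {..<length ts} then \<alpha> (nths ts S) else 0)"
  by (simp add: emb.rep_eq)

lemma coef_emb_top: "coef (emb ts \<alpha>) {..<length ts} = \<alpha> ts"
  by (simp add: coef_emb)

lemma in_vars_emb: "in_vars {..<length ts} (emb ts \<alpha>)"
  by (auto simp: in_vars_def coef_emb split: if_splits)

lemma length_nths_subset: "S \<subseteq> {..<length ts} \<Longrightarrow> length (nths ts S) = card S"
proof -
  assume "S \<subseteq> {..<length ts}"
  hence "{i. i < length ts \<and> i \<in> S} = S" by auto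
  thus ?thesis by (simp add: length_nths)
qed

text \<open>A sublist of a sublist of \<open>ts\<close> is a sublist of \<open>ts\<close>. The enumeration of the positions of the larger
one is increasing and so preserves shuffle signs, whence the two sums over subsets agree.\<close>

lemma emb_wedge: "emb ts (wedge \<alpha> \<beta>) = emb ts \<alpha> * emb ts \<beta>"
proof (rule grassmann_eqI)
  fix S :: "nat set" assume fin: "finite S"
  show "coef (emb ts (wedge \<alpha> \<beta>)) S = coef (emb ts \<alpha> * emb ts \<beta>) S"
  proof (cases "S \<subseteq> {..<length ts}")
    case False
    thus ?thesis
      using in_vars_mult[OF in_vars_emb in_vars_emb, of ts \<alpha> \<beta>] by (auto simp: in_vars_def coef_emb)
  next
    case True
    \<comment> \<open>\<open>r i\<close> is the position of \<open>i\<close> in the increasing enumeration of \<open>S\<close>.\<close>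
    define r where "r = (\<lambda>i. card {i' \<in> S. i' < i})"
    have mono: "strict_mono_on S r"
    proof (rule strict_mono_onI)
      fix i j assume ij: "i \<in> S" "j \<in> S" "i < j"
      hence "{i' \<in> S. i' < i} \<subset> {i' \<in> S. i' < j}" by auto
      thus "r i < r j" unfolding r_def using fin by (intro psubset_card_mono) auto
    qed
    have inj: "inj_on r S" using mono by (rule strict_mono_on_imp_inj_on)
    have "r ` S \<subseteq> {..<card S}"
    proof safe
      fix i assume "i \<in> S"
      hence "{i' \<in> S. i' < i} \<subset> S" by auto
      thus "r i < card S" unfolding r_def using fin by (intro psubset_card_mono) auto
    qed
    hence img: "r ` S = {..<card S}" using card_image[OF inj] by (intro card_subset_eq) auto
    have nn: "nths (nths ts S) T = nths ts {i \<in> S. r i \<in> T}" for T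
      by (simp add: nths_nths r_def)
    have "coef (emb ts (wedge \<alpha> \<beta>)) S =
       (\<Sum>T\<in>Pow {..<card S}. shuffle_sign T ({..<card S} - T) * \<alpha> (nths (nths ts S) T) * \<beta> (nths (nths ts S) (- T)))"
      using True by (simp add: coef_emb wedge_def length_nths_subset)
    also have "\<dots> = (\<Sum>U\<in>Pow S. shuffle_sign U (S - U) * \<alpha> (nths ts U) * \<beta> (nths ts (S - U)))"
    proof (rule sum.reindex_bij_witness[of _ "\<lambda>U. r ` U" "\<lambda>T. {i \<in> S. r i \<in> T}"])
      fix T assume T: "T \<in> Pow {..<card S}"
      let ?U = "{i \<in> S. r i \<in> T}"
      show im: "r ` ?U = T" using T img by (auto simp: image_iff)
      have "S - ?U = {i \<in> S. r i \<in> - T}" by auto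
      hence n2: "nths (nths ts S) (- T) = nths ts (S - ?U)" by (simp add: nn)
      have "r ` (S - ?U) = {..<card S} - T"
        using inj_on_image_set_diff[OF inj, of S ?U] im img by auto
      hence "shuffle_sign T ({..<card S} - T) = shuffle_sign ?U (S - ?U)"
        using shuffle_sign_strict_mono_image[OF mono, of ?U "S - ?U"] im by auto
      thus "shuffle_sign ?U (S - ?U) * \<alpha> (nths ts ?U) * \<beta> (nths ts (S - ?U)) =
        shuffle_sign T ({..<card S} - T) * \<alpha> (nths (nths ts S) T) * \<beta> (nths (nths ts S) (- T))"
        using n2 nn[of T] by simp
    next
      fix U assume "U \<in> Pow S"
      thus "{i \<in> S. r i \<in> r ` U} = U" using inj by (auto simp: inj_on_def)
      show "r ` U \<in> Pow {..<card S}" using \<open>U \<in> Pow S\<close> img by auto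
    qed auto
    also have "\<dots> = coef (emb ts \<alpha> * emb ts \<beta>) S"
      unfolding coef_times using True by (intro sum.cong) (auto simp: coef_emb subset_iff)
    finally show ?thesis .
  qed
qed

lemma emb_one: "emb ts (\<lambda>ts. if ts = [] then 1 else 0) = 1"
proof (rule grassmann_eqI)
  fix S :: "nat set"
  have "S \<subseteq> {..<length ts} \<Longrightarrow> nths ts S = [] \<longleftrightarrow> S = {}"
    using length_nths_subset[of S ts] finite_subset[of S "{..<length ts}"] by auto
  thus "coef (emb ts (\<lambda>ts. if ts = [] then 1 else 0)) S = coef 1 S"
    by (auto simp: coef_emb coef_one)
qed

lemma emb_wedge_list: "emb ts (wedge_list \<alpha>s) = prod_list (map (emb ts) \<alpha>s)"
  unfolding wedge_list_def by (induction \<alpha>s) (simp_all add: emb_one emb_wedge)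

lemma emb_sum: "emb ts (\<lambda>ts. \<Sum>i\<in>I. \<alpha> i ts) = (\<Sum>i\<in>I. emb ts (\<alpha> i))"
  by (rule grassmann_eqI) (simp add: coef_emb)

lemma emb_scale: "emb ts (\<lambda>ts. c * \<alpha> ts) = c *\<^sub>R emb ts \<alpha>"
  by (rule grassmann_eqI) (simp add: coef_emb)

lemma odd_emb_form1: "odd_elem (emb ts (form1 \<alpha>))"
  unfolding has_parity_def by (auto simp: coef_emb form1_def length_nths_subset split: if_splits)

lemma even_emb_form2: "even_elem (emb ts (form2 \<beta>))"
  unfolding has_parity_def by (auto simp: coef_emb form2_def length_nths_subset split: if_splits)

lemma nths_in_set: "x \<in> set (nths ts S) \<Longrightarrow> x \<in> set ts"
  using set_nths_subset[of ts S] by blast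

lemma emb_form1_sum:
  assumes "\<And>t. t \<in> set ts \<Longrightarrow> \<alpha> t = (\<Sum>j\<in>I. c j * \<beta> j t)"
  shows "emb ts (form1 \<alpha>) = (\<Sum>j\<in>I. c j *\<^sub>R emb ts (form1 (\<beta> j)))"
proof (rule grassmann_eqI)
  fix S :: "nat set"
  have "form1 \<alpha> (nths ts S) = (\<Sum>j\<in>I. c j * form1 (\<beta> j) (nths ts S))"
  proof (cases "length (nths ts S) = 1")
    case True
    hence "nths ts S ! 0 \<in> set (nths ts S)" by (intro nth_mem) simp
    hence "nths ts S ! 0 \<in> set ts" by (rule nths_in_set)
    thus ?thesis using True assms by (simp add: form1_def)
  qed (simp add: form1_def)
  thus "coef (emb ts (form1 \<alpha>)) S = coef (\<Sum>j\<in>I. c j *\<^sub>R emb ts (form1 (\<beta> j))) S"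
    by (simp add: coef_emb)
qed

lemma emb_form2_sum:
  assumes "\<And>s t. s \<in> set ts \<Longrightarrow> t \<in> set ts \<Longrightarrow> \<alpha> s t = (\<Sum>j\<in>I. c j * \<beta> j s t)"
  shows "emb ts (form2 \<alpha>) = (\<Sum>j\<in>I. c j *\<^sub>R emb ts (form2 (\<beta> j)))"
proof (rule grassmann_eqI)
  fix S :: "nat set"
  have "form2 \<alpha> (nths ts S) = (\<Sum>j\<in>I. c j * form2 (\<beta> j) (nths ts S))"
  proof (cases "length (nths ts S) = 2")
    case True
    hence "nths ts S ! 0 \<in> set (nths ts S)" "nths ts S ! 1 \<in> set (nths ts S)" by (auto intro!: nth_mem)
    hence "nths ts S ! 0 \<in> set ts" "nths ts S ! 1 \<in> set ts" by (auto dest: nths_in_set)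
    thus ?thesis using True assms by (simp add: form2_def)
  qed (simp add: form2_def)
  thus "coef (emb ts (form2 \<alpha>)) S = coef (\<Sum>j\<in>I. c j *\<^sub>R emb ts (form2 (\<beta> j))) S"
    by (simp add: coef_emb)
qed

lemma nths_singleton_index: "a < length ts \<Longrightarrow> nths ts {a} = [ts ! a]"
proof (induction ts arbitrary: a)
  case (Cons x ts)
  show ?case
  proof (cases a)
    case 0
    have "{j. Suc j \<in> {0::nat}} = {}" by auto
    thus ?thesis using 0 by (simp add: nths_Cons)
  next
    case (Suc a')
    have "{j. Suc j \<in> {Suc a'}} = {a'}" by auto
    thus ?thesis using Suc Cons by (simp add: nths_Cons)
  qed
qed simp

lemma emb_form1_expand: "emb ts (form1 \<alpha>) = (\<Sum>a<length ts. \<alpha> (ts ! a) *\<^sub>R gen a)"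
proof (rule grassmann_eqI)
  fix S :: "nat set" assume "finite S"
  show "coef (emb ts (form1 \<alpha>)) S = coef (\<Sum>a<length ts. \<alpha> (ts ! a) *\<^sub>R gen a) S"
  proof (cases "S \<subseteq> {..<length ts} \<and> card S = 1")
    case True
    then obtain a where S: "S = {a}" using card_1_singletonE by blast
    have a: "a < length ts" using True S by simp
    have "(\<Sum>b<length ts. \<alpha> (ts ! b) * (if {a} = {b} then 1 else 0)) = (\<Sum>b<length ts. if b = a then \<alpha> (ts ! b) else 0)"
      by (intro sum.cong refl) auto
    also have "\<dots> = \<alpha> (ts ! a)" using a by simp
    finally show ?thesis using a by (simp add: S coef_emb coef_gen nths_singleton_index form1_def)
  next
    case False
    have "coef (emb ts (form1 \<alpha>)) S = 0"
      using False length_nths_subset[of S ts] by (auto simp: coef_emb form1_def)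
    moreover have "(\<Sum>b<length ts. \<alpha> (ts ! b) * (if S = {b} then 1 else 0)) = 0"
      using False by (intro sum.neutral) auto
    ultimately show ?thesis by (simp add: coef_gen)
  qed
qed

lemma emb_form1_append:
  "emb (ts @ vs) (form1 \<alpha>) = emb ts (form1 \<alpha>) + (\<Sum>q<length vs. \<alpha> (vs ! q) *\<^sub>R gen (length ts + q))"
proof -
  have split: "(\<Sum>a<p + q. f a) = (\<Sum>a<p. f a) + (\<Sum>a<q. f (p + a))" for p q and f :: "nat \<Rightarrow> grassmann"
    by (induction q) (simp_all add: add.assoc)
  show ?thesis by (simp add: emb_form1_expand split nth_append)
qed

text \<open>In a sublist of length \<open>2\<close> that is not contained in \<open>ts\<close>, the second entry comes from \<open>vs\<close>,
because sublists keep the order.\<close>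

lemma emb_form2_append:
  assumes "\<And>s t. t \<in> set vs \<Longrightarrow> s \<in> set (ts @ vs) \<Longrightarrow> \<beta> s t = 0"
  shows "emb (ts @ vs) (form2 \<beta>) = emb ts (form2 \<beta>)"
proof (rule grassmann_eqI)
  fix S :: "nat set" assume "finite S"
  let ?vs = "nths vs {j. j + length ts \<in> S}"
  have app: "nths (ts @ vs) S = nths ts S @ ?vs" by (rule nths_append)
  show "coef (emb (ts @ vs) (form2 \<beta>)) S = coef (emb ts (form2 \<beta>)) S"
  proof (cases "S \<subseteq> {..<length ts}")
    case True
    have "{j. j + length ts \<in> S} = {}" using True by fastforce
    hence "nths (ts @ vs) S = nths ts S" using app by simp
    moreover have "S \<subseteq> {..<length (ts @ vs)}" using True by auto
    ultimately show ?thesis using True by (simp only: coef_emb if_True)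
  next
    case False
    have "form2 \<beta> (nths (ts @ vs) S) = 0" if S: "S \<subseteq> {..<length (ts @ vs)}"
    proof (cases "length (nths (ts @ vs) S) = 2")
      case True
      obtain a where a: "a \<in> S" "\<not> a < length ts" using False by blast
      have "a - length ts < length vs" using a S by auto
      moreover have "a - length ts \<in> {j. j + length ts \<in> S}" using a by simp
      ultimately have "vs ! (a - length ts) \<in> set ?vs" unfolding set_nths by blast
      hence ne: "?vs \<noteq> []" by auto
      have "nths (ts @ vs) S ! 1 = last (nths (ts @ vs) S)"
        using True by (subst last_conv_nth) (auto simp del: length_nths)
      also have "\<dots> = last ?vs" unfolding app using ne by simp
      finally have l: "nths (ts @ vs) S ! 1 \<in> set vs"
        using nths_in_set[OF last_in_set[OF ne]] by simp
      have "nths (ts @ vs) S ! 0 \<in> set (nths (ts @ vs) S)" using True by (intro nth_mem) simp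
      hence f: "nths (ts @ vs) S ! 0 \<in> set (ts @ vs)" by (rule nths_in_set)
      show ?thesis unfolding form2_def using assms[OF l f] by simp
    qed (simp add: form2_def)
    thus ?thesis using False by (simp add: coef_emb)
  qed
qed

lemma emb_form1_map: "emb (map f ts) (form1 \<alpha>) = emb ts (form1 (\<lambda>t. \<alpha> (f t)))"
  by (rule grassmann_eqI) (simp add: coef_emb nths_map form1_def del: length_nths)

lemma emb_form2_map: "emb (map f ts) (form2 \<beta>) = emb ts (form2 (\<lambda>s t. \<beta> (f s) (f t)))"
  by (rule grassmann_eqI) (simp add: coef_emb nths_map form2_def del: length_nths)

lemma emb_form1_times:
  "emb ts (form1 \<alpha>) * emb ts (form1 \<beta>) = emb ts (form2 (\<lambda>s t. \<alpha> s * \<beta> t - \<alpha> t * \<beta> s))"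
proof -
  have "wedge (form1 \<alpha>) (form1 \<beta>) ts = form2 (\<lambda>s t. \<alpha> s * \<beta> t - \<alpha> t * \<beta> s) ts" for ts
  proof (cases "length ts = 2")
    case True
    then obtain x y where ts: "ts = [x, y]" by (auto simp: length_Suc_conv numeral_2_eq_2)
    have P: "Pow {..<Suc (Suc 0)} = {{}, {0}, {Suc 0}, {0, Suc 0}}"
      by (simp add: lessThan_Suc Pow_insert insert_commute)
    have s: "{..<Suc (Suc 0)} - {0} = {Suc 0}" "{..<Suc (Suc 0)} - {Suc 0} = {0}" by auto
    have 1: "shuffle_sign {0} {Suc 0} = 1" by (rule shuffle_sign_mono_eq_1) simp
    have 2: "shuffle_sign {Suc 0} {0} = -1"
    proof -
      have "{(i, j). (i, j) \<in> {Suc 0} \<times> {0} \<and> j < i} = {(1, 0)}" by auto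
      thus ?thesis unfolding shuffle_sign_def by simp
    qed
    show ?thesis
      unfolding wedge_def ts by (simp add: P s 1 2 nths_Cons form1_def form2_def)
  next
    case False
    have "form1 \<alpha> (nths ts S) * form1 \<beta> (nths ts (- S)) = 0" for S
    proof -
      have "card {i. i < length ts \<and> i \<in> S} + card {i. i < length ts \<and> i \<in> - S} =
          card ({i. i < length ts \<and> i \<in> S} \<union> {i. i < length ts \<and> i \<in> - S})"
        by (rule card_Un_disjoint[symmetric]) auto
      also have "{i. i < length ts \<and> i \<in> S} \<union> {i. i < length ts \<and> i \<in> - S} = {..<length ts}" by auto
      finally have "length (nths ts S) + length (nths ts (- S)) = length ts" by (simp add: length_nths)
      hence "length (nths ts S) \<noteq> 1 \<or> length (nths ts (- S)) \<noteq> 1" using False by linarith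
      thus ?thesis unfolding form1_def by (auto simp del: length_nths)
    qed
    hence "wedge (form1 \<alpha>) (form1 \<beta>) ts = 0"
      unfolding wedge_def mult.assoc by (intro sum.neutral ballI) simp
    thus ?thesis using False by (simp add: form2_def)
  qed
  hence "wedge (form1 \<alpha>) (form1 \<beta>) = form2 (\<lambda>s t. \<alpha> s * \<beta> t - \<alpha> t * \<beta> s)" by (rule ext)
  thus ?thesis using emb_wedge[of ts "form1 \<alpha>" "form1 \<beta>"] by simp
qed

section \<open>Words in odd elements\<close>

definition word :: "nat \<Rightarrow> (nat \<Rightarrow> grassmann) \<Rightarrow> grassmann" where
  "word p a = prod_list (map a [0..<p])"

text \<open>The monomial in increasing order.\<close>

abbreviation omon :: "(nat \<Rightarrow> grassmann) \<Rightarrow> nat set \<Rightarrow> grassmann" where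
  "omon \<psi> J \<equiv> prod_list (map \<psi> (sorted_list_of_set J))"

lemma word_0 [simp]: "word 0 a = 1" and word_Suc [simp]: "word (Suc p) a = word p a * a p"
  by (simp_all add: word_def)

lemma word_cong: "(\<And>r. r < p \<Longrightarrow> a r = b r) \<Longrightarrow> word p a = word p b"
  unfolding word_def by (intro arg_cong[of _ _ prod_list] map_cong) auto

lemma word_nth: "word (card J) (\<lambda>r. \<psi> (sorted_list_of_set J ! r)) = omon \<psi> J"
  unfolding word_def
  by (rule arg_cong[of _ _ prod_list]) (auto intro!: nth_equalityI)

lemma word_scaleR: "word p (\<lambda>r. c r *\<^sub>R a r) = (\<Prod>r<p. c r) *\<^sub>R word p a"
  by (induction p) (simp_all add: mult.commute)

lemma sum_PiE_insert:
  assumes "x \<notin> S"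
  shows "(\<Sum>f\<in>PiE (insert x S) T. g f) = (\<Sum>f\<in>PiE S T. \<Sum>y\<in>T x. g (f(x := y)))"
proof -
  have "(\<Sum>f\<in>PiE (insert x S) T. g f) = (\<Sum>(y, f)\<in>T x \<times> PiE S T. g (f(x := y)))"
    unfolding PiE_insert_eq by (subst sum.reindex[OF inj_combinator[OF assms]]) (simp add: case_prod_unfold)
  also have "\<dots> = (\<Sum>y\<in>T x. \<Sum>f\<in>PiE S T. g (f(x := y)))"
    by (simp add: sum.cartesian_product)
  also have "\<dots> = (\<Sum>f\<in>PiE S T. \<Sum>y\<in>T x. g (f(x := y)))"
    by (rule sum.swap)
  finally show ?thesis .
qed

lemma word_sum:
  "word p (\<lambda>r. \<Sum>i\<in>X. a r i) = (\<Sum>f\<in>PiE {..<p} (\<lambda>_. X). word p (\<lambda>r. a r (f r)))"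
proof (induction p)
  case (Suc p)
  have "(\<Sum>f\<in>PiE {..<Suc p} (\<lambda>_. X). word (Suc p) (\<lambda>r. a r (f r))) =
     (\<Sum>f\<in>PiE {..<p} (\<lambda>_. X). \<Sum>y\<in>X. word (Suc p) (\<lambda>r. a r ((f(p := y)) r)))"
    unfolding lessThan_Suc by (rule sum_PiE_insert) simp
  also have "\<dots> = (\<Sum>f\<in>PiE {..<p} (\<lambda>_. X). \<Sum>y\<in>X. word p (\<lambda>r. a r (f r)) * a p y)"
    by (intro sum.cong refl) (simp, intro arg_cong2[of _ _ _ _ "(*)"] word_cong, auto)
  finally show ?case by (simp add: Suc sum_distrib_left sum_distrib_right) (rule sum.swap)
qed simp

lemma word_adjacent_swap:
  assumes "\<And>i. i < p \<Longrightarrow> odd_elem (\<psi> i)" "Suc a < p"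
  shows "word p (\<psi> \<circ> Transposition.transpose a (Suc a)) = - word p \<psi>"
proof -
  let ?s = "Transposition.transpose a (Suc a)"
  have split: "[0..<p] = [0..<a] @ [a, Suc a] @ [a + 2..<p]"
    using assms(2) upt_add_eq_append[of 0 a "p - a"] by (simp add: upt_conv_Cons numeral_2_eq_2)
  have "word p (\<psi> \<circ> ?s) = prod_list (map \<psi> [0..<a]) * (\<psi> (Suc a) * \<psi> a * prod_list (map \<psi> [a + 2..<p]))"
  proof -
    have "map (\<psi> \<circ> ?s) [0..<a] = map \<psi> [0..<a]" "map (\<psi> \<circ> ?s) [a + 2..<p] = map \<psi> [a + 2..<p]"
      by (auto simp: Transposition.transpose_def)
    thus ?thesis unfolding word_def split by (simp add: mult.assoc del: map_eq_conv)
  qed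
  also have "\<psi> (Suc a) * \<psi> a = - (\<psi> a * \<psi> (Suc a))"
    using assms by (intro odd_anticommute) auto
  finally show ?thesis unfolding word_def split by (simp add: mult.assoc)
qed

lemma word_swap_less:
  assumes "\<And>i. i < p \<Longrightarrow> odd_elem (\<psi> i)" "a < b" "b < p"
  shows "word p (\<psi> \<circ> Transposition.transpose a b) = - word p \<psi>"
  using assms
proof (induction "b - a" arbitrary: b \<psi>)
  case (Suc d)
  show ?case
  proof (cases "b = Suc a")
    case True
    thus ?thesis using word_adjacent_swap[of p \<psi> a] Suc by auto
  next
    case False
    then obtain c where c: "b = Suc c" "a < c" using Suc by (cases b) auto
    let ?s = "Transposition.transpose c (Suc c)"
    have odd1: "odd_elem ((\<psi> \<circ> ?s) i)" if "i < p" for i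
      using Suc.prems c that by (auto simp: Transposition.transpose_def)
    have odd2: "odd_elem ((\<psi> \<circ> ?s \<circ> Transposition.transpose a c) i)" if "i < p" for i
      using Suc.prems c that by (auto simp: Transposition.transpose_def)
    have "Transposition.transpose a b = ?s \<circ> Transposition.transpose a c \<circ> ?s"
      using c by (auto simp: Transposition.transpose_def fun_eq_iff)
    hence "word p (\<psi> \<circ> Transposition.transpose a b) = word p (\<psi> \<circ> ?s \<circ> Transposition.transpose a c \<circ> ?s)"
      by (simp add: o_assoc)
    also have "\<dots> = - word p (\<psi> \<circ> ?s \<circ> Transposition.transpose a c)"
      using odd2 c Suc.prems by (intro word_adjacent_swap) auto
    also have "word p (\<psi> \<circ> ?s \<circ> Transposition.transpose a c) = - word p (\<psi> \<circ> ?s)"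
      using c Suc odd1 by (intro Suc.hyps) auto
    also have "word p (\<psi> \<circ> ?s) = - word p \<psi>"
      using c Suc.prems by (intro word_adjacent_swap) auto
    finally show ?thesis by (simp only: minus_minus)
  qed
qed simp

lemma word_swap:
  assumes "\<And>i. i < p \<Longrightarrow> odd_elem (\<psi> i)" "a < p" "b < p" "a \<noteq> b"
  shows "word p (\<psi> \<circ> Transposition.transpose a b) = - word p \<psi>"
proof (cases "a < b")
  case True
  thus ?thesis using assms by (intro word_swap_less) auto
next
  case False
  thus ?thesis unfolding transpose_commute[of a b] using assms by (intro word_swap_less) auto
qed

text \<open>It suffices to treat transpositions, and among these the adjacent ones, which exchange two
anticommuting factors.\<close>

lemma word_permute:
  assumes "\<sigma> permutes {..<p}" "\<And>i. i < p \<Longrightarrow> odd_elem (\<psi> i)"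
  shows "word p (\<psi> \<circ> \<sigma>) = of_int (sign \<sigma>) *\<^sub>R word p \<psi>"
  using assms(1) finite_lessThan assms(2)
proof (induction arbitrary: \<psi> rule: permutes_induct)
  case (swap a b q)
  have "odd_elem ((\<psi> \<circ> Transposition.transpose a b) i)" if "i < p" for i
    using swap.prems swap.hyps that by (auto simp: Transposition.transpose_def)
  hence "word p (\<psi> \<circ> Transposition.transpose a b \<circ> q) = of_int (sign q) *\<^sub>R word p (\<psi> \<circ> Transposition.transpose a b)"
    by (rule swap.IH)
  also have "word p (\<psi> \<circ> Transposition.transpose a b) = - word p \<psi>"
    using swap by (intro word_swap) auto
  also have "\<psi> \<circ> Transposition.transpose a b \<circ> q = \<psi> \<circ> (Transposition.transpose a b \<circ> q)"
    by (rule o_assoc[symmetric])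
  finally show ?case
    using swap.hyps permutation_permutes
    by (subst sign_compose) (auto simp: sign_swap_id permutation_swap_id simp del: o_apply)
qed simp

lemma word_not_inj:
  assumes "\<not> inj_on f {..<p}" "\<And>r. r < p \<Longrightarrow> odd_elem (\<psi> (f r))"
  shows "word p (\<psi> \<circ> f) = 0"
proof -
  obtain a b where ab: "a < p" "b < p" "a \<noteq> b" "f a = f b"
    using assms(1) by (auto simp: inj_on_def)
  have "word p (\<psi> \<circ> f) = word p (\<psi> \<circ> f \<circ> Transposition.transpose a b)"
    using ab by (intro word_cong) (auto simp: Transposition.transpose_def)
  also have "\<dots> = - word p (\<psi> \<circ> f)"
    using assms ab by (intro word_swap) auto
  finally show ?thesis
    by (metis add.right_inverse scaleR_2 scaleR_eq_0_iff zero_neq_numeral)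
qed

lemma sum_bij_betw_lists:
  assumes J: "finite J" "card J = p"
    and cong: "\<And>f f'. (\<And>r. r < p \<Longrightarrow> f r = f' r) \<Longrightarrow> F f = F f'"
  shows "(\<Sum>f | f \<in> PiE {..<p} (\<lambda>_. J) \<and> bij_betw f {..<p} J. F f) =
         (\<Sum>\<sigma> | \<sigma> permutes {..<p}. F (\<lambda>r. sorted_list_of_set J ! \<sigma> r))"
proof -
  let ?i = "\<lambda>r. sorted_list_of_set J ! r"
  let ?k = "inv_into {..<p} ?i"
  have bij: "bij_betw ?i {..<p} J"
  proof -
    have e: "length (sorted_list_of_set J) = p" "set (sorted_list_of_set J) = J"
      using J by (simp_all only: length_sorted_list_of_set set_sorted_list_of_set)
    show ?thesis
      using bij_betw_nth[OF distinct_sorted_list_of_set refl refl, of J] unfolding e .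
  qed
  note bij' = bij_betw_inv_into[OF bij]
  show ?thesis
  proof (rule sum.reindex_bij_witness[where i = "\<lambda>\<sigma>. restrict (?i \<circ> \<sigma>) {..<p}" and j = "\<lambda>f r. if r < p then ?k (f r) else r"])
    fix f assume f: "f \<in> {f. f \<in> PiE {..<p} (\<lambda>_. J) \<and> bij_betw f {..<p} J}"
    hence fb: "bij_betw f {..<p} J" by simp
    have fJ: "f r \<in> J" if "r < p" for r using bij_betwE[OF fb] that by simp
    have ik: "?i (?k (f r)) = f r" if "r < p" for r
      using bij fJ[OF that] by (rule bij_betw_inv_into_right)
    have "bij_betw (?k \<circ> f) {..<p} {..<p}" by (rule bij_betw_trans[OF fb bij'])
    hence "bij_betw (\<lambda>r. if r < p then ?k (f r) else r) {..<p} {..<p}"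
      using bij_betw_cong[of "{..<p}" "?k \<circ> f" "\<lambda>r. if r < p then ?k (f r) else r" "{..<p}"] by simp
    thus "(\<lambda>r. if r < p then ?k (f r) else r) \<in> {\<sigma>. \<sigma> permutes {..<p}}"
      using bij_imp_permutes[of _ "{..<p}"] by simp
    show "restrict (?i \<circ> (\<lambda>r. if r < p then ?k (f r) else r)) {..<p} = f"
    proof
      fix r
      show "restrict (?i \<circ> (\<lambda>r. if r < p then ?k (f r) else r)) {..<p} r = f r"
        using ik[of r] PiE_arb[of f "{..<p}" "\<lambda>_. J" r] f by (cases "r < p") auto
    qed
    show "F (\<lambda>r. ?i (if r < p then ?k (f r) else r)) = F f"
      by (rule cong) (simp add: ik)
  next
    fix \<sigma> assume "\<sigma> \<in> {\<sigma>. \<sigma> permutes {..<p}}"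
    hence s: "\<sigma> permutes {..<p}" by simp
    have sl: "\<sigma> r < p" if "r < p" for r using permutes_in_image[OF s, of r] that by simp
    have "bij_betw (?i \<circ> \<sigma>) {..<p} J" by (rule bij_betw_trans[OF permutes_imp_bij[OF s] bij])
    hence "bij_betw (restrict (?i \<circ> \<sigma>) {..<p}) {..<p} J"
      using bij_betw_cong[of "{..<p}" "?i \<circ> \<sigma>" "restrict (?i \<circ> \<sigma>) {..<p}" J] by simp
    moreover have "restrict (?i \<circ> \<sigma>) {..<p} \<in> PiE {..<p} (\<lambda>_. J)"
      using bij_betwE[OF bij] sl by auto
    ultimately show "restrict (?i \<circ> \<sigma>) {..<p} \<in> {f. f \<in> PiE {..<p} (\<lambda>_. J) \<and> bij_betw f {..<p} J}" by simp
    show "(\<lambda>r. if r < p then ?k (restrict (?i \<circ> \<sigma>) {..<p} r) else r) = \<sigma>"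
    proof
      fix r
      show "(if r < p then ?k (restrict (?i \<circ> \<sigma>) {..<p} r) else r) = \<sigma> r"
      proof (cases "r < p")
        case True
        have "?k (?i (\<sigma> r)) = \<sigma> r" using bij_betw_inv_into_left[OF bij] sl[OF True] by simp
        thus ?thesis using True by simp
      next
        case False
        thus ?thesis using permutes_not_in[OF s, of r] by simp
      qed
    qed
  qed
qed

text \<open>Words with a repeated letter vanish, and the others are grouped by their set \<open>J\<close> of letters. The
letters of such a word are a permutation of the increasing enumeration of \<open>J\<close>, and sorting them
costs the sign of this permutation.\<close>

lemma sum_words:
  assumes odd: "\<And>i. i < n \<Longrightarrow> odd_elem (\<psi> i)"
    and cong: "\<And>f f'. (\<And>r. r < p \<Longrightarrow> f r = f' r) \<Longrightarrow> F f = (F f' :: grassmann)"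
  shows "(\<Sum>f\<in>PiE {..<p} (\<lambda>_. {..<n}). word p (\<psi> \<circ> f) * F f) =
    (\<Sum>J | J \<subseteq> {..<n} \<and> card J = p. omon \<psi> J *
       (\<Sum>\<sigma> | \<sigma> permutes {..<p}. of_int (sign \<sigma>) *\<^sub>R F (\<lambda>r. sorted_list_of_set J ! \<sigma> r)))"
proof -
  let ?A = "PiE {..<p} (\<lambda>_. {..<n})" and ?B = "{J. J \<subseteq> {..<n} \<and> card J = p}"
  have fA: "finite ?A" by (intro finite_PiE) auto
  have fB: "finite ?B" by (rule finite_subset[of _ "Pow {..<n}"]) auto
  have "(\<Sum>f\<in>?A. word p (\<psi> \<circ> f) * F f) = (\<Sum>f | f \<in> ?A \<and> inj_on f {..<p}. word p (\<psi> \<circ> f) * F f)"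
  proof (rule sum.mono_neutral_right)
    show "\<forall>f\<in>?A - {f. f \<in> ?A \<and> inj_on f {..<p}}. word p (\<psi> \<circ> f) * F f = 0"
    proof
      fix f assume "f \<in> ?A - {f. f \<in> ?A \<and> inj_on f {..<p}}"
      hence "\<not> inj_on f {..<p}" "\<And>r. r < p \<Longrightarrow> f r < n" by auto
      hence "word p (\<psi> \<circ> f) = 0" using odd by (intro word_not_inj) auto
      thus "word p (\<psi> \<circ> f) * F f = 0" by simp
    qed
  qed (use fA in auto)
  also have "\<dots> = (\<Sum>J\<in>?B. \<Sum>f | f \<in> {f. f \<in> ?A \<and> inj_on f {..<p}} \<and> f ` {..<p} = J. word p (\<psi> \<circ> f) * F f)"
  proof (rule sum.group[symmetric])
    show "(\<lambda>f. f ` {..<p}) ` {f. f \<in> ?A \<and> inj_on f {..<p}} \<subseteq> ?B"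
    proof (rule image_subsetI)
      fix f assume "f \<in> {f. f \<in> ?A \<and> inj_on f {..<p}}"
      hence f: "f \<in> ?A" "inj_on f {..<p}" by simp_all
      have "f ` {..<p} \<subseteq> {..<n}" using PiE_mem[OF f(1)] by blast
      thus "f ` {..<p} \<in> ?B" using card_image[OF f(2)] by simp
    qed
    show "finite {f. f \<in> ?A \<and> inj_on f {..<p}}" using fA by simp
  qed (use fB in auto)
  also have "\<dots> = (\<Sum>J\<in>?B. omon \<psi> J * (\<Sum>\<sigma> | \<sigma> permutes {..<p}. of_int (sign \<sigma>) *\<^sub>R F (\<lambda>r. sorted_list_of_set J ! \<sigma> r)))"
  proof (rule sum.cong)
    fix J assume "J \<in> ?B"
    hence J: "J \<subseteq> {..<n}" "card J = p" "finite J" by (auto intro: finite_subset)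
    let ?i = "\<lambda>r. sorted_list_of_set J ! r"
    have "{f. f \<in> {f. f \<in> ?A \<and> inj_on f {..<p}} \<and> f ` {..<p} = J} = {f. f \<in> PiE {..<p} (\<lambda>_. J) \<and> bij_betw f {..<p} J}"
      using J by (auto simp: bij_betw_def PiE_iff)
    hence "(\<Sum>f | f \<in> {f. f \<in> ?A \<and> inj_on f {..<p}} \<and> f ` {..<p} = J. word p (\<psi> \<circ> f) * F f)
      = (\<Sum>f | f \<in> PiE {..<p} (\<lambda>_. J) \<and> bij_betw f {..<p} J. word p (\<psi> \<circ> f) * F f)" by simp
    also have "\<dots> = (\<Sum>\<sigma> | \<sigma> permutes {..<p}. word p (\<psi> \<circ> (\<lambda>r. ?i (\<sigma> r))) * F (\<lambda>r. ?i (\<sigma> r)))"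
    proof (rule sum_bij_betw_lists)
      fix f f' :: "nat \<Rightarrow> nat" assume "\<And>r. r < p \<Longrightarrow> f r = f' r"
      thus "word p (\<psi> \<circ> f) * F f = word p (\<psi> \<circ> f') * F f'"
        by (intro arg_cong2[of _ _ _ _ "(*)"] word_cong cong) auto
    qed (use J in auto)
    also have "\<dots> = (\<Sum>\<sigma> | \<sigma> permutes {..<p}. omon \<psi> J * (of_int (sign \<sigma>) *\<^sub>R F (\<lambda>r. ?i (\<sigma> r))))"
    proof (rule sum.cong)
      fix \<sigma> assume "\<sigma> \<in> {\<sigma>. \<sigma> permutes {..<p}}"
      hence s: "\<sigma> permutes {..<p}" by simp
      have "odd_elem ((\<lambda>r. \<psi> (?i r)) i)" if "i < p" for i
      proof -
        have "?i i \<in> set (sorted_list_of_set J)" using that J(2) by (intro nth_mem) simp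
        hence "?i i \<in> J" using J(3) by simp
        thus ?thesis using odd J by auto
      qed
      hence "word p ((\<lambda>r. \<psi> (?i r)) \<circ> \<sigma>) = of_int (sign \<sigma>) *\<^sub>R word p (\<lambda>r. \<psi> (?i r))"
        by (rule word_permute[OF s])
      also have "word p (\<lambda>r. \<psi> (?i r)) = omon \<psi> J" using word_nth[of J \<psi>] J by simp
      finally show "word p (\<psi> \<circ> (\<lambda>r. ?i (\<sigma> r))) * F (\<lambda>r. ?i (\<sigma> r)) = omon \<psi> J * (of_int (sign \<sigma>) *\<^sub>R F (\<lambda>r. ?i (\<sigma> r)))"
        by (simp add: o_def)
    qed simp
    finally show "(\<Sum>f | f \<in> {f. f \<in> ?A \<and> inj_on f {..<p}} \<and> f ` {..<p} = J. word p (\<psi> \<circ> f) * F f) =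
       omon \<psi> J * (\<Sum>\<sigma> | \<sigma> permutes {..<p}. of_int (sign \<sigma>) *\<^sub>R F (\<lambda>r. ?i (\<sigma> r)))"
      by (simp add: sum_distrib_left)
  qed simp
  finally show ?thesis .
qed

lemma omon_full: "omon \<psi> {..<n} = word n \<psi>"
  by (simp add: word_def lessThan_atLeast0)

abbreviation det_of :: "nat \<Rightarrow> (nat \<Rightarrow> nat \<Rightarrow> real) \<Rightarrow> real" where
  "det_of n X \<equiv> Determinant.det (Matrix.mat n n (\<lambda>(i, j). X i j))"

text \<open>The action of a linear map on the top exterior power is its determinant.\<close>

lemma word_linear_substitution:
  assumes odd: "\<And>i. i < n \<Longrightarrow> odd_elem (\<eta> i)"
  shows "word n (\<lambda>j. \<Sum>i<n. G i j *\<^sub>R \<eta> i) = det_of n (\<lambda>i j. G i j) *\<^sub>R word n \<eta>"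
proof -
  let ?F = "\<lambda>f. (\<Prod>j<n. G (f j) j) *\<^sub>R (1 :: grassmann)"
  have "word n (\<lambda>j. \<Sum>i<n. G i j *\<^sub>R \<eta> i) = (\<Sum>f\<in>PiE {..<n} (\<lambda>_. {..<n}). word n (\<eta> \<circ> f) * ?F f)"
    by (simp add: word_sum word_scaleR o_def)
  also have "\<dots> = (\<Sum>J | J \<subseteq> {..<n} \<and> card J = n. omon \<eta> J *
       (\<Sum>\<sigma> | \<sigma> permutes {..<n}. of_int (sign \<sigma>) *\<^sub>R ?F (\<lambda>r. sorted_list_of_set J ! \<sigma> r)))"
    by (rule sum_words[OF odd]) auto
  also have "{J. J \<subseteq> {..<n} \<and> card J = n} = {{..<n}}"
    using card_subset_eq[of "{..<n}"] by auto
  also have "(\<Sum>J\<in>{{..<n}}. omon \<eta> J * (\<Sum>\<sigma> | \<sigma> permutes {..<n}. of_int (sign \<sigma>) *\<^sub>R ?F (\<lambda>r. sorted_list_of_set J ! \<sigma> r)))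
    = word n \<eta> * (\<Sum>\<sigma> | \<sigma> permutes {..<n}. of_int (sign \<sigma>) *\<^sub>R ?F (\<lambda>r. sorted_list_of_set {..<n} ! \<sigma> r))"
    by (simp add: omon_full)
  also have "(\<Sum>\<sigma> | \<sigma> permutes {..<n}. of_int (sign \<sigma>) *\<^sub>R ?F (\<lambda>r. sorted_list_of_set {..<n} ! \<sigma> r))
     = det_of n (\<lambda>i j. G i j) *\<^sub>R 1"
  proof -
    have "det_of n (\<lambda>i j. G i j) = (\<Sum>\<sigma> | \<sigma> permutes {0..<n}. signof \<sigma> * (\<Prod>j<n. Matrix.mat n n (\<lambda>(i, j). G i j) $$ (\<sigma> j, j)))"
      by (rule det_col) simp
    also have "\<dots> = (\<Sum>\<sigma> | \<sigma> permutes {..<n}. of_int (sign \<sigma>) * (\<Prod>j<n. G (sorted_list_of_set {..<n} ! \<sigma> j) j))"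
      unfolding lessThan_atLeast0
    proof (rule sum.cong)
      fix \<sigma> assume "\<sigma> \<in> {\<sigma>. \<sigma> permutes {0..<n}}"
      hence "\<sigma> j < n" if "j < n" for j using that permutes_in_image[of \<sigma> "{0..<n}" j] by auto
      thus "signof \<sigma> * (\<Prod>j = 0..<n. Matrix.mat n n (\<lambda>(i, j). G i j) $$ (\<sigma> j, j)) =
         of_int (sign \<sigma>) * (\<Prod>j = 0..<n. G (sorted_list_of_set {0..<n} ! \<sigma> j) j)"
        by (auto simp: sign_def intro!: prod.cong)
    qed simp
    finally show ?thesis by (simp add: scaleR_sum_left)
  qed
  finally show ?thesis by simp
qed

lemma sorted_list_of_set_insert_max:
  assumes "finite K" "\<And>k. k \<in> K \<Longrightarrow> k < (b::nat)"
  shows "sorted_list_of_set (insert b K) = sorted_list_of_set K @ [b]"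
proof -
  have "b \<notin> K" using assms(2) by blast
  hence "sorted_list_of_set (insert b K) = insort b (sorted_list_of_set K)"
    using assms(1) by simp
  also have "\<dots> = sorted_list_of_set K @ [b]"
    using assms by (intro sorted_insort_is_snoc) (auto simp: less_imp_le)
  finally show ?thesis .
qed

lemma omon_insert_max: "finite K \<Longrightarrow> (\<And>k. k \<in> K \<Longrightarrow> k < b) \<Longrightarrow> omon \<psi> (insert b K) = omon \<psi> K * \<psi> b"
  by (subst sorted_list_of_set_insert_max) auto

lemma omon_insert:
  assumes "finite K" "m \<notin> K" "\<And>i. i \<in> insert m K \<Longrightarrow> odd_elem (\<psi> i)"
  shows "omon \<psi> K * \<psi> m = shuffle_sign K {m} *\<^sub>R omon \<psi> (insert m K)"
  using assms
proof (induction K rule: finite_linorder_max_induct)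
  case empty thus ?case by simp
next
  case (insert b K)
  show ?case
  proof (cases "m < b")
    case False
    hence "b < m" using insert.prems(1) by auto
    hence "\<And>k. k \<in> insert b K \<Longrightarrow> k < m" using insert.hyps(2) by (auto dest: less_trans)
    moreover from this have "shuffle_sign (insert b K) {m} = 1"
      by (intro shuffle_sign_mono_eq_1) (auto simp: less_imp_le)
    ultimately show ?thesis using insert.hyps by (subst omon_insert_max) auto
  next
    case True
    have fin: "finite K" by fact
    have "omon \<psi> (insert b K) * \<psi> m = omon \<psi> K * \<psi> b * \<psi> m"
      using insert.hyps by (subst omon_insert_max) auto
    also have "\<dots> = - (omon \<psi> K * \<psi> m * \<psi> b)"
      using odd_anticommute[of "\<psi> m" "\<psi> b"] insert.prems by (simp add: mult.assoc)
    also have "omon \<psi> K * \<psi> m = shuffle_sign K {m} *\<^sub>R omon \<psi> (insert m K)"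
      using insert.prems by (intro insert.IH) auto
    also have "- (shuffle_sign K {m} *\<^sub>R omon \<psi> (insert m K) * \<psi> b) = (- shuffle_sign K {m}) *\<^sub>R omon \<psi> (insert b (insert m K))"
      using insert.hyps True by (subst omon_insert_max) auto
    also have "- shuffle_sign K {m} = shuffle_sign (insert b K) {m}"
    proof -
      have "shuffle_sign (K \<union> {b}) {m} = shuffle_sign K {m} * shuffle_sign {b} {m}"
        using insert by (intro shuffle_sign_Un_left) auto
      moreover have "{(i, j) \<in> {b} \<times> {m}. j < i} = {(b, m)}" using True by auto
      hence "shuffle_sign {b} {m} = -1" by (simp only: shuffle_sign_def) simp
      ultimately show ?thesis by simp
    qed
    finally show ?thesis unfolding insert_commute[of b m K] .
  qed
qed

lemma omon_Un:
  assumes "finite I" "finite J" "I \<inter> J = {}" "\<And>i. i \<in> I \<union> J \<Longrightarrow> odd_elem (\<psi> i)"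
  shows "omon \<psi> I * omon \<psi> J = shuffle_sign I J *\<^sub>R omon \<psi> (I \<union> J)"
  using assms(2,1,3,4)
proof (induction J rule: finite_linorder_max_induct)
  case empty thus ?case by simp
next
  case (insert b J)
  have "omon \<psi> I * omon \<psi> (insert b J) = omon \<psi> I * omon \<psi> J * \<psi> b"
    using insert.hyps by (subst omon_insert_max) (auto simp: mult.assoc)
  also have "omon \<psi> I * omon \<psi> J = shuffle_sign I J *\<^sub>R omon \<psi> (I \<union> J)"
    using insert.prems by (intro insert.IH) auto
  also have "shuffle_sign I J *\<^sub>R omon \<psi> (I \<union> J) * \<psi> b = shuffle_sign I J *\<^sub>R (omon \<psi> (I \<union> J) * \<psi> b)" by simp
  also have "omon \<psi> (I \<union> J) * \<psi> b = shuffle_sign (I \<union> J) {b} *\<^sub>R omon \<psi> (insert b (I \<union> J))"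
    using insert.hyps insert.prems by (intro omon_insert) auto
  also have "shuffle_sign (I \<union> J) {b} = shuffle_sign I {b}"
  proof -
    have "shuffle_sign J {b} = 1"
      using insert.hyps by (intro shuffle_sign_mono_eq_1) (auto simp: less_imp_le)
    moreover have "I \<inter> J = {}" using insert.prems by auto
    ultimately show ?thesis
      using shuffle_sign_Un_left[of I J "{b}"] insert.hyps(1) insert.prems(1) by simp
  qed
  also have "shuffle_sign I J *\<^sub>R shuffle_sign I {b} *\<^sub>R omon \<psi> (insert b (I \<union> J)) = shuffle_sign I (insert b J) *\<^sub>R omon \<psi> (I \<union> insert b J)"
  proof -
    have "b \<notin> J" using insert.hyps by auto
    hence "shuffle_sign I (J \<union> {b}) = shuffle_sign I J * shuffle_sign I {b}"
      using insert.hyps(1) insert.prems(1) by (intro shuffle_sign_Un_right) auto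
    thus ?thesis by simp
  qed
  finally show ?case .
qed

lemma omon_overlap:
  assumes "finite I" "finite J" "I \<inter> J \<noteq> {}" "\<And>i. i \<in> I \<union> J \<Longrightarrow> odd_elem (\<psi> i)"
  shows "omon \<psi> I * omon \<psi> J = 0"
proof -
  let ?w = "sorted_list_of_set I @ sorted_list_of_set J"
  have "omon \<psi> I * omon \<psi> J = word (length ?w) (\<psi> \<circ> (!) ?w)"
    unfolding word_def map_map[symmetric] map_nth by simp
  also have "\<dots> = 0"
  proof (rule word_not_inj)
    show "\<not> inj_on ((!) ?w) {..<length ?w}"
      using assms distinct_conv_nth[of ?w] by (auto simp: inj_on_def)
    show "odd_elem (\<psi> (?w ! r))" if "r < length ?w" for r
      using nth_mem[OF that] assms by auto
  qed
  finally show ?thesis .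
qed

section \<open>Exponentials of nilpotent elements\<close>

definition nilpotent :: "grassmann \<Rightarrow> bool" where "nilpotent a \<longleftrightarrow> (\<exists>N. a ^ N = 0)"

text \<open>The exponential series, which is finite on nilpotent elements; by \<open>nexp_eq\<close> it may be cut off at
any exponent at which the powers vanish.\<close>

definition nexp :: "grassmann \<Rightarrow> grassmann" where
  "nexp a = (\<Sum>l<(LEAST N. a ^ N = 0). (1 / fact l) *\<^sub>R a ^ l)"

lemma power_scaleR_g: "(r *\<^sub>R a) ^ l = r ^ l *\<^sub>R (a :: grassmann) ^ l"
  by (induction l) simp_all

lemma power_zero_mono:
  fixes a :: grassmann
  assumes "a ^ N = 0" "N \<le> l" shows "a ^ l = 0"
proof -
  have "a ^ l = a ^ N * a ^ (l - N)" using assms(2) by (simp flip: power_add)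
  thus ?thesis using assms(1) by simp
qed

lemma nexp_eq:
  assumes "a ^ N = 0" shows "nexp a = (\<Sum>l<N. (1 / fact l) *\<^sub>R a ^ l)"
proof -
  let ?L = "LEAST N. a ^ N = 0"
  have "?L \<le> N" using assms by (rule Least_le)
  moreover have "a ^ ?L = 0" using assms by (rule LeastI)
  ultimately show ?thesis unfolding nexp_def
    by (intro sum.mono_neutral_left) (auto dest: power_zero_mono)
qed

lemma nilpotentI: "a ^ N = 0 \<Longrightarrow> nilpotent a"
  unfolding nilpotent_def by blast

text \<open>The binomial theorem says that the divided powers of \<open>a + b\<close> are the convolution of those of \<open>a\<close>
and \<open>b\<close>; this needs only that \<open>a\<close> and \<open>b\<close> commute. In total degree at least \<open>p + q\<close> one factor of
each summand vanishes.\<close>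

lemma nexp_add_aux:
  fixes a b :: grassmann
  assumes comm: "a * b = b * a" and a: "a ^ p = 0" and b: "b ^ q = 0"
  shows "(a + b) ^ (p + q) = 0" and "nexp (a + b) = nexp a * nexp b"
proof -
  define S where "S = (\<lambda>(x :: grassmann) n. (1 / fact n) *\<^sub>R x ^ n)"
  have S_Suc: "real (Suc n) *\<^sub>R S x (Suc n) = x * S x n" for x n
  proof -
    have "real (Suc n) * (1 / fact (Suc n)) = 1 / fact n"
      by (simp add: fact_Suc del: of_nat_Suc)
    thus ?thesis unfolding S_def by (simp only: scaleR_scaleR power_Suc mult_scaleR_right)
  qed
  have com: "S a n * b = b * S a n" for n
    unfolding S_def using power_commuting_commutes[OF comm] by simp
  have add: "S (a + b) n = (\<Sum>i\<le>n. S a i * S b (n - i))" for n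
  proof (induction n)
    case 0 show ?case by (simp add: S_def)
  next
    case (Suc n)
    have "real (Suc n) *\<^sub>R S (a + b) (Suc n) = a * (\<Sum>i\<le>n. S a i * S b (n - i)) + b * (\<Sum>i\<le>n. S a i * S b (n - i))"
      unfolding S_Suc Suc by (rule distrib_right)
    also have "\<dots> = (\<Sum>i\<le>n. (a * S a i) * S b (n - i)) + (\<Sum>i\<le>n. S a i * (b * S b (n - i)))"
      unfolding sum_distrib_left mult.assoc[symmetric] com ..
    also have "\<dots> = (\<Sum>i\<le>n. real (Suc i) *\<^sub>R (S a (Suc i) * S b (n - i))) + (\<Sum>i\<le>n. real (Suc n - i) *\<^sub>R (S a i * S b (Suc n - i)))"
    proof (intro arg_cong2[of _ _ _ _ "(+)"] sum.cong refl)
      fix i assume "i \<in> {..n}"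
      hence "Suc n - i = Suc (n - i)" by auto
      thus "S a i * (b * S b (n - i)) = real (Suc n - i) *\<^sub>R (S a i * S b (Suc n - i))"
        by (simp only: S_Suc[symmetric] mult_scaleR_right)
    qed (simp only: S_Suc[symmetric] mult_scaleR_left)
    also have "(\<Sum>i\<le>n. real (Suc i) *\<^sub>R (S a (Suc i) * S b (n - i))) = (\<Sum>i\<le>Suc n. real i *\<^sub>R (S a i * S b (Suc n - i)))"
      by (subst sum.atMost_Suc_shift) simp
    also have "(\<Sum>i\<le>n. real (Suc n - i) *\<^sub>R (S a i * S b (Suc n - i))) = (\<Sum>i\<le>Suc n. real (Suc n - i) *\<^sub>R (S a i * S b (Suc n - i)))"
      by simp
    also have "(\<Sum>i\<le>Suc n. real i *\<^sub>R (S a i * S b (Suc n - i))) + \<dots> = (\<Sum>i\<le>Suc n. real (Suc n) *\<^sub>R (S a i * S b (Suc n - i)))"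
      unfolding sum.distrib[symmetric] scaleR_left_distrib[symmetric] of_nat_add[symmetric]
      by (intro sum.cong) auto
    finally have "real (Suc n) *\<^sub>R S (a + b) (Suc n) = real (Suc n) *\<^sub>R (\<Sum>i\<le>Suc n. S a i * S b (Suc n - i))"
      by (simp only: scaleR_sum_right)
    thus ?case by (simp only: scaleR_cancel_left) simp
  qed
  have Sa: "S a i = 0" if "p \<le> i" for i using power_zero_mono[OF a that] by (simp add: S_def)
  have Sb: "S b i = 0" if "q \<le> i" for i using power_zero_mono[OF b that] by (simp add: S_def)
  have "S (a + b) (p + q) = 0" unfolding add
  proof (rule sum.neutral, rule ballI)
    fix i assume "i \<in> {..p + q}"
    hence "p \<le> i \<or> q \<le> p + q - i" by auto
    thus "S a i * S b (p + q - i) = 0" using Sa Sb by auto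
  qed
  thus z: "(a + b) ^ (p + q) = 0" by (simp add: S_def)
  have "nexp (a + b) = (\<Sum>n<p+q. S (a + b) n)"
    unfolding nexp_eq[OF z] S_def ..
  also have "\<dots> = (\<Sum>n<p+q. \<Sum>i\<le>n. S a i * S b (n - i))"
    by (simp only: add)
  also have "\<dots> = (\<Sum>(i, j)\<in>{(i, j). i + j < p + q}. S a i * S b j)"
    by (rule sum.triangle_reindex[symmetric])
  also have "\<dots> = (\<Sum>(i, j)\<in>{..<p} \<times> {..<q}. S a i * S b j)"
  proof (rule sum.mono_neutral_right)
    show "finite {(i, j). i + j < p + q}"
      by (rule finite_subset[of _ "{..<p+q} \<times> {..<p+q}"]) auto
    show "\<forall>x\<in>{(i, j). i + j < p + q} - {..<p} \<times> {..<q}. (case x of (i, j) \<Rightarrow> S a i * S b j) = 0"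
    proof
      fix x assume "x \<in> {(i, j). i + j < p + q} - {..<p} \<times> {..<q}"
      hence "p \<le> fst x \<or> q \<le> snd x" by (cases x) auto
      thus "(case x of (i, j) \<Rightarrow> S a i * S b j) = 0" using Sa Sb by (cases x) auto
    qed
  qed auto
  also have "\<dots> = nexp a * nexp b"
    unfolding nexp_eq[OF a] nexp_eq[OF b] S_def sum_product by (simp add: sum.cartesian_product)
  finally show "nexp (a + b) = nexp a * nexp b" .
qed

lemma nilpotent_add: "a * b = b * a \<Longrightarrow> nilpotent a \<Longrightarrow> nilpotent b \<Longrightarrow> nilpotent (a + b)"
  unfolding nilpotent_def using nexp_add_aux(1) by blast

lemma nexp_add: "a * b = b * a \<Longrightarrow> nilpotent a \<Longrightarrow> nilpotent b \<Longrightarrow> nexp (a + b) = nexp a * nexp b"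
  unfolding nilpotent_def using nexp_add_aux(2) by blast

lemma nilpotent_0 [simp]: "nilpotent 0" by (rule nilpotentI[of _ 1]) simp

lemma nexp_0 [simp]: "nexp 0 = 1"
  by (subst nexp_eq[of _ 1]) simp_all

lemma nilpotent_scaleR: "nilpotent a \<Longrightarrow> nilpotent (r *\<^sub>R a)"
  unfolding nilpotent_def power_scaleR_g by (metis scaleR_zero_right)

lemma nilpotent_square_zero: "a * a = 0 \<Longrightarrow> nilpotent a"
  by (rule nilpotentI[of _ 2]) (simp add: power2_eq_square)

lemma nexp_square_zero: "a * a = 0 \<Longrightarrow> nexp a = 1 + a"
  by (subst nexp_eq[of _ 2]) (simp_all add: power2_eq_square lessThan_Suc numeral_2_eq_2 add.commute)

lemma even_nexp: "even_elem a \<Longrightarrow> even_elem (nexp a)"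
  unfolding nexp_def by (intro has_parity_sum has_parity_scaleR even_power)

lemma nexp_sum:
  assumes "\<And>i. i < n \<Longrightarrow> even_elem (a i)" "\<And>i. i < n \<Longrightarrow> nilpotent (a i)"
  shows "nilpotent (\<Sum>i<n. a i) \<and> nexp (\<Sum>i<n. a i) = word n (\<lambda>i. nexp (a i))"
  using assms
proof (induction n)
  case (Suc n)
  have IH: "nilpotent (\<Sum>i<n. a i)" "nexp (\<Sum>i<n. a i) = word n (\<lambda>i. nexp (a i))"
    using Suc by auto
  have c: "(\<Sum>i<n. a i) * a n = a n * (\<Sum>i<n. a i)"
    using Suc.prems by (intro even_commute_all has_parity_sum) auto
  show ?case using nilpotent_add[OF c IH(1)] nexp_add[OF c IH(1)] Suc.prems IH(2) by simp
qed simp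

lemma nexp_minus:
  assumes "nilpotent a" shows "nexp a * nexp (- a) = 1"
proof -
  have "nilpotent (- a)" using nilpotent_scaleR[OF assms, of "-1"] by simp
  hence "nexp (a + - a) = nexp a * nexp (- a)" using assms by (intro nexp_add) auto
  thus ?thesis by simp
qed

section \<open>The Berezin integral of a Gaussian\<close>

text \<open>The sign of sorting \<open>\<psi>\<^sub>1 D\<^sub>1 \<dots> \<psi>\<^sub>p D\<^sub>p\<close> into \<open>\<psi>\<^sub>1 \<dots> \<psi>\<^sub>p D\<^sub>1 \<dots> D\<^sub>p\<close> for odd factors: the last \<open>\<psi>\<close> moves past
\<open>p\<close> elements \<open>D\<close> in the step from \<open>p\<close> to \<open>Suc p\<close>.\<close>

primrec eps :: "nat \<Rightarrow> real" where
  "eps 0 = 1"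
| "eps (Suc p) = (-1) ^ p * eps p"

lemma eps_nonzero [simp]: "eps p \<noteq> 0" by (induction p) auto

lemma eps_add_even: "eps (p + 2 * l) = (-1) ^ l * eps p"
  by (induction l) auto

lemma prod_list_pairs:
  assumes "\<And>i. i \<in> set is \<Longrightarrow> odd_elem (\<psi> i)" "\<And>i. i \<in> set is \<Longrightarrow> odd_elem (D i)"
  shows "prod_list (map (\<lambda>i. \<psi> i * D i) is) = eps (length is) *\<^sub>R (prod_list (map \<psi> is) * prod_list (map D is))"
  using assms
proof (induction "is")
  case (Cons a xs)
  let ?P = "prod_list (map \<psi> xs)" and ?Q = "prod_list (map D xs)"
  have IH: "prod_list (map (\<lambda>i. \<psi> i * D i) xs) = eps (length xs) *\<^sub>R (?P * ?Q)"
    using Cons.prems by (intro Cons.IH) auto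
  have "has_parity (odd (length (map \<psi> xs))) ?P"
    using Cons.prems by (intro parity_prod_list) auto
  hence "D a * ?P = (if odd (length xs) then -1 else 1) *\<^sub>R (?P * D a)"
    using parity_commute[of "odd (length xs)" ?P True "D a"] Cons.prems by simp
  also have "(if odd (length xs) then -1 else 1 :: real) = (-1) ^ length xs"
    by simp
  finally have c: "D a * ?P = (-1) ^ length xs *\<^sub>R (?P * D a)" .
  have "prod_list (map (\<lambda>i. \<psi> i * D i) (a # xs)) = eps (length xs) *\<^sub>R (\<psi> a * (D a * ?P) * ?Q)"
    by (simp add: IH mult.assoc)
  thus ?case unfolding c by (simp add: mult.assoc mult.commute)
qed simp

lemma word_one_plus: "word n (\<lambda>i. 1 + a i) = (\<Sum>I\<in>Pow {..<n}. omon a I)"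
proof (induction n)
  case (Suc n)
  have "(\<Sum>I\<in>Pow {..<Suc n}. omon a I) = (\<Sum>I\<in>Pow {..<n}. omon a I) + (\<Sum>I\<in>insert n ` Pow {..<n}. omon a I)"
    unfolding lessThan_Suc Pow_insert by (rule sum.union_disjoint) auto
  also have "(\<Sum>I\<in>insert n ` Pow {..<n}. omon a I) = (\<Sum>I\<in>Pow {..<n}. omon a (insert n I))"
    by (subst sum.reindex) (auto intro!: inj_onI)
  also have "\<dots> = (\<Sum>I\<in>Pow {..<n}. omon a I * a n)"
    by (intro sum.cong omon_insert_max) (auto intro: finite_subset)
  finally show ?case unfolding word_Suc Suc by (simp add: distrib_left sum_distrib_right)
qed simp

text \<open>For antisymmetric \<open>Om\<close> and \<open>J\<close> of even cardinality this is the Pfaffian of the submatrix of \<open>Om / 2\<close> with indices in \<open>J\<close>,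
namely the factor that belongs to \<open>I' = J\<close> in the Mathai-Quillen form.\<close>

definition pfaff :: "nat set \<Rightarrow> (nat \<Rightarrow> nat \<Rightarrow> grassmann) \<Rightarrow> grassmann" where
  "pfaff J Om = (let l = card J; i' = (\<lambda>r. sorted_list_of_set J ! r) in
     (1 / (2 ^ l * fact (l div 2))) *\<^sub>R
       (\<Sum>\<sigma> | \<sigma> permutes {..<l}. of_int (sign \<sigma>) *\<^sub>R word (l div 2) (\<lambda>r. Om (i' (\<sigma> (2 * r))) (i' (\<sigma> (2 * r + 1))))))"

definition quad :: "nat \<Rightarrow> (nat \<Rightarrow> grassmann) \<Rightarrow> (nat \<Rightarrow> nat \<Rightarrow> grassmann) \<Rightarrow> grassmann" where
  "quad n \<psi> Om = (\<Sum>i<n. \<Sum>j<n. \<psi> i * \<psi> j * Om i j)"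

text \<open>The Mathai-Quillen form without its scalar factor, with odd elements \<open>D i\<close> in place of
\<open>(dx + \<theta>x)\<^sub>i\<close> and even elements \<open>Om i j\<close> in place of the curvature forms.\<close>

definition mq :: "nat \<Rightarrow> (nat \<Rightarrow> grassmann) \<Rightarrow> (nat \<Rightarrow> nat \<Rightarrow> grassmann) \<Rightarrow> grassmann" where
  "mq n D Om = (\<Sum>I\<in>{I. I \<subseteq> {..<n} \<and> even (card ({..<n} - I))}.
     shuffle_sign I ({..<n} - I) *\<^sub>R (omon D I * pfaff ({..<n} - I) Om))"

text \<open>The integrand of the Berezin integral that represents \<open>mq n D Om\<close>; integration means taking the
coefficient of the product of all \<open>\<psi> i\<close>.\<close>

definition berezin :: "nat \<Rightarrow> (nat \<Rightarrow> grassmann) \<Rightarrow> (nat \<Rightarrow> grassmann) \<Rightarrow> (nat \<Rightarrow> nat \<Rightarrow> grassmann) \<Rightarrow> grassmann" where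
  "berezin n \<psi> D Om = nexp (\<Sum>i<n. \<psi> i * D i) * nexp (- (1/4) *\<^sub>R quad n \<psi> Om)"

lemma word_closed:
  assumes "P 1" "\<And>x y. P x \<Longrightarrow> P y \<Longrightarrow> P (x * y)" "\<And>r. r < p \<Longrightarrow> P (a r)"
  shows "P (word p a)"
  using assms by (induction p) auto

lemma even_word: "(\<And>r. r < p \<Longrightarrow> even_elem (a r)) \<Longrightarrow> even_elem (word p a)"
  by (rule word_closed) (auto intro: even_mult)

lemma in_vars_word: "(\<And>r. r < p \<Longrightarrow> in_vars X (a r)) \<Longrightarrow> in_vars X (word p a)"
  by (rule word_closed) (auto intro: in_vars_mult)

lemma sorted_list_permuted_nth:
  assumes J: "finite J" and s: "\<sigma> permutes {..<card J}" and q: "q < card J"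
  shows "sorted_list_of_set J ! \<sigma> q \<in> J"
proof -
  have "\<sigma> q < card J" using permutes_in_image[OF s, of q] q by simp
  hence "sorted_list_of_set J ! \<sigma> q \<in> set (sorted_list_of_set J)" by (intro nth_mem) simp
  thus ?thesis using J by simp
qed

text \<open>Any property of the entries that is preserved by the ring operations passes to the Pfaffian; this is
applied to parity and to the set of generators that occur.\<close>

lemma pfaff_closed:
  assumes J: "finite J" and Om: "\<And>i j. i \<in> J \<Longrightarrow> j \<in> J \<Longrightarrow> P (Om i j)"
    and one: "P 1" and mult: "\<And>x y. P x \<Longrightarrow> P y \<Longrightarrow> P (x * y)"
    and add: "\<And>(f :: (nat \<Rightarrow> nat) \<Rightarrow> grassmann) I. (\<And>i. i \<in> I \<Longrightarrow> P (f i)) \<Longrightarrow> P (sum f I)" and scale: "\<And>r x. P x \<Longrightarrow> P (r *\<^sub>R x)"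
  shows "P (pfaff J Om)"
proof -
  let ?i = "\<lambda>r. sorted_list_of_set J ! r"
  note mem = sorted_list_permuted_nth[OF J]
  have w: "P (word (card J div 2) (\<lambda>r. Om (?i (\<sigma> (2 * r))) (?i (\<sigma> (2 * r + 1)))))"
    if s: "\<sigma> \<in> {\<sigma>. \<sigma> permutes {..<card J}}" for \<sigma>
  proof (rule word_closed[of P, OF one mult])
    fix r assume "r < card J div 2"
    hence r: "2 * r < card J" "2 * r + 1 < card J" by auto
    show "P (Om (?i (\<sigma> (2 * r))) (?i (\<sigma> (2 * r + 1))))"
      using s r by (intro Om mem) auto
  qed
  show ?thesis unfolding pfaff_def Let_def by (rule scale, rule add, rule scale, rule w)
qed

lemma even_pfaff: "finite J \<Longrightarrow> (\<And>i j. i \<in> J \<Longrightarrow> j \<in> J \<Longrightarrow> even_elem (Om i j)) \<Longrightarrow> even_elem (pfaff J Om)"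
  by (rule pfaff_closed[where P = even_elem]) (simp_all add: even_mult has_parity_sum has_parity_scaleR)

lemma in_vars_pfaff: "finite J \<Longrightarrow> (\<And>i j. i \<in> J \<Longrightarrow> j \<in> J \<Longrightarrow> in_vars X (Om i j)) \<Longrightarrow> in_vars X (pfaff J Om)"
  by (rule pfaff_closed[where P = "in_vars X"]) (simp_all add: in_vars_mult in_vars_sum in_vars_scaleR)

lemma pfaff_cong:
  assumes J: "finite J" and Om: "\<And>i j. i \<in> J \<Longrightarrow> j \<in> J \<Longrightarrow> Om i j = Om' i j"
  shows "pfaff J Om = pfaff J Om'"
proof -
  let ?i = "\<lambda>r. sorted_list_of_set J ! r"
  note mem = sorted_list_permuted_nth[OF J]
  have "word (card J div 2) (\<lambda>r. Om (?i (\<sigma> (2 * r))) (?i (\<sigma> (2 * r + 1)))) =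
      word (card J div 2) (\<lambda>r. Om' (?i (\<sigma> (2 * r))) (?i (\<sigma> (2 * r + 1))))"
    if s: "\<sigma> \<in> {\<sigma>. \<sigma> permutes {..<card J}}" for \<sigma>
  proof (rule word_cong)
    fix r assume "r < card J div 2"
    hence r: "2 * r < card J" "2 * r + 1 < card J" by auto
    show "Om (?i (\<sigma> (2 * r))) (?i (\<sigma> (2 * r + 1))) = Om' (?i (\<sigma> (2 * r))) (?i (\<sigma> (2 * r + 1)))"
      using s r by (intro Om mem) auto
  qed
  thus ?thesis unfolding pfaff_def Let_def
    by (intro arg_cong[of _ _ "scaleR _"] sum.cong refl)
qed

lemma mq_cong:
  assumes D: "\<And>i. i < n \<Longrightarrow> D i = D' i" and Om: "\<And>i j. i < n \<Longrightarrow> j < n \<Longrightarrow> Om i j = Om' i j"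
  shows "mq n D Om = mq n D' Om'"
  unfolding mq_def
proof (intro sum.cong refl)
  fix I assume I: "I \<in> {I. I \<subseteq> {..<n} \<and> even (card ({..<n} - I))}"
  hence f: "finite I" using finite_subset[of I "{..<n}"] by simp
  have "omon D I = omon D' I" using I f by (intro arg_cong[of _ _ prod_list] map_cong refl D) auto
  moreover have "pfaff ({..<n} - I) Om = pfaff ({..<n} - I) Om'" by (rule pfaff_cong) (auto intro: Om)
  ultimately show "shuffle_sign I ({..<n} - I) *\<^sub>R (omon D I * pfaff ({..<n} - I) Om) =
      shuffle_sign I ({..<n} - I) *\<^sub>R (omon D' I * pfaff ({..<n} - I) Om')" by simp
qed

text \<open>Expand the power into a sum over index sequences. The entries of \<open>Om\<close> are even, so the \<open>\<psi>\<close> may be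
collected in front of them.\<close>

lemma quad_power:
  assumes "\<And>i. i < n \<Longrightarrow> odd_elem (\<psi> i)" "\<And>i j. i < n \<Longrightarrow> j < n \<Longrightarrow> even_elem (Om i j)"
  shows "quad n \<psi> Om ^ l =
    (\<Sum>f\<in>PiE {..<2 * l} (\<lambda>_. {..<n}). word (2 * l) (\<psi> \<circ> f) * word l (\<lambda>r. Om (f (2 * r)) (f (2 * r + 1))))"
proof (induction l)
  case (Suc l)
  let ?T = "\<lambda>f l. word l (\<lambda>r. Om (f (2 * r)) (f (2 * r + 1)))"
  let ?A = "PiE {..<2 * l} (\<lambda>_. {..<n})"
  have set: "{..<2 * Suc l} = insert (2 * l + 1) (insert (2 * l) {..<2 * l})" by auto
  have "(\<Sum>f\<in>PiE {..<2 * Suc l} (\<lambda>_. {..<n}). word (2 * Suc l) (\<psi> \<circ> f) * ?T f (Suc l))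
     = (\<Sum>f\<in>?A. \<Sum>i<n. \<Sum>j<n. word (2 * Suc l) (\<psi> \<circ> f(2 * l := i, 2 * l + 1 := j)) * ?T (f(2 * l := i, 2 * l + 1 := j)) (Suc l))"
    unfolding set by (subst sum_PiE_insert, simp, subst sum_PiE_insert, simp, rule refl)
  also have "\<dots> = (\<Sum>f\<in>?A. \<Sum>i<n. \<Sum>j<n. word (2 * l) (\<psi> \<circ> f) * ?T f l * (\<psi> i * \<psi> j * Om i j))"
  proof (intro sum.cong refl)
    fix f i j assume f: "f \<in> ?A" and ij: "i \<in> {..<n}" "j \<in> {..<n}"
    let ?f = "f(2 * l := i, 2 * l + 1 := j)"
    have "word (2 * l) (\<psi> \<circ> ?f) = word (2 * l) (\<psi> \<circ> f)" by (rule word_cong) simp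
    hence 1: "word (2 * Suc l) (\<psi> \<circ> ?f) = word (2 * l) (\<psi> \<circ> f) * \<psi> i * \<psi> j" by simp
    have "?T ?f l = ?T f l" by (rule word_cong) simp
    hence 2: "?T ?f (Suc l) = ?T f l * Om i j" by simp
    have "f q < n" if "q < 2 * l" for q using PiE_mem[OF f, of q] that by simp
    hence "even_elem (?T f l)" using assms(2) by (intro even_word) simp
    hence "?T f l * (\<psi> i * \<psi> j) = (\<psi> i * \<psi> j) * ?T f l" by (rule even_commute_all)
    hence "word (2 * l) (\<psi> \<circ> f) * (?T f l * (\<psi> i * \<psi> j)) * Om i j = word (2 * l) (\<psi> \<circ> f) * ((\<psi> i * \<psi> j) * ?T f l) * Om i j"
      by (rule arg_cong)
    thus "word (2 * Suc l) (\<psi> \<circ> ?f) * ?T ?f (Suc l) = word (2 * l) (\<psi> \<circ> f) * ?T f l * (\<psi> i * \<psi> j * Om i j)"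
      unfolding 1 2 mult.assoc by simp
  qed
  also have "\<dots> = (\<Sum>f\<in>?A. word (2 * l) (\<psi> \<circ> f) * ?T f l) * quad n \<psi> Om"
  proof -
    have "(\<Sum>f\<in>?A. \<Sum>i<n. \<Sum>j<n. word (2 * l) (\<psi> \<circ> f) * ?T f l * (\<psi> i * \<psi> j * Om i j))
      = (\<Sum>f\<in>?A. word (2 * l) (\<psi> \<circ> f) * ?T f l * quad n \<psi> Om)"
      by (simp only: quad_def sum_distrib_left)
    thus ?thesis by (simp only: sum_distrib_right)
  qed
  finally show ?case by (simp only: power_Suc2 Suc)
qed simp

text \<open>By \<open>sum_words\<close> the sequences with a given set \<open>J\<close> of indices add up to the alternating sum in the
definition of the Pfaffian.\<close>

lemma quad_power_pfaff:
  assumes "\<And>i. i < n \<Longrightarrow> odd_elem (\<psi> i)" "\<And>i j. i < n \<Longrightarrow> j < n \<Longrightarrow> even_elem (Om i j)"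
  shows "quad n \<psi> Om ^ l = (4 ^ l * fact l) *\<^sub>R (\<Sum>J | J \<subseteq> {..<n} \<and> card J = 2 * l. omon \<psi> J * pfaff J Om)"
proof -
  let ?F = "\<lambda>f. word l (\<lambda>r. Om (f (2 * r)) (f (2 * r + 1)))"
  have "quad n \<psi> Om ^ l = (\<Sum>J | J \<subseteq> {..<n} \<and> card J = 2 * l. omon \<psi> J *
       (\<Sum>\<sigma> | \<sigma> permutes {..<2 * l}. of_int (sign \<sigma>) *\<^sub>R ?F (\<lambda>r. sorted_list_of_set J ! \<sigma> r)))"
  proof -
    have cong: "?F f = ?F f'" if e: "\<And>r. r < 2 * l \<Longrightarrow> f r = f' r" for f f' :: "nat \<Rightarrow> nat"
      by (rule word_cong) (simp add: e)
    have "quad n \<psi> Om ^ l = (\<Sum>f\<in>PiE {..<2 * l} (\<lambda>_. {..<n}). word (2 * l) (\<psi> \<circ> f) * ?F f)"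
      by (rule quad_power[OF assms])
    also have "\<dots> = (\<Sum>J | J \<subseteq> {..<n} \<and> card J = 2 * l. omon \<psi> J *
       (\<Sum>\<sigma> | \<sigma> permutes {..<2 * l}. of_int (sign \<sigma>) *\<^sub>R ?F (\<lambda>r. sorted_list_of_set J ! \<sigma> r)))"
      by (rule sum_words[of n \<psi> "2 * l" ?F, OF assms(1) cong])
    finally show ?thesis .
  qed
  also have "\<dots> = (\<Sum>J | J \<subseteq> {..<n} \<and> card J = 2 * l. omon \<psi> J * ((4 ^ l * fact l) *\<^sub>R pfaff J Om))"
  proof (intro sum.cong refl arg_cong2[of _ _ _ _ "(*)"])
    fix J assume "J \<in> {J. J \<subseteq> {..<n} \<and> card J = 2 * l}"
    hence c: "card J = 2 * l" by simp
    have "(2 :: real) ^ (2 * l) = 4 ^ l" by (simp add: power_mult)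
    thus "(\<Sum>\<sigma> | \<sigma> permutes {..<2 * l}. of_int (sign \<sigma>) *\<^sub>R ?F (\<lambda>r. sorted_list_of_set J ! \<sigma> r)) = (4 ^ l * fact l) *\<^sub>R pfaff J Om"
      unfolding pfaff_def Let_def c by simp
  qed
  finally show ?thesis by (simp add: scaleR_sum_right)
qed

lemma nexp_quad:
  assumes "\<And>i. i < n \<Longrightarrow> odd_elem (\<psi> i)" "\<And>i j. i < n \<Longrightarrow> j < n \<Longrightarrow> even_elem (Om i j)"
  shows "nilpotent (quad n \<psi> Om)"
    and "nexp (- (1/4) *\<^sub>R quad n \<psi> Om) =
      (\<Sum>J | J \<subseteq> {..<n} \<and> even (card J). (-1) ^ (card J div 2) *\<^sub>R (omon \<psi> J * pfaff J Om))"
proof -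
  let ?q = "quad n \<psi> Om"
  let ?B = "\<lambda>l. {J. J \<subseteq> {..<n} \<and> card J = 2 * l}"
  have pow: "?q ^ l = (4 ^ l * fact l) *\<^sub>R (\<Sum>J\<in>?B l. omon \<psi> J * pfaff J Om)" for l
    using assms by (rule quad_power_pfaff)
  have cle: "card J \<le> n" if "J \<subseteq> {..<n}" for J using card_mono[OF finite_lessThan that] by simp
  have "J \<notin> ?B (Suc n)" for J using cle[of J] by auto
  hence "?B (Suc n) = {}" by blast
  hence q: "?q ^ Suc n = 0" unfolding pow[of "Suc n"] by (simp only: sum.empty scaleR_zero_right)
  thus "nilpotent ?q" by (rule nilpotentI)
  have q': "(- (1/4) *\<^sub>R ?q) ^ Suc n = 0" unfolding power_scaleR_g q by (rule scaleR_zero_right)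
  have "nexp (- (1/4) *\<^sub>R ?q) = (\<Sum>l<Suc n. (1 / fact l) *\<^sub>R (- (1/4) *\<^sub>R ?q) ^ l)"
    by (rule nexp_eq[OF q'])
  also have "\<dots> = (\<Sum>l<Suc n. \<Sum>J\<in>?B l. (-1) ^ l *\<^sub>R (omon \<psi> J * pfaff J Om))"
  proof (intro sum.cong refl)
    fix l
    have "(1 / fact l) *\<^sub>R (- (1/4) *\<^sub>R ?q) ^ l = ((1 / fact l) * (- (1/4)) ^ l * (4 ^ l * fact l)) *\<^sub>R (\<Sum>J\<in>?B l. omon \<psi> J * pfaff J Om)"
      unfolding power_scaleR_g pow scaleR_scaleR mult.assoc ..
    also have "(1 / fact l) * (- (1/4)) ^ l * (4 ^ l * fact l) = ((- (1/4)) * 4 :: real) ^ l"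
      unfolding power_mult_distrib by simp
    also have "\<dots> = (-1) ^ l" by simp
    finally show "(1 / fact l) *\<^sub>R (- (1/4) *\<^sub>R ?q) ^ l = (\<Sum>J\<in>?B l. (-1) ^ l *\<^sub>R (omon \<psi> J * pfaff J Om))"
      by (simp only: scaleR_sum_right)
  qed
  also have "\<dots> = (\<Sum>l<Suc n. \<Sum>J\<in>{J \<in> {J. J \<subseteq> {..<n} \<and> even (card J)}. card J div 2 = l}. (-1) ^ (card J div 2) *\<^sub>R (omon \<psi> J * pfaff J Om))"
  proof (intro sum.cong refl)
    fix l show "?B l = {J \<in> {J. J \<subseteq> {..<n} \<and> even (card J)}. card J div 2 = l}" by auto
  qed auto
  also have "\<dots> = (\<Sum>J | J \<subseteq> {..<n} \<and> even (card J). (-1) ^ (card J div 2) *\<^sub>R (omon \<psi> J * pfaff J Om))"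
  proof (rule sum.group)
    show "finite {J. J \<subseteq> {..<n} \<and> even (card J)}" by simp
    show "(\<lambda>J. card J div 2) ` {J. J \<subseteq> {..<n} \<and> even (card J)} \<subseteq> {..<Suc n}"
    proof (rule image_subsetI)
      fix J assume "J \<in> {J. J \<subseteq> {..<n} \<and> even (card J)}"
      hence "card J \<le> n" using cle by blast
      thus "card J div 2 \<in> {..<Suc n}" by simp
    qed
  qed simp
  finally show "nexp (- (1/4) *\<^sub>R ?q) =
      (\<Sum>J | J \<subseteq> {..<n} \<and> even (card J). (-1) ^ (card J div 2) *\<^sub>R (omon \<psi> J * pfaff J Om))" .
qed

lemma parity_omon: "finite J \<Longrightarrow> (\<And>i. i \<in> J \<Longrightarrow> odd_elem (\<psi> i)) \<Longrightarrow> has_parity (odd (card J)) (omon \<psi> J)"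
  using parity_prod_list[of "map \<psi> (sorted_list_of_set J)"] by auto

lemma in_vars_omon: "finite J \<Longrightarrow> (\<And>i. i \<in> J \<Longrightarrow> in_vars X (\<psi> i)) \<Longrightarrow> in_vars X (omon \<psi> J)"
  by (intro in_vars_prod_list) auto

text \<open>The summands \<open>\<psi> i * D i\<close> are even and have square \<open>0\<close>, so the exponential of their sum is the
product of the factors \<open>1 + \<psi> i * D i\<close>.\<close>

lemma linear_term:
  assumes \<psi>: "\<And>i. i < n \<Longrightarrow> odd_elem (\<psi> i)" and D: "\<And>i. i < n \<Longrightarrow> odd_elem (D i)"
  shows "nilpotent (\<Sum>i<n. \<psi> i * D i)"
    and "nexp (\<Sum>i<n. \<psi> i * D i) = (\<Sum>I\<in>Pow {..<n}. eps (card I) *\<^sub>R (omon \<psi> I * omon D I))"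
proof -
  have sq: "(\<psi> i * D i) * (\<psi> i * D i) = 0" if "i < n" for i
  proof -
    have "\<psi> i * D i * (\<psi> i * D i) = \<psi> i * (D i * \<psi> i) * D i" by (simp add: mult.assoc)
    also have "D i * \<psi> i = - (\<psi> i * D i)" using assms that by (intro odd_anticommute) auto
    also have "\<psi> i * - (\<psi> i * D i) * D i = - ((\<psi> i * \<psi> i) * (D i * D i))" by (simp add: mult.assoc)
    finally show ?thesis using odd_square[OF \<psi>[OF that]] by simp
  qed
  have ev: "even_elem (\<psi> i * D i)" if "i < n" for i using assms that by (intro odd_mult_odd) auto
  note ns = nexp_sum[of n "\<lambda>i. \<psi> i * D i", OF ev nilpotent_square_zero[OF sq]]
  show "nilpotent (\<Sum>i<n. \<psi> i * D i)" using ns by blast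
  have "nexp (\<Sum>i<n. \<psi> i * D i) = word n (\<lambda>i. nexp (\<psi> i * D i))" using ns by blast
  also have "\<dots> = word n (\<lambda>i. 1 + \<psi> i * D i)" using sq by (intro word_cong nexp_square_zero)
  also have "\<dots> = (\<Sum>I\<in>Pow {..<n}. omon (\<lambda>i. \<psi> i * D i) I)" by (rule word_one_plus)
  also have "\<dots> = (\<Sum>I\<in>Pow {..<n}. eps (card I) *\<^sub>R (omon \<psi> I * omon D I))"
  proof (rule sum.cong)
    fix I assume "I \<in> Pow {..<n}"
    hence I: "finite I" "\<And>i. i \<in> I \<Longrightarrow> i < n" by (auto intro: finite_subset)
    have "omon (\<lambda>i. \<psi> i * D i) I = eps (length (sorted_list_of_set I)) *\<^sub>R (omon \<psi> I * omon D I)"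
      using I assms by (intro prod_list_pairs) auto
    thus "omon (\<lambda>i. \<psi> i * D i) I = eps (card I) *\<^sub>R (omon \<psi> I * omon D I)" by simp
  qed simp
  finally show "nexp (\<Sum>i<n. \<psi> i * D i) = (\<Sum>I\<in>Pow {..<n}. eps (card I) *\<^sub>R (omon \<psi> I * omon D I))" .
qed

lemma berezin_expand:
  assumes \<psi>: "\<And>i. i < n \<Longrightarrow> odd_elem (\<psi> i)" and D: "\<And>i. i < n \<Longrightarrow> odd_elem (D i)"
    and Om: "\<And>i j. i < n \<Longrightarrow> j < n \<Longrightarrow> even_elem (Om i j)"
  shows "berezin n \<psi> D Om = (\<Sum>I\<in>Pow {..<n}. \<Sum>J | J \<subseteq> {..<n} \<and> even (card J).
     (eps (card I) * (-1) ^ (card J div 2)) *\<^sub>R (omon \<psi> I * omon \<psi> J * (omon D I * pfaff J Om)))"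
proof -
  have "berezin n \<psi> D Om = (\<Sum>I\<in>Pow {..<n}. eps (card I) *\<^sub>R (omon \<psi> I * omon D I)) *
     (\<Sum>J | J \<subseteq> {..<n} \<and> even (card J). (-1) ^ (card J div 2) *\<^sub>R (omon \<psi> J * pfaff J Om))"
    unfolding berezin_def using linear_term(2)[of n \<psi> D, OF \<psi> D] nexp_quad(2)[of n \<psi> Om, OF \<psi> Om] by simp
  also have "\<dots> = (\<Sum>I\<in>Pow {..<n}. \<Sum>J | J \<subseteq> {..<n} \<and> even (card J).
     (eps (card I) * (-1) ^ (card J div 2)) *\<^sub>R (omon \<psi> I * omon \<psi> J * (omon D I * pfaff J Om)))"
    unfolding sum_product
  proof (intro sum.cong refl)
  fix I J assume I: "I \<in> Pow {..<n}" and "J \<in> {J. J \<subseteq> {..<n} \<and> even (card J)}"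
  hence J: "finite J" "even (card J)" "\<And>i. i \<in> J \<Longrightarrow> i < n" by (auto intro: finite_subset)
  have "even_elem (omon \<psi> J)" using parity_omon[of J \<psi>] J \<psi> by auto
  hence "omon \<psi> J * omon D I = omon D I * omon \<psi> J" by (rule even_commute_all)
  hence "omon \<psi> I * (omon D I * omon \<psi> J) * pfaff J Om = omon \<psi> I * (omon \<psi> J * omon D I) * pfaff J Om" by simp
  thus "eps (card I) *\<^sub>R (omon \<psi> I * omon D I) * (-1) ^ (card J div 2) *\<^sub>R (omon \<psi> J * pfaff J Om) =
     (eps (card I) * (-1) ^ (card J div 2)) *\<^sub>R (omon \<psi> I * omon \<psi> J * (omon D I * pfaff J Om))"
    by (simp add: mult.assoc mult.commute)
  qed
  finally show ?thesis .
qed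

text \<open>The Berezin integral over new generators \<open>N, \<dots>, N + n - 1\<close>. Since \<open>D\<close> and \<open>Om\<close> contain none of these,
a term contributes only if its \<open>\<psi>\<close> factors form the full product, that is, if the index set of the
\<open>\<psi>\<close> from the quadratic part is the complement of that from the linear part. This produces exactly
the terms of \<open>mq\<close>, with their shuffle signs. The \<open>\<psi>\<close> are allowed to be linear combinations of the new
generators, so that two choices of them can be compared in the proof of \<open>mq_linear_change\<close>.\<close>

lemma coef_berezin_top:
  assumes \<psi>: "\<And>j. j < n \<Longrightarrow> \<psi> j = (\<Sum>i<n. G i j *\<^sub>R gen (N + i))"
    and D: "\<And>i. i < n \<Longrightarrow> odd_elem (D i)" "\<And>i. i < n \<Longrightarrow> in_vars {..<N} (D i)"
    and Om: "\<And>i j. i < n \<Longrightarrow> j < n \<Longrightarrow> even_elem (Om i j)" "\<And>i j. i < n \<Longrightarrow> j < n \<Longrightarrow> in_vars {..<N} (Om i j)"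
  shows "coef (berezin n \<psi> D Om) {..<N + n} =
    eps n * shuffle_sign {N..<N + n} {..<N} * det_of n (\<lambda>i j. G i j) * coef (mq n D Om) {..<N}"
proof -
  let ?Y = "{N..<N + n}" and ?d = "det_of n (\<lambda>i j. G i j)"
  let ?\<eta> = "\<lambda>i. gen (N + i)" and ?X = "\<lambda>I J. omon D I * pfaff J Om"
  have odd\<psi>: "odd_elem (\<psi> j)" if "j < n" for j
    unfolding \<psi>[OF that] by (intro has_parity_sum has_parity_scaleR odd_gen)
  have deg\<psi>: "deg_le ?Y 1 (\<psi> j)" if "j < n" for j
    unfolding \<psi>[OF that] by (intro deg_le_sum deg_le_scaleR deg_le_gen)
  have full: "omon \<psi> {..<n} = ?d *\<^sub>R word n ?\<eta>"
  proof -
    have "omon \<psi> {..<n} = word n \<psi>" by (rule omon_full)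
    also have "\<dots> = word n (\<lambda>j. \<Sum>i<n. G i j *\<^sub>R ?\<eta> i)" using \<psi> by (intro word_cong) simp
    also have "\<dots> = ?d *\<^sub>R word n ?\<eta>" by (rule word_linear_substitution) simp
    finally show ?thesis .
  qed
  have top: "{..<N + n} = ?Y \<union> {..<N}" by auto
  have w\<eta>: "word n ?\<eta> = prod_list (map gen [N..<N + n])"
    unfolding word_def by (rule arg_cong[of _ _ prod_list]) (rule nth_equalityI; simp)
  have cw: "coef (word n ?\<eta>) ?Y = 1" unfolding w\<eta> by (rule coef_prod_gen)
  \<comment> \<open>The coefficient of a single term; it vanishes unless the two index sets are complementary.\<close>
  have tm: "coef (omon \<psi> I * omon \<psi> J * ?X I J) {..<N + n} =
      (if J = {..<n} - I then shuffle_sign I J * ?d * shuffle_sign ?Y {..<N} * coef (?X I J) {..<N} else 0)"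
    if I: "I \<subseteq> {..<n}" and J: "J \<subseteq> {..<n}" for I J
  proof -
    have fin: "finite I" "finite J" using I J by (auto intro: finite_subset)
    have oddIJ: "odd_elem (\<psi> i)" if "i \<in> I \<union> J" for i using that I J odd\<psi> by auto
    have vX: "in_vars {..<N} (?X I J)"
    proof (intro in_vars_mult in_vars_omon in_vars_pfaff fin)
      show "in_vars {..<N} (D i)" if "i \<in> I" for i using D(2) I that by auto
      show "in_vars {..<N} (Om i j)" if "i \<in> J" "j \<in> J" for i j
        using that J by (intro Om(2)) auto
    qed
    show ?thesis
    proof (cases "I \<inter> J = {}")
      case False
      hence "omon \<psi> I * omon \<psi> J = 0" using fin oddIJ by (intro omon_overlap) auto
      thus ?thesis using False by auto
    next
      case disj: True
      have IJ: "omon \<psi> I * omon \<psi> J = shuffle_sign I J *\<^sub>R omon \<psi> (I \<union> J)"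
        using fin oddIJ disj by (intro omon_Un) auto
      show ?thesis
      proof (cases "J = {..<n} - I")
        case True
        hence U: "I \<union> J = {..<n}" using I by auto
        have "coef (word n ?\<eta> * ?X I J) {..<N + n} = shuffle_sign ?Y {..<N} * coef (word n ?\<eta>) ?Y * coef (?X I J) {..<N}"
          unfolding top using vX
          by (intro coef_mult_split in_vars_word in_vars_gen) auto
        hence "coef (word n ?\<eta> * ?X I J) {..<N + n} = shuffle_sign ?Y {..<N} * coef (?X I J) {..<N}"
          unfolding cw by simp
        thus ?thesis unfolding IJ U full using True by simp
      next
        case False
        hence "I \<union> J \<noteq> {..<n}" using disj by auto
        hence "I \<union> J \<subset> {..<n}" using I J by auto
        hence card: "card I + card J < n"
          using psubset_card_mono[of "{..<n}" "I \<union> J"] card_Un_disjoint[OF fin disj] by simp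
        \<comment> \<open>If the index sets are disjoint but do not exhaust all indices, the degree in the new generators is too small.\<close>
        have d: "deg_le ?Y (card K) (omon \<psi> K)" if K: "K \<subseteq> {..<n}" for K
        proof -
          have "finite K" using K by (auto intro: finite_subset)
          hence "deg_le ?Y (length (map \<psi> (sorted_list_of_set K))) (omon \<psi> K)"
            using deg\<psi> K by (intro deg_le_prod_list) auto
          thus ?thesis by simp
        qed
        have "deg_le ?Y (card I + card J + 0) (omon \<psi> I * omon \<psi> J * ?X I J)"
          by (rule deg_le_mult[OF deg_le_mult[OF d[OF I] d[OF J]] deg_le_0[OF vX]]) auto
        moreover have "card ({..<N + n} \<inter> ?Y) = n"
        proof -
          have "{..<N + n} \<inter> ?Y = ?Y" by auto
          thus ?thesis by simp
        qed
        ultimately have "coef (omon \<psi> I * omon \<psi> J * ?X I J) {..<N + n} = 0"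
          unfolding deg_le_def using card by fastforce
        thus ?thesis using False by simp
      qed
    qed
  qed
  have "coef (berezin n \<psi> D Om) {..<N + n} = (\<Sum>I\<in>Pow {..<n}. \<Sum>J | J \<subseteq> {..<n} \<and> even (card J).
      (eps (card I) * (-1) ^ (card J div 2)) * coef (omon \<psi> I * omon \<psi> J * ?X I J) {..<N + n})"
    by (subst berezin_expand[OF odd\<psi> D(1) Om(1)]) simp_all
  also have "\<dots> = (\<Sum>I\<in>Pow {..<n}. \<Sum>J | J \<subseteq> {..<n} \<and> even (card J).
      if J = {..<n} - I then eps n * shuffle_sign ?Y {..<N} * ?d * (shuffle_sign I J * coef (?X I J) {..<N}) else 0)"
  proof (intro sum.cong refl)
    fix I J assume I: "I \<in> Pow {..<n}" and J: "J \<in> {J. J \<subseteq> {..<n} \<and> even (card J)}"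
    \<comment> \<open>The signs from both exponentials combine to one that is independent of \<open>I\<close>, as the complement is even.\<close>
    have "eps (card I) * (-1) ^ (card J div 2) = eps n" if "J = {..<n} - I"
    proof -
      have "card I + card J = n"
        using I that card_Diff_subset[of I "{..<n}"] card_mono[of "{..<n}" I] finite_subset[of I "{..<n}"] by auto
      moreover have "card J = 2 * (card J div 2)" using J by simp
      ultimately have "n = card I + 2 * (card J div 2)" by simp
      thus ?thesis using eps_add_even[of "card I" "card J div 2"] by simp
    qed
    thus "(eps (card I) * (-1) ^ (card J div 2)) * coef (omon \<psi> I * omon \<psi> J * ?X I J) {..<N + n} =
      (if J = {..<n} - I then eps n * shuffle_sign ?Y {..<N} * ?d * (shuffle_sign I J * coef (?X I J) {..<N}) else 0)"
      using tm[of I J] I J by (simp add: mult_ac)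
  qed
  also have "\<dots> = (\<Sum>I\<in>Pow {..<n}. if even (card ({..<n} - I)) then eps n * shuffle_sign ?Y {..<N} * ?d * (shuffle_sign I ({..<n} - I) * coef (?X I ({..<n} - I)) {..<N}) else 0)"
  proof (intro sum.cong refl)
    fix I
    have "finite {J. J \<subseteq> {..<n} \<and> even (card J)}" by simp
    moreover have "{..<n} - I \<in> {J. J \<subseteq> {..<n} \<and> even (card J)} \<longleftrightarrow> even (card ({..<n} - I))" by auto
    ultimately show "(\<Sum>J | J \<subseteq> {..<n} \<and> even (card J).
       if J = {..<n} - I then eps n * shuffle_sign ?Y {..<N} * ?d * (shuffle_sign I J * coef (?X I J) {..<N}) else 0)
      = (if even (card ({..<n} - I)) then eps n * shuffle_sign ?Y {..<N} * ?d * (shuffle_sign I ({..<n} - I) * coef (?X I ({..<n} - I)) {..<N}) else 0)"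
      by (simp add: sum.delta)
  qed
  also have "\<dots> = (\<Sum>I\<in>{I. I \<subseteq> {..<n} \<and> even (card ({..<n} - I))}. eps n * shuffle_sign ?Y {..<N} * ?d * (shuffle_sign I ({..<n} - I) * coef (?X I ({..<n} - I)) {..<N}))"
    by (subst sum.inter_filter[symmetric]) (auto intro!: sum.cong)
  also have "\<dots> = eps n * shuffle_sign ?Y {..<N} * ?d * coef (mq n D Om) {..<N}"
    unfolding mq_def by (simp add: sum_distrib_left)
  finally show ?thesis .
qed

lemma det_delta: "det_of n (\<lambda>i j. if i = j then 1 else 0 :: real) = 1"
proof -
  have "Matrix.mat n n (\<lambda>(i, j). if i = j then 1 else 0 :: real) = 1\<^sub>m n"
    by (rule eq_matI) auto
  thus ?thesis using det_one by (simp only:)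
qed

lemma coef_berezin_gen:
  assumes D: "\<And>i. i < n \<Longrightarrow> odd_elem (D i)" "\<And>i. i < n \<Longrightarrow> in_vars {..<N} (D i)"
    and Om: "\<And>i j. i < n \<Longrightarrow> j < n \<Longrightarrow> even_elem (Om i j)" "\<And>i j. i < n \<Longrightarrow> j < n \<Longrightarrow> in_vars {..<N} (Om i j)"
  shows "coef (berezin n (\<lambda>i. gen (N + i)) D Om) {..<N + n} = eps n * shuffle_sign {N..<N + n} {..<N} * coef (mq n D Om) {..<N}"
proof -
  have "gen (N + j) = (\<Sum>i<n. (if i = j then 1 else 0 :: real) *\<^sub>R gen (N + i))" if "j < n" for j
  proof -
    have "(\<Sum>i<n. (if i = j then 1 else 0 :: real) *\<^sub>R gen (N + i)) = (\<Sum>i<n. if i = j then gen (N + i) else 0)"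
      by (intro sum.cong) auto
    thus ?thesis using that by simp
  qed
  from coef_berezin_top[of n "\<lambda>i. gen (N + i)", OF this D Om] show ?thesis by (simp add: det_delta)
qed

text \<open>Substituting \<open>G\<close> into \<open>D\<close> and \<open>Om\<close> leaves the exponent unchanged if at the same time \<open>\<psi>\<close> is replaced by
its image under the transposed matrix; that replacement multiplies the top coefficient by the
determinant.\<close>

lemma mq_linear_change:
  assumes D: "\<And>i. i < n \<Longrightarrow> odd_elem (D i)" "\<And>i. i < n \<Longrightarrow> in_vars {..<N} (D i)"
    and Om: "\<And>i j. i < n \<Longrightarrow> j < n \<Longrightarrow> even_elem (Om i j)" "\<And>i j. i < n \<Longrightarrow> j < n \<Longrightarrow> in_vars {..<N} (Om i j)"
    and D': "\<And>i. i < n \<Longrightarrow> D' i = (\<Sum>j<n. G i j *\<^sub>R D j)"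
    and Om': "\<And>i k. i < n \<Longrightarrow> k < n \<Longrightarrow> Om' i k = (\<Sum>j<n. \<Sum>l<n. (G i j * G k l) *\<^sub>R Om j l)"
  shows "coef (mq n D' Om') {..<N} = det_of n (\<lambda>i j. G i j) * coef (mq n D Om) {..<N}"
proof -
  let ?\<eta> = "\<lambda>i. gen (N + i)"
  let ?\<psi> = "\<lambda>j. \<Sum>i<n. G i j *\<^sub>R ?\<eta> i"
  have "(\<Sum>i<n. ?\<eta> i * D' i) = (\<Sum>i<n. \<Sum>j<n. G i j *\<^sub>R (?\<eta> i * D j))"
    by (intro sum.cong refl) (simp add: D' sum_distrib_left)
  also have "\<dots> = (\<Sum>j<n. ?\<psi> j * D j)"
    by (subst sum.swap) (simp add: sum_distrib_right)
  finally have lin: "(\<Sum>i<n. ?\<eta> i * D' i) = (\<Sum>j<n. ?\<psi> j * D j)" .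
  have "quad n ?\<eta> Om' = (\<Sum>i<n. \<Sum>k<n. \<Sum>j<n. \<Sum>l<n. (G i j * G k l) *\<^sub>R (?\<eta> i * ?\<eta> k * Om j l))"
    unfolding quad_def by (intro sum.cong refl) (simp add: Om' sum_distrib_left)
  also have "\<dots> = (\<Sum>i<n. \<Sum>j<n. \<Sum>k<n. \<Sum>l<n. (G i j * G k l) *\<^sub>R (?\<eta> i * ?\<eta> k * Om j l))"
    by (rule sum.cong[OF refl], rule sum.swap)
  also have "\<dots> = (\<Sum>j<n. \<Sum>i<n. \<Sum>l<n. \<Sum>k<n. (G i j * G k l) *\<^sub>R (?\<eta> i * ?\<eta> k * Om j l))"
    by (rule trans[OF sum.swap], rule sum.cong[OF refl], rule sum.cong[OF refl], rule sum.swap)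
  also have "\<dots> = (\<Sum>j<n. \<Sum>l<n. \<Sum>i<n. \<Sum>k<n. (G i j * G k l) *\<^sub>R (?\<eta> i * ?\<eta> k * Om j l))"
    by (rule sum.cong[OF refl], rule sum.swap)
  also have "\<dots> = quad n ?\<psi> Om"
  proof -
    have "?\<psi> j * ?\<psi> l * Om j l = (\<Sum>i<n. \<Sum>k<n. (G i j * G k l) *\<^sub>R (?\<eta> i * ?\<eta> k * Om j l))" for j l
    proof -
      have "?\<psi> j * ?\<psi> l = (\<Sum>i<n. \<Sum>k<n. (G i j * G k l) *\<^sub>R (?\<eta> i * ?\<eta> k))"
        by (simp only: sum_product mult_scaleR_left mult_scaleR_right scaleR_scaleR) (simp only: mult.commute[of "G _ l"])
      thus ?thesis by (simp only: sum_distrib_right mult_scaleR_left)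
    qed
    thus ?thesis unfolding quad_def by (simp only:)
  qed
  finally have qu: "quad n ?\<eta> Om' = quad n ?\<psi> Om" .
  have b: "berezin n ?\<eta> D' Om' = berezin n ?\<psi> D Om"
    unfolding berezin_def lin qu ..
  have "eps n * shuffle_sign {N..<N + n} {..<N} * coef (mq n D' Om') {..<N} = coef (berezin n ?\<eta> D' Om') {..<N + n}"
  proof (rule coef_berezin_gen[symmetric])
    show "odd_elem (D' i)" "in_vars {..<N} (D' i)" if "i < n" for i
      unfolding D'[OF that] using D by (auto intro!: has_parity_sum has_parity_scaleR in_vars_sum in_vars_scaleR)
    show "even_elem (Om' i k)" "in_vars {..<N} (Om' i k)" if "i < n" "k < n" for i k
      unfolding Om'[OF that] using Om by (auto intro!: has_parity_sum has_parity_scaleR in_vars_sum in_vars_scaleR)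
  qed
  also have "\<dots> = eps n * shuffle_sign {N..<N + n} {..<N} * det_of n (\<lambda>i j. G i j) * coef (mq n D Om) {..<N}"
    unfolding b by (rule coef_berezin_top[OF refl D Om])
  finally have "(eps n * shuffle_sign {N..<N + n} {..<N}) * coef (mq n D' Om') {..<N} =
     (eps n * shuffle_sign {N..<N + n} {..<N}) * (det_of n (\<lambda>i j. G i j) * coef (mq n D Om) {..<N})"
    by (simp only: mult.assoc)
  thus ?thesis unfolding mult_cancel_left using eps_nonzero[of n] shuffle_sign_nonzero[of "{N..<N + n}" "{..<N}"]
    by (metis mult_eq_0_iff)
qed

section \<open>Gaussian integration\<close>

text \<open>The moments of \<open>exp (- x\<^sup>2)\<close> on the real line.\<close>

definition gmom :: "nat \<Rightarrow> real" where
  "gmom l = (if even l then sqrt pi * (fact l / (2 ^ l * fact (l div 2))) else 0)"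

lemma gaussian_moment: "has_bochner_integral lborel (\<lambda>x::real. exp (- x\<^sup>2) * x ^ l) (gmom l)"
proof (cases "even l")
  case True
  then obtain k where l: "l = 2 * k" by blast
  have "has_bochner_integral lborel (\<lambda>x::real. exp (- x\<^sup>2) * x ^ (2 * k)) (2 *\<^sub>R ((sqrt pi / 2) * (fact (2 * k) / (2 ^ (2 * k) * fact k))))"
    using gaussian_moment_even_pos[of k] by (rule has_bochner_integral_even_function) simp
  thus ?thesis unfolding l gmom_def by simp
next
  case False
  then obtain k where l: "l = 2 * k + 1" by (blast elim: oddE)
  have "has_bochner_integral lborel (\<lambda>x::real. exp (- x\<^sup>2) * x ^ (2 * k + 1)) 0"
    using gaussian_moment_odd_pos[of k] by (rule has_bochner_integral_odd_function) simp
  thus ?thesis unfolding l gmom_def by simp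
qed

lemma sum_even_odd:
  fixes f :: "nat \<Rightarrow> 'a :: comm_monoid_add" and P :: nat
  shows "(\<Sum>l<2 * P. f l) = (\<Sum>k<P. f (2 * k) + f (2 * k + 1))"
  by (induction P) (simp_all add: add.assoc)

text \<open>The integral of \<open>exp (- y\<^sup>2 + y t)\<close> for nilpotent \<open>t\<close>, where the exponential of \<open>y t\<close> is a polynomial in
\<open>y\<close> that is integrated termwise.\<close>

lemma gauss_nexp:
  assumes "t ^ P = 0"
  shows "(\<Sum>l<2 * P. gmom l *\<^sub>R ((1 / fact l) *\<^sub>R t ^ l)) = sqrt pi *\<^sub>R nexp ((1/4) *\<^sub>R (t * t))"
proof -
  have pw: "((1/4) *\<^sub>R (t * t)) ^ k = (1 / 4) ^ k *\<^sub>R t ^ (2 * k)" for k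
    unfolding power_scaleR_g power_mult power2_eq_square ..
  have "t ^ (2 * P) = 0" using assms by (rule power_zero_mono) simp
  hence z: "((1/4) *\<^sub>R (t * t)) ^ P = 0" unfolding pw by (simp only: scaleR_zero_right)
  have "(\<Sum>l<2 * P. gmom l *\<^sub>R ((1 / fact l) *\<^sub>R t ^ l)) = (\<Sum>k<P. sqrt pi *\<^sub>R ((1 / fact k) *\<^sub>R ((1 / 4) ^ k *\<^sub>R t ^ (2 * k))))"
    unfolding sum_even_odd
  proof (intro sum.cong refl)
    fix k
    have "gmom (2 * k + 1) = 0" by (simp add: gmom_def)
    moreover have "gmom (2 * k) * (1 / fact (2 * k)) = sqrt pi * ((1 / fact k) * (1 / 4) ^ k)"
      by (simp add: gmom_def power_mult power_one_over)
    ultimately show "gmom (2 * k) *\<^sub>R ((1 / fact (2 * k)) *\<^sub>R t ^ (2 * k)) + gmom (2 * k + 1) *\<^sub>R ((1 / fact (2 * k + 1)) *\<^sub>R t ^ (2 * k + 1))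
       = sqrt pi *\<^sub>R ((1 / fact k) *\<^sub>R ((1 / 4) ^ k *\<^sub>R t ^ (2 * k)))"
      unfolding scaleR_scaleR by (simp only: scaleR_zero_left add_0_right mult_zero_left)
  qed
  also have "\<dots> = sqrt pi *\<^sub>R nexp ((1/4) *\<^sub>R (t * t))"
    unfolding nexp_eq[OF z] pw scaleR_sum_right ..
  finally show ?thesis .
qed

lemma gaussian_monomial:
  fixes f :: "nat \<Rightarrow> nat"
  shows "integrable (\<Pi>\<^sub>M j\<in>{k..<k + m}. lborel :: real measure) (\<lambda>y :: nat \<Rightarrow> real. exp (- (\<Sum>j\<in>{k..<k + m}. (y j)\<^sup>2)) * (\<Prod>j<m. y (k + j) ^ f j))"
    and "(\<integral>y. exp (- (\<Sum>j\<in>{k..<k + m}. (y j)\<^sup>2)) * (\<Prod>j<m. y (k + j) ^ f j) \<partial>(\<Pi>\<^sub>M j\<in>{k..<k + m}. lborel)) = (\<Prod>j<m. gmom (f j))"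
proof -
  interpret product_sigma_finite "\<lambda>_ :: nat. lborel :: real measure" by standard
  let ?A = "{k..<k + m}"
  have shift: "(\<Prod>j<m. g (k + j) j) = (\<Prod>j\<in>?A. g j (j - k))" for g :: "nat \<Rightarrow> nat \<Rightarrow> real"
    by (rule prod.reindex_bij_witness[of _ "\<lambda>j. j - k" "\<lambda>j. k + j"]) auto
  have e: "exp (- (\<Sum>j\<in>?A. (y j)\<^sup>2)) * (\<Prod>j<m. y (k + j) ^ f j) = (\<Prod>j\<in>?A. exp (- (y j)\<^sup>2) * y j ^ f (j - k))" for y :: "nat \<Rightarrow> real"
    using shift[of "\<lambda>i j. y i ^ f j"] by (simp add: prod.distrib exp_sum flip: sum_negf)
  have e': "(\<lambda>y. exp (- (\<Sum>j\<in>?A. (y j)\<^sup>2)) * (\<Prod>j<m. y (k + j) ^ f j)) = (\<lambda>y :: nat \<Rightarrow> real. \<Prod>j\<in>?A. exp (- (y j)\<^sup>2) * y j ^ f (j - k))"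
    by (rule ext) (rule e)
  have i: "integrable lborel (\<lambda>x::real. exp (- x\<^sup>2) * x ^ l)" and v: "integral\<^sup>L lborel (\<lambda>x::real. exp (- x\<^sup>2) * x ^ l) = gmom l" for l
    using gaussian_moment[of l] by (auto simp: has_bochner_integral_iff)
  show "integrable (\<Pi>\<^sub>M j\<in>?A. lborel :: real measure) (\<lambda>y :: nat \<Rightarrow> real. exp (- (\<Sum>j\<in>?A. (y j)\<^sup>2)) * (\<Prod>j<m. y (k + j) ^ f j))"
  proof -
    have "integrable (\<Pi>\<^sub>M j\<in>?A. lborel) (\<lambda>y :: nat \<Rightarrow> real. \<Prod>j\<in>?A. exp (- (y j)\<^sup>2) * y j ^ f (j - k))"
      by (rule product_integrable_prod) (simp_all add: i)
    thus ?thesis by (simp only: e)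
  qed
  have "(\<integral>y. (\<Prod>j\<in>?A. exp (- (y j)\<^sup>2) * y j ^ f (j - k)) \<partial>(\<Pi>\<^sub>M j\<in>?A. lborel)) = (\<Prod>j\<in>?A. gmom (f (j - k)))"
    by (subst product_integral_prod) (simp_all add: i v)
  also have "\<dots> = (\<Prod>j<m. gmom (f j))" using shift[of "\<lambda>i j. gmom (f j)"] by simp
  finally show "(\<integral>y. exp (- (\<Sum>j\<in>?A. (y j)\<^sup>2)) * (\<Prod>j<m. y (k + j) ^ f j) \<partial>(\<Pi>\<^sub>M j\<in>?A. lborel)) = (\<Prod>j<m. gmom (f j))"
    unfolding e' .
qed

text \<open>Fubini for a product of polynomials in separate variables with coefficients in the algebra: each
factor is replaced by its Gaussian integral, assumed here to be scalar.\<close>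

lemma gaussian_word:
  assumes c: "\<And>j. j < m \<Longrightarrow> (\<Sum>l<P. gmom l *\<^sub>R c j l) = sqrt pi *\<^sub>R 1"
  shows "(\<integral>y. exp (- (\<Sum>j\<in>{k..<k + m}. (y j)\<^sup>2)) * coef (X * word m (\<lambda>j. \<Sum>l<P. y (k + j) ^ l *\<^sub>R c j l)) S \<partial>(\<Pi>\<^sub>M j\<in>{k..<k + m}. lborel))
    = sqrt pi ^ m * coef X S"
proof -
  let ?M = "\<Pi>\<^sub>M j\<in>{k..<k + m}. lborel :: real measure" and ?F = "PiE {..<m} (\<lambda>_. {..<P})"
  let ?K = "\<lambda>f. coef (X * word m (\<lambda>j. c j (f j))) S"
  have ex: "coef (X * word m (\<lambda>j. \<Sum>l<P. a j l *\<^sub>R c j l)) S = (\<Sum>f\<in>?F. (\<Prod>j<m. a j (f j)) * ?K f)" for a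
    by (simp add: word_sum word_scaleR sum_distrib_left)
  have e: "exp (- (\<Sum>j\<in>{k..<k + m}. (y j)\<^sup>2)) * coef (X * word m (\<lambda>j. \<Sum>l<P. y (k + j) ^ l *\<^sub>R c j l)) S
     = (\<Sum>f\<in>?F. exp (- (\<Sum>j\<in>{k..<k + m}. (y j)\<^sup>2)) * (\<Prod>j<m. y (k + j) ^ f j) * ?K f)" for y
    unfolding ex[of "\<lambda>j l. y (k + j) ^ l"] sum_distrib_left mult.assoc ..
  have "(\<integral>y. exp (- (\<Sum>j\<in>{k..<k + m}. (y j)\<^sup>2)) * coef (X * word m (\<lambda>j. \<Sum>l<P. y (k + j) ^ l *\<^sub>R c j l)) S \<partial>?M)
    = (\<Sum>f\<in>?F. (\<integral>y. exp (- (\<Sum>j\<in>{k..<k + m}. (y j)\<^sup>2)) * (\<Prod>j<m. y (k + j) ^ f j) * ?K f \<partial>?M))"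
    unfolding e by (rule Bochner_Integration.integral_sum) (intro integrable_mult_left gaussian_monomial(1))
  also have "\<dots> = (\<Sum>f\<in>?F. (\<Prod>j<m. gmom (f j)) * ?K f)"
    using gaussian_monomial by (intro sum.cong refl) simp
  also have "\<dots> = coef (X * word m (\<lambda>j. \<Sum>l<P. gmom l *\<^sub>R c j l)) S"
    by (rule ex[symmetric])
  also have "word m (\<lambda>j. \<Sum>l<P. gmom l *\<^sub>R c j l) = word m (\<lambda>j. sqrt pi *\<^sub>R 1)"
    using c by (rule word_cong)
  also have "\<dots> = sqrt pi ^ m *\<^sub>R 1"
    unfolding word_scaleR by (simp add: word_closed[of "\<lambda>x. x = 1"])
  finally show ?thesis by simp
qed

lemma nilpotent_mult_self: "nilpotent t \<Longrightarrow> nilpotent (t * t)"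
proof -
  assume "nilpotent t"
  then obtain P where P: "t ^ P = 0" unfolding nilpotent_def by blast
  have "(t * t) ^ P = t ^ (2 * P)" by (simp only: power_mult power2_eq_square)
  also have "\<dots> = 0" using P by (rule power_zero_mono) simp
  finally show ?thesis by (rule nilpotentI)
qed

text \<open>Completing the square. In the exponent of the Berezin integral the terms linear in \<open>y\<close> contribute
\<open>y\<^sub>j t\<^sub>j\<close> with \<open>t\<^sub>j = \<Sum>\<^sub>i \<eta>\<^sub>i s\<^sub>j\<^sub>i\<close>, and the correction of \<open>Om\<close> contributes \<open>- t\<^sub>j\<^sup>2 / 4\<close>. Integration over \<open>y\<^sub>j\<close>
turns the former into \<open>sqrt \<pi>\<close> times the exponential of \<open>t\<^sub>j\<^sup>2 / 4\<close>, so that the two cancel.\<close>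

lemma mq_gaussian:
  assumes D: "\<And>i. i < k \<Longrightarrow> odd_elem (D i)" "\<And>i. i < k \<Longrightarrow> in_vars {..<N} (D i)"
    and Om: "\<And>i l. i < k \<Longrightarrow> l < k \<Longrightarrow> even_elem (Om i l)" "\<And>i l. i < k \<Longrightarrow> l < k \<Longrightarrow> in_vars {..<N} (Om i l)"
    and s: "\<And>i j. i < k \<Longrightarrow> j \<in> {k..<k + m} \<Longrightarrow> odd_elem (s j i)" "\<And>i j. i < k \<Longrightarrow> j \<in> {k..<k + m} \<Longrightarrow> in_vars {..<N} (s j i)"
  shows "(\<integral>y. exp (- (\<Sum>j\<in>{k..<k + m}. (y j)\<^sup>2)) *
            coef (mq k (\<lambda>i. D i + (\<Sum>j\<in>{k..<k + m}. y j *\<^sub>R s j i)) (\<lambda>i l. Om i l - (\<Sum>j\<in>{k..<k + m}. s j i * s j l))) {..<N}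
           \<partial>(\<Pi>\<^sub>M j\<in>{k..<k + m}. lborel)) = sqrt pi ^ m * coef (mq k D Om) {..<N}"
proof -
  define Dy where "Dy = (\<lambda>y i. D i + (\<Sum>j\<in>{k..<k + m}. y j *\<^sub>R s j i))"
  define Om' where "Om' = (\<lambda>i l. Om i l - (\<Sum>j\<in>{k..<k + m}. s j i * s j l))"
  define \<eta> where "\<eta> = (\<lambda>i. gen (N + i))"
  define t where "t = (\<lambda>j. \<Sum>i<k. \<eta> i * s (k + j) i)"
  define X where "X = berezin k \<eta> D Om"
  \<comment> \<open>The nonzero factor between a top coefficient of \<open>berezin\<close> and \<open>mq\<close>; it is cancelled at the end.\<close>
  define z where "z = eps k * shuffle_sign {N..<N + k} {..<N}"
  have znz: "z \<noteq> 0" by (simp add: z_def)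
  have shift: "(\<Sum>j\<in>{k..<k + m}. h j) = (\<Sum>j<m. h (k + j))" for h :: "nat \<Rightarrow> grassmann"
    by (rule sum.reindex_bij_witness[of _ "\<lambda>j. k + j" "\<lambda>j. j - k"]) auto
  have odd\<eta>: "odd_elem (\<eta> i)" for i by (simp add: \<eta>_def)
  have os: "odd_elem (s (k + j) i)" if "i < k" "j < m" for i j using s(1) that by simp
  have te: "even_elem (t j)" if "j < m" for j
    unfolding t_def using os that odd\<eta> by (intro has_parity_sum odd_mult_odd) auto
  have tn: "nilpotent (t j)" if "j < m" for j
    unfolding t_def using os that odd\<eta> by (intro linear_term(1)) auto
  have An: "nilpotent (\<Sum>i<k. \<eta> i * D i)" using odd\<eta> D(1) by (rule linear_term(1))
  have Ae: "even_elem (\<Sum>i<k. \<eta> i * D i)" using odd\<eta> D(1) by (intro has_parity_sum odd_mult_odd) auto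
  have qn: "nilpotent (- (1/4) *\<^sub>R quad k \<eta> Om)"
    using odd\<eta> Om(1) by (intro nilpotent_scaleR nexp_quad(1)) auto
  have qe: "even_elem (- (1/4) *\<^sub>R quad k \<eta> Om)"
    unfolding quad_def using odd\<eta> Om(1) by (intro has_parity_scaleR has_parity_sum even_mult odd_mult_odd) auto
  \<comment> \<open>The minus sign comes from moving \<open>\<eta> l\<close> past the odd element \<open>s (k + j) i\<close>.\<close>
  have tt: "t j * t j = - (\<Sum>i<k. \<Sum>l<k. \<eta> i * \<eta> l * (s (k + j) i * s (k + j) l))" if j: "j < m" for j
  proof -
    have "t j * t j = (\<Sum>i<k. \<Sum>l<k. \<eta> i * s (k + j) i * (\<eta> l * s (k + j) l))"
      unfolding t_def sum_product ..
    also have "\<dots> = (\<Sum>i<k. \<Sum>l<k. - (\<eta> i * \<eta> l * (s (k + j) i * s (k + j) l)))"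
    proof (intro sum.cong refl)
      fix i l assume "i \<in> {..<k}"
      hence "s (k + j) i * \<eta> l = - (\<eta> l * s (k + j) i)"
        using os[of i j] j odd\<eta> by (intro odd_anticommute) auto
      hence "\<eta> i * (s (k + j) i * \<eta> l) * s (k + j) l = \<eta> i * (- (\<eta> l * s (k + j) i)) * s (k + j) l"
        by (rule arg_cong)
      thus "\<eta> i * s (k + j) i * (\<eta> l * s (k + j) l) = - (\<eta> i * \<eta> l * (s (k + j) i * s (k + j) l))"
        by (simp add: mult.assoc)
    qed
    finally show ?thesis by (simp add: sum_negf)
  qed
  have lin: "(\<Sum>i<k. \<eta> i * Dy y i) = (\<Sum>i<k. \<eta> i * D i) + (\<Sum>j<m. y (k + j) *\<^sub>R t j)" for y
  proof -
    have "(\<Sum>i<k. \<eta> i * Dy y i) = (\<Sum>i<k. \<eta> i * D i) + (\<Sum>i<k. \<Sum>j<m. y (k + j) *\<^sub>R (\<eta> i * s (k + j) i))"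
      unfolding Dy_def shift distrib_left sum.distrib by (simp add: sum_distrib_left)
    also have "(\<Sum>i<k. \<Sum>j<m. y (k + j) *\<^sub>R (\<eta> i * s (k + j) i)) = (\<Sum>j<m. y (k + j) *\<^sub>R t j)"
      unfolding t_def scaleR_sum_right by (rule sum.swap)
    finally show ?thesis .
  qed
  have qu: "- (1/4) *\<^sub>R quad k \<eta> Om' = - (1/4) *\<^sub>R quad k \<eta> Om + (\<Sum>j<m. - (1/4) *\<^sub>R (t j * t j))"
  proof -
    have "quad k \<eta> Om' = (\<Sum>i<k. \<Sum>l<k. \<eta> i * \<eta> l * Om i l - (\<Sum>j<m. \<eta> i * \<eta> l * (s (k + j) i * s (k + j) l)))"
      unfolding quad_def Om'_def shift right_diff_distrib sum_distrib_left ..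
    also have "\<dots> = quad k \<eta> Om - (\<Sum>i<k. \<Sum>l<k. \<Sum>j<m. \<eta> i * \<eta> l * (s (k + j) i * s (k + j) l))"
      unfolding sum_subtractf quad_def ..
    also have "(\<Sum>i<k. \<Sum>l<k. \<Sum>j<m. \<eta> i * \<eta> l * (s (k + j) i * s (k + j) l)) = (\<Sum>i<k. \<Sum>j<m. \<Sum>l<k. \<eta> i * \<eta> l * (s (k + j) i * s (k + j) l))"
      by (rule sum.cong[OF refl], rule sum.swap)
    also have "\<dots> = (\<Sum>j<m. \<Sum>i<k. \<Sum>l<k. \<eta> i * \<eta> l * (s (k + j) i * s (k + j) l))"
      by (rule sum.swap)
    also have "\<dots> = (\<Sum>j<m. - (t j * t j))"
      using tt by (intro sum.cong refl) simp
    finally have "quad k \<eta> Om' = quad k \<eta> Om + (\<Sum>j<m. t j * t j)" by (simp add: sum_negf)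
    thus ?thesis by (simp only: scaleR_add_right scaleR_sum_right)
  qed
  let ?g = "\<lambda>y j. nexp (y (k + j) *\<^sub>R t j) * nexp (- (1/4) *\<^sub>R (t j * t j))"
  \<comment> \<open>All exponents are even, so the exponentials can be separated and collected by \<open>j\<close>.\<close>
  have main: "berezin k \<eta> (Dy y) Om' = X * word m (?g y)" for y
  proof -
    let ?A = "\<Sum>i<k. \<eta> i * D i" and ?B = "\<Sum>j<m. y (k + j) *\<^sub>R t j"
      and ?C = "- (1/4) *\<^sub>R quad k \<eta> Om" and ?E = "\<Sum>j<m. - (1/4) *\<^sub>R (t j * t j)"
    have Be: "even_elem ?B" using te by (intro has_parity_sum has_parity_scaleR) auto
    have Ee: "even_elem ?E" using te by (intro has_parity_sum has_parity_scaleR even_mult) auto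
    have Bn: "nilpotent ?B"
      using nexp_sum[of m "\<lambda>j. y (k + j) *\<^sub>R t j"] te tn by (simp add: has_parity_scaleR nilpotent_scaleR)
    have En: "nilpotent ?E"
    proof -
      have "even_elem (- (1/4) *\<^sub>R (t j * t j))" if "j < m" for j
        using te[OF that] by (intro has_parity_scaleR even_mult)
      moreover have "nilpotent (- (1/4) *\<^sub>R (t j * t j))" if "j < m" for j
        using tn[OF that] by (intro nilpotent_scaleR nilpotent_mult_self)
      ultimately show ?thesis using nexp_sum[of m "\<lambda>j. - (1/4) *\<^sub>R (t j * t j)"] by blast
    qed
    have "berezin k \<eta> (Dy y) Om' = nexp (?A + ?B) * nexp (?C + ?E)"
      unfolding berezin_def lin qu ..
    also have "nexp (?A + ?B) = nexp ?A * nexp ?B"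
      using An Bn even_commute_all[OF Ae] by (intro nexp_add) auto
    also have "nexp (?C + ?E) = nexp ?C * nexp ?E"
      using qn En even_commute_all[OF qe] by (intro nexp_add) auto
    also have "nexp ?A * nexp ?B * (nexp ?C * nexp ?E) = nexp ?A * (nexp ?B * nexp ?C) * nexp ?E"
      by (simp only: mult.assoc)
    also have "nexp ?B * nexp ?C = nexp ?C * nexp ?B"
      using Be by (intro even_commute_all even_nexp)
    also have "nexp ?A * (nexp ?C * nexp ?B) * nexp ?E = X * (nexp ?B * nexp ?E)"
      unfolding X_def berezin_def by (simp only: mult.assoc)
    also have "nexp ?B * nexp ?E = nexp (?B + ?E)"
      using Bn En even_commute_all[OF Be] by (intro nexp_add[symmetric]) auto
    also have "?B + ?E = (\<Sum>j<m. y (k + j) *\<^sub>R t j + - (1/4) *\<^sub>R (t j * t j))"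
      by (simp only: sum.distrib)
    also have "nexp \<dots> = word m (\<lambda>j. nexp (y (k + j) *\<^sub>R t j + - (1/4) *\<^sub>R (t j * t j)))"
    proof -
      have "even_elem (y (k + j) *\<^sub>R t j + - (1/4) *\<^sub>R (t j * t j))" if "j < m" for j
        using te[OF that] by (intro has_parity_add has_parity_scaleR even_mult)
      moreover have "nilpotent (y (k + j) *\<^sub>R t j + - (1/4) *\<^sub>R (t j * t j))" if "j < m" for j
        using tn[OF that] te[OF that] by (intro nilpotent_add nilpotent_scaleR nilpotent_mult_self even_commute_all has_parity_scaleR)
      ultimately show ?thesis
        using nexp_sum[of m "\<lambda>j. y (k + j) *\<^sub>R t j + - (1/4) *\<^sub>R (t j * t j)"] by blast
    qed
    also have "\<dots> = word m (?g y)"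
    proof (rule word_cong)
      fix j assume j: "j < m"
      show "nexp (y (k + j) *\<^sub>R t j + - (1/4) *\<^sub>R (t j * t j)) = ?g y j"
        using tn[OF j] te[OF j] by (intro nexp_add nilpotent_scaleR nilpotent_mult_self even_commute_all has_parity_scaleR)
    qed
    finally show ?thesis .
  qed
  have "\<exists>P. \<forall>j<m. t j ^ P = 0"
  proof -
    have "\<forall>j. \<exists>P. j < m \<longrightarrow> t j ^ P = 0" using tn unfolding nilpotent_def by blast
    then obtain p where p: "\<And>j. j < m \<Longrightarrow> t j ^ p j = 0" by metis
    have "t j ^ (\<Sum>j<m. p j) = 0" if "j < m" for j
      by (rule power_zero_mono[OF p[OF that] member_le_sum[of j "{..<m}" p]]) (use that in auto)
    thus ?thesis by blast
  qed
  then obtain P where P: "\<And>j. j < m \<Longrightarrow> t j ^ P = 0" by blast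
  define c where "c = (\<lambda>j l. ((1 / fact l) *\<^sub>R t j ^ l) * nexp (- (1/4) *\<^sub>R (t j * t j)))"
  have g: "?g y j = (\<Sum>l<2 * P. y (k + j) ^ l *\<^sub>R c j l)" if j: "j < m" for y j
  proof -
    have "t j ^ (2 * P) = 0" using P[OF j] by (rule power_zero_mono) simp
    hence "(y (k + j) *\<^sub>R t j) ^ (2 * P) = 0" unfolding power_scaleR_g by (simp only: scaleR_zero_right)
    hence "nexp (y (k + j) *\<^sub>R t j) = (\<Sum>l<2 * P. (1 / fact l) *\<^sub>R (y (k + j) *\<^sub>R t j) ^ l)" by (rule nexp_eq)
    also have "\<dots> = (\<Sum>l<2 * P. y (k + j) ^ l *\<^sub>R ((1 / fact l) *\<^sub>R t j ^ l))"
      unfolding power_scaleR_g by (simp add: mult.commute)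
    finally show ?thesis unfolding c_def by (simp only: sum_distrib_right mult_scaleR_left)
  qed
  have c1: "(\<Sum>l<2 * P. gmom l *\<^sub>R c j l) = sqrt pi *\<^sub>R 1" if j: "j < m" for j
  proof -
    have "(\<Sum>l<2 * P. gmom l *\<^sub>R c j l) = (\<Sum>l<2 * P. gmom l *\<^sub>R ((1 / fact l) *\<^sub>R t j ^ l)) * nexp (- (1/4) *\<^sub>R (t j * t j))"
      unfolding c_def by (simp only: sum_distrib_right mult_scaleR_left)
    also have "\<dots> = sqrt pi *\<^sub>R (nexp ((1/4) *\<^sub>R (t j * t j)) * nexp (- ((1/4) *\<^sub>R (t j * t j))))"
      unfolding gauss_nexp[OF P[OF j]] by simp
    also have "nexp ((1/4) *\<^sub>R (t j * t j)) * nexp (- ((1/4) *\<^sub>R (t j * t j))) = 1"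
      using tn[OF j] by (intro nexp_minus nilpotent_scaleR nilpotent_mult_self)
    finally show ?thesis .
  qed
  have cy: "z * coef (mq k (Dy y) Om') {..<N} = coef (X * word m (\<lambda>j. \<Sum>l<2 * P. y (k + j) ^ l *\<^sub>R c j l)) {..<N + k}" for y
  proof -
    have "coef (berezin k (\<lambda>i. gen (N + i)) (Dy y) Om') {..<N + k} = eps k * shuffle_sign {N..<N + k} {..<N} * coef (mq k (Dy y) Om') {..<N}"
    proof (rule coef_berezin_gen)
      show "odd_elem (Dy y i)" "in_vars {..<N} (Dy y i)" if "i < k" for i
        unfolding Dy_def using D s that
        by (auto intro!: has_parity_add has_parity_sum has_parity_scaleR in_vars_add in_vars_sum in_vars_scaleR)
      show "even_elem (Om' i l)" "in_vars {..<N} (Om' i l)" if "i < k" "l < k" for i l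
        unfolding Om'_def using Om s that
        by (auto intro!: has_parity_diff has_parity_sum odd_mult_odd in_vars_diff in_vars_sum in_vars_mult)
    qed
    hence "z * coef (mq k (Dy y) Om') {..<N} = coef (X * word m (?g y)) {..<N + k}"
      unfolding main[of y, unfolded \<eta>_def, symmetric] z_def \<eta>_def by simp
    also have "word m (?g y) = word m (\<lambda>j. \<Sum>l<2 * P. y (k + j) ^ l *\<^sub>R c j l)"
      using g by (rule word_cong)
    finally show ?thesis .
  qed
  have "z * (\<integral>y. exp (- (\<Sum>j\<in>{k..<k + m}. (y j)\<^sup>2)) * coef (mq k (Dy y) Om') {..<N} \<partial>(\<Pi>\<^sub>M j\<in>{k..<k + m}. lborel))
    = (\<integral>y. z * (exp (- (\<Sum>j\<in>{k..<k + m}. (y j)\<^sup>2)) * coef (mq k (Dy y) Om') {..<N}) \<partial>(\<Pi>\<^sub>M j\<in>{k..<k + m}. lborel))"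
    by simp
  also have "\<dots> = (\<integral>y. exp (- (\<Sum>j\<in>{k..<k + m}. (y j)\<^sup>2)) * coef (X * word m (\<lambda>j. \<Sum>l<2 * P. y (k + j) ^ l *\<^sub>R c j l)) {..<N + k} \<partial>(\<Pi>\<^sub>M j\<in>{k..<k + m}. lborel))"
    unfolding cy[symmetric] by (simp only: mult.left_commute[of z])
  also have "\<dots> = sqrt pi ^ m * coef X {..<N + k}"
    using c1 by (rule gaussian_word)
  also have "coef X {..<N + k} = z * coef (mq k D Om) {..<N}"
    unfolding X_def \<eta>_def z_def using D Om by (rule coef_berezin_gen)
  finally have "z * (\<integral>y. exp (- (\<Sum>j\<in>{k..<k + m}. (y j)\<^sup>2)) * coef (mq k (Dy y) Om') {..<N} \<partial>(\<Pi>\<^sub>M j\<in>{k..<k + m}. lborel))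
    = z * (sqrt pi ^ m * coef (mq k D Om) {..<N})" by (simp only: mult.left_commute[of z])
  thus ?thesis unfolding mult_cancel_left Dy_def Om'_def using znz by blast
qed

lemma pi_powr_split: "pi powr (- real (k + m) / 2) * sqrt pi ^ m = pi powr (- real k / 2)"
proof -
  have "sqrt pi ^ m = (pi powr (1/2)) ^ m" by (simp add: powr_half_sqrt)
  also have "\<dots> = pi powr (real m / 2)" by (simp add: powr_power)
  finally show ?thesis by (simp add: powr_add[symmetric] field_simps)
qed

section \<open>The coefficient of the vertical differentials\<close>

text \<open>The generator \<open>N + j\<close> occurs in the \<open>j\<close>-th factor only, so the coefficient of all of them together
ignores the elements \<open>c j\<close>. No sign arises because the new generators come last and in order.\<close>

lemma coef_word_new_gens:
  assumes X: "in_vars {..<N} X" and c: "\<And>j. j < m \<Longrightarrow> in_vars {..<N} (c j)"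
  shows "in_vars {..<N + m} (X * word m (\<lambda>j. c j + gen (N + j)))
     \<and> coef (X * word m (\<lambda>j. c j + gen (N + j))) {..<N + m} = coef X {..<N}"
  using c
proof (induction m)
  case (Suc m)
  let ?W = "X * word m (\<lambda>j. c j + gen (N + j))"
  have IH: "in_vars {..<N + m} ?W" "coef ?W {..<N + m} = coef X {..<N}" using Suc by auto
  have W: "X * word (Suc m) (\<lambda>j. c j + gen (N + j)) = ?W * c m + ?W * gen (N + m)"
    by (simp add: mult.assoc distrib_left)
  have v: "in_vars {..<N + m} (?W * c m)"
    using in_vars_mono[OF Suc.prems, of m "{..<N + m}"] by (intro in_vars_mult[OF IH(1)]) auto
  have "coef (?W * c m) {..<N + Suc m} = 0"
  proof (rule ccontr)
    assume "coef (?W * c m) {..<N + Suc m} \<noteq> 0"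
    hence "{..<N + Suc m} \<subseteq> {..<N + m}" using v unfolding in_vars_def by blast
    thus False by simp
  qed
  moreover have "coef (?W * gen (N + m)) ({..<N + m} \<union> {N + m}) = shuffle_sign {..<N + m} {N + m} * coef ?W {..<N + m} * coef (gen (N + m)) {N + m}"
    using IH(1) by (intro coef_mult_split in_vars_gen) auto
  moreover have "shuffle_sign {..<N + m} {N + m} = 1" by (rule shuffle_sign_mono_eq_1) auto
  moreover have "{..<N + m} \<union> {N + m} = {..<N + Suc m}" by auto
  ultimately have "coef (X * word (Suc m) (\<lambda>j. c j + gen (N + j))) {..<N + Suc m} = coef X {..<N}"
    unfolding W using IH(2) by (simp add: coef_gen)
  moreover have "in_vars {..<N + Suc m} (X * word (Suc m) (\<lambda>j. c j + gen (N + j)))"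
    unfolding W using in_vars_mono[OF v, of "{..<N + Suc m}"] in_vars_mono[OF IH(1), of "{..<N + Suc m}"]
    by (intro in_vars_add in_vars_mult[of _ ?W "gen (N + m)"] in_vars_gen) auto
  ultimately show ?case by blast
qed (use X in simp)

text \<open>Every term must contain all the generators \<open>N, \<dots>, N + m - 1\<close>, and the \<open>q\<close>-th of these occurs in
\<open>D (k + q)\<close> only. So only the index sets \<open>I\<close> containing \<open>{k..<k + m}\<close> contribute. For these, the indices
from \<open>k\<close> on are moved past the complement of \<open>I\<close>, which has even cardinality, hence without a sign.\<close>

lemma mq_vertical:
  assumes D1: "\<And>i. i < k \<Longrightarrow> odd_elem (D i)" "\<And>i. i < k \<Longrightarrow> in_vars {..<N} (D i)"
    and D2: "\<And>j. j < m \<Longrightarrow> D (k + j) = c j + gen (N + j)" "\<And>j. j < m \<Longrightarrow> odd_elem (c j)" "\<And>j. j < m \<Longrightarrow> in_vars {..<N} (c j)"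
    and Om: "\<And>i l. i < k + m \<Longrightarrow> l < k + m \<Longrightarrow> even_elem (Om i l)" "\<And>i l. i < k + m \<Longrightarrow> l < k + m \<Longrightarrow> in_vars {..<N} (Om i l)"
  shows "coef (mq (k + m) D Om) {..<N + m} = coef (mq k D Om) {..<N}"
proof -
  let ?n = "k + m" and ?L = "{k..<k + m}"
  let ?S = "\<lambda>n. {I. I \<subseteq> {..<n} \<and> even (card ({..<n} - I))}"
  let ?T = "\<lambda>n I. omon D I * pfaff ({..<n} - I) Om"
  have Dodd: "odd_elem (D i)" if "i < ?n" for i
  proof (cases "i < k")
    case False
    then obtain j where "i = k + j" "j < m" using that[of "i - k"] \<open>i < ?n\<close> by simp
    thus ?thesis using D2 by (auto intro: has_parity_add)
  qed (rule D1)
  \<comment> \<open>Only \<open>D (k + q)\<close> contains the generator \<open>N + q\<close>.\<close>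
  have Dv: "in_vars ({..<N + m} - {N + q}) (D i)" if i: "i < ?n" "i \<noteq> k + q" and q: "q < m" for i q
  proof (cases "i < k")
    case True
    show ?thesis by (rule in_vars_mono[OF D1(2)[OF True]]) (use q in auto)
  next
    case False
    then obtain j where j: "i = k + j" "j < m" using that[of "i - k"] i(1) by simp
    have "in_vars ({..<N + m} - {N + q}) (c j)" by (rule in_vars_mono[OF D2(3)[OF j(2)]]) auto
    moreover have "in_vars ({..<N + m} - {N + q}) (gen (N + j))" using i j by (intro in_vars_gen) auto
    ultimately show ?thesis using D2(1)[OF j(2)] j(1) by (simp add: in_vars_add)
  qed
  have zero: "coef (?T ?n I) {..<N + m} = 0" if I: "I \<subseteq> {..<?n}" and nL: "\<not> ?L \<subseteq> I" for I
  proof -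
    obtain i where "i \<in> ?L" "i \<notin> I" using nL by blast
    hence "i - k < m \<and> k + (i - k) \<notin> I" by auto
    then obtain q where q: "q < m" "k + q \<notin> I" by blast
    have fin: "finite I" using I by (auto intro: finite_subset)
    have "in_vars ({..<N + m} - {N + q}) (?T ?n I)"
    proof (intro in_vars_mult in_vars_omon in_vars_pfaff fin)
      fix i assume "i \<in> I"
      hence "i < ?n" "i \<noteq> k + q" using I q by auto
      thus "in_vars ({..<N + m} - {N + q}) (D i)" using q(1) by (intro Dv)
    next
      fix i l assume "i \<in> {..<?n} - I" "l \<in> {..<?n} - I"
      hence "in_vars {..<N} (Om i l)" by (intro Om(2)) auto
      thus "in_vars ({..<N + m} - {N + q}) (Om i l)" by (rule in_vars_mono) auto
    qed simp
    hence "coef (?T ?n I) {..<N + m} \<noteq> 0 \<longrightarrow> {..<N + m} \<subseteq> {..<N + m} - {N + q}" unfolding in_vars_def by blast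
    moreover have "N + q \<in> {..<N + m}" using q by simp
    ultimately show ?thesis by blast
  qed
  have good: "shuffle_sign (I \<union> ?L) ({..<?n} - (I \<union> ?L)) * coef (?T ?n (I \<union> ?L)) {..<N + m}
     = shuffle_sign I ({..<k} - I) * coef (?T k I) {..<N}" if I: "I \<in> ?S k" for I
  proof -
    let ?J = "{..<k} - I"
    have fin: "finite I" using I by (auto intro: finite_subset)
    have ev: "even (card ?J)" using I by simp
    have J: "{..<?n} - (I \<union> ?L) = ?J" using I by auto
    have "shuffle_sign ?L ?J = (-1) ^ (card ?J * card ?L) * shuffle_sign ?J ?L"
      by (rule shuffle_sign_swap) auto
    also have "\<dots> = 1" using ev shuffle_sign_mono_eq_1[of ?J ?L] by simp
    finally have LJ: "shuffle_sign ?L ?J = 1" .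
    have sg: "shuffle_sign (I \<union> ?L) ?J = shuffle_sign I ?J"
      using LJ I fin by (subst shuffle_sign_Un_left) auto
    have "omon D I * omon D ?L = shuffle_sign I ?L *\<^sub>R omon D (I \<union> ?L)"
      using I fin Dodd by (intro omon_Un) auto
    moreover have "shuffle_sign I ?L = 1" using I by (intro shuffle_sign_mono_eq_1) auto
    ultimately have om: "omon D (I \<union> ?L) = omon D I * omon D ?L" by simp
    have "omon D ?L = word m (\<lambda>j. D (k + j))"
      unfolding word_def by (rule arg_cong[of _ _ prod_list]) (auto intro!: nth_equalityI)
    also have "\<dots> = word m (\<lambda>j. c j + gen (N + j))" using D2(1) by (rule word_cong)
    finally have oL: "omon D ?L = word m (\<lambda>j. c j + gen (N + j))" .
    have pe: "even_elem (pfaff ?J Om)" using Om(1) by (intro even_pfaff) auto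
    have "?T ?n (I \<union> ?L) = omon D I * (omon D ?L * pfaff ?J Om)" unfolding J om by (simp only: mult.assoc)
    also have "omon D ?L * pfaff ?J Om = pfaff ?J Om * omon D ?L" by (rule even_commute_all[OF pe, symmetric])
    also have "omon D I * (pfaff ?J Om * omon D ?L) = ?T k I * word m (\<lambda>j. c j + gen (N + j))"
      unfolding oL by (simp only: mult.assoc)
    finally have T: "?T ?n (I \<union> ?L) = ?T k I * word m (\<lambda>j. c j + gen (N + j))" .
    have Tv: "in_vars {..<N} (?T k I)"
    proof (intro in_vars_mult in_vars_omon in_vars_pfaff fin)
      show "in_vars {..<N} (D i)" if "i \<in> I" for i using that I by (intro D1(2)) auto
      show "in_vars {..<N} (Om i l)" if "i \<in> ?J" "l \<in> ?J" for i l using that by (intro Om(2)) auto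
    qed simp
    have "coef (?T ?n (I \<union> ?L)) {..<N + m} = coef (?T k I) {..<N}"
      unfolding T by (rule conjunct2[OF coef_word_new_gens[OF Tv D2(3)]])
    thus ?thesis unfolding J sg by simp
  qed
  have "coef (mq ?n D Om) {..<N + m} = (\<Sum>I\<in>?S ?n. shuffle_sign I ({..<?n} - I) * coef (?T ?n I) {..<N + m})"
    unfolding mq_def by simp
  also have "\<dots> = (\<Sum>I\<in>{I \<in> ?S ?n. ?L \<subseteq> I}. shuffle_sign I ({..<?n} - I) * coef (?T ?n I) {..<N + m})"
  proof (rule sum.mono_neutral_right)
    show "\<forall>I\<in>?S ?n - {I \<in> ?S ?n. ?L \<subseteq> I}. shuffle_sign I ({..<?n} - I) * coef (?T ?n I) {..<N + m} = 0"
    proof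
      fix I assume "I \<in> ?S ?n - {I \<in> ?S ?n. ?L \<subseteq> I}"
      hence "coef (?T ?n I) {..<N + m} = 0" by (intro zero) auto
      thus "shuffle_sign I ({..<?n} - I) * coef (?T ?n I) {..<N + m} = 0" by simp
    qed
  qed auto
  also have "\<dots> = (\<Sum>I\<in>?S k. shuffle_sign (I \<union> ?L) ({..<?n} - (I \<union> ?L)) * coef (?T ?n (I \<union> ?L)) {..<N + m})"
  proof (rule sum.reindex_bij_witness[where i = "\<lambda>I. I \<union> ?L" and j = "\<lambda>I. I \<inter> {..<k}"])
    fix I assume I: "I \<in> {I \<in> ?S ?n. ?L \<subseteq> I}"
    have lt: "x < k" if "x < ?n" "x \<notin> I" for x
    proof (rule ccontr)
      assume "\<not> x < k"
      hence "x \<in> ?L" using that by simp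
      thus False using I that by blast
    qed
    hence "{..<k} - I \<inter> {..<k} = {..<?n} - I" by auto
    thus "I \<inter> {..<k} \<in> ?S k" using I by auto
    show e: "I \<inter> {..<k} \<union> ?L = I" using I by auto
    show "shuffle_sign (I \<inter> {..<k} \<union> ?L) ({..<?n} - (I \<inter> {..<k} \<union> ?L)) * coef (?T ?n (I \<inter> {..<k} \<union> ?L)) {..<N + m} =
       shuffle_sign I ({..<?n} - I) * coef (?T ?n I) {..<N + m}" unfolding e ..
  next
    fix I assume I: "I \<in> ?S k"
    show "(I \<union> ?L) \<inter> {..<k} = I" using I by auto
    have "{..<?n} - (I \<union> ?L) = {..<k} - I" using I by auto
    thus "I \<union> ?L \<in> {I \<in> ?S ?n. ?L \<subseteq> I}" using I by auto
  qed
  also have "\<dots> = (\<Sum>I\<in>?S k. shuffle_sign I ({..<k} - I) * coef (?T k I) {..<N})"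
    using good by (intro sum.cong refl)
  also have "\<dots> = coef (mq k D Om) {..<N}" unfolding mq_def by simp
  finally show ?thesis .
qed

section \<open>The Mathai-Quillen form in the Grassmann algebra\<close>

lemma TMQ_local_eq_mq:
  "TMQ_local A B nabla \<tau> u e ts =
    pi powr (- real (rk B) / 2) * exp (- (\<Sum>i<rk B. (snd \<tau> u e i)\<^sup>2)) *
    coef (mq (rk B)
       (\<lambda>i. emb ts (form1 (\<lambda>t. snd t \<tau> i + (\<Sum>j<rk B. conn_form B nabla \<tau> i j u (fst t) * snd \<tau> u e j))))
       (\<lambda>i j. emb ts (form2 (\<lambda>s t. curv_form A B nabla \<tau> i j u (fst s) (fst t))))) {..<length ts}"
proof -
  let ?D = "\<lambda>i. form1 (\<lambda>t. snd t \<tau> i + (\<Sum>j<rk B. conn_form B nabla \<tau> i j u (fst t) * snd \<tau> u e j))"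
  let ?Om = "\<lambda>i j. form2 (\<lambda>s t. curv_form A B nabla \<tau> i j u (fst s) (fst t))"
  let ?pf = "\<lambda>J ts. 1 / (2 ^ card J * fact (card J div 2)) *
     (\<Sum>\<sigma> | \<sigma> permutes {..<card J}. of_int (sign \<sigma>) *
        wedge_list (map (\<lambda>r. ?Om (sorted_list_of_set J ! \<sigma> (2 * r)) (sorted_list_of_set J ! \<sigma> (2 * r + 1))) [0..<card J div 2]) ts)"
  let ?S = "{I. I \<subseteq> {..<rk B} \<and> even (card ({..<rk B} - I))}"
  have pf: "emb ts (?pf J) = pfaff J (\<lambda>i j. emb ts (?Om i j))" for J
    unfolding pfaff_def Let_def emb_scale emb_sum emb_wedge_list word_def map_map o_def ..
  have "coef (mq (rk B) (\<lambda>i. emb ts (?D i)) (\<lambda>i j. emb ts (?Om i j))) {..<length ts} =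
    (\<Sum>I\<in>?S. shuffle_sign I ({..<rk B} - I) * coef (omon (\<lambda>i. emb ts (?D i)) I * emb ts (?pf ({..<rk B} - I))) {..<length ts})"
    unfolding mq_def pf by simp
  also have "\<dots> = (\<Sum>I\<in>?S. shuffle_sign I ({..<rk B} - I) * wedge (wedge_list (map ?D (sorted_list_of_set I))) (?pf ({..<rk B} - I)) ts)"
  proof (intro sum.cong refl arg_cong2[of _ _ _ _ "(*)"])
    fix I
    have "omon (\<lambda>i. emb ts (?D i)) I * emb ts (?pf ({..<rk B} - I)) = emb ts (wedge (wedge_list (map ?D (sorted_list_of_set I))) (?pf ({..<rk B} - I)))"
      unfolding emb_wedge emb_wedge_list map_map o_def ..
    thus "coef (omon (\<lambda>i. emb ts (?D i)) I * emb ts (?pf ({..<rk B} - I))) {..<length ts} = wedge (wedge_list (map ?D (sorted_list_of_set I))) (?pf ({..<rk B} - I)) ts"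
      by (simp only: coef_emb_top)
  qed
  finally show ?thesis unfolding TMQ_local_def Let_def by simp
qed

section \<open>Functions of class \<open>C\<^sup>k\<close>\<close>

abbreviation dd :: "('a::real_normed_vector \<Rightarrow> 'b::real_normed_vector) \<Rightarrow> 'a \<Rightarrow> 'a \<Rightarrow> 'b" where
  "dd f x v \<equiv> frechet_derivative f (at x) v"

lemma dd_eq: "(f has_derivative F) (at x) \<Longrightarrow> dd f x v = F v"
  by (simp flip: frechet_derivative_at)

lemma dd_has: "f differentiable (at x) \<Longrightarrow> (f has_derivative dd f x) (at x)"
  by (simp flip: frechet_derivative_works)

lemma dd_cong:
  assumes "open S" "x \<in> S" "\<And>y. y \<in> S \<Longrightarrow> f y = g y" "f differentiable (at x)"
  shows "g differentiable (at x)" "dd g x = dd f x"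
proof -
  have "(g has_derivative dd f x) (at x)"
    using dd_has[OF assms(4)] assms(1-3) by (rule has_derivative_transform_within_open)
  thus "g differentiable (at x)" "dd g x = dd f x"
    by (auto intro: differentiableI simp flip: frechet_derivative_at)
qed

lemma Ck_on_cong:
  assumes "open S" "\<And>x. x \<in> S \<Longrightarrow> f x = g x" "Ck_on k S f"
  shows "Ck_on k S g"
  using assms(2,3)
proof (induction k arbitrary: f g)
  case 0 thus ?case using continuous_on_cong[of S S f g] by simp
next
  case (Suc k)
  have d: "g differentiable (at x) \<and> dd g x = dd f x" if "x \<in> S" for x
    using dd_cong[of S x f g] assms(1) that Suc.prems by auto
  have "Ck_on k S (\<lambda>x. dd g x v)" for v
  proof (rule Suc.IH)
    show "Ck_on k S (\<lambda>x. dd f x v)" using Suc.prems by simp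
    show "dd f x v = dd g x v" if "x \<in> S" for x using d[OF that] by simp
  qed
  thus ?case using d by simp
qed

lemma Ck_on_subset: "Ck_on k S f \<Longrightarrow> T \<subseteq> S \<Longrightarrow> Ck_on k T f"
  by (induction k arbitrary: f) (auto intro: continuous_on_subset)

lemma Ck_on_local:
  assumes "\<And>x. x \<in> S \<Longrightarrow> \<exists>T. open T \<and> x \<in> T \<and> Ck_on k T f"
  shows "Ck_on k S f"
  using assms
proof (induction k arbitrary: f)
  case 0
  have "isCont f x" if "x \<in> S" for x
    using 0[OF that] continuous_on_eq_continuous_at by auto
  thus ?case by (simp add: continuous_at_imp_continuous_on)
next
  case (Suc k)
  have "f differentiable (at x)" if "x \<in> S" for x using Suc.prems[OF that] by auto
  moreover have "Ck_on k S (\<lambda>x. dd f x v)" for v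
  proof (rule Suc.IH)
    fix x assume "x \<in> S"
    thus "\<exists>T. open T \<and> x \<in> T \<and> Ck_on k T (\<lambda>x. dd f x v)" using Suc.prems[of x] by auto
  qed
  ultimately show ?case by simp
qed

lemma Ck_on_pred: "Ck_on (Suc k) S f \<Longrightarrow> Ck_on k S f"
proof (induction k arbitrary: f)
  case 0
  hence "isCont f x" if "x \<in> S" for x
    using that differentiable_imp_continuous_within by auto
  thus ?case by (simp add: continuous_at_imp_continuous_on)
next
  case (Suc k)
  have "Ck_on k S (\<lambda>x. dd f x v)" for v
    by (rule Suc.IH) (use Suc.prems in simp)
  thus ?case using Suc.prems by simp
qed

lemma Ck_on_SucI:
  assumes "open S" "\<And>x. x \<in> S \<Longrightarrow> (f has_derivative F x) (at x)" "\<And>v. Ck_on k S (\<lambda>x. F x v)"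
  shows "Ck_on (Suc k) S f"
proof -
  have "Ck_on k S (\<lambda>x. dd f x v)" for v
    by (rule Ck_on_cong[OF assms(1) _ assms(3)[of v]]) (simp add: dd_eq[OF assms(2)])
  thus ?thesis using assms(2) by (auto intro: differentiableI)
qed

lemma Ck_on_has: "Ck_on (Suc k) S f \<Longrightarrow> x \<in> S \<Longrightarrow> (f has_derivative dd f x) (at x)"
  by (auto intro: dd_has)

lemma Ck_on_const: "open S \<Longrightarrow> Ck_on k S (\<lambda>_. c)"
proof (induction k arbitrary: c)
  case (Suc k)
  show ?case by (rule Ck_on_SucI[where F = "\<lambda>_ _. 0"]) (use Suc in auto)
qed simp

lemma Ck_on_add: "open S \<Longrightarrow> Ck_on k S f \<Longrightarrow> Ck_on k S g \<Longrightarrow> Ck_on k S (\<lambda>x. f x + g x)"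
proof (induction k arbitrary: f g)
  case (Suc k)
  show ?case
  proof (rule Ck_on_SucI[OF Suc.prems(1)])
    fix x assume x: "x \<in> S"
    show "((\<lambda>x. f x + g x) has_derivative (\<lambda>v. dd f x v + dd g x v)) (at x)"
      by (rule has_derivative_add[OF Ck_on_has[OF Suc.prems(2) x] Ck_on_has[OF Suc.prems(3) x]])
  next
    fix v show "Ck_on k S (\<lambda>x. dd f x v + dd g x v)"
      using Suc.prems by (intro Suc.IH) auto
  qed
qed (simp add: continuous_on_add)

lemma Ck_on_bounded_linear:
  assumes "bounded_linear h" "open S"
  shows "Ck_on k S f \<Longrightarrow> Ck_on k S (\<lambda>x. h (f x))"
proof (induction k arbitrary: f)
  case 0 thus ?case using bounded_linear.continuous_on[OF assms(1)] by simp
next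
  case (Suc k)
  show ?case
  proof (rule Ck_on_SucI[OF assms(2)])
    fix x assume x: "x \<in> S"
    show "((\<lambda>x. h (f x)) has_derivative (\<lambda>v. h (dd f x v))) (at x)"
      by (rule bounded_linear.has_derivative[OF assms(1) Ck_on_has[OF Suc.prems x]])
  next
    fix v show "Ck_on k S (\<lambda>x. h (dd f x v))"
      using Suc.prems by (intro Suc.IH) auto
  qed
qed

lemma Ck_on_mult:
  fixes f g :: "'a::real_normed_vector \<Rightarrow> real"
  shows "open S \<Longrightarrow> Ck_on k S f \<Longrightarrow> Ck_on k S g \<Longrightarrow> Ck_on k S (\<lambda>x. f x * g x)"
proof (induction k arbitrary: f g)
  case (Suc k)
  show ?case
  proof (rule Ck_on_SucI[OF Suc.prems(1)])
    fix x assume x: "x \<in> S"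
    show "((\<lambda>x. f x * g x) has_derivative (\<lambda>v. f x * dd g x v + dd f x v * g x)) (at x)"
      by (rule has_derivative_mult[OF Ck_on_has[OF Suc.prems(2) x] Ck_on_has[OF Suc.prems(3) x]])
  next
    fix v show "Ck_on k S (\<lambda>x. f x * dd g x v + dd f x v * g x)"
      using Suc.prems Ck_on_pred[OF Suc.prems(2)] Ck_on_pred[OF Suc.prems(3)]
      by (intro Ck_on_add Suc.IH) auto
  qed
qed (simp add: continuous_on_mult)

lemma Ck_on_inverse:
  fixes f :: "'a::real_normed_vector \<Rightarrow> real"
  shows "open S \<Longrightarrow> (\<And>x. x \<in> S \<Longrightarrow> f x \<noteq> 0) \<Longrightarrow> Ck_on k S f \<Longrightarrow> Ck_on k S (\<lambda>x. inverse (f x))"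
proof (induction k)
  case (Suc k)
  have IH: "Ck_on k S (\<lambda>x. inverse (f x))"
    using Suc.prems Ck_on_pred[OF Suc.prems(3)] by (intro Suc.IH) auto
  show ?case
  proof (rule Ck_on_SucI[OF Suc.prems(1)])
    fix x assume x: "x \<in> S"
    show "((\<lambda>x. inverse (f x)) has_derivative (\<lambda>v. - (inverse (f x) * dd f x v * inverse (f x)))) (at x)"
      by (rule Deriv.has_derivative_inverse[OF Suc.prems(2)[OF x] Ck_on_has[OF Suc.prems(3) x]])
  next
    fix v
    have "Ck_on k S (\<lambda>x. (-1) * (inverse (f x) * dd f x v * inverse (f x)))"
      using Suc.prems IH by (intro Ck_on_mult Ck_on_const) auto
    thus "Ck_on k S (\<lambda>x. - (inverse (f x) * dd f x v * inverse (f x)))" by simp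
  qed
qed (auto intro: continuous_on_inverse)

lemma Ck_on_sqrt:
  fixes f :: "'a::real_normed_vector \<Rightarrow> real"
  shows "open S \<Longrightarrow> (\<And>x. x \<in> S \<Longrightarrow> f x > 0) \<Longrightarrow> Ck_on k S f \<Longrightarrow> Ck_on k S (\<lambda>x. sqrt (f x))"
proof (induction k)
  case (Suc k)
  have IH: "Ck_on k S (\<lambda>x. sqrt (f x))"
    using Suc.prems Ck_on_pred[OF Suc.prems(3)] by (intro Suc.IH) auto
  show ?case
  proof (rule Ck_on_SucI[OF Suc.prems(1)])
    fix x assume x: "x \<in> S"
    have pos: "f x > 0" using Suc.prems(2)[OF x] .
    have "(sqrt has_derivative (*) (inverse (sqrt (f x)) / 2)) (at (f x))"
      using DERIV_real_sqrt[OF pos] unfolding has_field_derivative_def .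
    from has_derivative_compose[OF Ck_on_has[OF Suc.prems(3) x] this]
    show "((\<lambda>x. sqrt (f x)) has_derivative (\<lambda>v. inverse (sqrt (f x)) / 2 * dd f x v)) (at x)" .
  next
    fix v
    have "sqrt (f x) \<noteq> 0" if "x \<in> S" for x using Suc.prems(2)[OF that] by simp
    hence "Ck_on k S (\<lambda>x. inverse (sqrt (f x)) * (1 / 2) * dd f x v)"
      using Suc.prems IH by (intro Ck_on_mult Ck_on_const Ck_on_inverse) auto
    thus "Ck_on k S (\<lambda>x. inverse (sqrt (f x)) / 2 * dd f x v)" by simp
  qed
qed (auto intro: continuous_on_real_sqrt)

lemma second_difference:
  fixes F :: "'a::real_normed_vector \<Rightarrow> real"
  assumes C: "Ck_on 2 S F" and h: "h > 0"
    and inS: "\<And>s t. 0 \<le> s \<Longrightarrow> s \<le> h \<Longrightarrow> 0 \<le> t \<Longrightarrow> t \<le> h \<Longrightarrow> x + s *\<^sub>R a + t *\<^sub>R b \<in> S"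
  shows "\<exists>s t. 0 \<le> s \<and> s \<le> h \<and> 0 \<le> t \<and> t \<le> h \<and>
     F (x + h *\<^sub>R a + h *\<^sub>R b) - F (x + h *\<^sub>R a) - F (x + h *\<^sub>R b) + F x
       = h * h * dd (\<lambda>z. dd F z a) (x + s *\<^sub>R a + t *\<^sub>R b) b"
proof -
  have C1: "Ck_on (Suc (Suc 0)) S F" using C by (simp add: numeral_2_eq_2)
  have C2: "Ck_on (Suc 0) S (\<lambda>z. dd F z a)" using C1 by (simp del: Ck_on.simps(1))
  have line: "((\<lambda>t. G (p + t *\<^sub>R c)) has_real_derivative dd G (p + t *\<^sub>R c) c) (at t)"
    if "Ck_on (Suc k) S G" "p + t *\<^sub>R c \<in> S" for G :: "'a \<Rightarrow> real" and k p c t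
  proof -
    have "((\<lambda>t. p + t *\<^sub>R c) has_derivative (\<lambda>t. t *\<^sub>R c)) (at t)"
      by (auto intro!: derivative_eq_intros)
    from has_derivative_compose[OF this Ck_on_has[OF that]]
    have d: "((\<lambda>t. G (p + t *\<^sub>R c)) has_derivative (\<lambda>u. dd G (p + t *\<^sub>R c) (u *\<^sub>R c))) (at t)" .
    have "linear (dd G (p + t *\<^sub>R c))" using Ck_on_has[OF that] by (rule has_derivative_linear)
    hence "dd G (p + t *\<^sub>R c) (u *\<^sub>R c) = dd G (p + t *\<^sub>R c) c * u" for u
      by (simp add: linear_scale)
    with d show ?thesis by (simp add: has_field_derivative_def)
  qed
  let ?g = "\<lambda>s. F (x + h *\<^sub>R b + s *\<^sub>R a) - F (x + s *\<^sub>R a)"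
  let ?g' = "\<lambda>s. dd F (x + h *\<^sub>R b + s *\<^sub>R a) a - dd F (x + s *\<^sub>R a) a"
  have i1: "x + t *\<^sub>R b + s *\<^sub>R a \<in> S" if "0 \<le> s" "s \<le> h" "0 \<le> t" "t \<le> h" for s t
    using inS[OF that] by (simp add: add_ac)
  have i2: "x + s *\<^sub>R a \<in> S" if "0 \<le> s" "s \<le> h" for s
    using inS[of s 0] that h by simp
  have "(?g has_real_derivative ?g' s) (at s)" if "0 \<le> s" "s \<le> h" for s
    using i1[of s h] i2[of s] that h by (intro DERIV_diff line[OF C1]) auto
  from MVT2[OF h this] obtain s where s: "0 < s" "s < h" "?g h - ?g 0 = (h - 0) * ?g' s" by auto
  let ?k = "\<lambda>t. dd F (x + s *\<^sub>R a + t *\<^sub>R b) a"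
  have "(?k has_real_derivative dd (\<lambda>z. dd F z a) (x + s *\<^sub>R a + t *\<^sub>R b) b) (at t)" if "0 \<le> t" "t \<le> h" for t
    using inS[of s t] that s by (intro line[OF C2]) auto
  from MVT2[OF h this] obtain t where t: "0 < t" "t < h"
    "?k h - ?k 0 = (h - 0) * dd (\<lambda>z. dd F z a) (x + s *\<^sub>R a + t *\<^sub>R b) b" by auto
  have "?g h - ?g 0 = h * (?k h - ?k 0)" using s(3) by (simp add: add_ac)
  hence "?g h - ?g 0 = h * h * dd (\<lambda>z. dd F z a) (x + s *\<^sub>R a + t *\<^sub>R b) b" using t(3) by simp
  moreover have "?g h - ?g 0 = F (x + h *\<^sub>R a + h *\<^sub>R b) - F (x + h *\<^sub>R a) - F (x + h *\<^sub>R b) + F x"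
    by (simp add: add_ac)
  ultimately show ?thesis using s t by (intro exI[of _ s] exI[of _ t]) auto
qed

text \<open>Schwarz's theorem: the second difference in the directions \<open>a\<close> and \<open>b\<close> is symmetric, and by the mean
value theorem it is a value of either mixed derivative at a nearby point.\<close>

lemma symmetric_second_derivative:
  fixes F :: "'a::real_normed_vector \<Rightarrow> real"
  assumes C: "Ck_on 2 S F" and S: "open S" "x \<in> S"
  shows "dd (\<lambda>z. dd F z a) x b = dd (\<lambda>z. dd F z b) x a"
proof (rule ccontr)
  let ?P = "\<lambda>z. dd (\<lambda>z. dd F z a) z b" and ?Q = "\<lambda>z. dd (\<lambda>z. dd F z b) z a"
  assume "?P x \<noteq> ?Q x"
  define e where "e = \<bar>?P x - ?Q x\<bar> / 2"
  have e: "e > 0" using \<open>?P x \<noteq> ?Q x\<close> by (simp add: e_def)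
  have "continuous_on S ?P" "continuous_on S ?Q" using C by (auto simp: numeral_2_eq_2)
  hence "isCont ?P x" "isCont ?Q x" using S continuous_on_eq_continuous_at by blast+
  then obtain d1 d2 where d1: "d1 > 0" "\<And>z. dist z x < d1 \<Longrightarrow> dist (?P z) (?P x) < e"
    and d2: "d2 > 0" "\<And>z. dist z x < d2 \<Longrightarrow> dist (?Q z) (?Q x) < e"
    using e unfolding continuous_at_eps_delta by metis
  obtain d3 where d3: "d3 > 0" "ball x d3 \<subseteq> S" using S open_contains_ball by blast
  define d where "d = min d1 (min d2 d3)"
  \<comment> \<open>So small that the whole parallelogram lies where both mixed derivatives differ from their values at \<open>x\<close> by less than \<open>e\<close>.\<close>
  define h where "h = d / (2 * (norm a + norm b + 1))"
  have dpos: "d > 0" using d1 d2 d3 by (simp add: d_def)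
  have npos: "norm a + norm b + 1 > 0" by (intro add_nonneg_pos add_nonneg_nonneg) auto
  have hpos: "h > 0" using dpos npos by (simp add: h_def)
  have near: "dist (x + s *\<^sub>R a + t *\<^sub>R b) x < d" if "0 \<le> s" "s \<le> h" "0 \<le> t" "t \<le> h" for s t
  proof -
    have "dist (x + s *\<^sub>R a + t *\<^sub>R b) x = norm (s *\<^sub>R a + t *\<^sub>R b)" by (simp add: dist_norm)
    also have "\<dots> \<le> s * norm a + t * norm b"
      using norm_triangle_ineq[of "s *\<^sub>R a" "t *\<^sub>R b"] that by simp
    also have "\<dots> \<le> h * norm a + h * norm b"
      using that by (intro add_mono mult_right_mono) auto
    also have "\<dots> \<le> h * (norm a + norm b + 1)" using hpos by (simp add: algebra_simps)
    also have "\<dots> = d / 2"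
    proof -
      have "d / (2 * n) * n = d / 2" if "n > 0" for n using that by simp
      thus ?thesis unfolding h_def using npos by blast
    qed
    finally show ?thesis using dpos by simp
  qed
  have inS: "x + s *\<^sub>R a + t *\<^sub>R b \<in> S" if "0 \<le> s" "s \<le> h" "0 \<le> t" "t \<le> h" for s t
    using near[OF that] d3(2) by (auto simp: d_def dist_commute)
  have inS': "x + s *\<^sub>R b + t *\<^sub>R a \<in> S" if "0 \<le> s" "s \<le> h" "0 \<le> t" "t \<le> h" for s t
    using inS[OF that(3,4,1,2)] by (simp add: add_ac)
  obtain s t where st: "0 \<le> s" "s \<le> h" "0 \<le> t" "t \<le> h"
    "F (x + h *\<^sub>R a + h *\<^sub>R b) - F (x + h *\<^sub>R a) - F (x + h *\<^sub>R b) + F x = h * h * ?P (x + s *\<^sub>R a + t *\<^sub>R b)"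
    using second_difference[OF C hpos inS] by blast
  obtain s' t' where st': "0 \<le> s'" "s' \<le> h" "0 \<le> t'" "t' \<le> h"
    "F (x + h *\<^sub>R b + h *\<^sub>R a) - F (x + h *\<^sub>R b) - F (x + h *\<^sub>R a) + F x = h * h * ?Q (x + s' *\<^sub>R b + t' *\<^sub>R a)"
    using second_difference[OF C hpos inS'] by blast
  have xy: "x + h *\<^sub>R a + h *\<^sub>R b = x + h *\<^sub>R b + h *\<^sub>R a" by (simp add: add_ac)
  have "h * h * ?P (x + s *\<^sub>R a + t *\<^sub>R b) = h * h * ?Q (x + s' *\<^sub>R b + t' *\<^sub>R a)"
    using st(5) st'(5) unfolding xy by linarith
  hence eq: "?P (x + s *\<^sub>R a + t *\<^sub>R b) = ?Q (x + s' *\<^sub>R b + t' *\<^sub>R a)" using hpos by simp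
  have "dist (x + s *\<^sub>R a + t *\<^sub>R b) x < d1" using near[OF st(1-4)] by (simp add: d_def)
  moreover have "dist (x + s' *\<^sub>R b + t' *\<^sub>R a) x < d2"
    using near[OF st'(3,4,1,2)] by (simp add: d_def add_ac)
  ultimately have "\<bar>?P (x + s *\<^sub>R a + t *\<^sub>R b) - ?P x\<bar> < e" "\<bar>?Q (x + s' *\<^sub>R b + t' *\<^sub>R a) - ?Q x\<bar> < e"
    using d1(2) d2(2) by (auto simp: dist_real_def)
  hence "?P x - ?Q x < 2 * e \<and> ?Q x - ?P x < 2 * e" unfolding eq abs_less_iff by linarith
  hence "\<bar>?P x - ?Q x\<bar> < 2 * e" unfolding abs_less_iff by simp
  thus False by (simp add: e_def)
qed

section \<open>Smooth functions on a manifold\<close>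

locale manifold =
  fixes A :: "('m::{t2_space,second_countable_topology}, 'e::real_inner) chart set"
  assumes manifold: "smooth_manifold A"
begin

lemma chart_exists: "\<exists>c\<in>A. u \<in> fst c"
  using manifold unfolding smooth_manifold_def by blast

lemma
  assumes "c \<in> A"
  shows chart_open: "open (fst c)" and chart_image_open: "open (snd c ` fst c)"
    and chart_homeo: "homeomorphism (fst c) (snd c ` fst c) (snd c) (inv_into (fst c) (snd c))"
  using manifold assms unfolding smooth_manifold_def by (cases c; auto)+

lemma chart_inv: "c \<in> A \<Longrightarrow> y \<in> fst c \<Longrightarrow> inv_into (fst c) (snd c) (snd c y) = y"
  using chart_homeo[of c] by (rule homeomorphism_apply1)

lemma chart_transition_smooth:
  "c \<in> A \<Longrightarrow> c' \<in> A \<Longrightarrow> smooth_on (snd c ` (fst c \<inter> fst c')) (snd c' \<circ> inv_into (fst c) (snd c))"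
  using manifold unfolding smooth_manifold_def by (simp add: case_prod_unfold)

lemma chart_open_map:
  assumes "c \<in> A" "open W" shows "open (snd c ` (fst c \<inter> W))"
proof -
  have "openin (top_of_set (fst c)) (fst c \<inter> W)" using assms(2) by (rule openin_open_Int)
  hence "openin (top_of_set (snd c ` fst c)) (snd c ` (fst c \<inter> W))"
    by (rule homeomorphism_imp_open_map[OF chart_homeo[OF assms(1)]])
  thus ?thesis using chart_image_open[OF assms(1)] by (rule openin_open_trans)
qed

lemma smooth_fun_alt:
  "smooth_fun A W f \<longleftrightarrow> (\<forall>c\<in>A. \<forall>k. Ck_on k (snd c ` (fst c \<inter> W)) (\<lambda>x. f (inv_into (fst c) (snd c) x)))"
  unfolding smooth_fun_def smooth_on_def o_def by (auto simp: case_prod_beta)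

lemma chart_inv_mem: "c \<in> A \<Longrightarrow> x \<in> snd c ` (fst c \<inter> W) \<Longrightarrow> inv_into (fst c) (snd c) x \<in> fst c \<inter> W"
  by (auto simp: chart_inv)

lemma smooth_fun_cong:
  assumes "open W" "\<And>y. y \<in> W \<Longrightarrow> f y = g y" "smooth_fun A W f"
  shows "smooth_fun A W g"
  unfolding smooth_fun_alt
proof (intro ballI allI)
  fix c k assume c: "c \<in> A"
  show "Ck_on k (snd c ` (fst c \<inter> W)) (\<lambda>x. g (inv_into (fst c) (snd c) x))"
  proof (rule Ck_on_cong[OF chart_open_map[OF c assms(1)]])
    show "Ck_on k (snd c ` (fst c \<inter> W)) (\<lambda>x. f (inv_into (fst c) (snd c) x))"
      using assms(3) c unfolding smooth_fun_alt by blast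
    show "f (inv_into (fst c) (snd c) x) = g (inv_into (fst c) (snd c) x)" if "x \<in> snd c ` (fst c \<inter> W)" for x
      using chart_inv_mem[OF c that] assms(2) by blast
  qed
qed

lemma smooth_fun_subset: "smooth_fun A W f \<Longrightarrow> W' \<subseteq> W \<Longrightarrow> smooth_fun A W' f"
  unfolding smooth_fun_alt by (meson Ck_on_subset image_mono Int_mono order_refl)

lemma smooth_fun_local:
  assumes "\<And>y. y \<in> W \<Longrightarrow> \<exists>W'. open W' \<and> y \<in> W' \<and> smooth_fun A W' f"
  shows "smooth_fun A W f"
  unfolding smooth_fun_alt
proof (intro ballI allI)
  fix c k assume c: "c \<in> A"
  show "Ck_on k (snd c ` (fst c \<inter> W)) (\<lambda>x. f (inv_into (fst c) (snd c) x))"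
  proof (rule Ck_on_local)
    fix x assume "x \<in> snd c ` (fst c \<inter> W)"
    then obtain y where y: "x = snd c y" "y \<in> fst c" "y \<in> W" by blast
    from assms[OF y(3)] obtain W' where W': "open W'" "y \<in> W'" "smooth_fun A W' f" by blast
    show "\<exists>T. open T \<and> x \<in> T \<and> Ck_on k T (\<lambda>x. f (inv_into (fst c) (snd c) x))"
      by (rule exI[of _ "snd c ` (fst c \<inter> W')"])
        (use W' y c chart_open_map[OF c W'(1)] in \<open>auto simp: smooth_fun_alt\<close>)
  qed
qed

lemma smooth_fun_const: "open W \<Longrightarrow> smooth_fun A W (\<lambda>_. r)"
  unfolding smooth_fun_alt by (intro ballI allI Ck_on_const chart_open_map)

lemma smooth_fun_add: "open W \<Longrightarrow> smooth_fun A W f \<Longrightarrow> smooth_fun A W g \<Longrightarrow> smooth_fun A W (\<lambda>y. f y + g y)"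
  unfolding smooth_fun_alt by (intro ballI allI Ck_on_add chart_open_map) simp_all

lemma smooth_fun_mult: "open W \<Longrightarrow> smooth_fun A W f \<Longrightarrow> smooth_fun A W g \<Longrightarrow> smooth_fun A W (\<lambda>y. f y * g y)"
  unfolding smooth_fun_alt by (intro ballI allI Ck_on_mult chart_open_map) simp_all

lemma smooth_fun_uminus: "open W \<Longrightarrow> smooth_fun A W f \<Longrightarrow> smooth_fun A W (\<lambda>y. - f y)"
  using smooth_fun_mult[OF _ smooth_fun_const[of W "-1"], of f] by simp

lemma smooth_fun_sum: "open W \<Longrightarrow> (\<And>i. i \<in> I \<Longrightarrow> smooth_fun A W (f i)) \<Longrightarrow> smooth_fun A W (\<lambda>y. \<Sum>i\<in>I. f i y)"
  by (induction I rule: infinite_finite_induct) (auto intro: smooth_fun_const smooth_fun_add)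

lemma smooth_fun_prod: "open W \<Longrightarrow> (\<And>i. i \<in> I \<Longrightarrow> smooth_fun A W (f i)) \<Longrightarrow> smooth_fun A W (\<lambda>y. \<Prod>i\<in>I. f i y)"
  by (induction I rule: infinite_finite_induct) (auto intro: smooth_fun_const smooth_fun_mult)

lemma smooth_fun_inverse:
  assumes "open W" "\<And>y. y \<in> W \<Longrightarrow> f y \<noteq> 0" "smooth_fun A W f"
  shows "smooth_fun A W (\<lambda>y. inverse (f y))"
  unfolding smooth_fun_alt
proof (intro ballI allI)
  fix c k assume c: "c \<in> A"
  show "Ck_on k (snd c ` (fst c \<inter> W)) (\<lambda>x. inverse (f (inv_into (fst c) (snd c) x)))"
    using assms(3) c chart_inv_mem[OF c] assms(2)
    by (intro Ck_on_inverse chart_open_map[OF c assms(1)]) (auto simp: smooth_fun_alt)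
qed

lemma smooth_fun_sqrt:
  assumes "open W" "\<And>y. y \<in> W \<Longrightarrow> f y > 0" "smooth_fun A W f"
  shows "smooth_fun A W (\<lambda>y. sqrt (f y))"
  unfolding smooth_fun_alt
proof (intro ballI allI)
  fix c k assume c: "c \<in> A"
  show "Ck_on k (snd c ` (fst c \<inter> W)) (\<lambda>x. sqrt (f (inv_into (fst c) (snd c) x)))"
    using assms(3) c chart_inv_mem[OF c] assms(2)
    by (intro Ck_on_sqrt chart_open_map[OF c assms(1)]) (auto simp: smooth_fun_alt)
qed

lemma smooth_fun_isCont:
  assumes "open W" "smooth_fun A W f" "u \<in> W"
  shows "isCont f u"
proof -
  obtain c where c: "c \<in> A" "u \<in> fst c" using chart_exists by blast
  let ?i = "inv_into (fst c) (snd c)" and ?V = "fst c \<inter> W"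
  have "Ck_on 0 (snd c ` ?V) (\<lambda>x. f (?i x))" using assms(2) c(1) unfolding smooth_fun_alt by blast
  hence "continuous_on (snd c ` ?V) (\<lambda>x. f (?i x))" by simp
  moreover have "continuous_on ?V (snd c)"
    using continuous_on_subset[OF homeomorphism_cont1[OF chart_homeo[OF c(1)]], of ?V] by simp
  ultimately have "continuous_on ?V (\<lambda>y. f (?i (snd c y)))"
    by (rule continuous_on_compose2) simp
  hence "continuous_on ?V f"
    by (rule continuous_on_eq) (simp add: chart_inv[OF c(1)])
  thus ?thesis using c assms chart_open[OF c(1)] by (simp add: continuous_on_eq_continuous_at open_Int)
qed

lemma smooth_fun_pos_nbhd:
  assumes "open W" "smooth_fun A W f" "u \<in> W" "f u > 0"
  obtains W' where "open W'" "u \<in> W'" "W' \<subseteq> W" "\<And>y. y \<in> W' \<Longrightarrow> f y > (0::real)"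
proof -
  have "continuous_on W f"
    using smooth_fun_isCont[OF assms(1,2)] by (simp add: continuous_at_imp_continuous_on)
  hence "open (W \<inter> f -` {0<..})" using assms(1) continuous_open_preimage[of W f "{0<..}"] by simp
  thus thesis using that[of "W \<inter> f -` {0<..}"] assms by auto
qed

lemma smooth_fun_coord:
  assumes "c \<in> A"
  shows "smooth_fun A (fst c) (\<lambda>y. inner (snd c y) d)"
  unfolding smooth_fun_alt
proof (intro ballI allI)
  fix c' k assume c': "c' \<in> A"
  have "Ck_on k (snd c' ` (fst c' \<inter> fst c)) (snd c \<circ> inv_into (fst c') (snd c'))"
    using chart_transition_smooth[OF c' assms] unfolding smooth_on_def by blast
  thus "Ck_on k (snd c' ` (fst c' \<inter> fst c)) (\<lambda>x. inner (snd c (inv_into (fst c') (snd c') x)) d)"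
    using Ck_on_bounded_linear[OF bounded_linear_inner_left chart_open_map[OF c' chart_open[OF assms]], of k "\<lambda>x. snd c (inv_into (fst c') (snd c') x)" d]
    by (simp add: o_def)
qed

section \<open>Tangent vectors as derivations\<close>

definition smooth_near :: "'m \<Rightarrow> ('m \<Rightarrow> real) \<Rightarrow> bool" where
  "smooth_near u f \<longleftrightarrow> (\<exists>W. open W \<and> u \<in> W \<and> smooth_fun A W f)"

lemma smooth_nearI: "open W \<Longrightarrow> u \<in> W \<Longrightarrow> smooth_fun A W f \<Longrightarrow> smooth_near u f"
  unfolding smooth_near_def by blast

lemma smooth_near_cong:
  assumes "open W" "u \<in> W" "\<And>y. y \<in> W \<Longrightarrow> f y = g y" "smooth_near u f"
  shows "smooth_near u g"
proof -
  obtain W' where W': "open W'" "u \<in> W'" "smooth_fun A W' f" using assms(4) unfolding smooth_near_def by blast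
  have "smooth_fun A (W \<inter> W') g"
    by (rule smooth_fun_cong[of _ f]) (use assms W' in \<open>auto intro: smooth_fun_subset\<close>)
  thus ?thesis using assms W' by (intro smooth_nearI[of "W \<inter> W'"]) auto
qed

lemma smooth_near2:
  assumes "smooth_near u f" "smooth_near u g"
  obtains W where "open W" "u \<in> W" "smooth_fun A W f" "smooth_fun A W g"
proof -
  obtain W W' where "open W" "u \<in> W" "smooth_fun A W f" "open W'" "u \<in> W'" "smooth_fun A W' g"
    using assms unfolding smooth_near_def by blast
  thus thesis using that[of "W \<inter> W'"] by (auto intro: smooth_fun_subset)
qed

lemma smooth_near_const: "smooth_near u (\<lambda>_. r)"
  by (rule smooth_nearI[of UNIV]) (auto intro: smooth_fun_const)

lemma smooth_near_add: "smooth_near u f \<Longrightarrow> smooth_near u g \<Longrightarrow> smooth_near u (\<lambda>y. f y + g y)"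
  by (erule (1) smooth_near2) (auto intro: smooth_nearI smooth_fun_add)

lemma smooth_near_mult: "smooth_near u f \<Longrightarrow> smooth_near u g \<Longrightarrow> smooth_near u (\<lambda>y. f y * g y)"
  by (erule (1) smooth_near2) (auto intro: smooth_nearI smooth_fun_mult)

lemma smooth_near_sum: "(\<And>i. i \<in> I \<Longrightarrow> smooth_near u (f i)) \<Longrightarrow> smooth_near u (\<lambda>y. \<Sum>i\<in>I. f i y)"
  by (induction I rule: infinite_finite_induct) (auto intro: smooth_near_const smooth_near_add)

lemma coord_vec_eq: "smooth_near u f \<Longrightarrow> coord_vec A c u w f = dd (f \<circ> inv_into (fst c) (snd c)) (snd c u) w"
  unfolding coord_vec_def smooth_near_def by simp

lemma coord_vec_not: "\<not> smooth_near u f \<Longrightarrow> coord_vec A c u w f = 0"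
  unfolding coord_vec_def smooth_near_def by (simp only: if_False)

lemma chart_differentiable:
  assumes "c \<in> A" "u \<in> fst c" "smooth_near u f"
  shows "(f \<circ> inv_into (fst c) (snd c)) differentiable (at (snd c u))"
proof -
  obtain W where W: "open W" "u \<in> W" "smooth_fun A W f" using assms(3) unfolding smooth_near_def by blast
  have "Ck_on (Suc 0) (snd c ` (fst c \<inter> W)) (f \<circ> inv_into (fst c) (snd c))"
    using W(3) assms(1) unfolding smooth_fun_alt o_def by blast
  moreover have "snd c u \<in> snd c ` (fst c \<inter> W)" using assms W by auto
  ultimately show ?thesis by (rule differentiableI[OF Ck_on_has])
qed

lemma coord_vec_tangent: "c \<in> A \<Longrightarrow> u \<in> fst c \<Longrightarrow> coord_vec A c u w \<in> tangent_space A u"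
  unfolding tangent_space_def by blast

lemma tangent_cong:
  assumes "v \<in> tangent_space A u" "open W" "u \<in> W" "\<And>y. y \<in> W \<Longrightarrow> f y = g y"
  shows "v f = v g"
proof -
  obtain c w where c: "c \<in> A" "u \<in> fst c" and v: "v = coord_vec A c u w"
    using assms(1) unfolding tangent_space_def by blast
  have iff: "smooth_near u f \<longleftrightarrow> smooth_near u g"
    using smooth_near_cong[OF assms(2,3), of f g] smooth_near_cong[OF assms(2,3), of g f] assms(4) by auto
  show ?thesis
  proof (cases "smooth_near u f")
    case True
    have "dd (g \<circ> inv_into (fst c) (snd c)) (snd c u) = dd (f \<circ> inv_into (fst c) (snd c)) (snd c u)"
    proof (rule dd_cong(2)[OF chart_open_map[OF c(1) assms(2)]])
      show "snd c u \<in> snd c ` (fst c \<inter> W)" using c assms by auto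
      show "(f \<circ> inv_into (fst c) (snd c)) differentiable (at (snd c u))"
        using c True by (rule chart_differentiable)
      show "(f \<circ> inv_into (fst c) (snd c)) x = (g \<circ> inv_into (fst c) (snd c)) x" if "x \<in> snd c ` (fst c \<inter> W)" for x
        using chart_inv_mem[OF c(1) that] assms(4) by simp
    qed
    thus ?thesis unfolding v using True iff by (simp add: coord_vec_eq)
  next
    case False
    thus ?thesis unfolding v using iff by (simp add: coord_vec_not)
  qed
qed

lemma tangent_const: "v \<in> tangent_space A u \<Longrightarrow> v (\<lambda>_. r) = 0"
proof -
  assume "v \<in> tangent_space A u"
  then obtain c w where v: "v = coord_vec A c u w" unfolding tangent_space_def by blast
  show ?thesis unfolding v coord_vec_eq[OF smooth_near_const] o_def by (rule dd_eq) (rule has_derivative_const)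
qed

lemma tangent_add:
  assumes "v \<in> tangent_space A u" "smooth_near u f" "smooth_near u g"
  shows "v (\<lambda>y. f y + g y) = v f + v g"
proof -
  obtain c w where c: "c \<in> A" "u \<in> fst c" and v: "v = coord_vec A c u w"
    using assms(1) unfolding tangent_space_def by blast
  show ?thesis unfolding v using assms
    by (simp add: coord_vec_eq smooth_near_add o_def
      dd_eq[OF has_derivative_add[OF dd_has[OF chart_differentiable[OF c assms(2)]] dd_has[OF chart_differentiable[OF c assms(3)]]], unfolded o_def])
qed

lemma tangent_mult:
  assumes "v \<in> tangent_space A u" "smooth_near u f" "smooth_near u g"
  shows "v (\<lambda>y. f y * g y) = v f * g u + f u * v g"
proof -
  obtain c w where c: "c \<in> A" "u \<in> fst c" and v: "v = coord_vec A c u w"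
    using assms(1) unfolding tangent_space_def by blast
  show ?thesis unfolding v using assms chart_inv[OF c]
    by (simp add: coord_vec_eq smooth_near_mult o_def
      dd_eq[OF has_derivative_mult[OF dd_has[OF chart_differentiable[OF c assms(2)]] dd_has[OF chart_differentiable[OF c assms(3)]]], unfolded o_def])
qed

lemma tangent_sum:
  assumes "v \<in> tangent_space A u" "\<And>i. i \<in> I \<Longrightarrow> smooth_near u (f i)"
  shows "v (\<lambda>y. \<Sum>i\<in>I. f i y) = (\<Sum>i\<in>I. v (f i))"
  using assms(2)
proof (induction I rule: infinite_finite_induct)
  case (insert i I)
  have "v (\<lambda>y. f i y + (\<Sum>i\<in>I. f i y)) = v (f i) + v (\<lambda>y. \<Sum>i\<in>I. f i y)"
    using insert by (intro tangent_add[OF assms(1)] smooth_near_sum) auto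
  thus ?case using insert by simp
qed (simp_all add: tangent_const[OF assms(1)])

lemma coord_vec_linear:
  assumes c: "c \<in> A" "u \<in> fst c"
  shows "coord_vec A c u (r *\<^sub>R a + b) = (\<lambda>f. r * coord_vec A c u a f + coord_vec A c u b f)"
proof
  fix f
  show "coord_vec A c u (r *\<^sub>R a + b) f = r * coord_vec A c u a f + coord_vec A c u b f"
  proof (cases "smooth_near u f")
    case True
    have "linear (dd (f \<circ> inv_into (fst c) (snd c)) (snd c u))"
      using dd_has[OF chart_differentiable[OF c True]] by (rule has_derivative_linear)
    thus ?thesis unfolding coord_vec_eq[OF True] by (simp add: linear_add linear_scale)
  qed (simp add: coord_vec_not)
qed

lemma coord_vec_0: "c \<in> A \<Longrightarrow> u \<in> fst c \<Longrightarrow> coord_vec A c u 0 = (\<lambda>f. 0)"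
  using coord_vec_linear[of c u "-1" 0 0] by (auto simp: fun_eq_iff)

lemma zero_tangent: "(\<lambda>f. 0) \<in> tangent_space A u"
  using chart_exists[of u] coord_vec_0 coord_vec_tangent by metis

lemma coord_vec_inj:
  assumes c: "c \<in> A" "u \<in> fst c" and eq: "coord_vec A c u a = coord_vec A c u b"
  shows "a = b"
proof -
  have val: "coord_vec A c u w (\<lambda>y. inner (snd c y) d) = inner w d" for w d
  proof -
    have sn: "smooth_near u (\<lambda>y. inner (snd c y) d)"
      using smooth_nearI[OF chart_open[OF c(1)] c(2) smooth_fun_coord[OF c(1)]] .
    have "((\<lambda>z. inner z d) has_derivative (\<lambda>z. inner z d)) (at (snd c u))"
      by (rule bounded_linear_imp_has_derivative[OF bounded_linear_inner_left])
    hence "(((\<lambda>y. inner (snd c y) d) \<circ> inv_into (fst c) (snd c)) has_derivative (\<lambda>z. inner z d)) (at (snd c u))"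
    proof (rule has_derivative_transform_within_open[OF _ chart_image_open[OF c(1)]])
      show "inner x d = ((\<lambda>y. inner (snd c y) d) \<circ> inv_into (fst c) (snd c)) x" if "x \<in> snd c ` fst c" for x
        using that by (simp add: f_inv_into_f)
    qed (use c in simp)
    thus ?thesis unfolding coord_vec_eq[OF sn] by (rule dd_eq)
  qed
  have "inner (a - b) (a - b) = 0"
    using fun_cong[OF eq, of "\<lambda>y. inner (snd c y) (a - b)"] unfolding val by (simp add: inner_diff_left)
  thus ?thesis by simp
qed

text \<open>The chain rule for the transition between two charts.\<close>

lemma tangent_in_chart:
  assumes c: "c \<in> A" "u \<in> fst c" and v: "v \<in> tangent_space A u"
  obtains w where "v = coord_vec A c u w"
proof -
  obtain c' w' where c': "c' \<in> A" "u \<in> fst c'" and v': "v = coord_vec A c' u w'"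
    using v unfolding tangent_space_def by blast
  let ?i = "inv_into (fst c) (snd c)" and ?i' = "inv_into (fst c') (snd c')"
  let ?h = "snd c \<circ> ?i'" and ?S = "snd c' ` (fst c' \<inter> fst c)"
  have So: "open ?S" by (rule chart_open_map[OF c'(1) chart_open[OF c(1)]])
  have uS: "snd c' u \<in> ?S" using c c' by auto
  have "Ck_on (Suc 0) ?S ?h" using chart_transition_smooth[OF c'(1) c(1)] unfolding smooth_on_def by blast
  hence dh: "(?h has_derivative dd ?h (snd c' u)) (at (snd c' u))" using uS by (rule Ck_on_has)
  have hu: "?h (snd c' u) = snd c u" using chart_inv[OF c'] by simp
  have "v = coord_vec A c u (dd ?h (snd c' u) w')"
  proof
    fix f
    show "v f = coord_vec A c u (dd ?h (snd c' u) w') f"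
    proof (cases "smooth_near u f")
      case True
      have "((f \<circ> ?i) has_derivative dd (f \<circ> ?i) (snd c u)) (at (?h (snd c' u)))"
        unfolding hu by (rule dd_has[OF chart_differentiable[OF c True]])
      from has_derivative_compose[OF dh this]
      have "((\<lambda>x. (f \<circ> ?i) (?h x)) has_derivative (\<lambda>x. dd (f \<circ> ?i) (snd c u) (dd ?h (snd c' u) x))) (at (snd c' u))" .
      hence "((f \<circ> ?i') has_derivative (\<lambda>x. dd (f \<circ> ?i) (snd c u) (dd ?h (snd c' u) x))) (at (snd c' u))"
      proof (rule has_derivative_transform_within_open[OF _ So uS])
        show "(f \<circ> ?i) (?h x) = (f \<circ> ?i') x" if "x \<in> ?S" for x
          using chart_inv_mem[OF c'(1) that] chart_inv[OF c(1)] by simp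
      qed
      thus ?thesis unfolding v' coord_vec_eq[OF True] by (rule dd_eq)
    qed (simp add: v' coord_vec_not)
  qed
  thus thesis by (rule that)
qed

text \<open>The chart and the coordinates of \<open>v\<close> and \<open>w\<close> depend only on \<open>u\<close>, \<open>v\<close> and \<open>w\<close>. Hence a single choice serves
all forms \<open>\<alpha>\<close> simultaneously and makes
their exterior derivatives comparable.\<close>

lemma ext_deriv_chart:
  assumes "v \<in> tangent_space A u" "w \<in> tangent_space A u"
  obtains c a b where "c \<in> A" "u \<in> fst c" "v = coord_vec A c u a" "w = coord_vec A c u b"
    "\<And>\<alpha>. ext_deriv A \<alpha> u v w = v (\<lambda>y. \<alpha> y (coord_vec A c y b)) - w (\<lambda>y. \<alpha> y (coord_vec A c y a))"
proof -
  define c where "c = (SOME c. c \<in> A \<and> u \<in> fst c)"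
  have c: "c \<in> A" "u \<in> fst c"
    using someI_ex[of "\<lambda>c. c \<in> A \<and> u \<in> fst c"] chart_exists[of u] unfolding c_def by blast+
  obtain a where a: "v = coord_vec A c u a" using tangent_in_chart[OF c assms(1)] .
  obtain b where b: "w = coord_vec A c u b" using tangent_in_chart[OF c assms(2)] .
  have "(THE a. coord_vec A c u a = v) = a" using a coord_vec_inj[OF c] by (intro the_equality) auto
  moreover have "(THE b. coord_vec A c u b = w) = b" using b coord_vec_inj[OF c] by (intro the_equality) auto
  ultimately have "ext_deriv A \<alpha> u v w = v (\<lambda>y. \<alpha> y (coord_vec A c y b)) - w (\<lambda>y. \<alpha> y (coord_vec A c y a))" for \<alpha>
    unfolding ext_deriv_def Let_def c_def[symmetric] by simp
  thus thesis using that c a b by blast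
qed

lemma tangent_combination:
  assumes v: "v \<in> tangent_space A u" and w: "w \<in> tangent_space A u"
  shows "(\<lambda>f. r * v f + w f) \<in> tangent_space A u"
proof -
  obtain c where c: "c \<in> A" "u \<in> fst c" using chart_exists by blast
  obtain a where a: "v = coord_vec A c u a" using tangent_in_chart[OF c v] by blast
  obtain b where b: "w = coord_vec A c u b" using tangent_in_chart[OF c w] by blast
  have "coord_vec A c u (r *\<^sub>R a + b) \<in> tangent_space A u" by (rule coord_vec_tangent[OF c])
  thus ?thesis unfolding coord_vec_linear[OF c] a b .
qed

lemma ext_deriv_cong:
  assumes W: "open W" "u \<in> W" and eq: "\<And>y v. y \<in> W \<Longrightarrow> v \<in> tangent_space A y \<Longrightarrow> \<alpha> y v = \<beta> y v"
    and v: "v \<in> tangent_space A u" and w: "w \<in> tangent_space A u"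
  shows "ext_deriv A \<alpha> u v w = ext_deriv A \<beta> u v w"
proof -
  obtain c a b where c: "c \<in> A" "u \<in> fst c"
    and d: "\<And>\<alpha>. ext_deriv A \<alpha> u v w = v (\<lambda>y. \<alpha> y (coord_vec A c y b)) - w (\<lambda>y. \<alpha> y (coord_vec A c y a))"
    using ext_deriv_chart[OF v w] by metis
  have o: "open (W \<inter> fst c)" "u \<in> W \<inter> fst c" using W c chart_open[OF c(1)] by auto
  have e: "\<alpha> y (coord_vec A c y r) = \<beta> y (coord_vec A c y r)" if "y \<in> W \<inter> fst c" for y r
    using that c(1) by (intro eq coord_vec_tangent) auto
  have "v (\<lambda>y. \<alpha> y (coord_vec A c y b)) = v (\<lambda>y. \<beta> y (coord_vec A c y b))"
    by (rule tangent_cong[OF v o e])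
  moreover have "w (\<lambda>y. \<alpha> y (coord_vec A c y a)) = w (\<lambda>y. \<beta> y (coord_vec A c y a))"
    by (rule tangent_cong[OF w o e])
  ultimately show ?thesis unfolding d by simp
qed

lemma ext_deriv_zero_vec:
  assumes W: "open W" "u \<in> W" and z: "\<And>y. y \<in> W \<Longrightarrow> \<alpha> y (\<lambda>f. 0) = 0" and v: "v \<in> tangent_space A u"
  shows "ext_deriv A \<alpha> u v (\<lambda>f. 0) = 0"
proof -
  obtain c a b where c: "c \<in> A" "u \<in> fst c" and b: "(\<lambda>f. 0) = coord_vec A c u b"
    and d: "\<And>\<alpha>. ext_deriv A \<alpha> u v (\<lambda>f. 0) = v (\<lambda>y. \<alpha> y (coord_vec A c y b)) - (\<lambda>f. 0) (\<lambda>y. \<alpha> y (coord_vec A c y a))"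
    using ext_deriv_chart[OF v zero_tangent] by metis
  have b0: "b = 0" using coord_vec_inj[OF c, of b 0] b coord_vec_0[OF c] by simp
  have "v (\<lambda>y. \<alpha> y (coord_vec A c y b)) = v (\<lambda>y. 0)"
  proof (rule tangent_cong[OF v, of "W \<inter> fst c"])
    fix y assume "y \<in> W \<inter> fst c"
    thus "\<alpha> y (coord_vec A c y b) = 0" using coord_vec_0[OF c(1), of y] z b0 by simp
  qed (use W c chart_open[OF c(1)] in auto)
  thus ?thesis unfolding d using tangent_const[OF v] by simp
qed

text \<open>Coordinate fields commute; equivalently, the exterior derivative of \<open>df\<close> vanishes.\<close>

lemma coord_vec_commute:
  assumes c: "c \<in> A" "u \<in> fst c" and f: "smooth_near u f"
    and sa: "smooth_near u (\<lambda>y. coord_vec A c y a f)" and sb: "smooth_near u (\<lambda>y. coord_vec A c y b f)"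
  shows "coord_vec A c u a (\<lambda>y. coord_vec A c y b f) = coord_vec A c u b (\<lambda>y. coord_vec A c y a f)"
proof -
  obtain W where W: "open W" "u \<in> W" "smooth_fun A W f" using f unfolding smooth_near_def by blast
  let ?i = "inv_into (fst c) (snd c)" and ?S = "snd c ` (fst c \<inter> W)"
  let ?F = "f \<circ> ?i"
  have So: "open ?S" by (rule chart_open_map[OF c(1) W(1)])
  have uS: "snd c u \<in> ?S" using c W by auto
  have C: "Ck_on 2 ?S ?F" using W(3) c(1) unfolding smooth_fun_alt o_def by blast
  have e: "((\<lambda>y. coord_vec A c y w f) \<circ> ?i) x = dd ?F x w" if "x \<in> ?S" for x w
  proof -
    have y: "?i x \<in> fst c \<inter> W" using chart_inv_mem[OF c(1) that] .
    hence "smooth_near (?i x) f" using W by (intro smooth_nearI) auto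
    moreover have "snd c (?i x) = x" using that by (auto intro: f_inv_into_f)
    ultimately show ?thesis by (simp add: coord_vec_eq)
  qed
  have d: "coord_vec A c u a' (\<lambda>y. coord_vec A c y w f) = dd (\<lambda>x. dd ?F x w) (snd c u) a'"
    if "smooth_near u (\<lambda>y. coord_vec A c y w f)" for a' w
    unfolding coord_vec_eq[OF that]
    using dd_cong(2)[OF So uS e chart_differentiable[OF c that]] by simp
  show ?thesis unfolding d[OF sa] d[OF sb] by (rule symmetric_second_derivative[OF C So uS])
qed

end

section \<open>Trivializations and sections\<close>

lemma linear_trivD:
  assumes "linear_triv B \<tau>" "u \<in> fst \<tau>"
  shows triv_bij: "bij_betw (snd \<tau> u) (fib B u) {x. \<forall>i\<ge>rk B. x i = 0}"
    and triv_linear: "e \<in> fib B u \<Longrightarrow> e' \<in> fib B u \<Longrightarrow> snd \<tau> u (a *\<^sub>R e + e') i = a * snd \<tau> u e i + snd \<tau> u e' i"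
  using assms unfolding linear_triv_def by (auto simp: case_prod_beta)

lemma linear_triv_open: "linear_triv B \<tau> \<Longrightarrow> open (fst \<tau>)"
  unfolding linear_triv_def by (auto simp: case_prod_beta)

lemma triv_outside: "linear_triv B \<tau> \<Longrightarrow> u \<in> fst \<tau> \<Longrightarrow> e \<in> fib B u \<Longrightarrow> rk B \<le> i \<Longrightarrow> snd \<tau> u e i = 0"
  using bij_betwE[OF triv_bij] by blast

lemma triv_inj:
  assumes "linear_triv B \<tau>" "u \<in> fst \<tau>" "e \<in> fib B u" "e' \<in> fib B u" "\<And>i. i < rk B \<Longrightarrow> snd \<tau> u e i = snd \<tau> u e' i"
  shows "e = e'"
proof -
  have "snd \<tau> u e i = snd \<tau> u e' i" for i
    using assms(5) triv_outside[OF assms(1-3), of i] triv_outside[OF assms(1,2,4), of i] by (cases "i < rk B") auto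
  hence "snd \<tau> u e = snd \<tau> u e'" by (rule ext)
  thus ?thesis using bij_betw_imp_inj_on[OF triv_bij[OF assms(1,2)]] assms(3,4) by (meson inj_onD)
qed

lemma
  assumes "linear_triv B \<tau>" "u \<in> fst \<tau>" "j < rk B"
  shows frame_in: "frame B \<tau> u j \<in> fib B u"
    and frame_coord: "snd \<tau> u (frame B \<tau> u j) i = (if i = j then 1 else 0)"
proof -
  let ?d = "\<lambda>i. if i = j then 1 else 0 :: real"
  have "?d \<in> snd \<tau> u ` fib B u"
    using triv_bij[OF assms(1,2)] assms(3) unfolding bij_betw_def by auto
  thus "frame B \<tau> u j \<in> fib B u" "snd \<tau> u (frame B \<tau> u j) i = ?d i"
    unfolding frame_def by (auto simp: f_inv_into_f intro: inv_into_into)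
qed

lemma triv_sum:
  assumes lt: "linear_triv B \<tau>" "u \<in> fst \<tau>" and sub: "subspace (fib B u)" and e: "\<And>j. j \<in> I \<Longrightarrow> e j \<in> fib B u"
  shows "snd \<tau> u (\<Sum>j\<in>I. a j *\<^sub>R e j) i = (\<Sum>j\<in>I. a j * snd \<tau> u (e j) i)"
  using e
proof (induction I rule: infinite_finite_induct)
  case (insert j I)
  have "(\<Sum>j\<in>I. a j *\<^sub>R e j) \<in> fib B u" using insert.prems by (intro subspace_sum subspace_scale sub) auto
  thus ?case using insert triv_linear[OF lt, of "e j" "\<Sum>j\<in>I. a j *\<^sub>R e j"] by simp
qed (use triv_linear[OF lt, of 0 0 "-1"] subspace_0[OF sub] in auto)

lemma triv_expand:
  assumes lt: "linear_triv B \<tau>" "u \<in> fst \<tau>" and sub: "subspace (fib B u)" and e: "e \<in> fib B u"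
  shows "e = (\<Sum>j<rk B. snd \<tau> u e j *\<^sub>R frame B \<tau> u j)"
proof (rule triv_inj[OF lt e])
  show "(\<Sum>j<rk B. snd \<tau> u e j *\<^sub>R frame B \<tau> u j) \<in> fib B u"
    using frame_in[OF lt] by (intro subspace_sum subspace_scale sub) auto
  fix i assume i: "i < rk B"
  have "snd \<tau> u (\<Sum>j<rk B. snd \<tau> u e j *\<^sub>R frame B \<tau> u j) i = (\<Sum>j<rk B. snd \<tau> u e j * snd \<tau> u (frame B \<tau> u j) i)"
    using frame_in[OF lt] by (intro triv_sum[OF lt sub]) auto
  also have "\<dots> = (\<Sum>j<rk B. if j = i then snd \<tau> u e j else 0)"
    using frame_coord[OF lt] by (intro sum.cong refl) auto
  also have "\<dots> = snd \<tau> u e i" using i by simp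
  finally show "snd \<tau> u e i = snd \<tau> u (\<Sum>j<rk B. snd \<tau> u e j *\<^sub>R frame B \<tau> u j) i" ..
qed

lemma transition_apply:
  assumes lt: "linear_triv B \<tau>" "u \<in> fst \<tau>" and lt': "linear_triv B \<tau>'" "u \<in> fst \<tau>'"
    and sub: "subspace (fib B u)" and e: "e \<in> fib B u"
  shows "snd \<tau>' u e i = (\<Sum>j<rk B. transition B \<tau> \<tau>' i j u * snd \<tau> u e j)"
proof -
  have "snd \<tau>' u e i = snd \<tau>' u (\<Sum>j<rk B. snd \<tau> u e j *\<^sub>R frame B \<tau> u j) i"
    using triv_expand[OF lt sub e] by simp
  also have "\<dots> = (\<Sum>j<rk B. snd \<tau> u e j * snd \<tau>' u (frame B \<tau> u j) i)"
    using frame_in[OF lt] by (intro triv_sum[OF lt' sub]) auto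
  finally show ?thesis unfolding transition_def by (simp add: mult.commute)
qed

lemma transition_compose:
  assumes lt: "linear_triv B \<tau>" "u \<in> fst \<tau>" and lt': "linear_triv B \<tau>'" "u \<in> fst \<tau>'"
    and lt'': "linear_triv B \<tau>''" "u \<in> fst \<tau>''" and sub: "subspace (fib B u)" and j: "j < rk B"
  shows "transition B \<tau> \<tau>'' i j u = (\<Sum>l<rk B. transition B \<tau>' \<tau>'' i l u * transition B \<tau> \<tau>' l j u)"
  unfolding transition_def[of B \<tau>] using transition_apply[OF lt' lt'' sub frame_in[OF lt j]] .

lemma transition_refl:
  "linear_triv B \<tau> \<Longrightarrow> u \<in> fst \<tau> \<Longrightarrow> j < rk B \<Longrightarrow> transition B \<tau> \<tau> i j u = (if i = j then 1 else 0)"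
  unfolding transition_def by (rule frame_coord)

lemma local_triv_linear: "local_triv A B \<tau> \<Longrightarrow> linear_triv B \<tau>"
  unfolding local_triv_def by blast

context manifold
begin

context
  fixes B :: "('m, 'v::real_vector) vbundle"
  assumes vb: "vector_bundle A B"
begin

lemma fib_subspace: "subspace (fib B u)"
  using vb unfolding vector_bundle_def by blast

lemma triv_exists: "\<exists>\<tau>\<in>trivs B. u \<in> fst \<tau>"
  using vb unfolding vector_bundle_def by blast

lemma trivs_local: "\<tau> \<in> trivs B \<Longrightarrow> local_triv A B \<tau>"
  using vb unfolding vector_bundle_def local_triv_def by blast

text \<open>The definition of a local trivialization compares it only with the members of the given atlas;
around each point one of these serves as an intermediate trivialization.\<close>

lemma transition_smooth:
  assumes l: "local_triv A B \<tau>" "local_triv A B \<tau>'" and ij: "i < rk B" "j < rk B"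
  shows "smooth_fun A (fst \<tau> \<inter> fst \<tau>') (transition B \<tau> \<tau>' i j)"
proof (rule smooth_fun_local)
  fix u assume u: "u \<in> fst \<tau> \<inter> fst \<tau>'"
  obtain \<sigma> where s: "\<sigma> \<in> trivs B" "u \<in> fst \<sigma>" using triv_exists by blast
  note ls = trivs_local[OF s(1)]
  note lin = local_triv_linear[OF l(1)] local_triv_linear[OF l(2)] local_triv_linear[OF ls]
  let ?W = "fst \<tau> \<inter> fst \<tau>' \<inter> fst \<sigma>"
  have W: "open ?W" using lin by (auto intro: linear_triv_open)
  have s1: "smooth_fun A ?W (transition B \<tau> \<sigma> p j)" and s2: "smooth_fun A ?W (transition B \<sigma> \<tau>' i p)" if "p < rk B" for p
  proof -
    have "smooth_fun A (fst \<tau> \<inter> fst \<sigma>) (transition B \<tau> \<sigma> p j)" "smooth_fun A (fst \<sigma> \<inter> fst \<tau>') (transition B \<sigma> \<tau>' i p)"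
      using l s that ij unfolding local_triv_def smoothly_related_def by blast+
    thus "smooth_fun A ?W (transition B \<tau> \<sigma> p j)" "smooth_fun A ?W (transition B \<sigma> \<tau>' i p)"
      by (auto elim!: smooth_fun_subset)
  qed
  have "smooth_fun A ?W (\<lambda>y. \<Sum>p<rk B. transition B \<sigma> \<tau>' i p y * transition B \<tau> \<sigma> p j y)"
    using W s1 s2 by (intro smooth_fun_sum smooth_fun_mult) auto
  hence "smooth_fun A ?W (transition B \<tau> \<tau>' i j)"
    using lin ij by (intro smooth_fun_cong[OF W transition_compose[symmetric]]) (auto simp: fib_subspace)
  thus "\<exists>W'. open W' \<and> u \<in> W' \<and> smooth_fun A W' (transition B \<tau> \<tau>' i j)"
    using W u s by (intro exI[of _ ?W]) auto
qed

lemma section_in: "smooth_section A B W s \<Longrightarrow> u \<in> W \<Longrightarrow> s u \<in> fib B u"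
  unfolding smooth_section_def by blast

lemma section_coord:
  assumes s: "smooth_section A B W s" and W: "open W" and l: "local_triv A B \<tau>" and i: "i < rk B"
  shows "smooth_fun A (fst \<tau> \<inter> W) (\<lambda>u. snd \<tau> u (s u) i)"
proof (rule smooth_fun_local)
  fix u assume u: "u \<in> fst \<tau> \<inter> W"
  obtain \<sigma> where g: "\<sigma> \<in> trivs B" "u \<in> fst \<sigma>" using triv_exists by blast
  note lg = trivs_local[OF g(1)]
  note lin = local_triv_linear[OF l] local_triv_linear[OF lg]
  let ?W = "fst \<tau> \<inter> W \<inter> fst \<sigma>"
  have Wo: "open ?W" using lin W by (auto intro: linear_triv_open)
  have s1: "smooth_fun A ?W (\<lambda>u. snd \<sigma> u (s u) p)" if "p < rk B" for p
  proof -
    have "smooth_fun A (fst \<sigma> \<inter> W) (\<lambda>u. snd \<sigma> u (s u) p)"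
      using s g that unfolding smooth_section_def by (auto simp: case_prod_beta)
    thus ?thesis by (rule smooth_fun_subset) auto
  qed
  have s2: "smooth_fun A ?W (transition B \<sigma> \<tau> i p)" if "p < rk B" for p
    using transition_smooth[OF lg l i that] by (rule smooth_fun_subset) auto
  have "smooth_fun A ?W (\<lambda>y. \<Sum>p<rk B. transition B \<sigma> \<tau> i p y * snd \<sigma> y (s y) p)"
    using Wo s1 s2 by (intro smooth_fun_sum smooth_fun_mult) auto
  hence "smooth_fun A ?W (\<lambda>u. snd \<tau> u (s u) i)"
    using lin section_in[OF s] by (intro smooth_fun_cong[OF Wo transition_apply[symmetric]]) (auto simp: fib_subspace)
  thus "\<exists>W'. open W' \<and> u \<in> W' \<and> smooth_fun A W' (\<lambda>u. snd \<tau> u (s u) i)"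
    using Wo u g by (intro exI[of _ ?W]) auto
qed

lemma sectionI:
  assumes "open W" "\<And>u. u \<in> W \<Longrightarrow> s u \<in> fib B u"
    and "\<And>\<tau> i. local_triv A B \<tau> \<Longrightarrow> i < rk B \<Longrightarrow> smooth_fun A (fst \<tau> \<inter> W) (\<lambda>u. snd \<tau> u (s u) i)"
  shows "smooth_section A B W s"
  unfolding smooth_section_def using assms trivs_local by (auto simp: case_prod_beta)

lemma section_subset: "smooth_section A B W s \<Longrightarrow> W' \<subseteq> W \<Longrightarrow> smooth_section A B W' s"
  unfolding smooth_section_def by (fastforce elim: smooth_fun_subset)

lemma section_local:
  assumes "open W" "\<And>u. u \<in> W \<Longrightarrow> \<exists>W'. open W' \<and> u \<in> W' \<and> smooth_section A B W' s"
  shows "smooth_section A B W s"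
proof (rule sectionI[OF assms(1)])
  show "s u \<in> fib B u" if "u \<in> W" for u using assms(2)[OF that] section_in by blast
  fix \<tau> i assume t: "local_triv A B \<tau>" "i < rk B"
  show "smooth_fun A (fst \<tau> \<inter> W) (\<lambda>u. snd \<tau> u (s u) i)"
  proof (rule smooth_fun_local)
    fix u assume u: "u \<in> fst \<tau> \<inter> W"
    then obtain W' where W': "open W'" "u \<in> W'" "smooth_section A B W' s" using assms(2)[of u] by blast
    have "smooth_fun A (fst \<tau> \<inter> W') (\<lambda>u. snd \<tau> u (s u) i)" by (rule section_coord[OF W'(3,1) t])
    moreover have "open (fst \<tau> \<inter> W')" using W' linear_triv_open[OF local_triv_linear[OF t(1)]] by blast
    ultimately show "\<exists>W'. open W' \<and> u \<in> W' \<and> smooth_fun A W' (\<lambda>u. snd \<tau> u (s u) i)"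
      using u W' by blast
  qed
qed

lemma section_cong:
  assumes "open W" "\<And>u. u \<in> W \<Longrightarrow> s u = t u" "smooth_section A B W s"
  shows "smooth_section A B W t"
proof (rule sectionI[OF assms(1)])
  show "t u \<in> fib B u" if "u \<in> W" for u using section_in[OF assms(3) that] assms(2)[OF that] by simp
  fix \<tau> i assume t: "local_triv A B \<tau>" "i < rk B"
  show "smooth_fun A (fst \<tau> \<inter> W) (\<lambda>u. snd \<tau> u (t u) i)"
    by (rule smooth_fun_cong[OF _ _ section_coord[OF assms(3,1) t]])
      (use assms linear_triv_open[OF local_triv_linear[OF t(1)]] in auto)
qed

lemma section_add_scale:
  assumes W: "open W" and f: "smooth_fun A W f" and s: "smooth_section A B W s" and t: "smooth_section A B W t"
  shows "smooth_section A B W (\<lambda>u. f u *\<^sub>R s u + t u)"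
proof (rule sectionI[OF W])
  show "f u *\<^sub>R s u + t u \<in> fib B u" if "u \<in> W" for u
    using section_in[OF s that] section_in[OF t that] by (intro subspace_add subspace_scale fib_subspace)
  fix \<tau> i assume l: "local_triv A B \<tau>" "i < rk B"
  note lin = local_triv_linear[OF l(1)]
  have o: "open (fst \<tau> \<inter> W)" using W linear_triv_open[OF lin] by blast
  have "smooth_fun A (fst \<tau> \<inter> W) (\<lambda>u. f u * snd \<tau> u (s u) i + snd \<tau> u (t u) i)"
    using smooth_fun_subset[OF f, of "fst \<tau> \<inter> W"]
    by (intro smooth_fun_add smooth_fun_mult section_coord[OF s W l] section_coord[OF t W l] o) auto
  thus "smooth_fun A (fst \<tau> \<inter> W) (\<lambda>u. snd \<tau> u (f u *\<^sub>R s u + t u) i)"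
    by (rule smooth_fun_cong[OF o, rotated]) (simp add: triv_linear[OF lin] section_in[OF s] section_in[OF t])
qed

lemma section_zero: "open W \<Longrightarrow> smooth_section A B W (\<lambda>_. 0)"
proof (rule sectionI)
  assume W: "open W"
  fix \<tau> i assume l: "local_triv A B \<tau>" "i < rk B"
  note lin = local_triv_linear[OF l(1)]
  have o: "open (fst \<tau> \<inter> W)" using W linear_triv_open[OF lin] by blast
  show "smooth_fun A (fst \<tau> \<inter> W) (\<lambda>u. snd \<tau> u 0 i)"
    by (rule smooth_fun_cong[OF o _ smooth_fun_const[OF o, of 0]])
      (use triv_sum[OF lin _ fib_subspace, of _ "{}"] in simp)
qed (auto intro: subspace_0 fib_subspace)

lemma section_scale:
  assumes "open W" "smooth_fun A W f" "smooth_section A B W s"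
  shows "smooth_section A B W (\<lambda>u. f u *\<^sub>R s u)"
  using section_add_scale[OF assms section_zero[OF assms(1)]] by simp

lemma section_sum:
  assumes W: "open W" and "\<And>i. i \<in> I \<Longrightarrow> smooth_fun A W (f i)" "\<And>i. i \<in> I \<Longrightarrow> smooth_section A B W (s i)"
  shows "smooth_section A B W (\<lambda>u. \<Sum>i\<in>I. f i u *\<^sub>R s i u)"
  using assms(2,3)
  by (induction I rule: infinite_finite_induct) (auto intro: section_zero[OF W] section_add_scale[OF W])

lemma section_frame:
  assumes l: "local_triv A B \<tau>" and j: "j < rk B"
  shows "smooth_section A B (fst \<tau>) (\<lambda>u. frame B \<tau> u j)"
proof (rule sectionI[OF linear_triv_open[OF local_triv_linear[OF l]]])
  show "frame B \<tau> u j \<in> fib B u" if "u \<in> fst \<tau>" for u using frame_in[OF local_triv_linear[OF l] that j] .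
  fix \<tau>' i assume t: "local_triv A B \<tau>'" "i < rk B"
  show "smooth_fun A (fst \<tau>' \<inter> fst \<tau>) (\<lambda>u. snd \<tau>' u (frame B \<tau> u j) i)"
    using transition_smooth[OF l t(1) t(2) j] unfolding transition_def by (simp add: Int_commute)
qed

text \<open>Only the values of a trivialization on the fibers matter.\<close>

lemma local_triv_cong:
  assumes l: "local_triv A B \<tau>" and f: "fst \<tau>' = fst \<tau>"
    and e: "\<And>u x. u \<in> fst \<tau> \<Longrightarrow> x \<in> fib B u \<Longrightarrow> snd \<tau>' u x = snd \<tau> u x"
  shows "local_triv A B \<tau>'" and "\<And>u j. u \<in> fst \<tau> \<Longrightarrow> frame B \<tau>' u j = frame B \<tau> u j"
proof -
  show fr: "frame B \<tau>' u j = frame B \<tau> u j" if "u \<in> fst \<tau>" for u j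
    unfolding frame_def inv_into_def using e[OF that] by (metis (no_types, lifting))
  note lin = local_triv_linear[OF l]
  have "linear_triv B \<tau>'"
    unfolding linear_triv_def case_prod_beta f
  proof (intro conjI ballI allI)
    show "open (fst \<tau>)" using lin by (rule linear_triv_open)
    fix u assume u: "u \<in> fst \<tau>"
    show "bij_betw (snd \<tau>' u) (fib B u) {x. \<forall>i\<ge>rk B. x i = 0}"
      using triv_bij[OF lin u] bij_betw_cong[of "fib B u" "snd \<tau>' u" "snd \<tau> u"] e[OF u] by simp
    fix x y a i assume "x \<in> fib B u" "y \<in> fib B u"
    thus "snd \<tau>' u (a *\<^sub>R x + y) i = a * snd \<tau>' u x i + snd \<tau>' u y i"
      using e[OF u] triv_linear[OF lin u] subspace_add[OF fib_subspace subspace_scale[OF fib_subspace]] by simp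
  qed
  moreover have "smoothly_related A B \<tau>' \<sigma> \<and> smoothly_related A B \<sigma> \<tau>'" if s: "\<sigma> \<in> trivs B" for \<sigma>
    unfolding smoothly_related_def f
  proof (intro conjI allI impI)
    note ls = trivs_local[OF s]
    note o = linear_triv_open[OF lin] linear_triv_open[OF local_triv_linear[OF ls]]
    fix i j assume ij: "i < rk B" "j < rk B"
    show "smooth_fun A (fst \<tau> \<inter> fst \<sigma>) (transition B \<tau>' \<sigma> i j)"
      by (rule smooth_fun_cong[OF _ _ transition_smooth[OF l ls ij]]) (use o fr in \<open>auto simp: transition_def\<close>)
    show "smooth_fun A (fst \<sigma> \<inter> fst \<tau>) (transition B \<sigma> \<tau>' i j)"
      by (rule smooth_fun_cong[OF _ _ transition_smooth[OF ls l ij]])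
        (use o e frame_in[OF local_triv_linear[OF ls]] ij in \<open>auto simp: transition_def\<close>)
  qed
  ultimately show "local_triv A B \<tau>'" unfolding local_triv_def by blast
qed

end

end

section \<open>Orthonormal frames\<close>

locale metric_bundle = manifold A
  for A :: "('m::{t2_space,second_countable_topology}, 'e::real_inner) chart set" +
  fixes E :: "('m, 'v::real_vector) vbundle" and g :: "'m \<Rightarrow> 'v \<Rightarrow> 'v \<Rightarrow> real"
  assumes vbE: "vector_bundle A E" and metric: "bundle_metric A E g"
begin

lemmas sub = fib_subspace[OF vbE]

lemma
  assumes "e \<in> fib E u" "e' \<in> fib E u"
  shows g_sym: "g u e e' = g u e' e"
    and g_lin: "e'' \<in> fib E u \<Longrightarrow> g u (a *\<^sub>R e + e') e'' = a * g u e e'' + g u e' e''"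
    and g_pos: "e \<noteq> 0 \<Longrightarrow> g u e e > 0"
  using metric assms unfolding bundle_metric_def by blast+

lemma g_smooth: "open W \<Longrightarrow> smooth_section A E W s \<Longrightarrow> smooth_section A E W t \<Longrightarrow> smooth_fun A W (\<lambda>u. g u (s u) (t u))"
  using metric unfolding bundle_metric_def by blast

lemma g_0: "x \<in> fib E u \<Longrightarrow> g u 0 x = 0"
  using g_lin[of 0 u 0 x "-1"] subspace_0[OF sub] by simp

lemma g_sum:
  assumes "\<And>j. j \<in> I \<Longrightarrow> e j \<in> fib E u" "x \<in> fib E u"
  shows "g u (\<Sum>j\<in>I. a j *\<^sub>R e j) x = (\<Sum>j\<in>I. a j * g u (e j) x)"
  using assms(1)
proof (induction I rule: infinite_finite_induct)
  case (insert j I)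
  have "(\<Sum>j\<in>I. a j *\<^sub>R e j) \<in> fib E u" using insert.prems by (intro subspace_sum subspace_scale sub) auto
  thus ?case using insert g_lin[of "e j" u "\<Sum>j\<in>I. a j *\<^sub>R e j" x] assms(2) by simp
qed (simp_all add: g_0 assms(2))

definition orthonormal :: "'m \<Rightarrow> nat \<Rightarrow> (nat \<Rightarrow> 'v) \<Rightarrow> bool" where
  "orthonormal u p b \<longleftrightarrow> (\<forall>i<p. b i \<in> fib E u \<and> (\<forall>j<p. g u (b i) (b j) = (if i = j then 1 else 0)))"

lemma orthonormal_coeff:
  assumes "orthonormal u p b" "i < p"
  shows "g u (\<Sum>j<p. a j *\<^sub>R b j) (b i) = a i"
proof -
  have "g u (\<Sum>j<p. a j *\<^sub>R b j) (b i) = (\<Sum>j<p. a j * g u (b j) (b i))"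
    using assms by (intro g_sum) (auto simp: orthonormal_def)
  also have "\<dots> = (\<Sum>j<p. if j = i then a j else 0)"
    using assms by (intro sum.cong refl) (auto simp: orthonormal_def)
  finally show ?thesis using assms(2) by simp
qed

lemma orthonormal_independent:
  assumes "orthonormal u p b"
  shows "inj_on b {..<p}" "independent (b ` {..<p})"
proof -
  show inj: "inj_on b {..<p}"
  proof (rule inj_onI)
    fix i j assume ij: "i \<in> {..<p}" "j \<in> {..<p}" "b i = b j"
    have o: "g u (b i) (b k) = (if i = k then 1 else 0)" if "k < p" for k
      using assms ij(1) that by (simp add: orthonormal_def)
    show "i = j"
    proof (rule ccontr)
      assume "i \<noteq> j"
      hence "g u (b i) (b j) = 0" using o[of j] ij(2) by simp
      moreover have "g u (b i) (b i) = 1" using o[of i] ij(1) by simp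
      ultimately show False using ij(3) by simp
    qed
  qed
  show "independent (b ` {..<p})"
  proof (rule independent_if_scalars_zero)
    fix f x assume z: "(\<Sum>x\<in>b ` {..<p}. f x *\<^sub>R x) = 0" and x: "x \<in> b ` {..<p}"
    then obtain i where i: "i < p" "x = b i" by auto
    have "(\<Sum>j<p. f (b j) *\<^sub>R b j) = 0" using z by (simp add: sum.reindex[OF inj])
    hence "f (b i) = g u 0 (b i)" using orthonormal_coeff[OF assms i(1), of "\<lambda>j. f (b j)"] by simp
    thus "f x = 0" using i assms by (simp add: g_0 orthonormal_def)
  qed simp
qed

lemma frame_spans: "linear_triv E \<tau> \<Longrightarrow> u \<in> fst \<tau> \<Longrightarrow> fib E u \<subseteq> span (frame E \<tau> u ` {..<rk E})"
proof
  fix x assume l: "linear_triv E \<tau>" "u \<in> fst \<tau>" and x: "x \<in> fib E u"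
  have "(\<Sum>j<rk E. snd \<tau> u x j *\<^sub>R frame E \<tau> u j) \<in> span (frame E \<tau> u ` {..<rk E})"
    by (intro span_sum span_scale span_base) auto
  thus "x \<in> span (frame E \<tau> u ` {..<rk E})" using triv_expand[OF l sub x] by simp
qed

lemma independent_card_le:
  assumes "independent S" "S \<subseteq> fib E u" shows "finite S \<and> card S \<le> rk E"
proof -
  obtain \<tau> where t: "\<tau> \<in> trivs E" "u \<in> fst \<tau>" using triv_exists[OF vbE] by blast
  note l = local_triv_linear[OF trivs_local[OF vbE t(1)]]
  have "finite S \<and> card S \<le> card (frame E \<tau> u ` {..<rk E})"
    using frame_spans[OF l t(2)] assms by (intro independent_span_bound) auto
  moreover have "card (frame E \<tau> u ` {..<rk E}) \<le> rk E" using card_image_le[of "{..<rk E}" "frame E \<tau> u"] by simp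
  ultimately show ?thesis by linarith
qed

lemma orthonormal_le: "orthonormal u p b \<Longrightarrow> p \<le> rk E"
proof -
  assume o: "orthonormal u p b"
  have "b ` {..<p} \<subseteq> fib E u" using o by (auto simp: orthonormal_def)
  from independent_card_le[OF orthonormal_independent(2)[OF o] this] show ?thesis
    using card_image[OF orthonormal_independent(1)[OF o]] by simp
qed

lemma orthonormal_expand:
  assumes o: "orthonormal u (rk E) b" and x: "x \<in> fib E u"
  shows "x = (\<Sum>i<rk E. g u x (b i) *\<^sub>R b i)"
proof -
  let ?S = "b ` {..<rk E}"
  note inj = orthonormal_independent(1)[OF o]
  have sub': "?S \<subseteq> fib E u" using o by (auto simp: orthonormal_def)
  have "x \<in> span ?S"
  proof (rule ccontr)
    assume n: "x \<notin> span ?S"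
    hence "independent (insert x ?S)" using orthonormal_independent(2)[OF o] by (rule independent_insertI)
    hence "card (insert x ?S) \<le> rk E" using independent_card_le[of "insert x ?S" u] sub' x by blast
    moreover have "x \<notin> ?S" using n span_base[of x ?S] by argo
    ultimately show False using card_image[OF inj] by simp
  qed
  hence "x \<in> range (\<lambda>f. \<Sum>v\<in>?S. f v *\<^sub>R v)" using span_finite[of ?S] by simp
  then obtain f where "x = (\<Sum>v\<in>?S. f v *\<^sub>R v)" by (rule rangeE)
  hence f: "x = (\<Sum>j<rk E. f (b j) *\<^sub>R b j)" by (simp add: sum.reindex[OF inj])
  have "g u x (b i) = f (b i)" if "i < rk E" for i
    unfolding f by (rule orthonormal_coeff[OF o that])
  hence "(\<Sum>i<rk E. g u x (b i) *\<^sub>R b i) = (\<Sum>j<rk E. f (b j) *\<^sub>R b j)" by (intro sum.cong) auto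
  thus ?thesis using f by simp
qed

text \<open>Frames are indexed by all natural numbers; the members from \<open>p\<close> on are arbitrary.\<close>

definition orthoframe :: "'m set \<Rightarrow> nat \<Rightarrow> (nat \<Rightarrow> 'm \<Rightarrow> 'v) \<Rightarrow> bool" where
  "orthoframe W p b \<longleftrightarrow> open W \<and> (\<forall>i<p. smooth_section A E W (b i)) \<and> (\<forall>u\<in>W. orthonormal u p (\<lambda>i. b i u))"

lemma orthoframe_subset: "orthoframe W p b \<Longrightarrow> open W' \<Longrightarrow> W' \<subseteq> W \<Longrightarrow> orthoframe W' p b"
  unfolding orthoframe_def using section_subset[OF vbE] by blast

text \<open>One step of Gram-Schmidt: some member of a local frame is at \<open>u\<close> independent of the given fields,
and after orthogonalization it remains nonzero near \<open>u\<close>, where it can be normalized smoothly.\<close>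

lemma orthoframe_extend1:
  assumes ofr: "orthoframe W p b" and u: "u \<in> W" and p: "p < rk E"
  shows "\<exists>W' h. W' \<subseteq> W \<and> u \<in> W' \<and> orthoframe W' (Suc p) (b(p := h))"
proof -
  have W: "open W" and bs: "\<And>i. i < p \<Longrightarrow> smooth_section A E W (b i)"
    and on: "\<And>y. y \<in> W \<Longrightarrow> orthonormal y p (\<lambda>i. b i y)"
    using ofr unfolding orthoframe_def by blast+
  obtain \<tau> where t: "\<tau> \<in> trivs E" "u \<in> fst \<tau>" using triv_exists[OF vbE] by blast
  note lt = trivs_local[OF vbE t(1)]
  note l = local_triv_linear[OF lt]
  let ?S = "(\<lambda>i. b i u) ` {..<p}" and ?f = "\<lambda>j y. frame E \<tau> y j"
  \<comment> \<open>The frame consists of \<open>rk E\<close> independent vectors and cannot lie in the span of \<open>p\<close> vectors.\<close>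
  have "\<exists>j<rk E. ?f j u \<notin> span ?S"
  proof (rule ccontr)
    assume "\<not> (\<exists>j<rk E. ?f j u \<notin> span ?S)"
    hence c: "?f j u \<in> span ?S" if "j < rk E" for j using that by blast
    have inj: "inj_on (frame E \<tau> u) {..<rk E}"
    proof (rule inj_onI)
      fix i j assume ij: "i \<in> {..<rk E}" "j \<in> {..<rk E}" "frame E \<tau> u i = frame E \<tau> u j"
      show "i = j"
      proof (rule ccontr)
        assume ne: "i \<noteq> j"
        have "snd \<tau> u (frame E \<tau> u i) i = 1" using frame_coord[OF l t(2), of i i] ij(1) by simp
        moreover have "snd \<tau> u (frame E \<tau> u j) i = 0" using frame_coord[OF l t(2), of j i] ij(2) ne by simp
        ultimately show False using ij(3) by simp
      qed
    qed
    have "independent (frame E \<tau> u ` {..<rk E})"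
    proof (rule independent_if_scalars_zero)
      fix f x assume z: "(\<Sum>x\<in>frame E \<tau> u ` {..<rk E}. f x *\<^sub>R x) = 0" and "x \<in> frame E \<tau> u ` {..<rk E}"
      then obtain i where i: "i < rk E" "x = frame E \<tau> u i" by auto
      have "0 = snd \<tau> u (\<Sum>j<rk E. f (frame E \<tau> u j) *\<^sub>R frame E \<tau> u j) i"
        using z triv_sum[OF l t(2) sub, of "{}"] by (simp add: sum.reindex[OF inj])
      also have "\<dots> = (\<Sum>j<rk E. f (frame E \<tau> u j) * snd \<tau> u (frame E \<tau> u j) i)"
        using frame_in[OF l t(2)] by (intro triv_sum[OF l t(2) sub]) auto
      also have "\<dots> = (\<Sum>j<rk E. if j = i then f (frame E \<tau> u j) else 0)"
        using frame_coord[OF l t(2)] by (intro sum.cong refl) auto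
      finally show "f x = 0" using i by simp
    qed simp
    from independent_span_bound[OF _ this, of ?S] c
    have "card (frame E \<tau> u ` {..<rk E}) \<le> card ?S" by auto
    also have "\<dots> \<le> p" using card_image_le[of "{..<p}" "\<lambda>i. b i u"] by simp
    finally show False using card_image[OF inj] p by simp
  qed
  then obtain j where j: "j < rk E" "?f j u \<notin> span ?S" by blast
  let ?W = "W \<inter> fst \<tau>"
  have Wo: "open ?W" using W linear_triv_open[OF l] by blast
  have fs: "smooth_section A E ?W (?f j)" using section_frame[OF vbE lt j(1)] by (rule section_subset[OF vbE]) auto
  have bs': "smooth_section A E ?W (b i)" if "i < p" for i using bs[OF that] by (rule section_subset[OF vbE]) auto
  define c where "c = (\<lambda>i y. - g y (?f j y) (b i y))"
  have cs: "smooth_fun A ?W (c i)" if "i < p" for i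
    unfolding c_def using Wo fs bs'[OF that] by (intro smooth_fun_uminus g_smooth)
  \<comment> \<open>The component of the frame vector orthogonal to the given fields.\<close>
  define h0 where "h0 = (\<lambda>y. 1 *\<^sub>R ?f j y + (\<Sum>i<p. c i y *\<^sub>R b i y))"
  have h0s: "smooth_section A E ?W h0"
    unfolding h0_def using Wo fs bs' cs
    by (intro section_add_scale[OF vbE] section_sum[OF vbE] smooth_fun_const) auto
  have h0o: "g y (h0 y) (b i y) = 0" if y: "y \<in> ?W" and i: "i < p" for y i
  proof -
    have fy: "?f j y \<in> fib E y" using section_in[OF vbE fs y] .
    have by': "b i y \<in> fib E y" if "i < p" for i using section_in[OF vbE bs'[OF that] y] .
    have sy: "(\<Sum>i<p. c i y *\<^sub>R b i y) \<in> fib E y" using by' by (intro subspace_sum subspace_scale sub) auto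
    have "g y (h0 y) (b i y) = 1 * g y (?f j y) (b i y) + g y (\<Sum>i<p. c i y *\<^sub>R b i y) (b i y)"
      unfolding h0_def by (rule g_lin[OF fy sy by'[OF i]])
    also have "g y (\<Sum>i<p. c i y *\<^sub>R b i y) (b i y) = c i y"
      using orthonormal_coeff[OF on i, of y "\<lambda>i. c i y"] y by simp
    finally show ?thesis by (simp add: c_def)
  qed
  have uW: "u \<in> ?W" using u t by simp
  have "h0 u \<noteq> 0"
  proof
    assume "h0 u = 0"
    hence "?f j u = - (\<Sum>i<p. c i u *\<^sub>R b i u)" unfolding h0_def by (simp add: eq_neg_iff_add_eq_0)
    moreover have "- (\<Sum>i<p. c i u *\<^sub>R b i u) \<in> span ?S" by (intro span_neg span_sum span_scale span_base) auto
    ultimately show False using j by simp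
  qed
  hence "g u (h0 u) (h0 u) > 0" using section_in[OF vbE h0s uW] by (intro g_pos)
  then obtain W' where W': "open W'" "u \<in> W'" "W' \<subseteq> ?W" "\<And>y. y \<in> W' \<Longrightarrow> g y (h0 y) (h0 y) > 0"
    using smooth_fun_pos_nbhd[OF Wo g_smooth[OF Wo h0s h0s] uW] by blast
  define r where "r = (\<lambda>y. inverse (sqrt (g y (h0 y) (h0 y))))"
  have h0s': "smooth_section A E W' h0" using h0s W'(3) by (rule section_subset[OF vbE])
  have rs: "smooth_fun A W' r"
    unfolding r_def
  proof (rule smooth_fun_inverse[OF W'(1)])
    show "sqrt (g y (h0 y) (h0 y)) \<noteq> 0" if "y \<in> W'" for y using W'(4)[OF that] by simp
    show "smooth_fun A W' (\<lambda>y. sqrt (g y (h0 y) (h0 y)))"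
      using W'(1,4) g_smooth[OF W'(1) h0s' h0s'] by (rule smooth_fun_sqrt)
  qed
  define h where "h = (\<lambda>y. r y *\<^sub>R h0 y)"
  have hs: "smooth_section A E W' h" unfolding h_def by (rule section_scale[OF vbE W'(1) rs h0s'])
  have sc: "g y (h y) x = r y * g y (h0 y) x" if "y \<in> W'" "x \<in> fib E y" for y x
    using g_lin[of "h0 y" y 0 x "r y"] section_in[OF vbE h0s' that(1)] that(2) subspace_0[OF sub] g_0 unfolding h_def by simp
  have "orthonormal y (Suc p) (\<lambda>i. (b(p := h)) i y)" if y: "y \<in> W'" for y
  proof -
    have yW: "y \<in> ?W" "y \<in> W" using y W' by auto
    have hy: "h y \<in> fib E y" "h0 y \<in> fib E y" using section_in[OF vbE hs y] section_in[OF vbE h0s' y] by auto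
    have by': "b i y \<in> fib E y" if "i < p" for i using section_in[OF vbE bs'[OF that] yW(1)] .
    have hb: "g y (h y) (b i y) = 0" if "i < p" for i using sc[OF y by'[OF that]] h0o[OF yW(1) that] by simp
    have hb': "g y (b i y) (h y) = 0" if "i < p" for i using g_sym[OF hy(1) by'[OF that]] hb[OF that] by simp
    have "g y (h y) (h y) = r y * (r y * g y (h0 y) (h0 y))"
      using sc[OF y hy(1)] sc[OF y hy(2)] g_sym[OF hy(2) hy(1)] by simp
    also have "\<dots> = 1"
    proof -
      have q: "g y (h0 y) (h0 y) > 0" using W'(4)[OF y] .
      hence "sqrt (g y (h0 y) (h0 y)) * sqrt (g y (h0 y) (h0 y)) = g y (h0 y) (h0 y)" by simp
      thus ?thesis unfolding r_def using q by (simp add: field_simps)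
    qed
    finally have hh: "g y (h y) (h y) = 1" .
    show ?thesis unfolding orthonormal_def
    proof (intro allI impI conjI)
      fix i assume i: "i < Suc p"
      show "(b(p := h)) i y \<in> fib E y" using i hy by' by (auto simp: less_Suc_eq)
      fix k assume k: "k < Suc p"
      show "g y ((b(p := h)) i y) ((b(p := h)) k y) = (if i = k then 1 else 0)"
        using i k hb hb' hh on[OF yW(2)] by (auto simp: less_Suc_eq orthonormal_def)
    qed
  qed
  moreover have "smooth_section A E W' ((b(p := h)) i)" if "i < Suc p" for i
    using that hs section_subset[OF vbE bs', of i W'] W'(3) by (auto simp: less_Suc_eq)
  ultimately have "orthoframe W' (Suc p) (b(p := h))" unfolding orthoframe_def using W' by blast
  thus ?thesis using W' by blast
qed

lemma orthoframe_extend: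
  assumes "orthoframe W p b" "u \<in> W"
  shows "\<exists>W' b'. W' \<subseteq> W \<and> u \<in> W' \<and> orthoframe W' (rk E) b' \<and> (\<forall>i<p. b' i = b i)"
proof -
  have "p + q \<le> rk E \<Longrightarrow> \<exists>W' b'. W' \<subseteq> W \<and> u \<in> W' \<and> orthoframe W' (p + q) b' \<and> (\<forall>i<p. b' i = b i)" for q
  proof (induction q)
    case 0
    show ?case using assms by (intro exI[of _ W] exI[of _ b]) auto
  next
    case (Suc q)
    then obtain W' b' where 1: "W' \<subseteq> W" "u \<in> W'" "orthoframe W' (p + q) b'" "\<forall>i<p. b' i = b i" by auto
    have "p + q < rk E" using Suc.prems by simp
    from orthoframe_extend1[OF 1(3,2) this] obtain W'' h where 2: "W'' \<subseteq> W'" "u \<in> W''" "orthoframe W'' (Suc (p + q)) (b'(p + q := h))"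
      by blast
    have "\<forall>i<p. (b'(p + q := h)) i = b i" using 1(4) by simp
    moreover have "W'' \<subseteq> W" using 1(1) 2(1) by (rule order_trans[rotated])
    moreover have "orthoframe W'' (p + Suc q) (b'(p + q := h))" using 2(3) by (simp only: add_Suc_right)
    ultimately show ?case using 2(2) by blast
  qed
  note ex = this
  have "orthonormal u p (\<lambda>i. b i u)" using assms unfolding orthoframe_def by simp
  hence "p \<le> rk E" by (rule orthonormal_le)
  hence "p + (rk E - p) = rk E" by simp
  with ex[of "rk E - p"] show ?thesis by simp
qed

lemma orthoframe_0: "open W \<Longrightarrow> orthoframe W 0 b"
  by (simp add: orthoframe_def orthonormal_def)

text \<open>The coordinates with respect to an orthonormal frame are inner products with its members.\<close>

definition frame_triv :: "'m set \<Rightarrow> (nat \<Rightarrow> 'm \<Rightarrow> 'v) \<Rightarrow> ('m, 'v) triv" where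
  "frame_triv W b = (W, \<lambda>u x i. if i < rk E then g u x (b i u) else 0)"

lemma frame_triv:
  assumes ofr: "orthoframe W (rk E) b"
  shows "local_triv A E (frame_triv W b)" "orthonormal_triv E g (frame_triv W b)"
    "\<And>u j. u \<in> W \<Longrightarrow> j < rk E \<Longrightarrow> frame E (frame_triv W b) u j = b j u"
proof -
  let ?t = "frame_triv W b"
  have W: "open W" and bs: "\<And>i. i < rk E \<Longrightarrow> smooth_section A E W (b i)"
    and on: "\<And>y. y \<in> W \<Longrightarrow> orthonormal y (rk E) (\<lambda>i. b i y)"
    using ofr unfolding orthoframe_def by blast+
  have fst: "fst ?t = W" and snd: "\<And>u x i. snd ?t u x i = (if i < rk E then g u x (b i u) else 0)"
    by (simp_all add: frame_triv_def)
  have bin: "b i u \<in> fib E u" if "u \<in> W" "i < rk E" for u i using on[OF that(1)] that(2) by (simp add: orthonormal_def)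
  have lin: "linear_triv E ?t"
    unfolding linear_triv_def case_prod_beta fst
  proof (intro conjI ballI allI W)
    fix u assume u: "u \<in> W"
    have inj: "x = y" if "x \<in> fib E u" "y \<in> fib E u" "snd ?t u x = snd ?t u y" for x y
    proof -
      have "g u x (b i u) = g u y (b i u)" if "i < rk E" for i
        using fun_cong[OF \<open>snd ?t u x = snd ?t u y\<close>, of i] that by (simp add: snd)
      hence "(\<Sum>i<rk E. g u x (b i u) *\<^sub>R b i u) = (\<Sum>i<rk E. g u y (b i u) *\<^sub>R b i u)" by (intro sum.cong) auto
      thus ?thesis using orthonormal_expand[OF on[OF u] that(1)] orthonormal_expand[OF on[OF u] that(2)] by (simp only:)
    qed
    have surj: "\<exists>x\<in>fib E u. snd ?t u x = z" if z: "\<forall>i\<ge>rk E. z i = 0" for z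
    proof (rule bexI[of _ "\<Sum>j<rk E. z j *\<^sub>R b j u"])
      show "(\<Sum>j<rk E. z j *\<^sub>R b j u) \<in> fib E u" using bin[OF u] by (intro subspace_sum subspace_scale sub) auto
      show "snd ?t u (\<Sum>j<rk E. z j *\<^sub>R b j u) = z"
        using orthonormal_coeff[OF on[OF u], of _ z] z by (auto simp: snd fun_eq_iff not_less)
    qed
    show "bij_betw (snd ?t u) (fib E u) {x. \<forall>i\<ge>rk E. x i = 0}"
      unfolding bij_betw_def
    proof
      show "inj_on (snd ?t u) (fib E u)" using inj by (intro inj_onI)
      show "snd ?t u ` fib E u = {x. \<forall>i\<ge>rk E. x i = 0}"
      proof
        show "snd ?t u ` fib E u \<subseteq> {x. \<forall>i\<ge>rk E. x i = 0}" by (auto simp: snd)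
        show "{x. \<forall>i\<ge>rk E. x i = 0} \<subseteq> snd ?t u ` fib E u"
        proof
          fix z :: "nat \<Rightarrow> real" assume "z \<in> {x. \<forall>i\<ge>rk E. x i = 0}"
          then obtain x where "x \<in> fib E u" "snd ?t u x = z" using surj[of z] by blast
          thus "z \<in> snd ?t u ` fib E u" by blast
        qed
      qed
    qed
    fix x y a i assume "x \<in> fib E u" "y \<in> fib E u"
    thus "snd ?t u (a *\<^sub>R x + y) i = a * snd ?t u x i + snd ?t u y i"
      using bin[OF u, of i] by (simp add: snd g_lin)
  qed
  show fr: "frame E ?t u j = b j u" if u: "u \<in> W" and j: "j < rk E" for u j
  proof (rule triv_inj[OF lin])
    show "u \<in> fst ?t" using u fst by simp
    show "frame E ?t u j \<in> fib E u" using frame_in[OF lin, of u j] u j fst by simp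
    show "b j u \<in> fib E u" using bin[OF u j] .
    fix i assume i: "i < rk E"
    have "snd ?t u (frame E ?t u j) i = (if i = j then 1 else 0)" using frame_coord[OF lin, of u j] u j fst by simp
    also have "\<dots> = g u (b j u) (b i u)" using on[OF u] i j by (auto simp: orthonormal_def)
    finally show "snd ?t u (frame E ?t u j) i = snd ?t u (b j u) i" using i by (simp add: snd)
  qed
  have "smoothly_related A E ?t \<sigma> \<and> smoothly_related A E \<sigma> ?t" if s: "\<sigma> \<in> trivs E" for \<sigma>
    unfolding smoothly_related_def fst
  proof (intro conjI allI impI)
    note ls = trivs_local[OF vbE s]
    note o = linear_triv_open[OF local_triv_linear[OF ls]]
    fix i j assume ij: "i < rk E" "j < rk E"
    show "smooth_fun A (W \<inter> fst \<sigma>) (transition E ?t \<sigma> i j)"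
      by (rule smooth_fun_cong[OF _ _ smooth_fun_subset[OF section_coord[OF vbE bs[OF ij(2)] W ls ij(1)]]])
        (use W o fr ij in \<open>auto simp: transition_def\<close>)
    have "smooth_fun A (fst \<sigma> \<inter> W) (\<lambda>u. g u (frame E \<sigma> u j) (b i u))"
      using W o section_subset[OF vbE section_frame[OF vbE ls ij(2)], of "fst \<sigma> \<inter> W"]
        section_subset[OF vbE bs[OF ij(1)], of "fst \<sigma> \<inter> W"] by (intro g_smooth) auto
    thus "smooth_fun A (fst \<sigma> \<inter> W) (transition E \<sigma> ?t i j)"
      by (rule smooth_fun_cong[rotated 2]) (use W o ij in \<open>auto simp: transition_def snd\<close>)
  qed
  thus loc: "local_triv A E ?t" unfolding local_triv_def using lin by blast
  show "orthonormal_triv E g ?t"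
    unfolding orthonormal_triv_def fst
  proof (intro ballI)
    fix u x assume u: "u \<in> W" and x: "x \<in> fib E u"
    have "g u x x = g u (\<Sum>i<rk E. g u x (b i u) *\<^sub>R b i u) x" using orthonormal_expand[OF on[OF u] x] by simp
    also have "\<dots> = (\<Sum>i<rk E. g u x (b i u) * g u (b i u) x)" using bin[OF u] x by (intro g_sum) auto
    also have "\<dots> = (\<Sum>i<rk E. (snd ?t u x i)\<^sup>2)"
      using g_sym[OF x bin[OF u]] by (intro sum.cong refl) (simp add: snd power2_eq_square)
    finally show "g u x x = (\<Sum>i<rk E. (snd ?t u x i)\<^sup>2)" .
  qed
qed

lemma orthonormal_triv_inner:
  assumes o: "orthonormal_triv E g \<tau>" and l: "linear_triv E \<tau>" and u: "u \<in> fst \<tau>" and x: "x \<in> fib E u" and y: "y \<in> fib E u"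
  shows "g u x y = (\<Sum>i<rk E. snd \<tau> u x i * snd \<tau> u y i)"
proof -
  have q: "g u z z = (\<Sum>i<rk E. (snd \<tau> u z i)\<^sup>2)" if "z \<in> fib E u" for z
    using o u that unfolding orthonormal_triv_def by blast
  have xy: "x + y \<in> fib E u" using x y by (rule subspace_add[OF sub])
  have "g u (x + y) (x + y) = g u x x + 2 * g u x y + g u y y"
    using g_lin[OF x y xy, of 1] g_lin[OF x y x, of 1] g_lin[OF x y y, of 1] g_sym[OF x xy] g_sym[OF y xy] g_sym[OF x y] by simp
  moreover have "g u (x + y) (x + y) = (\<Sum>i<rk E. (snd \<tau> u x i)\<^sup>2 + 2 * (snd \<tau> u x i * snd \<tau> u y i) + (snd \<tau> u y i)\<^sup>2)"
    unfolding q[OF xy] using triv_linear[OF l u x y, of 1]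
    by (intro sum.cong refl) (simp add: power2_eq_square algebra_simps)
  ultimately show ?thesis unfolding q[OF x] q[OF y] by (simp add: sum.distrib sum_distrib_left[symmetric])
qed

lemma orthonormal_triv_frame:
  assumes o: "orthonormal_triv E g \<tau>" and l: "local_triv A E \<tau>"
  shows "orthoframe (fst \<tau>) (rk E) (\<lambda>i u. frame E \<tau> u i)"
    and "\<And>u x i. u \<in> fst \<tau> \<Longrightarrow> x \<in> fib E u \<Longrightarrow> i < rk E \<Longrightarrow> snd \<tau> u x i = g u x (frame E \<tau> u i)"
proof -
  note lin = local_triv_linear[OF l]
  have c: "g u x (frame E \<tau> u i) = snd \<tau> u x i" if u: "u \<in> fst \<tau>" and x: "x \<in> fib E u" and i: "i < rk E" for u x i
  proof -
    have "g u x (frame E \<tau> u i) = (\<Sum>j<rk E. snd \<tau> u x j * snd \<tau> u (frame E \<tau> u i) j)"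
      by (rule orthonormal_triv_inner[OF o lin u x frame_in[OF lin u i]])
    also have "\<dots> = (\<Sum>j<rk E. if j = i then snd \<tau> u x j else 0)"
      using frame_coord[OF lin u i] by (intro sum.cong refl) auto
    finally show ?thesis using i by simp
  qed
  thus "snd \<tau> u x i = g u x (frame E \<tau> u i)" if "u \<in> fst \<tau>" "x \<in> fib E u" "i < rk E" for u x i using that by simp
  show "orthoframe (fst \<tau>) (rk E) (\<lambda>i u. frame E \<tau> u i)"
    unfolding orthoframe_def orthonormal_def
    using linear_triv_open[OF lin] section_frame[OF vbE l] frame_in[OF lin] c frame_coord[OF lin] by auto
qed

end

section \<open>Products of square matrices\<close>

text \<open>Matrices are functions here, because their entries are values of functions and forms at varying
points and vectors.\<close>

definition mm :: "nat \<Rightarrow> (nat \<Rightarrow> nat \<Rightarrow> real) \<Rightarrow> (nat \<Rightarrow> nat \<Rightarrow> real) \<Rightarrow> nat \<Rightarrow> nat \<Rightarrow> real" where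
  "mm n X Y i j = (\<Sum>l<n. X i l * Y l j)"

lemma mm_assoc: "mm n (mm n X Y) Z i j = mm n X (mm n Y Z) i j"
proof -
  have "mm n (mm n X Y) Z i j = (\<Sum>l<n. \<Sum>p<n. X i p * Y p l * Z l j)"
    unfolding mm_def sum_distrib_right ..
  also have "\<dots> = (\<Sum>p<n. \<Sum>l<n. X i p * Y p l * Z l j)" by (rule sum.swap)
  also have "\<dots> = mm n X (mm n Y Z) i j"
    unfolding mm_def sum_distrib_left mult.assoc ..
  finally show ?thesis .
qed

lemma mm_add_left: "mm n (\<lambda>i j. X i j + Y i j) Z i j = mm n X Z i j + mm n Y Z i j"
  and mm_add_right: "mm n Z (\<lambda>i j. X i j + Y i j) i j = mm n Z X i j + mm n Z Y i j"
  and mm_diff_left: "mm n (\<lambda>i j. X i j - Y i j) Z i j = mm n X Z i j - mm n Y Z i j"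
  and mm_diff_right: "mm n Z (\<lambda>i j. X i j - Y i j) i j = mm n Z X i j - mm n Z Y i j"
  by (simp_all add: mm_def distrib_left distrib_right left_diff_distrib right_diff_distrib sum.distrib sum_subtractf)

lemma mm_cong: "(\<And>l. l < n \<Longrightarrow> X i l = X' i l) \<Longrightarrow> (\<And>l. l < n \<Longrightarrow> Y l j = Y' l j) \<Longrightarrow> mm n X Y i j = mm n X' Y' i j"
  unfolding mm_def by (intro sum.cong) auto

section \<open>Lifting tangent vectors to the total space\<close>

context manifold
begin

context
  fixes B :: "('m, 'v::real_vector) vbundle"
  assumes vb: "vector_bundle A B"
begin

lemma total_tangent_iff:
  "t \<in> total_tangent A B u e \<longleftrightarrow> fst t \<in> tangent_space A u \<and>
     (\<forall>\<tau> \<tau>'. local_triv A B \<tau> \<and> u \<in> fst \<tau> \<and> local_triv A B \<tau>' \<and> u \<in> fst \<tau>' \<longrightarrow>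
        (\<forall>i<rk B. snd t \<tau>' i =
           (\<Sum>j<rk B. fst t (transition B \<tau> \<tau>' i j) * snd \<tau> u e j + transition B \<tau> \<tau>' i j u * snd t \<tau> j))) \<and>
     (\<forall>\<tau> i. \<not> (local_triv A B \<tau> \<and> u \<in> fst \<tau> \<and> i < rk B) \<longrightarrow> snd t \<tau> i = 0)"
  unfolding total_tangent_def case_prod_beta by (rule mem_Collect_eq)

lemma transition_near:
  assumes "local_triv A B \<tau>" "local_triv A B \<tau>'" "u \<in> fst \<tau>" "u \<in> fst \<tau>'" "i < rk B" "j < rk B"
  shows "smooth_near u (transition B \<tau> \<tau>' i j)"
  using transition_smooth[OF vb assms(1,2,5,6)] assms linear_triv_open[OF local_triv_linear[OF assms(1)]]
    linear_triv_open[OF local_triv_linear[OF assms(2)]]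
  by (intro smooth_nearI[of "fst \<tau> \<inter> fst \<tau>'"]) auto

lemma tangent_transition_compose:
  assumes l: "local_triv A B \<tau>" "local_triv A B \<tau>'" "local_triv A B \<tau>''" "u \<in> fst \<tau>" "u \<in> fst \<tau>'" "u \<in> fst \<tau>''"
    and ij: "i < rk B" "j < rk B" and v: "v \<in> tangent_space A u"
  shows "v (transition B \<tau> \<tau>'' i j) = (\<Sum>l<rk B. v (transition B \<tau>' \<tau>'' i l) * transition B \<tau> \<tau>' l j u
     + transition B \<tau>' \<tau>'' i l u * v (transition B \<tau> \<tau>' l j))"
proof -
  note lin = local_triv_linear[OF l(1)] local_triv_linear[OF l(2)] local_triv_linear[OF l(3)]
  let ?W = "fst \<tau> \<inter> fst \<tau>' \<inter> fst \<tau>''"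
  have "v (transition B \<tau> \<tau>'' i j) = v (\<lambda>y. \<Sum>l<rk B. transition B \<tau>' \<tau>'' i l y * transition B \<tau> \<tau>' l j y)"
  proof (rule tangent_cong[OF v])
    show "open ?W" using lin by (auto intro: linear_triv_open)
    show "u \<in> ?W" using l by simp
    fix y assume y: "y \<in> ?W"
    show "transition B \<tau> \<tau>'' i j y = (\<Sum>l<rk B. transition B \<tau>' \<tau>'' i l y * transition B \<tau> \<tau>' l j y)"
      using y by (intro transition_compose lin fib_subspace[OF vb] ij) auto
  qed
  also have "\<dots> = (\<Sum>l<rk B. v (\<lambda>y. transition B \<tau>' \<tau>'' i l y * transition B \<tau> \<tau>' l j y))"
    using l ij by (intro tangent_sum[OF v] smooth_near_mult transition_near) auto
  also have "\<dots> = (\<Sum>l<rk B. v (transition B \<tau>' \<tau>'' i l) * transition B \<tau> \<tau>' l j u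
     + transition B \<tau>' \<tau>'' i l u * v (transition B \<tau> \<tau>' l j))"
    using l ij by (intro sum.cong refl tangent_mult[OF v] transition_near) auto
  finally show ?thesis .
qed

text \<open>The fiber components in the trivialization \<open>\<tau>\<close> determine those in all others by the law for \<open>dx'\<close>. The
components so obtained are consistent because, by the product rule, this law is compatible with the
composition of transition functions.\<close>

lemma tangent_vec:
  assumes l: "local_triv A B \<tau>" "u \<in> fst \<tau>" and e: "e \<in> fib B u" and v: "v \<in> tangent_space A u"
  shows "tangent_vec A B u e \<tau> v x \<in> total_tangent A B u e" "fst (tangent_vec A B u e \<tau> v x) = v"
    "\<And>i. i < rk B \<Longrightarrow> snd (tangent_vec A B u e \<tau> v x) \<tau> i = x i"
proof -
  let ?n = "rk B" and ?T = "transition B \<tau>"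
  let ?P = "\<lambda>t. t \<in> total_tangent A B u e \<and> fst t = v \<and> (\<forall>i<?n. snd t \<tau> i = x i)"
  \<comment> \<open>The components in all trivializations, computed from those in \<open>\<tau>\<close>.\<close>
  define \<xi> where "\<xi> = (\<lambda>\<sigma> i. if local_triv A B \<sigma> \<and> u \<in> fst \<sigma> \<and> i < ?n then
     \<Sum>j<?n. v (?T \<sigma> i j) * snd \<tau> u e j + ?T \<sigma> i j u * x j else 0)"
  note lin = local_triv_linear[OF l(1)]
  have coc: "\<xi> \<rho> i = (\<Sum>j<?n. v (transition B \<sigma> \<rho> i j) * snd \<sigma> u e j + transition B \<sigma> \<rho> i j u * \<xi> \<sigma> j)"
    if s: "local_triv A B \<sigma>" "u \<in> fst \<sigma>" and r: "local_triv A B \<rho>" "u \<in> fst \<rho>" and i: "i < ?n" for \<sigma> \<rho> i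
  proof -
    let ?R = "transition B \<sigma> \<rho>" and ?Q = "?T \<sigma>"
    note ls = local_triv_linear[OF s(1)] and lr = local_triv_linear[OF r(1)]
    have T: "?T \<rho> i j u = (\<Sum>l<?n. ?R i l u * ?Q l j u)" if "j < ?n" for j
      using that by (intro transition_compose[OF lin l(2) ls s(2) lr r(2)] fib_subspace[OF vb])
    have vT: "v (?T \<rho> i j) = (\<Sum>l<?n. v (?R i l) * ?Q l j u + ?R i l u * v (?Q l j))" if "j < ?n" for j
      using tangent_transition_compose[OF l(1) s(1) r(1) l(2) s(2) r(2) i that v] .
    have se: "snd \<sigma> u e j = (\<Sum>l<?n. ?Q j l u * snd \<tau> u e l)" for j
      by (rule transition_apply[OF lin l(2) ls s(2) fib_subspace[OF vb] e])
    have "\<xi> \<rho> i = (\<Sum>j<?n. (\<Sum>l<?n. v (?R i l) * ?Q l j u + ?R i l u * v (?Q l j)) * snd \<tau> u e j + (\<Sum>l<?n. ?R i l u * ?Q l j u) * x j)"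
      unfolding \<xi>_def using r i T vT by simp
    also have "\<dots> = (\<Sum>j<?n. \<Sum>l<?n. v (?R i l) * (?Q l j u * snd \<tau> u e j) + ?R i l u * (v (?Q l j) * snd \<tau> u e j + ?Q l j u * x j))"
      unfolding sum_distrib_right sum.distrib[symmetric] by (intro sum.cong refl) (simp add: algebra_simps)
    also have "\<dots> = (\<Sum>l<?n. \<Sum>j<?n. v (?R i l) * (?Q l j u * snd \<tau> u e j) + ?R i l u * (v (?Q l j) * snd \<tau> u e j + ?Q l j u * x j))"
      by (rule sum.swap)
    also have "\<dots> = (\<Sum>l<?n. v (?R i l) * snd \<sigma> u e l + ?R i l u * \<xi> \<sigma> l)"
    proof (rule sum.cong[OF refl])
      fix k assume "k \<in> {..<?n}"
      hence q: "\<xi> \<sigma> k = (\<Sum>j<?n. v (?Q k j) * snd \<tau> u e j + ?Q k j u * x j)" unfolding \<xi>_def using s by simp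
      have "(\<Sum>j<?n. v (?R i k) * (?Q k j u * snd \<tau> u e j) + ?R i k u * (v (?Q k j) * snd \<tau> u e j + ?Q k j u * x j))
        = (\<Sum>j<?n. v (?R i k) * (?Q k j u * snd \<tau> u e j)) + (\<Sum>j<?n. ?R i k u * (v (?Q k j) * snd \<tau> u e j + ?Q k j u * x j))"
        by (rule sum.distrib)
      thus "(\<Sum>j<?n. v (?R i k) * (?Q k j u * snd \<tau> u e j) + ?R i k u * (v (?Q k j) * snd \<tau> u e j + ?Q k j u * x j)) = v (?R i k) * snd \<sigma> u e k + ?R i k u * \<xi> \<sigma> k"
        unfolding se[of k] q sum_distrib_left .
    qed
    finally show ?thesis .
  qed
  have \<xi>\<tau>: "\<xi> \<tau> i = x i" if i: "i < ?n" for i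
  proof -
    have t0: "v (?T \<tau> i j) = 0" if j: "j < ?n" for j
    proof -
      have "v (?T \<tau> i j) = v (\<lambda>_. if i = j then 1 else 0)"
        using transition_refl[OF lin _ j] by (intro tangent_cong[OF v linear_triv_open[OF lin] l(2)])
      thus ?thesis by (simp add: tangent_const[OF v])
    qed
    have "\<xi> \<tau> i = (\<Sum>j<?n. v (?T \<tau> i j) * snd \<tau> u e j + ?T \<tau> i j u * x j)"
      unfolding \<xi>_def using l i by simp
    also have "\<dots> = (\<Sum>j<?n. if j = i then x j else 0)"
    proof (rule sum.cong[OF refl])
      fix j assume "j \<in> {..<?n}"
      hence j: "j < ?n" by simp
      show "v (?T \<tau> i j) * snd \<tau> u e j + ?T \<tau> i j u * x j = (if j = i then x j else 0)"
        unfolding t0[OF j] transition_refl[OF lin l(2) j] by simp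
    qed
    finally have "\<xi> \<tau> i = (\<Sum>j<?n. if j = i then x j else 0)" .
    thus ?thesis using i by simp
  qed
  have ex: "?P (v, \<xi>)"
  proof -
    have "\<xi> \<sigma> i = 0" if "\<not> (local_triv A B \<sigma> \<and> u \<in> fst \<sigma> \<and> i < ?n)" for \<sigma> i
      unfolding \<xi>_def using that by (simp only: if_False)
    thus ?thesis unfolding total_tangent_iff fst_conv snd_conv using v coc \<xi>\<tau> by blast
  qed
  have uniq: "t = (v, \<xi>)" if t: "?P t" for t
  proof -
    have "snd t \<sigma> i = \<xi> \<sigma> i" for \<sigma> i
    proof (cases "local_triv A B \<sigma> \<and> u \<in> fst \<sigma> \<and> i < ?n")
      case True
      hence "snd t \<sigma> i = (\<Sum>j<?n. v (?T \<sigma> i j) * snd \<tau> u e j + ?T \<sigma> i j u * snd t \<tau> j)"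
        using t l unfolding total_tangent_iff by blast
      also have "\<dots> = \<xi> \<sigma> i" unfolding \<xi>_def using True t by simp
      finally show ?thesis .
    next
      case False
      hence "snd t \<sigma> i = 0" using t unfolding total_tangent_iff by blast
      moreover have "\<xi> \<sigma> i = 0" unfolding \<xi>_def using False by (simp only: if_False)
      ultimately show ?thesis by simp
    qed
    hence "snd t = \<xi>" by (intro ext)
    thus ?thesis using t by (simp add: prod_eq_iff)
  qed
  have "?P (tangent_vec A B u e \<tau> v x)"
    unfolding tangent_vec_def by (rule theI[of ?P, OF ex uniq])
  thus "tangent_vec A B u e \<tau> v x \<in> total_tangent A B u e" "fst (tangent_vec A B u e \<tau> v x) = v"
    "\<And>i. i < rk B \<Longrightarrow> snd (tangent_vec A B u e \<tau> v x) \<tau> i = x i" by auto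
qed

lemma total_tangentD:
  assumes "t \<in> total_tangent A B u e"
  shows "fst t \<in> tangent_space A u"
    and "local_triv A B \<tau> \<Longrightarrow> u \<in> fst \<tau> \<Longrightarrow> local_triv A B \<tau>' \<Longrightarrow> u \<in> fst \<tau>' \<Longrightarrow> i < rk B \<Longrightarrow>
      snd t \<tau>' i = (\<Sum>j<rk B. fst t (transition B \<tau> \<tau>' i j) * snd \<tau> u e j + transition B \<tau> \<tau>' i j u * snd t \<tau> j)"
  using assms unfolding total_tangent_iff by blast+

end

end

section \<open>Connection and curvature forms\<close>

locale connection_bundle = metric_bundle A E g
  for A :: "('m::{t2_space,second_countable_topology}, 'e::real_inner) chart set"
    and E :: "('m, 'v::real_vector) vbundle" and g :: "'m \<Rightarrow> 'v \<Rightarrow> 'v \<Rightarrow> real" +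
  fixes nabla :: "('m, 'v) covd"
  assumes mconn: "metric_connection A E g nabla"
begin

lemma conn: "connection A E nabla"
  using mconn unfolding metric_connection_def by blast

lemma
  assumes W: "open W" and s: "smooth_section A E W s" and u: "u \<in> W" and v: "v \<in> tangent_space A u"
  shows nabla_in: "nabla s u v \<in> fib E u"
    and nabla_vlin: "v' \<in> tangent_space A u \<Longrightarrow> nabla s u (\<lambda>f. a * v f + v' f) = a *\<^sub>R nabla s u v + nabla s u v'"
    and nabla_add: "smooth_section A E W t \<Longrightarrow> nabla (\<lambda>y. s y + t y) u v = nabla s u v + nabla t u v"
    and nabla_cong: "smooth_section A E W t \<Longrightarrow> (\<And>y. y \<in> W \<Longrightarrow> s y = t y) \<Longrightarrow> nabla s u v = nabla t u v"
    and nabla_scale: "smooth_fun A W f \<Longrightarrow> nabla (\<lambda>y. f y *\<^sub>R s y) u v = v f *\<^sub>R s u + f u *\<^sub>R nabla s u v"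
proof -
  note c = conn[unfolded connection_def, rule_format, OF W s, THEN conjunct2, rule_format, OF u v]
  show "nabla s u v \<in> fib E u" using c by (rule conjunct1)
  note c2 = c[THEN conjunct2]
  show "v' \<in> tangent_space A u \<Longrightarrow> nabla s u (\<lambda>f. a * v f + v' f) = a *\<^sub>R nabla s u v + nabla s u v'"
    using c2[THEN conjunct1] by blast
  note c3 = c2[THEN conjunct2, THEN conjunct1, rule_format]
  show "smooth_section A E W t \<Longrightarrow> nabla (\<lambda>y. s y + t y) u v = nabla s u v + nabla t u v"
    using c3 by blast
  show "smooth_section A E W t \<Longrightarrow> (\<And>y. y \<in> W \<Longrightarrow> s y = t y) \<Longrightarrow> nabla s u v = nabla t u v"
    using c3 by blast
  show "smooth_fun A W f \<Longrightarrow> nabla (\<lambda>y. f y *\<^sub>R s y) u v = v f *\<^sub>R s u + f u *\<^sub>R nabla s u v"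
    using c2[THEN conjunct2, THEN conjunct2] by blast
qed

lemma nabla_smooth:
  assumes "open W" "smooth_section A E W s" "c \<in> A"
  shows "smooth_section A E (fst c \<inter> W) (\<lambda>y. nabla s y (coord_vec A c y w))"
  using conn[unfolded connection_def, rule_format, OF assms(1,2), THEN conjunct1] assms(3) by blast

lemma nabla_metric:
  assumes "open W" "smooth_section A E W s" "smooth_section A E W t" "u \<in> W" "v \<in> tangent_space A u"
  shows "v (\<lambda>y. g y (s y) (t y)) = g u (nabla s u v) (t u) + g u (s u) (nabla t u v)"
  using mconn[unfolded metric_connection_def, THEN conjunct2, rule_format, OF assms] .

lemma nabla_zero_vec:
  assumes "open W" "smooth_section A E W s" "u \<in> W"
  shows "nabla s u (\<lambda>f. 0) = 0"
  using nabla_vlin[OF assms zero_tangent zero_tangent, of "-1"] by simp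

lemma nabla_sum:
  assumes W: "open W" and f: "\<And>i. i \<in> I \<Longrightarrow> smooth_fun A W (f i)" and s: "\<And>i. i \<in> I \<Longrightarrow> smooth_section A E W (s i)"
    and u: "u \<in> W" and v: "v \<in> tangent_space A u"
  shows "nabla (\<lambda>y. \<Sum>i\<in>I. f i y *\<^sub>R s i y) u v = (\<Sum>i\<in>I. v (f i) *\<^sub>R s i u + f i u *\<^sub>R nabla (s i) u v)"
proof -
  have zero: "nabla (\<lambda>y. 0) u v = 0"
    using nabla_scale[OF W section_zero[OF vbE W] u v smooth_fun_const[OF W, of 0]] by simp
  show ?thesis using f s
  proof (induction I rule: infinite_finite_induct)
    case (insert i I)
    have si: "smooth_section A E W (\<lambda>y. f i y *\<^sub>R s i y)"
      using insert.prems by (intro section_scale[OF vbE W]) auto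
    have sI: "smooth_section A E W (\<lambda>y. \<Sum>i\<in>I. f i y *\<^sub>R s i y)"
      using insert.prems by (intro section_sum[OF vbE W]) auto
    have "nabla (\<lambda>y. f i y *\<^sub>R s i y + (\<Sum>i\<in>I. f i y *\<^sub>R s i y)) u v = nabla (\<lambda>y. f i y *\<^sub>R s i y) u v + nabla (\<lambda>y. \<Sum>i\<in>I. f i y *\<^sub>R s i y) u v"
      by (rule nabla_add[OF W si u v sI])
    moreover have "nabla (\<lambda>y. f i y *\<^sub>R s i y) u v = v (f i) *\<^sub>R s i u + f i u *\<^sub>R nabla (s i) u v"
      using insert.prems by (intro nabla_scale[OF W _ u v]) auto
    ultimately show ?case using insert by simp
  qed (simp_all add: zero)
qed

abbreviation "\<theta> \<equiv> conn_form E nabla"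

lemma nabla_frame_expand:
  assumes l: "local_triv A E \<tau>" "u \<in> fst \<tau>" and j: "j < rk E" and v: "v \<in> tangent_space A u"
  shows "nabla (\<lambda>y. frame E \<tau> y j) u v = (\<Sum>i<rk E. \<theta> \<tau> i j u v *\<^sub>R frame E \<tau> u i)"
    and "nabla (\<lambda>y. frame E \<tau> y j) u v \<in> fib E u"
proof -
  note lin = local_triv_linear[OF l(1)]
  show i: "nabla (\<lambda>y. frame E \<tau> y j) u v \<in> fib E u"
    by (rule nabla_in[OF linear_triv_open[OF lin] section_frame[OF vbE l(1) j] l(2) v])
  show "nabla (\<lambda>y. frame E \<tau> y j) u v = (\<Sum>i<rk E. \<theta> \<tau> i j u v *\<^sub>R frame E \<tau> u i)"
    unfolding conn_form_def by (rule triv_expand[OF lin l(2) sub i])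
qed

lemma conn_form_zero_vec:
  assumes l: "local_triv A E \<tau>" "u \<in> fst \<tau>" and j: "j < rk E"
  shows "\<theta> \<tau> i j u (\<lambda>f. 0) = 0"
proof -
  note lin = local_triv_linear[OF l(1)]
  have "nabla (\<lambda>y. frame E \<tau> y j) u (\<lambda>f. 0) = 0"
    by (rule nabla_zero_vec[OF linear_triv_open[OF lin] section_frame[OF vbE l(1) j] l(2)])
  thus ?thesis using triv_sum[OF lin l(2) sub, of "{}"] by (simp add: conn_form_def)
qed

text \<open>With \<open>G = transition E \<tau> \<tau>'\<close> this reads \<open>G \<theta> = dG + \<theta>' G\<close>; it expresses \<open>\<nabla>\<close> of the frame of \<open>\<tau>\<close> in the
frame of \<open>\<tau>'\<close>.\<close>

lemma conn_form_gauge: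
  assumes l: "local_triv A E \<tau>" "u \<in> fst \<tau>" and l': "local_triv A E \<tau>'" "u \<in> fst \<tau>'"
    and ij: "i < rk E" "j < rk E" and v: "v \<in> tangent_space A u"
  shows "(\<Sum>l<rk E. transition E \<tau> \<tau>' i l u * \<theta> \<tau> l j u v) =
    v (transition E \<tau> \<tau>' i j) + (\<Sum>l<rk E. \<theta> \<tau>' i l u v * transition E \<tau> \<tau>' l j u)"
proof -
  let ?n = "rk E" and ?G = "transition E \<tau> \<tau>'" and ?W = "fst \<tau> \<inter> fst \<tau>'"
  note lin = local_triv_linear[OF l(1)] and lin' = local_triv_linear[OF l'(1)]
  have W: "open ?W" "u \<in> ?W" using l l' linear_triv_open[OF lin] linear_triv_open[OF lin'] by auto
  have s: "smooth_section A E ?W (\<lambda>y. frame E \<tau> y j)"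
    using section_frame[OF vbE l(1) ij(2)] by (rule section_subset[OF vbE]) auto
  have s': "smooth_section A E ?W (\<lambda>y. frame E \<tau>' y p)" if "p < ?n" for p
    using section_frame[OF vbE l'(1) that] by (rule section_subset[OF vbE]) auto
  have Gs: "smooth_fun A ?W (?G p j)" if "p < ?n" for p using transition_smooth[OF vbE l(1) l'(1) that ij(2)] .
  have e: "frame E \<tau> y j = (\<Sum>p<?n. ?G p j y *\<^sub>R frame E \<tau>' y p)" if "y \<in> ?W" for y
    using triv_expand[OF lin' _ sub frame_in[OF lin _ ij(2)], of y] that unfolding transition_def by simp
  have ss: "smooth_section A E ?W (\<lambda>y. \<Sum>p<?n. ?G p j y *\<^sub>R frame E \<tau>' y p)"
    using W(1) Gs s' by (intro section_sum[OF vbE]) auto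
  have "nabla (\<lambda>y. frame E \<tau> y j) u v = nabla (\<lambda>y. \<Sum>p<?n. ?G p j y *\<^sub>R frame E \<tau>' y p) u v"
    using e by (rule nabla_cong[OF W(1) s W(2) v ss])
  also have "\<dots> = (\<Sum>p<?n. v (?G p j) *\<^sub>R frame E \<tau>' u p + ?G p j u *\<^sub>R nabla (\<lambda>y. frame E \<tau>' y p) u v)"
    using Gs s' by (intro nabla_sum[OF W(1) _ _ W(2) v]) auto
  finally have n: "nabla (\<lambda>y. frame E \<tau> y j) u v = (\<Sum>p<?n. v (?G p j) *\<^sub>R frame E \<tau>' u p) + (\<Sum>p<?n. ?G p j u *\<^sub>R nabla (\<lambda>y. frame E \<tau>' y p) u v)"
    by (simp only: sum.distrib)
  have in1: "(\<Sum>p<?n. v (?G p j) *\<^sub>R frame E \<tau>' u p) \<in> fib E u"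
    using frame_in[OF lin' l'(2)] by (intro subspace_sum subspace_scale sub) auto
  have in2: "(\<Sum>p<?n. ?G p j u *\<^sub>R nabla (\<lambda>y. frame E \<tau>' y p) u v) \<in> fib E u"
    using nabla_frame_expand(2)[OF l' _ v] by (intro subspace_sum subspace_scale sub) auto
  have "snd \<tau>' u (nabla (\<lambda>y. frame E \<tau> y j) u v) i = (\<Sum>p<?n. v (?G p j) * snd \<tau>' u (frame E \<tau>' u p) i) + (\<Sum>p<?n. ?G p j u * \<theta> \<tau>' i p u v)"
  proof -
    have "snd \<tau>' u (\<Sum>p<?n. v (?G p j) *\<^sub>R frame E \<tau>' u p) i = (\<Sum>p<?n. v (?G p j) * snd \<tau>' u (frame E \<tau>' u p) i)"
      using frame_in[OF lin' l'(2)] by (intro triv_sum[OF lin' l'(2) sub]) auto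
    moreover have "snd \<tau>' u (\<Sum>p<?n. ?G p j u *\<^sub>R nabla (\<lambda>y. frame E \<tau>' y p) u v) i = (\<Sum>p<?n. ?G p j u * \<theta> \<tau>' i p u v)"
      unfolding conn_form_def using nabla_frame_expand(2)[OF l' _ v] by (intro triv_sum[OF lin' l'(2) sub]) auto
    ultimately show ?thesis unfolding n using triv_linear[OF lin' l'(2) in1 in2, of 1] by simp
  qed
  also have "(\<Sum>p<?n. v (?G p j) * snd \<tau>' u (frame E \<tau>' u p) i) = (\<Sum>p<?n. if p = i then v (?G p j) else 0)"
    using frame_coord[OF lin' l'(2)] by (intro sum.cong refl) auto
  also have "\<dots> = v (?G i j)" using ij by simp
  finally have r: "snd \<tau>' u (nabla (\<lambda>y. frame E \<tau> y j) u v) i = v (?G i j) + (\<Sum>p<?n. ?G p j u * \<theta> \<tau>' i p u v)" .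
  have "snd \<tau>' u (nabla (\<lambda>y. frame E \<tau> y j) u v) i = (\<Sum>p<?n. \<theta> \<tau> p j u v * snd \<tau>' u (frame E \<tau> u p) i)"
    unfolding nabla_frame_expand(1)[OF l ij(2) v] using frame_in[OF lin l(2)] by (intro triv_sum[OF lin' l'(2) sub]) auto
  thus ?thesis unfolding r transition_def by (simp add: mult.commute)
qed

lemma conn_form_smooth:
  assumes l: "local_triv A E \<tau>" "u \<in> fst \<tau>" and ij: "i < rk E" "j < rk E" and c: "c \<in> A" "u \<in> fst c"
  shows "smooth_near u (\<lambda>y. \<theta> \<tau> i j y (coord_vec A c y w))"
proof -
  note lin = local_triv_linear[OF l(1)]
  let ?W = "fst c \<inter> fst \<tau>"
  have W: "open ?W" using chart_open[OF c(1)] linear_triv_open[OF lin] by blast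
  have "smooth_section A E ?W (\<lambda>y. nabla (\<lambda>y. frame E \<tau> y j) y (coord_vec A c y w))"
    by (rule nabla_smooth[OF linear_triv_open[OF lin] section_frame[OF vbE l(1) ij(2)] c(1)])
  from section_coord[OF vbE this W l(1) ij(1)]
  have "smooth_fun A (fst \<tau> \<inter> ?W) (\<lambda>y. \<theta> \<tau> i j y (coord_vec A c y w))" unfolding conn_form_def .
  thus ?thesis using l c W by (intro smooth_nearI[of "fst \<tau> \<inter> ?W"]) (auto intro: linear_triv_open[OF lin])
qed

text \<open>With \<open>G = transition E \<tau> \<tau>'\<close> this reads \<open>G \<Omega> = \<Omega>' G\<close>. It follows from \<open>d(dG) = 0\<close> with \<open>dG = G \<theta> - \<theta>' G\<close>:
the derivative of the right-hand side is \<open>dG \<theta> + G d\<theta> - d\<theta>' G + \<theta>' dG\<close>, where \<open>dG\<close> is replaced once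
more.\<close>

lemma curv_form_gauge:
  assumes l: "local_triv A E \<tau>" "u \<in> fst \<tau>" and l': "local_triv A E \<tau>'" "u \<in> fst \<tau>'"
    and ij: "i < rk E" "j < rk E" and v: "v \<in> tangent_space A u" and w: "w \<in> tangent_space A u"
  shows "(\<Sum>l<rk E. transition E \<tau> \<tau>' i l u * curv_form A E nabla \<tau> l j u v w) =
    (\<Sum>l<rk E. curv_form A E nabla \<tau>' i l u v w * transition E \<tau> \<tau>' l j u)"
proof -
  let ?n = "rk E" and ?G = "transition E \<tau> \<tau>'"
  note lin = local_triv_linear[OF l(1)] and lin' = local_triv_linear[OF l'(1)]
  obtain c a b where c: "c \<in> A" "u \<in> fst c" and va: "v = coord_vec A c u a" and wb: "w = coord_vec A c u b"
    and ed: "\<And>\<alpha>. ext_deriv A \<alpha> u v w = v (\<lambda>y. \<alpha> y (coord_vec A c y b)) - w (\<lambda>y. \<alpha> y (coord_vec A c y a))"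
    using ext_deriv_chart[OF v w] by blast
  let ?W = "fst \<tau> \<inter> fst \<tau>' \<inter> fst c"
  have W: "open ?W" "u \<in> ?W" using l l' c linear_triv_open[OF lin] linear_triv_open[OF lin'] chart_open[OF c(1)] by auto
  define G where "G = (\<lambda>i j. ?G i j u)"
  define T where "T = (\<lambda>i j. \<theta> \<tau> i j u v)"
  define S where "S = (\<lambda>i j. \<theta> \<tau> i j u w)"
  define T' where "T' = (\<lambda>i j. \<theta> \<tau>' i j u v)"
  define S' where "S' = (\<lambda>i j. \<theta> \<tau>' i j u w)"
  define d where "d = (\<lambda>i j. ext_deriv A (\<theta> \<tau> i j) u v w)"
  define d' where "d' = (\<lambda>i j. ext_deriv A (\<theta> \<tau>' i j) u v w)"
  have Gn: "smooth_near u (?G p q)" if "p < ?n" "q < ?n" for p q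
    using transition_near[OF vbE l(1) l'(1) l(2) l'(2) that] .
  have vG: "v (?G p q) = mm ?n G T p q - mm ?n T' G p q" if "p < ?n" "q < ?n" for p q
    using conn_form_gauge[OF l l' that v] by (simp add: mm_def G_def T_def T'_def)
  have wG: "w (?G p q) = mm ?n G S p q - mm ?n S' G p q" if "p < ?n" "q < ?n" for p q
    using conn_form_gauge[OF l l' that w] by (simp add: mm_def G_def S_def S'_def)
  \<comment> \<open>The gauge law solved for \<open>dG\<close>, as functions near \<open>u\<close>, so that it can be differentiated again.\<close>
  let ?h = "\<lambda>x y. (\<Sum>l<?n. ?G i l y * \<theta> \<tau> l j y (coord_vec A c y x)) + (\<Sum>l<?n. (-1) * (\<theta> \<tau>' i l y (coord_vec A c y x) * ?G l j y))"
  have h: "coord_vec A c y x (?G i j) = ?h x y" if y: "y \<in> ?W" for x y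
  proof -
    have "coord_vec A c y x \<in> tangent_space A y" using coord_vec_tangent[OF c(1)] y by simp
    from conn_form_gauge[OF l(1) _ l'(1) _ ij this] y show ?thesis by (simp add: sum_negf)
  qed
  have hs1: "smooth_near u (\<lambda>y. \<Sum>l<?n. ?G i l y * \<theta> \<tau> l j y (coord_vec A c y x))" for x
    by (rule smooth_near_sum, rule smooth_near_mult) (simp_all add: ij Gn conn_form_smooth[OF l _ _ c])
  have hs2: "smooth_near u (\<lambda>y. \<Sum>l<?n. (-1) * (\<theta> \<tau>' i l y (coord_vec A c y x) * ?G l j y))" for x
    by (rule smooth_near_sum, rule smooth_near_mult[OF smooth_near_const], rule smooth_near_mult)
      (simp_all add: ij Gn conn_form_smooth[OF l' _ _ c])
  have hs: "smooth_near u (?h x)" for x using hs1 hs2 by (rule smooth_near_add)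
  have near: "smooth_near u (\<lambda>y. coord_vec A c y x (?G i j))" for x
    by (rule smooth_near_cong[OF W h[symmetric] hs])
  \<comment> \<open>A second derivative of \<open>G\<close>, by the product rule.\<close>
  have D: "z (\<lambda>y. coord_vec A c y x (?G i j)) =
     (\<Sum>l<?n. z (?G i l) * \<theta> \<tau> l j u (coord_vec A c u x) + G i l * z (\<lambda>y. \<theta> \<tau> l j y (coord_vec A c y x)))
     - (\<Sum>l<?n. z (\<lambda>y. \<theta> \<tau>' i l y (coord_vec A c y x)) * G l j + \<theta> \<tau>' i l u (coord_vec A c u x) * z (?G l j))"
    if z: "z \<in> tangent_space A u" for z x
  proof -
    have "z (\<lambda>y. coord_vec A c y x (?G i j)) = z (?h x)"
      by (rule tangent_cong[OF z W h])
    also have "\<dots> = z (\<lambda>y. \<Sum>l<?n. ?G i l y * \<theta> \<tau> l j y (coord_vec A c y x)) + z (\<lambda>y. \<Sum>l<?n. (-1) * (\<theta> \<tau>' i l y (coord_vec A c y x) * ?G l j y))"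
      by (rule tangent_add[OF z hs1 hs2])
    also have "z (\<lambda>y. \<Sum>l<?n. ?G i l y * \<theta> \<tau> l j y (coord_vec A c y x)) = (\<Sum>l<?n. z (\<lambda>y. ?G i l y * \<theta> \<tau> l j y (coord_vec A c y x)))"
      using ij Gn conn_form_smooth[OF l _ _ c] by (intro tangent_sum[OF z] smooth_near_mult) auto
    also have "\<dots> = (\<Sum>l<?n. z (?G i l) * \<theta> \<tau> l j u (coord_vec A c u x) + G i l * z (\<lambda>y. \<theta> \<tau> l j y (coord_vec A c y x)))"
      unfolding G_def using ij Gn conn_form_smooth[OF l _ _ c] by (intro sum.cong refl tangent_mult[OF z]) auto
    also have "z (\<lambda>y. \<Sum>l<?n. (-1) * (\<theta> \<tau>' i l y (coord_vec A c y x) * ?G l j y)) = (\<Sum>l<?n. z (\<lambda>y. (-1) * (\<theta> \<tau>' i l y (coord_vec A c y x) * ?G l j y)))"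
      using ij Gn conn_form_smooth[OF l' _ _ c] by (intro tangent_sum[OF z] smooth_near_mult smooth_near_const) auto
    also have "\<dots> = (\<Sum>l<?n. - (z (\<lambda>y. \<theta> \<tau>' i l y (coord_vec A c y x)) * G l j + \<theta> \<tau>' i l u (coord_vec A c u x) * z (?G l j)))"
    proof (rule sum.cong[OF refl])
      fix k assume k: "k \<in> {..<?n}"
      have s1: "smooth_near u (\<lambda>y. \<theta> \<tau>' i k y (coord_vec A c y x))" "smooth_near u (?G k j)"
        using k ij Gn conn_form_smooth[OF l' _ _ c] by auto
      have "z (\<lambda>y. (-1) * (\<theta> \<tau>' i k y (coord_vec A c y x) * ?G k j y)) = z (\<lambda>_. -1) * (\<theta> \<tau>' i k u (coord_vec A c u x) * ?G k j u) + (-1) * z (\<lambda>y. \<theta> \<tau>' i k y (coord_vec A c y x) * ?G k j y)"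
        by (rule tangent_mult[OF z smooth_near_const smooth_near_mult[OF s1]])
      also have "\<dots> = - (z (\<lambda>y. \<theta> \<tau>' i k y (coord_vec A c y x)) * ?G k j u + \<theta> \<tau>' i k u (coord_vec A c u x) * z (?G k j))"
        unfolding tangent_const[OF z] tangent_mult[OF z s1] by simp
      finally show "z (\<lambda>y. (-1) * (\<theta> \<tau>' i k y (coord_vec A c y x) * ?G k j y)) = - (z (\<lambda>y. \<theta> \<tau>' i k y (coord_vec A c y x)) * G k j + \<theta> \<tau>' i k u (coord_vec A c u x) * z (?G k j))"
        unfolding G_def .
    qed
    finally show ?thesis by (simp only: sum_negf add_uminus_conv_diff)
  qed
  have sym: "v (\<lambda>y. coord_vec A c y b (?G i j)) = w (\<lambda>y. coord_vec A c y a (?G i j))"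
    unfolding va wb by (rule coord_vec_commute[OF c Gn[OF ij] near near])
  have d: "d p q = v (\<lambda>y. \<theta> \<tau> p q y (coord_vec A c y b)) - w (\<lambda>y. \<theta> \<tau> p q y (coord_vec A c y a))" for p q
    unfolding d_def by (rule ed)
  have d': "d' p q = v (\<lambda>y. \<theta> \<tau>' p q y (coord_vec A c y b)) - w (\<lambda>y. \<theta> \<tau>' p q y (coord_vec A c y a))" for p q
    unfolding d'_def by (rule ed)
  let ?vG = "\<lambda>p q. v (?G p q)" and ?wG = "\<lambda>p q. w (?G p q)"
  have 1: "v (\<lambda>y. coord_vec A c y b (?G i j)) = mm ?n ?vG S i j + mm ?n G (\<lambda>p q. v (\<lambda>y. \<theta> \<tau> p q y (coord_vec A c y b))) i j
     - (mm ?n (\<lambda>p q. v (\<lambda>y. \<theta> \<tau>' p q y (coord_vec A c y b))) G i j + mm ?n S' ?vG i j)"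
    unfolding D[OF v] wb[symmetric] by (simp add: mm_def S_def S'_def sum.distrib)
  have 2: "w (\<lambda>y. coord_vec A c y a (?G i j)) = mm ?n ?wG T i j + mm ?n G (\<lambda>p q. w (\<lambda>y. \<theta> \<tau> p q y (coord_vec A c y a))) i j
     - (mm ?n (\<lambda>p q. w (\<lambda>y. \<theta> \<tau>' p q y (coord_vec A c y a))) G i j + mm ?n T' ?wG i j)"
    unfolding D[OF w] va[symmetric] by (simp add: mm_def T_def T'_def sum.distrib)
  have Gd: "mm ?n G d i j = mm ?n G (\<lambda>p q. v (\<lambda>y. \<theta> \<tau> p q y (coord_vec A c y b))) i j - mm ?n G (\<lambda>p q. w (\<lambda>y. \<theta> \<tau> p q y (coord_vec A c y a))) i j"
    unfolding d mm_diff_right[symmetric] ..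
  have dG: "mm ?n d' G i j = mm ?n (\<lambda>p q. v (\<lambda>y. \<theta> \<tau>' p q y (coord_vec A c y b))) G i j - mm ?n (\<lambda>p q. w (\<lambda>y. \<theta> \<tau>' p q y (coord_vec A c y a))) G i j"
    unfolding d' mm_diff_left[symmetric] ..
  have e1: "mm ?n ?vG S i j = mm ?n (mm ?n G T) S i j - mm ?n (mm ?n T' G) S i j"
    unfolding mm_diff_left[symmetric] using vG ij by (intro mm_cong) auto
  have e2: "mm ?n ?wG T i j = mm ?n (mm ?n G S) T i j - mm ?n (mm ?n S' G) T i j"
    unfolding mm_diff_left[symmetric] using wG ij by (intro mm_cong) auto
  have e3: "mm ?n S' ?vG i j = mm ?n S' (mm ?n G T) i j - mm ?n S' (mm ?n T' G) i j"
    unfolding mm_diff_right[symmetric] using vG ij by (intro mm_cong) auto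
  have e4: "mm ?n T' ?wG i j = mm ?n T' (mm ?n G S) i j - mm ?n T' (mm ?n S' G) i j"
    unfolding mm_diff_right[symmetric] using wG ij by (intro mm_cong) auto
  have cv: "curv_form A E nabla \<tau> p q u v w = d p q + (mm ?n T S p q - mm ?n S T p q)" for p q
    unfolding curv_form_def Let_def d_def mm_def T_def S_def by (simp add: sum_subtractf)
  have cv': "curv_form A E nabla \<tau>' p q u v w = d' p q + (mm ?n T' S' p q - mm ?n S' T' p q)" for p q
    unfolding curv_form_def Let_def d'_def mm_def T'_def S'_def by (simp add: sum_subtractf)
  have L: "(\<Sum>l<?n. ?G i l u * curv_form A E nabla \<tau> l j u v w) = mm ?n G d i j + (mm ?n (mm ?n G T) S i j - mm ?n (mm ?n G S) T i j)"
  proof -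
    have "(\<Sum>l<?n. ?G i l u * curv_form A E nabla \<tau> l j u v w) = mm ?n G (\<lambda>p q. d p q + (mm ?n T S p q - mm ?n S T p q)) i j"
      unfolding cv mm_def[of ?n G] by (simp add: G_def)
    thus ?thesis unfolding mm_add_right mm_diff_right mm_assoc .
  qed
  have R: "(\<Sum>l<?n. curv_form A E nabla \<tau>' i l u v w * ?G l j u) = mm ?n d' G i j + (mm ?n T' (mm ?n S' G) i j - mm ?n S' (mm ?n T' G) i j)"
  proof -
    have "(\<Sum>l<?n. curv_form A E nabla \<tau>' i l u v w * ?G l j u) = mm ?n (\<lambda>p q. d' p q + (mm ?n T' S' p q - mm ?n S' T' p q)) G i j"
      unfolding cv' mm_def[of ?n _ G] by (simp add: G_def)
    thus ?thesis unfolding mm_add_left mm_diff_left mm_assoc .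
  qed
  show ?thesis
    unfolding L R Gd dG using sym unfolding 1 2 e1 e2 e3 e4 mm_assoc by linarith
qed

text \<open>The inner products of the members of an orthonormal frame are constant.\<close>

lemma conn_form_antisym:
  assumes o: "orthonormal_triv E g \<tau>" and l: "local_triv A E \<tau>" "u \<in> fst \<tau>"
    and ij: "i < rk E" "j < rk E" and v: "v \<in> tangent_space A u"
  shows "\<theta> \<tau> i j u v = - \<theta> \<tau> j i u v"
proof -
  note lin = local_triv_linear[OF l(1)]
  note W = linear_triv_open[OF lin]
  let ?f = "\<lambda>j y. frame E \<tau> y j"
  note fi = section_frame[OF vbE l(1) ij(1)] and fj = section_frame[OF vbE l(1) ij(2)]
  note ni = nabla_frame_expand(2)[OF l ij(1) v] and nj = nabla_frame_expand(2)[OF l ij(2) v]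
  have "v (\<lambda>y. g y (?f i y) (?f j y)) = v (\<lambda>_. if i = j then 1 else 0)"
  proof (rule tangent_cong[OF v W l(2)])
    fix y assume "y \<in> fst \<tau>"
    thus "g y (?f i y) (?f j y) = (if i = j then 1 else 0)"
      using orthonormal_triv_frame(1)[OF o l(1)] ij unfolding orthoframe_def orthonormal_def by simp
  qed
  hence "v (\<lambda>y. g y (?f i y) (?f j y)) = 0" by (simp add: tangent_const[OF v])
  hence "g u (nabla (?f i) u v) (?f j u) + g u (?f i u) (nabla (?f j) u v) = 0"
    using nabla_metric[OF W fi fj l(2) v] by simp
  moreover have "g u (nabla (?f i) u v) (?f j u) = \<theta> \<tau> j i u v"
    using orthonormal_triv_frame(2)[OF o l(1,2) ni ij(2)] by (simp add: conn_form_def)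
  moreover have "g u (?f i u) (nabla (?f j) u v) = \<theta> \<tau> i j u v"
    using orthonormal_triv_frame(2)[OF o l(1,2) nj ij(1)] g_sym[OF frame_in[OF lin l(2) ij(1)] nj] by (simp add: conn_form_def)
  ultimately show ?thesis by simp
qed

lemma transition_orthogonal:
  assumes o: "orthonormal_triv E g \<tau>" and l: "local_triv A E \<tau>" "u \<in> fst \<tau>"
    and o': "orthonormal_triv E g \<tau>'" and l': "local_triv A E \<tau>'" "u \<in> fst \<tau>'" and ij: "i < rk E" "k < rk E"
  shows "(\<Sum>j<rk E. transition E \<tau> \<tau>' i j u * transition E \<tau> \<tau>' k j u) = (if i = k then 1 else 0)"
proof -
  let ?n = "rk E"
  note lin = local_triv_linear[OF l(1)] and lin' = local_triv_linear[OF l'(1)]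
  have G: "transition E \<tau> \<tau>' p j u = snd \<tau> u (frame E \<tau>' u p) j" if "p < ?n" "j < ?n" for p j
  proof -
    have "transition E \<tau> \<tau>' p j u = g u (frame E \<tau> u j) (frame E \<tau>' u p)"
      unfolding transition_def using orthonormal_triv_frame(2)[OF o' l' frame_in[OF lin l(2) that(2)] that(1)] .
    also have "\<dots> = g u (frame E \<tau>' u p) (frame E \<tau> u j)"
      by (rule g_sym[OF frame_in[OF lin l(2) that(2)] frame_in[OF lin' l'(2) that(1)]])
    also have "\<dots> = snd \<tau> u (frame E \<tau>' u p) j"
      using orthonormal_triv_frame(2)[OF o l frame_in[OF lin' l'(2) that(1)] that(2)] by simp
    finally show ?thesis .
  qed
  have "(\<Sum>j<?n. transition E \<tau> \<tau>' i j u * transition E \<tau> \<tau>' k j u) = (\<Sum>j<?n. snd \<tau> u (frame E \<tau>' u i) j * snd \<tau> u (frame E \<tau>' u k) j)"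
    using G ij by (intro sum.cong refl) auto
  also have "\<dots> = g u (frame E \<tau>' u i) (frame E \<tau>' u k)"
    by (rule orthonormal_triv_inner[OF o lin l(2) frame_in[OF lin' l'(2) ij(1)] frame_in[OF lin' l'(2) ij(2)], symmetric])
  also have "\<dots> = (if i = k then 1 else 0)"
    using orthonormal_triv_frame(1)[OF o' l'(1)] l'(2) ij unfolding orthoframe_def orthonormal_def by simp
  finally show ?thesis .
qed

text \<open>The entries of \<open>dx + \<theta>x\<close> and the curvature matrix transform linearly under \<open>G = transition E \<tau> \<tau>'\<close>; for
the curvature, orthogonality of \<open>G\<close> turns \<open>\<Omega>' = G \<Omega> G\<^sup>-\<^sup>1\<close> into the law for a bilinear form. So the
expressions differ by \<open>det G\<close>.\<close>

theorem TMQ_local_change: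
  assumes o: "orthonormal_triv E g \<tau>" and l: "local_triv A E \<tau>" "u \<in> fst \<tau>"
    and o': "orthonormal_triv E g \<tau>'" and l': "local_triv A E \<tau>'" "u \<in> fst \<tau>'"
    and e: "e \<in> fib E u" and ts: "set ts \<subseteq> total_tangent A E u e"
  shows "TMQ_local A E nabla \<tau>' u e ts =
    det_of (rk E) (\<lambda>i j. transition E \<tau> \<tau>' i j u) * TMQ_local A E nabla \<tau> u e ts"
proof -
  let ?n = "rk E" and ?G = "transition E \<tau> \<tau>'"
  note lin = local_triv_linear[OF l(1)] and lin' = local_triv_linear[OF l'(1)]
  let ?D = "\<lambda>\<tau> i t. snd t \<tau> i + (\<Sum>j<?n. \<theta> \<tau> i j u (fst t) * snd \<tau> u e j)"
  let ?\<Omega> = "\<lambda>\<tau> i j s t. curv_form A E nabla \<tau> i j u (fst s) (fst t)"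
  have tt: "fst t \<in> tangent_space A u" if "t \<in> set ts" for t
    using total_tangentD(1)[OF vbE] ts that by blast
  have D: "?D \<tau>' i t = (\<Sum>j<?n. ?G i j u * ?D \<tau> j t)" if i: "i < ?n" and t: "t \<in> set ts" for i t
  proof -
    have "t \<in> total_tangent A E u e" using ts t by blast
    hence x: "snd t \<tau>' i = (\<Sum>j<?n. fst t (?G i j) * snd \<tau> u e j + ?G i j u * snd t \<tau> j)"
      by (rule total_tangentD(2)[OF vbE _ l l' i])
    have "(\<Sum>k<?n. \<theta> \<tau>' i k u (fst t) * snd \<tau>' u e k) = (\<Sum>k<?n. \<theta> \<tau>' i k u (fst t) * (\<Sum>j<?n. ?G k j u * snd \<tau> u e j))"
      using transition_apply[OF lin l(2) lin' l'(2) sub e] by simp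
    also have "\<dots> = (\<Sum>j<?n. (\<Sum>k<?n. \<theta> \<tau>' i k u (fst t) * ?G k j u) * snd \<tau> u e j)"
      unfolding sum_distrib_left sum_distrib_right by (subst sum.swap) (simp only: mult.assoc)
    finally have "?D \<tau>' i t = (\<Sum>j<?n. (fst t (?G i j) + (\<Sum>k<?n. \<theta> \<tau>' i k u (fst t) * ?G k j u)) * snd \<tau> u e j) + (\<Sum>j<?n. ?G i j u * snd t \<tau> j)"
      unfolding x by (simp add: sum.distrib distrib_right)
    also have "(\<Sum>j<?n. (fst t (?G i j) + (\<Sum>k<?n. \<theta> \<tau>' i k u (fst t) * ?G k j u)) * snd \<tau> u e j) = (\<Sum>j<?n. (\<Sum>k<?n. ?G i k u * \<theta> \<tau> k j u (fst t)) * snd \<tau> u e j)"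
      using conn_form_gauge[OF l l' i _ tt[OF t]] by (intro sum.cong refl) simp
    also have "\<dots> = (\<Sum>k<?n. ?G i k u * (\<Sum>j<?n. \<theta> \<tau> k j u (fst t) * snd \<tau> u e j))"
      unfolding sum_distrib_left sum_distrib_right by (subst sum.swap) (simp only: mult.assoc)
    finally show ?thesis by (simp add: sum.distrib distrib_left)
  qed
  have \<Omega>: "?\<Omega> \<tau>' i k s t = (\<Sum>(j, p)\<in>{..<?n} \<times> {..<?n}. (?G i j u * ?G k p u) * ?\<Omega> \<tau> j p s t)"
    if ik: "i < ?n" "k < ?n" and st: "s \<in> set ts" "t \<in> set ts" for i k s t
  proof -
    have "?\<Omega> \<tau>' i k s t = (\<Sum>q<?n. if q = k then ?\<Omega> \<tau>' i q s t else 0)" using ik by simp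
    also have "\<dots> = (\<Sum>q<?n. ?\<Omega> \<tau>' i q s t * (\<Sum>p<?n. ?G q p u * ?G k p u))"
      using transition_orthogonal[OF o l o' l' _ ik(2)] by (intro sum.cong refl) auto
    also have "\<dots> = (\<Sum>p<?n. (\<Sum>q<?n. ?\<Omega> \<tau>' i q s t * ?G q p u) * ?G k p u)"
      unfolding sum_distrib_left sum_distrib_right by (subst sum.swap) (simp only: mult.assoc)
    also have "\<dots> = (\<Sum>p<?n. (\<Sum>j<?n. ?G i j u * ?\<Omega> \<tau> j p s t) * ?G k p u)"
      using curv_form_gauge[OF l l' ik(1) _ tt[OF st(1)] tt[OF st(2)]] by (intro sum.cong refl) simp
    also have "\<dots> = (\<Sum>p<?n. \<Sum>j<?n. (?G i j u * ?G k p u) * ?\<Omega> \<tau> j p s t)"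
      unfolding sum_distrib_right by (intro sum.cong refl) simp
    also have "\<dots> = (\<Sum>(j, p)\<in>{..<?n} \<times> {..<?n}. (?G i j u * ?G k p u) * ?\<Omega> \<tau> j p s t)"
      by (subst sum.swap) (rule sum.cartesian_product)
    finally show ?thesis .
  qed
  have "coef (mq ?n (\<lambda>i. emb ts (form1 (?D \<tau>' i))) (\<lambda>i j. emb ts (form2 (?\<Omega> \<tau>' i j)))) {..<length ts} =
     det_of ?n (\<lambda>i j. ?G i j u) *
     coef (mq ?n (\<lambda>i. emb ts (form1 (?D \<tau> i))) (\<lambda>i j. emb ts (form2 (?\<Omega> \<tau> i j)))) {..<length ts}"
  proof (rule mq_linear_change)
    show "emb ts (form1 (?D \<tau>' i)) = (\<Sum>j<?n. ?G i j u *\<^sub>R emb ts (form1 (?D \<tau> j)))" if "i < ?n" for i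
      using D[OF that] by (rule emb_form1_sum)
    show "emb ts (form2 (?\<Omega> \<tau>' i k)) = (\<Sum>j<?n. \<Sum>p<?n. (?G i j u * ?G k p u) *\<^sub>R emb ts (form2 (?\<Omega> \<tau> j p)))" if ik: "i < ?n" "k < ?n" for i k
    proof -
      have "emb ts (form2 (?\<Omega> \<tau>' i k)) = (\<Sum>x\<in>{..<?n} \<times> {..<?n}. (?G i (fst x) u * ?G k (snd x) u) *\<^sub>R emb ts (form2 (?\<Omega> \<tau> (fst x) (snd x))))"
        using \<Omega>[OF ik] by (intro emb_form2_sum) (simp add: case_prod_unfold)
      thus ?thesis by (simp add: sum.cartesian_product case_prod_unfold)
    qed
  qed (simp_all add: odd_emb_form1 even_emb_form2 in_vars_emb)
  moreover have "(\<Sum>i<?n. (snd \<tau>' u e i)\<^sup>2) = (\<Sum>i<?n. (snd \<tau> u e i)\<^sup>2)"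
    using o o' l l' e unfolding orthonormal_triv_def by metis
  ultimately show ?thesis unfolding TMQ_local_eq_mq by simp
qed

end

section \<open>Orientations\<close>

lemma det_mat_mult:
  "det_of n (\<lambda>i j. mm n X Y i j) =
   det_of n (\<lambda>i j. X i j) * det_of n (\<lambda>i j. Y i j)"
proof -
  have "Matrix.mat n n (\<lambda>(i, j). mm n X Y i j) = Matrix.mat n n (\<lambda>(i, j). X i j) * Matrix.mat n n (\<lambda>(i, j). Y i j)"
    by (rule eq_matI) (auto simp: mm_def scalar_prod_def lessThan_atLeast0 intro!: sum.cong)
  thus ?thesis by (simp add: det_mult[of _ n])
qed

lemma det_mat_cong:
  "(\<And>i j. i < n \<Longrightarrow> j < n \<Longrightarrow> X i j = Y i j) \<Longrightarrow>
   det_of n (\<lambda>i j. X i j) = det_of n (\<lambda>i j. Y i j)"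
  by (intro arg_cong[of _ _ Determinant.det] eq_matI) auto

lemma det_orthogonal:
  assumes "\<And>i k. i < n \<Longrightarrow> k < n \<Longrightarrow> (\<Sum>j<n. X i j * X k j) = (if i = k then 1 else 0 :: real)"
  shows "det_of n (\<lambda>i j. X i j) \<in> {1, -1}"
proof -
  let ?d = "det_of n (\<lambda>i j. X i j)"
  have "det_of n (\<lambda>i j. X j i) = ?d"
  proof -
    have "Matrix.mat n n (\<lambda>(i, j). X j i) = transpose_mat (Matrix.mat n n (\<lambda>(i, j). X i j))"
      by (rule eq_matI) auto
    thus ?thesis using det_transpose[of "Matrix.mat n n (\<lambda>(i, j). X i j)" n] by simp
  qed
  hence "?d * ?d = det_of n (\<lambda>i j. mm n X (\<lambda>i j. X j i) i j)"
    unfolding det_mat_mult by simp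
  also have "\<dots> = det_of n (\<lambda>i j. if i = j then 1 else 0)"
    using assms by (intro det_mat_cong) (simp add: mm_def)
  finally have "?d * ?d = 1" unfolding det_delta .
  thus ?thesis using square_eq_1_iff[of ?d] by simp
qed

lemma det_diag_neg:
  assumes "0 < n"
  shows "det_of n (\<lambda>i j. if i = j then (if j = 0 then - 1 else 1) else 0 :: real) = -1"
proof -
  have "Matrix.mat n n (\<lambda>(i, j). if i = j then (if j = 0 then - 1 else 1) else 0 :: real) = multrow 0 (-1) (1\<^sub>m n)"
    by (rule eq_matI) auto
  thus ?thesis using det_multrow[of 0 n "1\<^sub>m n" "-1"] assms by simp
qed

lemma det_block_id:
  fixes P :: "nat \<Rightarrow> nat \<Rightarrow> real"
  assumes "k \<le> n"
  shows "det_of n (\<lambda>i j. if j < k then (if i < k then P i j else 0) else (if i = j then 1 else 0))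
    = det_of k (\<lambda>i j. P i j)"
proof -
  let ?A = "Matrix.mat k k (\<lambda>(i, j). P i j)"
  have "Matrix.mat n n (\<lambda>(i, j). if j < k then (if i < k then P i j else 0) else (if i = j then 1 else 0))
    = four_block_mat ?A (0\<^sub>m k (n - k)) (0\<^sub>m (n - k) k) (1\<^sub>m (n - k))"
    using assms by (intro eq_matI) auto
  also have "Determinant.det \<dots> = Determinant.det ?A * Determinant.det (1\<^sub>m (n - k))"
    by (rule det_four_block_mat_lower_left_zero) auto
  finally show ?thesis by simp
qed

context metric_bundle
begin

text \<open>Local orientations are signs of determinants of coordinates, which are multiplicative.\<close>

lemma orientation_change:
  assumes ori: "orientation A E ori"
    and b: "length b = rk E" "set b \<subseteq> fib E u" and b': "length b' = rk E"
    and P: "\<And>j. j < rk E \<Longrightarrow> b' ! j = (\<Sum>l<rk E. P l j *\<^sub>R b ! l)"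
  shows "ori u b' = sgn (det_of (rk E) (\<lambda>i j. P i j)) * ori u b"
proof -
  let ?n = "rk E"
  obtain U \<phi> where l: "local_triv A E (U, \<phi>)" "u \<in> U"
    and o: "\<And>b. length b = ?n \<Longrightarrow> set b \<subseteq> fib E u \<Longrightarrow> ori u b = sgn (det_of ?n (\<lambda>i j. \<phi> u (b ! j) i))"
    using ori unfolding orientation_def by meson
  note lin = local_triv_linear[OF l(1)]
  have bin: "b ! l \<in> fib E u" if "l < ?n" for l using b that nth_mem by force
  have bin': "b' ! j \<in> fib E u" if "j < ?n" for j
    unfolding P[OF that] using bin by (intro subspace_sum subspace_scale sub) auto
  hence b's: "set b' \<subseteq> fib E u" using b' by (auto simp: in_set_conv_nth)
  have "\<phi> u (b' ! j) i = mm ?n (\<lambda>i l. \<phi> u (b ! l) i) P i j" if "j < ?n" for i j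
  proof -
    have "snd (U, \<phi>) u (\<Sum>l<?n. P l j *\<^sub>R b ! l) i = (\<Sum>l<?n. P l j * snd (U, \<phi>) u (b ! l) i)"
      using bin l(2) by (intro triv_sum[OF lin _ sub]) auto
    thus ?thesis unfolding P[OF that] mm_def by (simp add: mult.commute)
  qed
  hence "det_of ?n (\<lambda>i j. \<phi> u (b' ! j) i) =
     det_of ?n (\<lambda>i j. \<phi> u (b ! j) i) * det_of ?n (\<lambda>i j. P i j)"
    unfolding det_mat_mult[symmetric] by (intro det_mat_cong) auto
  thus ?thesis unfolding o[OF b] o[OF b' b's] by (simp add: sgn_mult)
qed

lemma orientation_orthonormal_nonzero:
  assumes ori: "orientation A E ori" and b: "orthonormal u (rk E) b"
  shows "ori u (map b [0..<rk E]) \<noteq> 0"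
proof
  let ?n = "rk E"
  assume z: "ori u (map b [0..<?n]) = 0"
  obtain U \<phi> where l: "local_triv A E (U, \<phi>)" "u \<in> U"
    and o: "\<And>b. length b = ?n \<Longrightarrow> set b \<subseteq> fib E u \<Longrightarrow> ori u b = sgn (det_of ?n (\<lambda>i j. \<phi> u (b ! j) i))"
    using ori unfolding orientation_def by meson
  note lin = local_triv_linear[OF l(1)]
  let ?f = "frame E (U, \<phi>) u"
  have fin: "?f j \<in> fib E u" if "j < ?n" for j using frame_in[OF lin _ that, of u] l(2) by simp
  have "ori u (map ?f [0..<?n]) = sgn (det_of ?n (\<lambda>i j. \<phi> u (map ?f [0..<?n] ! j) i))"
    by (rule o) (use fin in auto)
  also have "det_of ?n (\<lambda>i j. \<phi> u (map ?f [0..<?n] ! j) i) = det_of ?n (\<lambda>i j. if i = j then 1 else 0)"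
    using frame_coord[OF lin, of u] l(2) by (intro det_mat_cong) auto
  finally have 1: "ori u (map ?f [0..<?n]) = 1" unfolding det_delta by simp
  have "ori u (map ?f [0..<?n]) = sgn (det_of ?n (\<lambda>i j. g u (?f j) (b i))) * ori u (map b [0..<?n])"
  proof (rule orientation_change[OF ori])
    show "set (map b [0..<?n]) \<subseteq> fib E u" using b by (auto simp: orthonormal_def)
    fix j assume j: "j < ?n"
    show "map ?f [0..<?n] ! j = (\<Sum>l<?n. g u (?f j) (b l) *\<^sub>R map b [0..<?n] ! l)"
      using orthonormal_expand[OF b fin[OF j]] j by simp
  qed auto
  thus False using 1 z by simp
qed

text \<open>Take a smooth orthonormal frame. Its orientation is locally constant by continuity of the
determinant, and if it is negative then the first member of the frame is reversed. A first member
exists in this case, as the empty determinant is positive.\<close>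

lemma compatible_exists:
  assumes ori: "orientation A E ori"
  shows "\<exists>\<tau>. compatible_triv A E g ori \<tau> \<and> u \<in> fst \<tau>"
proof -
  let ?n = "rk E"
  obtain W b where W: "u \<in> W" and of0: "orthoframe W ?n b"
    using orthoframe_extend[OF orthoframe_0[OF open_UNIV], of u undefined] by blast
  have Wo: "open W" using of0 unfolding orthoframe_def by blast
  obtain U \<phi> where l: "local_triv A E (U, \<phi>)" "u \<in> U"
    and o: "\<And>w b. w \<in> U \<Longrightarrow> length b = ?n \<Longrightarrow> set b \<subseteq> fib E w \<Longrightarrow> ori w b = sgn (det_of ?n (\<lambda>i j. \<phi> w (b ! j) i))"
    using ori unfolding orientation_def by meson
  note lin = local_triv_linear[OF l(1)]
  have Uo: "open U" using linear_triv_open[OF lin] by simp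
  let ?W = "U \<inter> W"
  define D where "D = (\<lambda>w. det_of ?n (\<lambda>i j. \<phi> w (b j w) i))"
  have bs: "smooth_section A E W (b j)" if "j < ?n" for j using of0 that unfolding orthoframe_def by blast
  have on: "orthonormal w ?n (\<lambda>i. b i w)" if "w \<in> W" for w using of0 that unfolding orthoframe_def by blast
  have oD: "ori w (map (\<lambda>j. b j w) [0..<?n]) = sgn (D w)" if w: "w \<in> ?W" for w
  proof -
    have "ori w (map (\<lambda>j. b j w) [0..<?n]) = sgn (det_of ?n (\<lambda>i j. \<phi> w (map (\<lambda>j. b j w) [0..<?n] ! j) i))"
      by (rule o) (use w on[of w] in \<open>auto simp: orthonormal_def\<close>)
    also have "det_of ?n (\<lambda>i j. \<phi> w (map (\<lambda>j. b j w) [0..<?n] ! j) i) = D w"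
      unfolding D_def by (rule det_mat_cong) simp
    finally show ?thesis .
  qed
  have Deq: "D w = (\<Sum>p | p permutes {0..<?n}. signof p * (\<Prod>i = 0..<?n. \<phi> w (b (p i) w) i))" for w
  proof -
    have "D w = (\<Sum>p | p permutes {0..<?n}. signof p * (\<Prod>i = 0..<?n. Matrix.mat ?n ?n (\<lambda>(i, j). \<phi> w (b j w) i) $$ (i, p i)))"
      unfolding D_def by (rule det_def') simp
    also have "\<dots> = (\<Sum>p | p permutes {0..<?n}. signof p * (\<Prod>i = 0..<?n. \<phi> w (b (p i) w) i))"
    proof (intro sum.cong refl arg_cong2[of _ _ _ _ "(*)"] prod.cong)
      fix p i assume "p \<in> {p. p permutes {0..<?n}}" "i \<in> {0..<?n}"
      thus "Matrix.mat ?n ?n (\<lambda>(i, j). \<phi> w (b j w) i) $$ (i, p i) = \<phi> w (b (p i) w) i"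
        using permutes_in_image[of p "{0..<?n}" i] by simp
    qed
    finally show ?thesis .
  qed
  have Ds: "smooth_fun A ?W D"
    unfolding Deq[abs_def]
  proof (intro smooth_fun_sum smooth_fun_mult smooth_fun_const smooth_fun_prod open_Int Uo Wo)
    fix p i assume "p \<in> {p. p permutes {0..<?n}}" "i \<in> {0..<?n}"
    hence "i < ?n" "p i < ?n" using permutes_in_image[of p "{0..<?n}" i] by auto
    thus "smooth_fun A (U \<inter> W) (\<lambda>w. \<phi> w (b (p i) w) i)"
      using section_coord[OF vbE bs Wo l(1), of "p i" i] by simp
  qed
  have uW: "u \<in> ?W" using W l by simp
  have sW: "smooth_fun A ?W (\<lambda>w. sgn (D u) * D w)"
    using Ds Uo Wo by (intro smooth_fun_mult smooth_fun_const) auto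
  have Du: "D u \<noteq> 0"
    using orientation_orthonormal_nonzero[OF ori on[OF W]] oD[OF uW] by auto
  hence "sgn (D u) * D u > 0" by (simp add: sgn_if)
  then obtain W' where W': "open W'" "u \<in> W'" "W' \<subseteq> ?W" "\<And>w. w \<in> W' \<Longrightarrow> sgn (D u) * D w > 0"
    using smooth_fun_pos_nbhd[OF open_Int[OF Uo Wo] sW uW] by blast
  have s: "sgn (D w) = sgn (D u)" if "w \<in> W'" for w
    using W'(4)[OF that] Du by (auto simp: sgn_if zero_less_mult_iff split: if_splits)
  have of1: "orthoframe W' ?n b" using of0 W' by (intro orthoframe_subset[OF of0]) auto
  have fin: "\<exists>\<tau>. compatible_triv A E g ori \<tau> \<and> u \<in> fst \<tau>"
    if oc: "orthoframe W' ?n c" and p: "\<And>w. w \<in> W' \<Longrightarrow> ori w (map (\<lambda>j. c j w) [0..<?n]) = 1" for c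
  proof (intro exI[of _ "frame_triv W' c"] conjI)
    have fst: "fst (frame_triv W' c) = W'" by (simp add: frame_triv_def)
    show "u \<in> fst (frame_triv W' c)" using W' fst by simp
    have mapeq: "map (frame E (frame_triv W' c) w) [0..<?n] = map (\<lambda>j. c j w) [0..<?n]" if "w \<in> W'" for w
      using frame_triv(3)[OF oc that] by simp
    have "\<forall>w\<in>W'. ori w (map (frame E (frame_triv W' c) w) [0..<?n]) = 1"
    proof
      fix w assume w: "w \<in> W'"
      show "ori w (map (frame E (frame_triv W' c) w) [0..<?n]) = 1"
        unfolding mapeq[OF w] by (rule p[OF w])
    qed
    thus "compatible_triv A E g ori (frame_triv W' c)"
      unfolding compatible_triv_def fst using frame_triv(1,2)[OF oc] by blast
  qed
  consider "sgn (D u) = 1" | "sgn (D u) = -1" using Du by (cases "D u > 0") (simp_all add: sgn_if)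
  thus ?thesis
  proof cases
    case 1
    have "ori w (map (\<lambda>j. b j w) [0..<?n]) = 1" if "w \<in> W'" for w
      using oD[of w] s[OF that] W'(3) that 1 by auto
    thus ?thesis by (rule fin[OF of1])
  next
    case 2
    have n: "0 < ?n"
    proof (rule ccontr)
      assume "\<not> 0 < ?n"
      hence "D u = 1" unfolding D_def by (simp add: det_dim_zero)
      thus False using 2 by simp
    qed
    define c where "c = (\<lambda>j w. (if j = 0 then - 1 else 1) *\<^sub>R b j w)"
    have on': "orthonormal w ?n (\<lambda>i. b i w)" if "w \<in> W'" for w using of1 that unfolding orthoframe_def by blast
    have cc: "orthonormal w ?n (\<lambda>i. c i w)" if w: "w \<in> W'" for w
      unfolding orthonormal_def
    proof (intro allI impI conjI)
      note ow = on'[OF w]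
      have bin: "b i w \<in> fib E w" if "i < ?n" for i using ow that by (simp add: orthonormal_def)
      fix i assume i: "i < ?n"
      show "c i w \<in> fib E w" unfolding c_def by (rule subspace_scale[OF sub bin[OF i]])
      fix j assume j: "j < ?n"
      have sc: "g w (r *\<^sub>R x) y = r * g w x y" if "x \<in> fib E w" "y \<in> fib E w" for r x y
        using g_lin[OF that(1) subspace_0[OF sub] that(2), of r] g_0[OF that(2)] by simp
      have "g w (c i w) (c j w) = (if i = 0 then - 1 else 1) * ((if j = 0 then - 1 else 1) * g w (b i w) (b j w))"
        unfolding c_def
        using sc[OF bin[OF i] subspace_scale[OF sub bin[OF j]]] sc[OF bin[OF j] bin[OF i]]
          g_sym[OF bin[OF i] subspace_scale[OF sub bin[OF j]]] g_sym[OF bin[OF i] bin[OF j]] by (simp only:)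
      thus "g w (c i w) (c j w) = (if i = j then 1 else 0)"
        using ow i j by (auto simp: orthonormal_def)
    qed
    have oc: "orthoframe W' ?n c"
      unfolding orthoframe_def
    proof (intro conjI allI impI ballI W'(1) cc)
      fix i assume "i < ?n"
      hence "smooth_section A E W' (b i)" using of1 unfolding orthoframe_def by blast
      thus "smooth_section A E W' (c i)"
        unfolding c_def by (intro section_scale[OF vbE W'(1) smooth_fun_const[OF W'(1)]])
    qed
    have "ori w (map (\<lambda>j. c j w) [0..<?n]) = 1" if w: "w \<in> W'" for w
    proof -
      have "ori w (map (\<lambda>j. c j w) [0..<?n]) = sgn (det_of ?n (\<lambda>i j. if i = j then (if j = 0 then - 1 else 1) else 0)) * ori w (map (\<lambda>j. b j w) [0..<?n])"
      proof (rule orientation_change[OF ori])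
        show "set (map (\<lambda>j. b j w) [0..<?n]) \<subseteq> fib E w" using on'[OF w] by (auto simp: orthonormal_def)
        fix j assume j: "j < ?n"
        have "(\<Sum>l<?n. (if l = j then (if j = 0 then - 1 else 1) else 0 :: real) *\<^sub>R map (\<lambda>j. b j w) [0..<?n] ! l) = (\<Sum>l<?n. if l = j then c j w else 0)"
          by (intro sum.cong refl) (auto simp: c_def)
        thus "map (\<lambda>j. c j w) [0..<?n] ! j = (\<Sum>l<?n. (if l = j then (if j = 0 then - 1 else 1) else 0 :: real) *\<^sub>R map (\<lambda>j. b j w) [0..<?n] ! l)"
          using j by simp
      qed auto
      also have "\<dots> = 1" unfolding det_diag_neg[OF n] using oD[of w] s[OF w] W'(3) w 2 by auto
      finally show ?thesis .
    qed
    thus ?thesis by (rule fin[OF oc])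
  qed
qed

end

section \<open>Subbundles and splitting trivializations\<close>

locale subbundle_setup = connection_bundle A E g nabla
  for A :: "('m::{t2_space,second_countable_topology}, 'e::real_inner) chart set"
    and E :: "('m, 'v::real_vector) vbundle" and g :: "'m \<Rightarrow> 'v \<Rightarrow> 'v \<Rightarrow> real" and nabla +
  fixes V :: "('m, 'v) vbundle"
  assumes subb: "subbundle A V E"
begin

lemma vbV: "vector_bundle A V" and V_sub: "fib V u \<subseteq> fib E u"
  and V_frame: "\<tau> \<in> trivs V \<Longrightarrow> j < rk V \<Longrightarrow> smooth_section A E (fst \<tau>) (\<lambda>u. frame V \<tau> u j)"
  using subb unfolding subbundle_def by blast+

lemma V_in_E: "e \<in> fib V u \<Longrightarrow> e \<in> fib E u" using V_sub by blast

text \<open>In local coordinates \<open>s\<close> is a combination, with smooth coefficients, of a frame of \<open>V\<close>, and the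
members of the frame are smooth in \<open>E\<close>.\<close>

lemma section_V_E:
  assumes W: "open W" and s: "smooth_section A V W s"
  shows "smooth_section A E W s"
proof (rule section_local[OF vbE W])
  fix u assume u: "u \<in> W"
  obtain \<tau> where t: "\<tau> \<in> trivs V" "u \<in> fst \<tau>" using triv_exists[OF vbV] by blast
  note l = trivs_local[OF vbV t(1)]
  note lin = local_triv_linear[OF l]
  let ?W = "fst \<tau> \<inter> W"
  have Wo: "open ?W" using W linear_triv_open[OF lin] by blast
  have "smooth_section A E ?W (\<lambda>y. \<Sum>j<rk V. snd \<tau> y (s y) j *\<^sub>R frame V \<tau> y j)"
    using section_coord[OF vbV s W l] section_subset[OF vbE V_frame[OF t(1)], of _ ?W]
    by (intro section_sum[OF vbE Wo]) auto
  hence "smooth_section A E ?W s"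
    by (rule section_cong[OF vbE Wo, rotated])
      (use triv_expand[OF lin _ fib_subspace[OF vbV] section_in[OF vbV s]] in auto)
  thus "\<exists>W'. open W' \<and> u \<in> W' \<and> smooth_section A E W' s" using Wo u t by blast
qed

lemma metric_V: "bundle_metric A V g"
  unfolding bundle_metric_def
proof (intro conjI allI ballI impI)
  fix u e e' assume e: "e \<in> fib V u" "e' \<in> fib V u"
  show "g u e e' = g u e' e" using e V_in_E by (intro g_sym)
  show "g u (a *\<^sub>R e + e') e'' = a * g u e e'' + g u e' e''" if "e'' \<in> fib V u" for a e''
    using e that V_in_E by (intro g_lin)
  show "g u e e > 0" if "e \<noteq> 0" using e that V_in_E by (intro g_pos[of e u e'])
next
  fix W s t assume "open W" "smooth_section A V W s" "smooth_section A V W t"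
  thus "smooth_fun A W (\<lambda>u. g u (s u) (t u))" using section_V_E by (intro g_smooth)
qed

sublocale VB: metric_bundle A V g
  by unfold_locales (rule vbV, rule metric_V)

lemma orthonormal_V_E: "VB.orthonormal u p b \<Longrightarrow> orthonormal u p b"
  unfolding VB.orthonormal_def orthonormal_def using V_in_E by blast

lemma orthoframe_V_E: "VB.orthoframe W p b \<Longrightarrow> orthoframe W p b"
  unfolding VB.orthoframe_def orthoframe_def using orthonormal_V_E section_V_E by blast

lemma V_orthoframe: "\<exists>W b. u \<in> W \<and> VB.orthoframe W (rk V) b"
  using VB.orthoframe_extend[OF VB.orthoframe_0[OF open_UNIV], of u undefined] by blast

text \<open>The coefficients of \<open>s\<close> in an orthonormal frame of \<open>V\<close> are inner products in \<open>E\<close>, hence smooth.\<close>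

lemma section_E_V:
  assumes W: "open W" and s: "smooth_section A E W s" and V: "\<And>y. y \<in> W \<Longrightarrow> s y \<in> fib V y"
  shows "smooth_section A V W s"
proof (rule section_local[OF vbV W])
  fix u assume u: "u \<in> W"
  obtain W' b where W': "u \<in> W'" and ofr: "VB.orthoframe W' (rk V) b" using V_orthoframe by blast
  have Wo': "open W'" and on: "\<And>y. y \<in> W' \<Longrightarrow> VB.orthonormal y (rk V) (\<lambda>i. b i y)"
    and bs: "\<And>i. i < rk V \<Longrightarrow> smooth_section A V W' (b i)"
    using ofr unfolding VB.orthoframe_def by blast+
  let ?W = "W \<inter> W'"
  have Wo: "open ?W" using W Wo' by blast
  have bs': "smooth_section A V ?W (b i)" if "i < rk V" for i using bs[OF that] by (rule section_subset[OF vbV]) simp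
  have "smooth_fun A ?W (\<lambda>y. g y (s y) (b i y))" if "i < rk V" for i
    using section_subset[OF vbE s, of ?W] section_V_E[OF Wo bs'[OF that]] by (intro g_smooth Wo) auto
  hence "smooth_section A V ?W (\<lambda>y. \<Sum>i<rk V. g y (s y) (b i y) *\<^sub>R b i y)"
    using bs' by (intro section_sum[OF vbV Wo]) auto
  hence "smooth_section A V ?W s"
    by (rule section_cong[OF vbV Wo, rotated]) (use VB.orthonormal_expand[OF on V] in auto)
  thus "\<exists>W'. open W' \<and> u \<in> W' \<and> smooth_section A V W' s" using Wo u W' by blast
qed

lemma rk_le: "rk V \<le> rk E"
proof -
  obtain u :: 'm and W b where "u \<in> W" "VB.orthoframe W (rk V) b" using V_orthoframe by blast
  hence "orthonormal u (rk V) (\<lambda>i. b i u)" using orthoframe_V_E unfolding orthoframe_def by blast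
  thus ?thesis by (rule orthonormal_le)
qed

text \<open>By counting dimensions, the members with index below \<open>rk V\<close> span the fiber of \<open>V\<close>; so the other
coordinates vanish exactly on \<open>V\<close>.\<close>

lemma splitting_of_frames:
  assumes ofr: "orthoframe W (rk E) b" and V: "\<And>u i. u \<in> W \<Longrightarrow> i < rk V \<Longrightarrow> b i u \<in> fib V u"
  shows "splitting_triv A E V g (frame_triv W b)"
proof -
  let ?n = "rk E" and ?k = "rk V"
  have fst: "fst (frame_triv W b) = W" and snd: "\<And>u x i. snd (frame_triv W b) u x i = (if i < ?n then g u x (b i u) else 0)"
    by (simp_all add: frame_triv_def)
  have "fib V u = {e \<in> fib E u. \<forall>i\<in>{?k..<?n}. snd (frame_triv W b) u e i = 0}" if u: "u \<in> W" for u
  proof -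
    have on: "orthonormal u ?n (\<lambda>i. b i u)" using ofr u unfolding orthoframe_def by blast
    have onV: "VB.orthonormal u ?k (\<lambda>i. b i u)"
      unfolding VB.orthonormal_def using on V[OF u] rk_le unfolding orthonormal_def by auto
    have bin: "b i u \<in> fib E u" if "i < ?n" for i using on that by (simp add: orthonormal_def)
    have 1: "g u e (b i u) = 0" if e: "e \<in> fib V u" and i: "i \<in> {?k..<?n}" for e i
    proof -
      have "g u e (b i u) = g u (\<Sum>j<?k. g u e (b j u) *\<^sub>R b j u) (b i u)" using VB.orthonormal_expand[OF onV e] by simp
      also have "\<dots> = (\<Sum>j<?k. g u e (b j u) * g u (b j u) (b i u))"
        using bin i rk_le by (intro g_sum) auto
      also have "\<dots> = 0"
      proof (rule sum.neutral, rule ballI)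
        fix j assume "j \<in> {..<?k}"
        hence "j < ?n" "i < ?n" "j \<noteq> i" using i rk_le by auto
        hence "g u (b j u) (b i u) = 0" using on by (simp add: orthonormal_def)
        thus "g u e (b j u) * g u (b j u) (b i u) = 0" by simp
      qed
      finally show ?thesis .
    qed
    have 2: "e \<in> fib V u" if e: "e \<in> fib E u" and z: "\<And>i. i \<in> {?k..<?n} \<Longrightarrow> g u e (b i u) = 0" for e
    proof -
      have "e = (\<Sum>i<?n. g u e (b i u) *\<^sub>R b i u)" by (rule orthonormal_expand[OF on e])
      also have "\<dots> = (\<Sum>i<?k. g u e (b i u) *\<^sub>R b i u)"
        using z rk_le by (intro sum.mono_neutral_right) auto
      also have "\<dots> \<in> fib V u" using V[OF u] by (intro subspace_sum subspace_scale fib_subspace[OF vbV]) auto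
      finally show ?thesis .
    qed
    show ?thesis
    proof (intro Set.set_eqI iffI)
      fix e assume e: "e \<in> fib V u"
      thus "e \<in> {e \<in> fib E u. \<forall>i\<in>{?k..<?n}. snd (frame_triv W b) u e i = 0}"
        using 1[OF e] V_in_E by (simp add: snd)
    next
      fix e assume "e \<in> {e \<in> fib E u. \<forall>i\<in>{?k..<?n}. snd (frame_triv W b) u e i = 0}"
      thus "e \<in> fib V u" using 2[of e] by (simp add: snd)
    qed
  qed
  thus ?thesis unfolding splitting_triv_def fst using frame_triv(1,2)[OF ofr] by blast
qed

lemma splitting_exists: "\<exists>\<tau>. splitting_triv A E V g \<tau> \<and> u \<in> fst \<tau>"
proof -
  obtain W b where W: "u \<in> W" and ofr: "VB.orthoframe W (rk V) b" using V_orthoframe by blast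
  obtain W' b' where W': "W' \<subseteq> W" "u \<in> W'" "orthoframe W' (rk E) b'" "\<forall>i<rk V. b' i = b i"
    using orthoframe_extend[OF orthoframe_V_E[OF ofr] W] by blast
  have "splitting_triv A E V g (frame_triv W' b')"
  proof (rule splitting_of_frames[OF W'(3)])
    fix y i assume "y \<in> W'" "i < rk V"
    thus "b' i y \<in> fib V y" using ofr W' unfolding VB.orthoframe_def VB.orthonormal_def by auto
  qed
  thus ?thesis using W'(2) by (intro exI[of _ "frame_triv W' b'"]) (simp add: frame_triv_def)
qed

lemma splittingD:
  assumes "splitting_triv A E V g \<tau>"
  shows "local_triv A E \<tau>" "orthonormal_triv E g \<tau>"
    "\<And>u. u \<in> fst \<tau> \<Longrightarrow> fib V u = {e \<in> fib E u. \<forall>i\<in>{rk V..<rk E}. snd \<tau> u e i = 0}"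
  using assms unfolding splitting_triv_def by blast+

lemma splitting_frame_V:
  assumes s: "splitting_triv A E V g \<tau>" and u: "u \<in> fst \<tau>" and j: "j < rk V"
  shows "frame E \<tau> u j \<in> fib V u"
proof -
  note lin = local_triv_linear[OF splittingD(1)[OF s]]
  have jn: "j < rk E" using j rk_le by simp
  show ?thesis unfolding splittingD(3)[OF s u] using frame_in[OF lin u jn] frame_coord[OF lin u jn] j by auto
qed

lemma restrict_local:
  assumes s: "splitting_triv A E V g \<tau>"
  shows "local_triv A V (restrict_triv (rk V) \<tau>)"
    and "\<And>u j. u \<in> fst \<tau> \<Longrightarrow> j < rk V \<Longrightarrow> frame V (restrict_triv (rk V) \<tau>) u j = frame E \<tau> u j"
proof -
  let ?k = "rk V" and ?b = "\<lambda>i u. frame E \<tau> u i"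
  note l = splittingD(1)[OF s] and o = splittingD(2)[OF s]
  note lin = local_triv_linear[OF l]
  have W: "open (fst \<tau>)" by (rule linear_triv_open[OF lin])
  have ofE: "orthoframe (fst \<tau>) (rk E) ?b" by (rule orthonormal_triv_frame(1)[OF o l])
  have ofr: "VB.orthoframe (fst \<tau>) ?k ?b"
    unfolding VB.orthoframe_def
  proof (intro conjI allI impI ballI W)
    fix i assume i: "i < ?k"
    hence "i < rk E" using rk_le by simp
    thus "smooth_section A V (fst \<tau>) (?b i)"
      using splitting_frame_V[OF s _ i] by (intro section_E_V[OF W section_frame[OF vbE l]])
  next
    fix u assume u: "u \<in> fst \<tau>"
    hence "orthonormal u (rk E) (\<lambda>i. ?b i u)" using ofE unfolding orthoframe_def by blast
    thus "VB.orthonormal u ?k (\<lambda>i. ?b i u)"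
      unfolding VB.orthonormal_def orthonormal_def using splitting_frame_V[OF s u] rk_le by auto
  qed
  note ft = VB.frame_triv[OF ofr]
  have fst: "fst (restrict_triv ?k \<tau>) = fst (VB.frame_triv (fst \<tau>) ?b)"
    by (simp add: restrict_triv_def VB.frame_triv_def)
  have eq: "snd (restrict_triv ?k \<tau>) u x = snd (VB.frame_triv (fst \<tau>) ?b) u x"
    if "u \<in> fst (VB.frame_triv (fst \<tau>) ?b)" "x \<in> fib V u" for u x
  proof
    fix i
    have "u \<in> fst \<tau>" using that by (simp add: VB.frame_triv_def)
    thus "snd (restrict_triv ?k \<tau>) u x i = snd (VB.frame_triv (fst \<tau>) ?b) u x i"
      using orthonormal_triv_frame(2)[OF o l, of u x i] V_in_E[OF that(2)] rk_le
      by (simp add: restrict_triv_def VB.frame_triv_def)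
  qed
  show "local_triv A V (restrict_triv ?k \<tau>)" by (rule local_triv_cong(1)[OF vbV ft(1) fst eq])
  fix u j assume u: "u \<in> fst \<tau>" and j: "j < ?k"
  have "frame V (restrict_triv ?k \<tau>) u j = frame V (VB.frame_triv (fst \<tau>) ?b) u j"
    by (rule local_triv_cong(2)[OF vbV ft(1) fst eq]) (use u in \<open>simp_all add: VB.frame_triv_def\<close>)
  thus "frame V (restrict_triv ?k \<tau>) u j = frame E \<tau> u j" using ft(3)[OF u j] by simp
qed

section \<open>The constrained connection\<close>

text \<open>The property by which \<open>constraint_involution\<close> is characterized.\<close>

definition is_involution :: "'m \<Rightarrow> ('v \<Rightarrow> 'v) \<Rightarrow> bool" where
  "is_involution u q \<longleftrightarrow>
     (\<forall>e\<in>fib E u. q e \<in> fib E u \<and> q (q e) = e) \<and>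
     (\<forall>e\<in>fib E u. \<forall>e'\<in>fib E u. \<forall>a. q (a *\<^sub>R e + e') = a *\<^sub>R q e + q e') \<and>
     (\<forall>e\<in>fib E u. \<forall>e'\<in>fib E u. g u (q e) (q e') = g u e e') \<and>
     {e \<in> fib E u. q e = - e} = fib V u \<and>
     (\<forall>e. e \<notin> fib E u \<longrightarrow> q e = 0)"

lemma involution_uminus: "is_involution u q \<Longrightarrow> e \<in> fib E u \<Longrightarrow> q (- e) = - q e"
proof -
  assume q: "is_involution u q" and e: "e \<in> fib E u"
  have lin: "q (a *\<^sub>R x + y) = a *\<^sub>R q x + q y" if "x \<in> fib E u" "y \<in> fib E u" for a x y
    using q that unfolding is_involution_def by blast
  have 0: "0 \<in> fib E u" by (rule subspace_0[OF sub])
  have q0: "q 0 = 0" using lin[OF 0 0, of "-1"] by simp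
  show ?thesis using lin[OF e 0, of "-1"] q0 by simp
qed

text \<open>The difference \<open>e - q e\<close> lies in \<open>V\<close>, and it is orthogonal to \<open>V\<close> because \<open>e\<close> is and \<open>q\<close> is orthogonal.\<close>

lemma involution_fixes_complement:
  assumes q: "is_involution u q" and e: "e \<in> fib E u" and perp: "\<And>v. v \<in> fib V u \<Longrightarrow> g u e v = 0"
  shows "q e = e"
proof -
  have qe: "q e \<in> fib E u" "q (q e) = e" using q e unfolding is_involution_def by blast+
  have lin: "q (a *\<^sub>R x + y) = a *\<^sub>R q x + q y" if "x \<in> fib E u" "y \<in> fib E u" for a x y
    using q that unfolding is_involution_def by blast
  let ?d = "(-1) *\<^sub>R q e + e"
  have d: "?d \<in> fib E u" using e qe by (intro subspace_add subspace_scale sub)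
  have "q ?d = - ?d" using lin[OF qe(1) e, of "-1"] qe(2) by simp
  hence dV: "?d \<in> fib V u" using q d unfolding is_involution_def by blast
  hence qd: "q ?d = - ?d" using q unfolding is_involution_def by blast
  have gm: "g u (- x) y = - g u x y" if "x \<in> fib E u" "y \<in> fib E u" for x y
    using g_lin[OF that(1) subspace_0[OF sub] that(2), of "-1"] g_0[OF that(2)] by simp
  have "g u (q e) ?d = g u (q (q e)) (q ?d)"
    using q qe(1) d unfolding is_involution_def by (metis (no_types, lifting))
  also have "\<dots> = g u e (- ?d)" unfolding qe(2) qd ..
  also have "\<dots> = - g u e ?d"
  proof -
    have nd: "- ?d \<in> fib E u" using d by (rule subspace_neg[OF sub])
    show ?thesis using g_sym[OF e nd] g_sym[OF e d] gm[OF d e] by simp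
  qed
  finally have "g u (q e) ?d = 0" using perp[OF dV] by simp
  hence "g u ?d ?d = 0" using g_lin[OF qe(1) e d, of "-1"] perp[OF dV] by simp
  hence "?d = 0" using g_pos[OF d d] by fastforce
  thus ?thesis by simp
qed

text \<open>The involution is \<open>1 - 2P\<close> for the orthogonal projection \<open>P\<close> to \<open>V\<close>.\<close>

lemma involution_unique_exists: "\<exists>!q. is_involution u q"
proof -
  let ?k = "rk V"
  obtain W b where "u \<in> W" and ofr: "VB.orthoframe W ?k b" using V_orthoframe by blast
  hence onV: "VB.orthonormal u ?k (\<lambda>i. b i u)" unfolding VB.orthoframe_def by blast
  have bV: "b i u \<in> fib V u" if "i < ?k" for i using onV that by (simp add: VB.orthonormal_def)
  have bE: "b i u \<in> fib E u" if "i < ?k" for i using bV[OF that] by (rule V_in_E)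
  \<comment> \<open>The orthogonal projection to \<open>V\<close>.\<close>
  define P where "P = (\<lambda>e. \<Sum>i<?k. g u e (b i u) *\<^sub>R b i u)"
  have PV: "P e \<in> fib V u" for e unfolding P_def using bV by (intro subspace_sum subspace_scale fib_subspace[OF vbV]) auto
  have PE: "P e \<in> fib E u" for e using PV by (rule V_in_E)
  have Pfix: "P e = e" if "e \<in> fib V u" for e unfolding P_def using VB.orthonormal_expand[OF onV that] by simp
  have Plin: "P (a *\<^sub>R x + y) = a *\<^sub>R P x + P y" if "x \<in> fib E u" "y \<in> fib E u" for a x y
    unfolding P_def using that bE
    by (simp add: g_lin scaleR_sum_right scaleR_left_distrib sum.distrib)
  have Psym: "g u (P x) y = (\<Sum>i<?k. g u x (b i u) * g u y (b i u))" if "y \<in> fib E u" for x y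
  proof -
    have "g u (P x) y = (\<Sum>i<?k. g u x (b i u) * g u (b i u) y)"
      unfolding P_def using bE that by (intro g_sum) auto
    thus ?thesis using g_sym[OF bE that] by simp
  qed
  have Padj: "g u (P x) y = g u x (P y)" if "x \<in> fib E u" "y \<in> fib E u" for x y
    using Psym[OF that(2), of x] Psym[OF that(1), of y] g_sym[OF that(1) PE] by (simp add: mult.commute)
  define q where "q = (\<lambda>e. if e \<in> fib E u then (-2) *\<^sub>R P e + e else 0)"
  have qE: "q e \<in> fib E u" if "e \<in> fib E u" for e
    unfolding q_def using that PE by (simp add: subspace_add subspace_scale sub del: scaleR_minus_left)
  have PP: "P (P e) = P e" for e using PV by (rule Pfix)
  have Pq: "P (q e) = - P e" if e: "e \<in> fib E u" for e
  proof -
    have "P (q e) = (-2) *\<^sub>R P (P e) + P e" unfolding q_def using e Plin[OF PE e, of "-2" e] by simp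
    also have "\<dots> = (-2 + 1) *\<^sub>R P e" unfolding PP by (simp only: scaleR_left_distrib scaleR_one)
    finally show ?thesis by simp
  qed
  have inv: "is_involution u q"
    unfolding is_involution_def
  proof (intro conjI ballI allI impI)
    fix e assume e: "e \<in> fib E u"
    show "q e \<in> fib E u" by (rule qE[OF e])
    have "q (q e) = (-2) *\<^sub>R P (q e) + q e" using qE[OF e] by (simp add: q_def)
    also have "\<dots> = e" unfolding Pq[OF e] using e by (simp add: q_def)
    finally show "q (q e) = e" .
  next
    fix e e' a assume e: "e \<in> fib E u" "e' \<in> fib E u"
    have s: "a *\<^sub>R e + e' \<in> fib E u" using e by (intro subspace_add subspace_scale sub)
    show "q (a *\<^sub>R e + e') = a *\<^sub>R q e + q e'"
      unfolding q_def using e s Plin[OF e] by (simp add: algebra_simps)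
  next
    fix e e' assume e: "e \<in> fib E u" "e' \<in> fib E u"
    have "g u (q e) (q e') = -2 * g u (P e) (q e') + g u e (q e')"
      using g_lin[OF PE e(1) qE[OF e(2)], of "-2" e] e by (simp add: q_def)
    also have "g u (P e) (q e') = g u e (- P e')" using Padj[OF e(1) qE[OF e(2)]] Pq[OF e(2)] by simp
    also have "g u e (- P e') = - g u e (P e')"
      using g_lin[OF PE subspace_0[OF sub] e(1), of "-1" e'] g_0[OF e(1)] g_sym[OF e(1) PE] g_sym[OF e(1) subspace_neg[OF sub PE]] by simp
    also have "g u e (q e') = -2 * g u e (P e') + g u e e'"
      using g_lin[OF PE e(2) e(1), of "-2" e'] g_sym[OF e(1) qE[OF e(2)]] g_sym[OF e(1) PE] g_sym[OF e] e by (simp add: q_def)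
    finally show "g u (q e) (q e') = g u e e'" by simp
  next
    show "{e \<in> fib E u. q e = - e} = fib V u"
    proof (intro Set.set_eqI iffI)
      fix e assume "e \<in> {e \<in> fib E u. q e = - e}"
      hence e: "e \<in> fib E u" and "(-2) *\<^sub>R P e + e = - e" by (auto simp: q_def)
      hence "2 *\<^sub>R P e = 2 *\<^sub>R e" by (simp add: scaleR_2 algebra_simps)
      hence "P e = e" by simp
      thus "e \<in> fib V u" using PV[of e] by simp
    next
      fix e assume e: "e \<in> fib V u"
      show "e \<in> {e \<in> fib E u. q e = - e}" using V_in_E[OF e] Pfix[OF e] by (simp add: q_def scaleR_2)
    qed
  next
    fix e assume "e \<notin> fib E u" thus "q e = 0" by (simp add: q_def)
  qed
  have uniq: "q' = q" if q': "is_involution u q'" for q'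
  proof
    fix e
    show "q' e = q e"
    proof (cases "e \<in> fib E u")
      case True
      have form: "r e = (-1) *\<^sub>R P e + (e - P e)" if r: "is_involution u r" for r
      proof -
        let ?d = "(-1) *\<^sub>R P e + e"
        have d: "?d \<in> fib E u" using PE True by (intro subspace_add subspace_scale sub)
        have "r (1 *\<^sub>R P e + ?d) = 1 *\<^sub>R r (P e) + r ?d" using r PE d unfolding is_involution_def by blast
        moreover have "r (P e) = - P e" using r PV unfolding is_involution_def by blast
        moreover have "r ?d = ?d"
        proof (rule involution_fixes_complement[OF r d])
          fix v assume v: "v \<in> fib V u"
          have vE: "v \<in> fib E u" using v by (rule V_in_E)
          have "g u ?d v = - g u (P e) v + g u e v" using g_lin[OF PE True vE, of "-1"] by simp
          also have "g u (P e) v = g u e v" using Padj[OF True vE] Pfix[OF v] by simp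
          finally show "g u ?d v = 0" by simp
        qed
        ultimately show ?thesis by simp
      qed
      show ?thesis using form[OF q'] form[OF inv] by simp
    qed (use q' inv in \<open>simp add: is_involution_def\<close>)
  qed
  show ?thesis using inv uniq by blast
qed

lemma constraint_involution: "is_involution u (constraint_involution E V g u)"
  unfolding constraint_involution_def using theI'[OF involution_unique_exists[of u]] unfolding is_involution_def .

abbreviation "nablaV \<equiv> constrained_connection E V g nabla"

text \<open>On sections of \<open>V\<close> one has \<open>Q s = - s\<close>, so \<open>\<nabla>\<^sub>Q s = (\<nabla>s - Q \<nabla>s) / 2\<close>, which is the orthogonal projection of
\<open>\<nabla>s\<close> to \<open>V\<close>.\<close>

lemma constrained_connection_inner:
  assumes W: "open W" and s: "smooth_section A E W s" and sV: "\<And>y. y \<in> W \<Longrightarrow> s y \<in> fib V y"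
    and u: "u \<in> W" and v: "v \<in> tangent_space A u"
  shows "nablaV s u v \<in> fib V u" and "\<And>f. f \<in> fib V u \<Longrightarrow> g u (nablaV s u v) f = g u (nabla s u v) f"
proof -
  let ?Q = "constraint_involution E V g"
  let ?x = "nabla s u v"
  note q = constraint_involution[of u]
  have Qs: "?Q y (s y) = (-1) *\<^sub>R s y" if "y \<in> W" for y
    using constraint_involution[of y] sV[OF that] unfolding is_involution_def by auto
  have s': "smooth_section A E W (\<lambda>y. (-1) *\<^sub>R s y)"
    by (rule section_scale[OF vbE W smooth_fun_const[OF W] s])
  have s'': "smooth_section A E W (\<lambda>y. ?Q y (s y))"
    by (rule section_cong[OF vbE W _ s']) (simp add: Qs)
  have "nabla (\<lambda>y. ?Q y (s y)) u v = nabla (\<lambda>y. (-1) *\<^sub>R s y) u v"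
    using Qs by (rule nabla_cong[OF W s'' u v s'])
  also have "\<dots> = - ?x"
    using nabla_scale[OF W s u v smooth_fun_const[OF W, of "-1"]] by (simp add: tangent_const[OF v])
  finally have n: "nabla (\<lambda>y. ?Q y (s y)) u v = - ?x" .
  have x: "?x \<in> fib E u" by (rule nabla_in[OF W s u v])
  have qx: "?Q u ?x \<in> fib E u" "?Q u (?Q u ?x) = ?x" using q x unfolding is_involution_def by blast+
  have lin: "?Q u (a *\<^sub>R y + z) = a *\<^sub>R ?Q u y + ?Q u z" if "y \<in> fib E u" "z \<in> fib E u" for a y z
    using q that unfolding is_involution_def by blast
  have "nablaV s u v = (1/2) *\<^sub>R (?x + ?Q u (- ?x))"
    unfolding constrained_connection_def Let_def n ..
  hence c: "nablaV s u v = (1/2) *\<^sub>R ?x + (-1/2) *\<^sub>R ?Q u ?x"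
    unfolding involution_uminus[OF q x] by (simp add: scaleR_right_diff_distrib)
  have half: "(-1/2) *\<^sub>R ?Q u ?x \<in> fib E u" using qx(1) by (rule subspace_scale[OF sub])
  have E: "nablaV s u v \<in> fib E u" unfolding c by (rule subspace_add[OF sub subspace_scale[OF sub x] half])
  have "?Q u ((-1/2) *\<^sub>R ?Q u ?x) = (-1/2) *\<^sub>R ?x"
    using lin[OF qx(1) subspace_0[OF sub], of "-1/2"] lin[OF subspace_0[OF sub] subspace_0[OF sub], of "-1"] qx(2) by simp
  hence "?Q u (nablaV s u v) = (1/2) *\<^sub>R ?Q u ?x + (-1/2) *\<^sub>R ?x"
    unfolding c lin[OF x half] by simp
  also have "\<dots> = - nablaV s u v" unfolding c by simp
  finally show "nablaV s u v \<in> fib V u" using q E unfolding is_involution_def by blast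
  fix f assume f: "f \<in> fib V u"
  have fE: "f \<in> fib E u" using f by (rule V_in_E)
  have qf: "?Q u f = - f" using q f unfolding is_involution_def by blast
  have "g u (?Q u ?x) f = g u (?Q u (?Q u ?x)) (?Q u f)"
    using q qx(1) fE unfolding is_involution_def by (metis (no_types, lifting))
  also have "\<dots> = g u ?x (- f)" unfolding qx(2) qf ..
  also have "\<dots> = - g u ?x f"
    using g_lin[OF fE subspace_0[OF sub] x, of "-1"] g_0[OF x] g_sym[OF x fE] g_sym[OF x subspace_neg[OF sub fE]] by simp
  finally have gq: "g u (?Q u ?x) f = - g u ?x f" .
  have "g u (nablaV s u v) f = (1/2) * g u ?x f + g u ((-1/2) *\<^sub>R ?Q u ?x) f"
    unfolding c by (rule g_lin[OF x half fE])
  also have "g u ((-1/2) *\<^sub>R ?Q u ?x) f = (-1/2) * g u (?Q u ?x) f"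
    using g_lin[OF qx(1) subspace_0[OF sub] fE, of "-1/2"] g_0[OF fE] by simp
  finally show "g u (nablaV s u v) f = g u ?x f" unfolding gq by simp
qed

lemmas subV = fib_subspace[OF vbV]

text \<open>Together with \<open>nablaV_inner\<close> this reduces every identity for the constrained connection to the
corresponding one for \<open>\<nabla>\<close>.\<close>

lemma V_inner_eqI:
  assumes x: "x \<in> fib V u" and y: "y \<in> fib V u" and eq: "\<And>f. f \<in> fib V u \<Longrightarrow> g u x f = g u y f"
  shows "x = y"
proof (rule ccontr)
  assume ne: "x \<noteq> y"
  let ?z = "(-1) *\<^sub>R y + x"
  have z: "?z \<in> fib V u" by (rule subspace_add[OF subV subspace_scale[OF subV y] x])
  have "g u ?z ?z = (-1) * g u y ?z + g u x ?z" by (rule VB.g_lin[OF y x z])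
  hence "g u ?z ?z = 0" using eq[OF z] by simp
  moreover have "?z \<noteq> 0" using ne by simp
  ultimately show False using VB.g_pos[OF z z] by simp
qed

lemma nablaV_inner:
  assumes "open W" "smooth_section A V W s" "u \<in> W" "v \<in> tangent_space A u"
  shows "nablaV s u v \<in> fib V u" and "\<And>f. f \<in> fib V u \<Longrightarrow> g u (nablaV s u v) f = g u (nabla s u v) f"
  using constrained_connection_inner[OF assms(1) section_V_E[OF assms(1,2)] section_in[OF vbV assms(2)] assms(3,4)]
  by blast+

lemma nablaV_smooth:
  assumes W: "open W" and s: "smooth_section A V W s" and c: "c \<in> A"
  shows "smooth_section A V (fst c \<inter> W) (\<lambda>y. nablaV s y (coord_vec A c y w))"
proof (rule section_local[OF vbV])
  show o: "open (fst c \<inter> W)" using W chart_open[OF c] by blast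
  fix y0 assume y0: "y0 \<in> fst c \<inter> W"
  obtain W0 b where W0: "y0 \<in> W0" and ofr: "VB.orthoframe W0 (rk V) b" using V_orthoframe by blast
  have W0o: "open W0" using ofr unfolding VB.orthoframe_def by blast
  let ?W = "W0 \<inter> (fst c \<inter> W)"
  have Wo: "open ?W" using o W0o by blast
  have bV: "smooth_section A V ?W (b i)" if "i < rk V" for i
    using ofr that section_subset[OF vbV, of W0 "b i" ?W] unfolding VB.orthoframe_def by blast
  have nE: "smooth_section A E ?W (\<lambda>y. nabla s y (coord_vec A c y w))"
    by (rule section_subset[OF vbE nabla_smooth[OF W section_V_E[OF W s] c]]) blast
  have sm: "smooth_section A V ?W (\<lambda>y. \<Sum>i<rk V. g y (nabla s y (coord_vec A c y w)) (b i y) *\<^sub>R b i y)"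
    using bV section_V_E[OF Wo bV] by (intro section_sum[OF vbV Wo] g_smooth[OF Wo nE]) auto
  have eq: "(\<Sum>i<rk V. g y (nabla s y (coord_vec A c y w)) (b i y) *\<^sub>R b i y) = nablaV s y (coord_vec A c y w)"
    if y: "y \<in> ?W" for y
  proof -
    have v: "coord_vec A c y w \<in> tangent_space A y" using y by (intro coord_vec_tangent[OF c]) blast
    have yW: "y \<in> W" using y by blast
    have on: "VB.orthonormal y (rk V) (\<lambda>i. b i y)" using ofr y unfolding VB.orthoframe_def by blast
    note n = nablaV_inner[OF W s yW v]
    have "nablaV s y (coord_vec A c y w) = (\<Sum>i<rk V. g y (nablaV s y (coord_vec A c y w)) (b i y) *\<^sub>R b i y)"
      by (rule VB.orthonormal_expand[OF on n(1)])
    also have "\<dots> = (\<Sum>i<rk V. g y (nabla s y (coord_vec A c y w)) (b i y) *\<^sub>R b i y)"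
    proof (intro sum.cong refl)
      fix i assume "i \<in> {..<rk V}"
      hence "b i y \<in> fib V y" using on by (simp add: VB.orthonormal_def)
      thus "g y (nablaV s y (coord_vec A c y w)) (b i y) *\<^sub>R b i y = g y (nabla s y (coord_vec A c y w)) (b i y) *\<^sub>R b i y"
        by (simp only: n(2))
    qed
    finally show ?thesis ..
  qed
  have "smooth_section A V ?W (\<lambda>y. nablaV s y (coord_vec A c y w))"
    by (rule section_cong[OF vbV Wo eq sm])
  thus "\<exists>W'. open W' \<and> y0 \<in> W' \<and> smooth_section A V W' (\<lambda>y. nablaV s y (coord_vec A c y w))"
    using Wo W0 y0 by blast
qed

lemma constrained_connection: "connection A V nablaV"
  unfolding connection_def
proof (intro allI impI conjI ballI)
  fix W s assume W: "open W" and s: "smooth_section A V W s"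
  note sE = section_V_E[OF W s]
  {
    fix c w assume "c \<in> A"
    thus "smooth_section A V (fst c \<inter> W) (\<lambda>y. nablaV s y (coord_vec A c y w))" by (rule nablaV_smooth[OF W s])
  next
    fix u v assume u: "u \<in> W" and v: "v \<in> tangent_space A u"
    note n = nablaV_inner[OF W s u v] and N = nabla_in[OF W sE u v]
    show "nablaV s u v \<in> fib V u" by (rule n(1))
    {
      fix v' a assume v': "v' \<in> tangent_space A u"
      note vv = tangent_combination[OF v v', of a]
      note n' = nablaV_inner[OF W s u v'] and N' = nabla_in[OF W sE u v'] and n'' = nablaV_inner[OF W s u vv]
      show "nablaV s u (\<lambda>f. a * v f + v' f) = a *\<^sub>R nablaV s u v + nablaV s u v'"
      proof (rule V_inner_eqI[OF n''(1) subspace_add[OF subV subspace_scale[OF subV n(1)] n'(1)]])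
        fix f assume f: "f \<in> fib V u"
        show "g u (nablaV s u (\<lambda>f. a * v f + v' f)) f = g u (a *\<^sub>R nablaV s u v + nablaV s u v') f"
          unfolding n''(2)[OF f] nabla_vlin[OF W sE u v v'] VB.g_lin[OF n(1) n'(1) f] g_lin[OF N N' V_in_E[OF f]]
            n(2)[OF f] n'(2)[OF f] ..
      qed
    next
      fix t assume t: "smooth_section A V W t"
      note tE = section_V_E[OF W t]
      note n' = nablaV_inner[OF W t u v] and N' = nabla_in[OF W tE u v]
      have st: "smooth_section A V W (\<lambda>y. s y + t y)"
        using section_add_scale[OF vbV W smooth_fun_const[OF W, of 1] s t] by simp
      note n'' = nablaV_inner[OF W st u v]
      show "nablaV (\<lambda>y. s y + t y) u v = nablaV s u v + nablaV t u v"
      proof (rule V_inner_eqI[OF n''(1) subspace_add[OF subV n(1) n'(1)]])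
        fix f assume f: "f \<in> fib V u"
        show "g u (nablaV (\<lambda>y. s y + t y) u v) f = g u (nablaV s u v + nablaV t u v) f"
          unfolding n''(2)[OF f] nabla_add[OF W sE u v tE]
          using VB.g_lin[OF n(1) n'(1) f, of 1] g_lin[OF N N' V_in_E[OF f], of 1] n(2)[OF f] n'(2)[OF f] by simp
      qed
      assume eq: "\<forall>y\<in>W. s y = t y"
      show "nablaV s u v = nablaV t u v"
      proof (rule V_inner_eqI[OF n(1) n'(1)])
        fix f assume f: "f \<in> fib V u"
        have "nabla s u v = nabla t u v" by (rule nabla_cong[OF W sE u v tE]) (use eq in blast)
        thus "g u (nablaV s u v) f = g u (nablaV t u v) f" unfolding n(2)[OF f] n'(2)[OF f] by simp
      qed
    next
      fix h assume h: "smooth_fun A W h"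
      note sh = section_scale[OF vbV W h s] and su = section_in[OF vbV s u]
      note n' = nablaV_inner[OF W sh u v]
      have hn: "h u *\<^sub>R nablaV s u v \<in> fib V u" "h u *\<^sub>R nabla s u v \<in> fib E u"
        by (rule subspace_scale[OF subV n(1)], rule subspace_scale[OF sub N])
      show "nablaV (\<lambda>y. h y *\<^sub>R s y) u v = v h *\<^sub>R s u + h u *\<^sub>R nablaV s u v"
      proof (rule V_inner_eqI[OF n'(1) subspace_add[OF subV subspace_scale[OF subV su] hn(1)]])
        fix f assume f: "f \<in> fib V u"
        note fE = V_in_E[OF f] and z = subspace_0[OF subV, of u]
        have 1: "g u (h u *\<^sub>R nablaV s u v) f = h u * g u (nablaV s u v) f"
          using VB.g_lin[OF n(1) z f, of "h u"] VB.g_0[OF f] by simp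
        have 2: "g u (h u *\<^sub>R nabla s u v) f = h u * g u (nabla s u v) f"
          using g_lin[OF N V_in_E[OF z] fE, of "h u"] g_0[OF fE] by simp
        show "g u (nablaV (\<lambda>y. h y *\<^sub>R s y) u v) f = g u (v h *\<^sub>R s u + h u *\<^sub>R nablaV s u v) f"
          unfolding n'(2)[OF f] nabla_scale[OF W sE u v h] VB.g_lin[OF su hn(1) f] g_lin[OF V_in_E[OF su] hn(2) fE] 1 2
            n(2)[OF f] ..
      qed
    }
  }
qed

sublocale VC: connection_bundle A V g nablaV
proof
  show "metric_connection A V g nablaV"
    unfolding metric_connection_def
  proof (intro conjI constrained_connection allI impI ballI)
    fix W s t u v assume W: "open W" and s: "smooth_section A V W s" and t: "smooth_section A V W t"
      and u: "u \<in> W" and v: "v \<in> tangent_space A u"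
    note sE = section_V_E[OF W s] and tE = section_V_E[OF W t]
    note su = section_in[OF vbV s u] and tu = section_in[OF vbV t u]
    note n = nablaV_inner[OF W s u v] and n' = nablaV_inner[OF W t u v]
    show "v (\<lambda>y. g y (s y) (t y)) = g u (nablaV s u v) (t u) + g u (s u) (nablaV t u v)"
      unfolding nabla_metric[OF W sE tE u v] n(2)[OF tu] VB.g_sym[OF su n'(1)] n'(2)[OF su]
        g_sym[OF V_in_E[OF su] nabla_in[OF W tE u v]] ..
  qed
qed

section \<open>The Gauss equation in a splitting trivialization\<close>

lemma restrict_orthonormal:
  assumes s: "splitting_triv A E V g \<tau>"
  shows "orthonormal_triv V g (restrict_triv (rk V) \<tau>)"
  unfolding orthonormal_triv_def
proof (intro ballI)
  fix u e assume u: "u \<in> fst (restrict_triv (rk V) \<tau>)" and e: "e \<in> fib V u"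
  have u': "u \<in> fst \<tau>" using u by (simp add: restrict_triv_def)
  have "g u e e = (\<Sum>i<rk E. (snd \<tau> u e i)\<^sup>2)"
    using splittingD(2)[OF s] u' V_in_E[OF e] unfolding orthonormal_triv_def by blast
  also have "\<dots> = (\<Sum>i<rk V. (snd \<tau> u e i)\<^sup>2)"
    using rk_le e splittingD(3)[OF s u'] by (intro sum.mono_neutral_right) auto
  finally show "g u e e = (\<Sum>i<rk V. (snd (restrict_triv (rk V) \<tau>) u e i)\<^sup>2)"
    by (simp add: restrict_triv_def)
qed

lemma conn_form_restrict:
  assumes s: "splitting_triv A E V g \<tau>" and u: "u \<in> fst \<tau>" and ij: "i < rk V" "j < rk V" and v: "v \<in> tangent_space A u"
  shows "conn_form V nablaV (restrict_triv (rk V) \<tau>) i j u v = \<theta> \<tau> i j u v"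
proof -
  let ?\<rho> = "restrict_triv (rk V) \<tau>"
  have fst: "fst ?\<rho> = fst \<tau>" by (simp add: restrict_triv_def)
  note l = splittingD(1)[OF s]
  have W: "open (fst \<tau>)" by (rule linear_triv_open[OF local_triv_linear[OF l]])
  have ijE: "i < rk E" "j < rk E" using ij rk_le by auto
  have sV: "smooth_section A V (fst \<tau>) (\<lambda>y. frame V ?\<rho> y j)"
    using section_frame[OF vbV restrict_local(1)[OF s] ij(2)] unfolding fst .
  have sE: "smooth_section A E (fst \<tau>) (\<lambda>y. frame E \<tau> y j)" by (rule section_frame[OF vbE l ijE(2)])
  note n = nablaV_inner[OF W sV u v]
  note o = orthonormal_triv_frame(2)[OF splittingD(2)[OF s] l u _ ijE(1)]
  have eq: "nabla (\<lambda>y. frame V ?\<rho> y j) u v = nabla (\<lambda>y. frame E \<tau> y j) u v"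
    by (rule nabla_cong[OF W section_V_E[OF W sV] u v sE]) (rule restrict_local(2)[OF s _ ij(2)])
  have "conn_form V nablaV ?\<rho> i j u v = g u (nablaV (\<lambda>y. frame V ?\<rho> y j) u v) (frame E \<tau> u i)"
    using ij(1) o[OF V_in_E[OF n(1)]] by (simp add: conn_form_def restrict_triv_def)
  also have "\<dots> = g u (nabla (\<lambda>y. frame E \<tau> y j) u v) (frame E \<tau> u i)"
    unfolding n(2)[OF splitting_frame_V[OF s u ij(1)]] eq ..
  also have "\<dots> = \<theta> \<tau> i j u v"
    using o[OF nabla_in[OF W sE u v]] by (simp add: conn_form_def)
  finally show ?thesis .
qed

text \<open>The Gauss equation. The exterior derivatives agree since the connection forms do; the additional
terms are those of \<open>\<theta>\<theta>\<close> with an intermediate index \<open>p\<close> in the complement, rewritten by antisymmetry of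
\<open>\<theta>\<close>.\<close>

lemma curv_form_restrict:
  assumes s: "splitting_triv A E V g \<tau>" and u: "u \<in> fst \<tau>" and ij: "i < rk V" "j < rk V"
    and v: "v \<in> tangent_space A u" and w: "w \<in> tangent_space A u"
  shows "curv_form A E nabla \<tau> i j u v w = curv_form A V nablaV (restrict_triv (rk V) \<tau>) i j u v w
    - (\<Sum>p\<in>{rk V..<rk E}. \<theta> \<tau> i p u v * \<theta> \<tau> j p u w - \<theta> \<tau> i p u w * \<theta> \<tau> j p u v)"
proof -
  let ?\<rho> = "restrict_triv (rk V) \<tau>"
  note l = splittingD(1)[OF s]
  have W: "open (fst \<tau>)" by (rule linear_triv_open[OF local_triv_linear[OF l]])
  have ijE: "i < rk E" "j < rk E" using ij rk_le by auto
  have d: "ext_deriv A (conn_form V nablaV ?\<rho> i j) u v w = ext_deriv A (\<theta> \<tau> i j) u v w"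
    by (rule ext_deriv_cong[OF W u conn_form_restrict[OF s _ ij] v w])
  have un: "{..<rk E} = {..<rk V} \<union> {rk V..<rk E}" using rk_le by auto
  have "(\<Sum>l<rk E. \<theta> \<tau> i l u v * \<theta> \<tau> l j u w - \<theta> \<tau> i l u w * \<theta> \<tau> l j u v) =
     (\<Sum>l<rk V. \<theta> \<tau> i l u v * \<theta> \<tau> l j u w - \<theta> \<tau> i l u w * \<theta> \<tau> l j u v)
     + (\<Sum>p\<in>{rk V..<rk E}. \<theta> \<tau> i p u v * \<theta> \<tau> p j u w - \<theta> \<tau> i p u w * \<theta> \<tau> p j u v)"
    unfolding un by (rule sum.union_disjoint) auto
  also have "(\<Sum>l<rk V. \<theta> \<tau> i l u v * \<theta> \<tau> l j u w - \<theta> \<tau> i l u w * \<theta> \<tau> l j u v) =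
      (\<Sum>l<rk V. conn_form V nablaV ?\<rho> i l u v * conn_form V nablaV ?\<rho> l j u w
        - conn_form V nablaV ?\<rho> i l u w * conn_form V nablaV ?\<rho> l j u v)"
    using conn_form_restrict[OF s u] ij v w by (intro sum.cong refl) simp
  also have "(\<Sum>p\<in>{rk V..<rk E}. \<theta> \<tau> i p u v * \<theta> \<tau> p j u w - \<theta> \<tau> i p u w * \<theta> \<tau> p j u v) =
      (\<Sum>p\<in>{rk V..<rk E}. - (\<theta> \<tau> i p u v * \<theta> \<tau> j p u w - \<theta> \<tau> i p u w * \<theta> \<tau> j p u v))"
  proof (intro sum.cong refl)
    fix p assume "p \<in> {rk V..<rk E}"
    hence p: "p < rk E" by simp
    have "\<theta> \<tau> p j u x = - \<theta> \<tau> j p u x" if "x \<in> tangent_space A u" for x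
      by (rule conn_form_antisym[OF splittingD(2)[OF s] l u p ijE(2) that])
    from this[OF v] this[OF w]
    show "\<theta> \<tau> i p u v * \<theta> \<tau> p j u w - \<theta> \<tau> i p u w * \<theta> \<tau> p j u v =
       - (\<theta> \<tau> i p u v * \<theta> \<tau> j p u w - \<theta> \<tau> i p u w * \<theta> \<tau> j p u v)" by simp
  qed
  finally show ?thesis unfolding curv_form_def Let_def d sum_negf by simp
qed

lemma curv_form_zero_vec:
  assumes l: "local_triv A E \<tau>" "u \<in> fst \<tau>" and ij: "i < rk E" "j < rk E" and v: "v \<in> tangent_space A u"
  shows "curv_form A E nabla \<tau> i j u v (\<lambda>f. 0) = 0"
proof -
  have "ext_deriv A (\<theta> \<tau> i j) u v (\<lambda>f. 0) = 0"
    by (rule ext_deriv_zero_vec[OF linear_triv_open[OF local_triv_linear[OF l(1)]] l(2) _ v])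
      (rule conn_form_zero_vec[OF l(1) _ ij(2)])
  thus ?thesis unfolding curv_form_def Let_def using conn_form_zero_vec[OF l] ij(2) by simp
qed

end

section \<open>Fiber integration in a splitting trivialization\<close>

context subbundle_setup
begin

text \<open>The theorem for local expressions in a splitting trivialization. Inserting the lifted and the
vertical vectors identifies the integrand, up to scalar factors, with the left-hand side of
\<open>mq_gaussian\<close>. The other two claims let the integrand be computed in a different trivialization.\<close>

lemma TMQ_local_integral:
  fixes ts :: "('m, 'v) ttvec list"
  assumes s: "splitting_triv A E V g \<tau>" and u: "u \<in> fst \<tau>" and e: "e \<in> fib V u"
    and ts: "set ts \<subseteq> total_tangent A V u e"
  defines "k \<equiv> rk V" and "n \<equiv> rk E"
  defines "pt \<equiv> \<lambda>y. e + (\<Sum>j\<in>{k..<n}. y j *\<^sub>R frame E \<tau> u j)"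
  defines "lift \<equiv> \<lambda>y t. tangent_vec A E u (pt y) \<tau> (fst t) (\<lambda>i. if i < k then snd t (restrict_triv k \<tau>) i else 0)"
    and "vert \<equiv> \<lambda>y j. tangent_vec A E u (pt y) \<tau> (\<lambda>f. 0) (\<lambda>i. if i = j then 1 else 0)"
  shows "(\<integral>y. TMQ_local A E nabla \<tau> u (pt y) (map (lift y) ts @ map (vert y) [k..<n]) \<partial>(\<Pi>\<^sub>M j\<in>{k..<n}. lborel)) =
     TMQ_local A V nablaV (restrict_triv k \<tau>) u e ts"
    and "pt y \<in> fib E u" and "set (map (lift y) ts @ map (vert y) [k..<n]) \<subseteq> total_tangent A E u (pt y)"
proof -
  let ?\<rho> = "restrict_triv k \<tau>"
  let ?N = "length ts"
  define m where "m = n - k"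
  have kn: "n = k + m" using rk_le by (simp add: m_def k_def n_def)
  note l = splittingD(1)[OF s]
  note lin = local_triv_linear[OF l]
  have fr: "frame E \<tau> u j \<in> fib E u" if "j < n" for j using frame_in[OF lin u] that by (simp add: n_def)
  have sm: "(\<Sum>j\<in>{k..<n}. y j *\<^sub>R frame E \<tau> u j) \<in> fib E u" for y :: "nat \<Rightarrow> real"
    using fr by (intro subspace_sum subspace_scale sub) auto
  have pt: "pt y \<in> fib E u" for y unfolding pt_def by (rule subspace_add[OF sub V_in_E[OF e] sm])
  thus "pt y \<in> fib E u" .
  have e0: "snd \<tau> u e i = 0" if "i \<in> {k..<n}" for i
    using e that unfolding splittingD(3)[OF s u] k_def n_def by blast
  have x: "snd \<tau> u (pt y) i = (if i < k then snd \<tau> u e i else y i)" if i: "i < n" for y i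
  proof -
    have "snd \<tau> u (pt y) i = snd \<tau> u e i + snd \<tau> u (\<Sum>j\<in>{k..<n}. y j *\<^sub>R frame E \<tau> u j) i"
      using triv_linear[OF lin u V_in_E[OF e] sm, of 1] unfolding pt_def by simp
    also have "snd \<tau> u (\<Sum>j\<in>{k..<n}. y j *\<^sub>R frame E \<tau> u j) i = (\<Sum>j\<in>{k..<n}. y j * snd \<tau> u (frame E \<tau> u j) i)"
      using fr by (intro triv_sum[OF lin u sub]) auto
    also have "\<dots> = (\<Sum>j\<in>{k..<n}. if j = i then y j else 0)"
      using frame_coord[OF lin u] by (intro sum.cong refl) (simp add: n_def)
    also have "\<dots> = (if i < k then 0 else y i)" using i by simp
    finally show ?thesis using e0[of i] i by auto
  qed
  have tb: "fst t \<in> tangent_space A u" if "t \<in> set ts" for t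
    using total_tangentD(1)[OF vbV, of t u e] ts that by blast
  have lft: "lift y t \<in> total_tangent A E u (pt y)" "fst (lift y t) = fst t"
      "i < n \<Longrightarrow> snd (lift y t) \<tau> i = (if i < k then snd t ?\<rho> i else 0)" if "t \<in> set ts" for t y i
    unfolding lift_def n_def using tangent_vec[OF vbE l u pt tb[OF that]] by simp_all
  have vrt: "vert y j \<in> total_tangent A E u (pt y)" "fst (vert y j) = (\<lambda>f. 0)"
      "i < n \<Longrightarrow> snd (vert y j) \<tau> i = (if i = j then 1 else 0)" for y i j
    unfolding vert_def n_def using tangent_vec[OF vbE l u pt zero_tangent] by simp_all
  show "set (map (lift y) ts @ map (vert y) [k..<n]) \<subseteq> total_tangent A E u (pt y)"
    using lft(1) vrt(1) by auto
  define L where "L = (\<lambda>y. map (lift y) ts @ map (vert y) [k..<n])"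
  have lenL: "length (L y) = ?N + m" for y by (simp add: L_def m_def)
  define d where "d = (\<lambda>y i t. snd t \<tau> i + (\<Sum>j<n. \<theta> \<tau> i j u (fst t) * snd \<tau> u (pt y) j))"
  define dV where "dV = (\<lambda>i t. snd t ?\<rho> i + (\<Sum>j<k. conn_form V nablaV ?\<rho> i j u (fst t) * snd ?\<rho> u e j))"
  define s where "s = (\<lambda>j i. emb ts (form1 (\<lambda>t :: ('m, 'v) ttvec. \<theta> \<tau> i j u (fst t))))"
  define D where "D = (\<lambda>i. emb ts (form1 (dV i)))"
  define Om where "Om = (\<lambda>i j. emb ts (form2 (\<lambda>s t. curv_form A V nablaV ?\<rho> i j u (fst s) (fst t))))"
  define OmE where "OmE = (\<lambda>i j. emb ts (form2 (\<lambda>s t. curv_form A E nabla \<tau> i j u (fst s) (fst t))))"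
  define c where "c = (\<lambda>y i. emb ts (form1 (\<lambda>t. d y i (lift y t))))"
  \<comment> \<open>The vertical vectors see \<open>dy\<close> only, because \<open>\<theta>\<close> is pulled back from the base and their projection to it is \<open>0\<close>.\<close>
  have Dsplit: "emb (L y) (form1 (d y i)) = c y i + (\<Sum>q<m. (if i = k + q then 1 else 0) *\<^sub>R gen (?N + q))"
    if i: "i < n" for y i
  proof -
    have v: "d y i (vert y j) = (if i = j then 1 else 0)" if "j < n" for j
      unfolding d_def vrt(2) using vrt(3)[OF i] conn_form_zero_vec[OF l u] by (simp add: n_def)
    have "(\<Sum>q<length (map (vert y) [k..<n]). d y i (map (vert y) [k..<n] ! q) *\<^sub>R gen (length (map (lift y) ts) + q)) =
        (\<Sum>q<m. (if i = k + q then 1 else 0) *\<^sub>R gen (?N + q))"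
      using v by (intro sum.cong) (auto simp: m_def)
    thus ?thesis unfolding L_def emb_form1_append emb_form1_map c_def by simp
  qed
  have D1: "emb (L y) (form1 (d y i)) = D i + (\<Sum>j\<in>{k..<k+m}. y j *\<^sub>R s j i)" if i: "i < k" for y i
  proof -
    have iE: "i < n" using i kn by simp
    have "(\<Sum>q<m. (if i = k + q then 1 else 0) *\<^sub>R gen (?N + q)) = (\<Sum>q<m. 0)" using i by (intro sum.cong refl) auto
    hence "emb (L y) (form1 (d y i)) = c y i" unfolding Dsplit[OF iE] by simp
    \<comment> \<open>The index \<open>n\<close>, which is not a coordinate, stands for the summand that belongs to \<open>V\<close>.\<close>
    also have "\<dots> = (\<Sum>j\<in>insert n {k..<n}. (if j = n then 1 else y j) *\<^sub>R
        emb ts (form1 (if j = n then dV i else (\<lambda>t. \<theta> \<tau> i j u (fst t)))))"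
      unfolding c_def
    proof (rule emb_form1_sum)
      fix t assume t: "t \<in> set ts"
      have un: "{..<n} = {..<k} \<union> {k..<n}" using kn by auto
      have "d y i (lift y t) = snd t ?\<rho> i + ((\<Sum>j<k. \<theta> \<tau> i j u (fst t) * snd \<tau> u (pt y) j)
          + (\<Sum>j\<in>{k..<n}. \<theta> \<tau> i j u (fst t) * snd \<tau> u (pt y) j))"
        unfolding d_def lft(2)[OF t] un using lft(3)[OF t iE] i by (subst sum.union_disjoint) auto
      also have "(\<Sum>j<k. \<theta> \<tau> i j u (fst t) * snd \<tau> u (pt y) j) = (\<Sum>j<k. conn_form V nablaV ?\<rho> i j u (fst t) * snd ?\<rho> u e j)"
      proof (intro sum.cong refl)
        fix j assume "j \<in> {..<k}"
        hence j: "j < k" by simp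
        show "\<theta> \<tau> i j u (fst t) * snd \<tau> u (pt y) j = conn_form V nablaV ?\<rho> i j u (fst t) * snd ?\<rho> u e j"
          using conn_form_restrict[OF assms(1) u _ _ tb[OF t], of i j] i j x[of j y] kn
          by (simp add: k_def restrict_triv_def)
      qed
      also have "(\<Sum>j\<in>{k..<n}. \<theta> \<tau> i j u (fst t) * snd \<tau> u (pt y) j) = (\<Sum>j\<in>{k..<n}. y j * \<theta> \<tau> i j u (fst t))"
        using x by (intro sum.cong refl) simp
      finally have "d y i (lift y t) = dV i t + (\<Sum>j\<in>{k..<n}. y j * \<theta> \<tau> i j u (fst t))" by (simp add: dV_def)
      also have "\<dots> = (\<Sum>j\<in>insert n {k..<n}. (if j = n then 1 else y j) * (if j = n then dV i else (\<lambda>t. \<theta> \<tau> i j u (fst t))) t)"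
        by (subst sum.insert) (auto intro!: sum.cong)
      finally show "d y i (lift y t) = \<dots>" .
    qed
    also have "\<dots> = D i + (\<Sum>j\<in>{k..<n}. y j *\<^sub>R s j i)"
      by (subst sum.insert) (auto simp: D_def s_def intro!: sum.cong)
    finally show ?thesis unfolding kn .
  qed
  have D2: "emb (L y) (form1 (d y (k + q))) = c y (k + q) + gen (?N + q)" if q: "q < m" for y q
  proof -
    have "(\<Sum>q'<m. (if k + q = k + q' then 1 else 0) *\<^sub>R gen (?N + q')) = (\<Sum>q'<m. if q' = q then gen (?N + q') else 0)"
      by (intro sum.cong refl) auto
    also have "\<dots> = gen (?N + q)" using q by simp
    finally show ?thesis using Dsplit[of "k + q" y] q kn by simp
  qed
  \<comment> \<open>The curvature is pulled back from the base, so the vertical vectors do not contribute.\<close>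
  have O1: "emb (L y) (form2 (\<lambda>s t. curv_form A E nabla \<tau> i j u (fst s) (fst t))) = OmE i j"
    if i: "i < n" and j: "j < n" for y i j
  proof -
    have "emb (L y) (form2 (\<lambda>s t. curv_form A E nabla \<tau> i j u (fst s) (fst t))) =
        emb (map (lift y) ts) (form2 (\<lambda>s t. curv_form A E nabla \<tau> i j u (fst s) (fst t)))"
      unfolding L_def
    proof (rule emb_form2_append)
      fix s t assume t: "t \<in> set (map (vert y) [k..<n])" and s: "s \<in> set (map (lift y) ts @ map (vert y) [k..<n])"
      have "fst t = (\<lambda>f. 0)" using t vrt(2) by auto
      moreover have "fst s \<in> tangent_space A u" using s lft(2) tb vrt(2) zero_tangent by auto
      ultimately show "curv_form A E nabla \<tau> i j u (fst s) (fst t) = 0"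
        using curv_form_zero_vec[OF l u] i j by (simp add: n_def)
    qed
    also have "\<dots> = OmE i j"
      unfolding OmE_def emb_form2_map
      using emb_form2_sum[of ts "\<lambda>s t. curv_form A E nabla \<tau> i j u (fst (lift y s)) (fst (lift y t))" "\<lambda>_. 1"
          "\<lambda>_ s t. curv_form A E nabla \<tau> i j u (fst s) (fst t)" "{0::nat}"] lft(2) by simp
    finally show ?thesis .
  qed
  have O2: "OmE i j = Om i j - (\<Sum>p\<in>{k..<k+m}. s p i * s p j)" if i: "i < k" and j: "j < k" for i j
  proof -
    let ?f = "\<lambda>p (s :: ('m, 'v) ttvec) (t :: ('m, 'v) ttvec). \<theta> \<tau> i p u (fst s) * \<theta> \<tau> j p u (fst t) - \<theta> \<tau> i p u (fst t) * \<theta> \<tau> j p u (fst s)"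
    \<comment> \<open>Again \<open>n\<close> stands for the summand that belongs to \<open>V\<close>.\<close>
    have "OmE i j = (\<Sum>p\<in>insert n {k..<n}. (if p = n then 1 else -1) *\<^sub>R
        emb ts (form2 (if p = n then (\<lambda>s t. curv_form A V nablaV ?\<rho> i j u (fst s) (fst t)) else ?f p)))"
      unfolding OmE_def
    proof (rule emb_form2_sum)
      fix s t assume st: "s \<in> set ts" "t \<in> set ts"
      have "curv_form A E nabla \<tau> i j u (fst s) (fst t) =
          curv_form A V nablaV ?\<rho> i j u (fst s) (fst t) + (\<Sum>p\<in>{k..<n}. - ?f p s t)"
        using curv_form_restrict[OF assms(1) u _ _ tb[OF st(1)] tb[OF st(2)], of i j] i j
        unfolding k_def n_def sum_negf by simp
      also have "\<dots> = (\<Sum>p\<in>insert n {k..<n}. (if p = n then 1 else -1) *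
          (if p = n then (\<lambda>s t. curv_form A V nablaV ?\<rho> i j u (fst s) (fst t)) else ?f p) s t)"
        by (subst sum.insert) (auto intro!: sum.cong)
      finally show "curv_form A E nabla \<tau> i j u (fst s) (fst t) = \<dots>" .
    qed
    also have "\<dots> = Om i j + (\<Sum>p\<in>{k..<n}. - emb ts (form2 (?f p)))"
      by (subst sum.insert) (auto simp: Om_def intro!: sum.cong)
    also have "(\<Sum>p\<in>{k..<n}. - emb ts (form2 (?f p))) = - (\<Sum>p\<in>{k..<k+m}. s p i * s p j)"
      unfolding s_def emb_form1_times sum_negf kn ..
    finally show ?thesis by simp
  qed
  define C where "C = pi powr (- real n / 2) * exp (- (\<Sum>i<k. (snd ?\<rho> u e i)\<^sup>2))"
  have integrand: "TMQ_local A E nabla \<tau> u (pt y) (L y) = C * (exp (- (\<Sum>j\<in>{k..<k+m}. (y j)\<^sup>2)) *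
      coef (mq k (\<lambda>i. D i + (\<Sum>j\<in>{k..<k+m}. y j *\<^sub>R s j i)) (\<lambda>i j. Om i j - (\<Sum>p\<in>{k..<k+m}. s p i * s p j))) {..<?N})" for y
  proof -
    have un: "{..<n} = {..<k} \<union> {k..<k+m}" using kn by auto
    have "(\<Sum>i<n. (snd \<tau> u (pt y) i)\<^sup>2) = (\<Sum>i<k. (snd \<tau> u (pt y) i)\<^sup>2) + (\<Sum>i\<in>{k..<k+m}. (snd \<tau> u (pt y) i)\<^sup>2)"
      unfolding un by (rule sum.union_disjoint) auto
    also have "(\<Sum>i<k. (snd \<tau> u (pt y) i)\<^sup>2) = (\<Sum>i<k. (snd ?\<rho> u e i)\<^sup>2)"
      using x kn by (intro sum.cong refl) (simp add: restrict_triv_def)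
    also have "(\<Sum>i\<in>{k..<k+m}. (snd \<tau> u (pt y) i)\<^sup>2) = (\<Sum>j\<in>{k..<k+m}. (y j)\<^sup>2)"
      using x kn by (intro sum.cong refl) simp
    finally have ex: "exp (- (\<Sum>i<n. (snd \<tau> u (pt y) i)\<^sup>2)) =
        exp (- (\<Sum>i<k. (snd ?\<rho> u e i)\<^sup>2)) * exp (- (\<Sum>j\<in>{k..<k+m}. (y j)\<^sup>2))" by (simp add: exp_add[symmetric])
    let ?D = "\<lambda>i. emb (L y) (form1 (d y i))"
    let ?O = "\<lambda>i j. emb (L y) (form2 (\<lambda>s t. curv_form A E nabla \<tau> i j u (fst s) (fst t)))"
    have "coef (mq n ?D ?O) {..<?N + m} = coef (mq k ?D ?O) {..<?N}"
      unfolding kn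
    proof (rule mq_vertical)
      fix i assume i: "i < k"
      show "odd_elem (?D i)" by (rule odd_emb_form1)
      show "in_vars {..<?N} (?D i)" unfolding D1[OF i] D_def s_def
        by (intro in_vars_add in_vars_sum in_vars_scaleR in_vars_emb)
    next
      fix j assume j: "j < m"
      show "?D (k + j) = c y (k + j) + gen (?N + j)" by (rule D2[OF j])
      show "odd_elem (c y (k + j))" "in_vars {..<?N} (c y (k + j))"
        unfolding c_def by (rule odd_emb_form1, rule in_vars_emb)
    next
      fix i j assume ij: "i < k + m" "j < k + m"
      show "even_elem (?O i j)" by (rule even_emb_form2)
      show "in_vars {..<?N} (?O i j)" using O1[of i j y] ij kn unfolding OmE_def by (simp add: in_vars_emb)
    qed
    also have "mq k ?D ?O = mq k (\<lambda>i. D i + (\<Sum>j\<in>{k..<k+m}. y j *\<^sub>R s j i)) (\<lambda>i j. Om i j - (\<Sum>p\<in>{k..<k+m}. s p i * s p j))"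
    proof (rule mq_cong)
      fix i j assume "i < k" "j < k"
      thus "?O i j = Om i j - (\<Sum>p\<in>{k..<k+m}. s p i * s p j)" using O1[of i j y] O2[of i j] kn by simp
    qed (rule D1)
    finally have mq: "coef (mq n ?D ?O) {..<?N + m} =
      coef (mq k (\<lambda>i. D i + (\<Sum>j\<in>{k..<k+m}. y j *\<^sub>R s j i)) (\<lambda>i j. Om i j - (\<Sum>p\<in>{k..<k+m}. s p i * s p j))) {..<?N}" .
    have "TMQ_local A E nabla \<tau> u (pt y) (L y) = pi powr (- real n / 2) * exp (- (\<Sum>i<n. (snd \<tau> u (pt y) i)\<^sup>2)) *
        coef (mq n ?D ?O) {..<?N + m}"
      unfolding TMQ_local_eq_mq lenL n_def[symmetric] d_def ..
    thus ?thesis unfolding ex mq C_def by (simp only: mult.assoc)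
  qed
  have "(\<integral>y. TMQ_local A E nabla \<tau> u (pt y) (L y) \<partial>(\<Pi>\<^sub>M j\<in>{k..<n}. lborel)) =
     C * (sqrt pi ^ m * coef (mq k D Om) {..<?N})"
    unfolding integrand integral_mult_right_zero kn
    by (intro arg_cong[of _ _ "(*) C"] mq_gaussian)
      (auto simp: D_def Om_def s_def odd_emb_form1 in_vars_emb even_emb_form2)
  also have "\<dots> = (pi powr (- real (k + m) / 2) * sqrt pi ^ m) * exp (- (\<Sum>i<k. (snd ?\<rho> u e i)\<^sup>2)) * coef (mq k D Om) {..<?N}"
    unfolding C_def kn by (simp only: mult_ac)
  also have "\<dots> = TMQ_local A V nablaV ?\<rho> u e ts"
    unfolding pi_powr_split TMQ_local_eq_mq k_def[symmetric] D_def Om_def dV_def ..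
  finally show "(\<integral>y. TMQ_local A E nabla \<tau> u (pt y) (map (lift y) ts @ map (vert y) [k..<n]) \<partial>(\<Pi>\<^sub>M j\<in>{k..<n}. lborel)) =
     TMQ_local A V nablaV ?\<rho> u e ts" unfolding L_def .
qed

end

section \<open>Comparison of the orientations\<close>

context metric_bundle
begin

lemma orientation_transition:
  assumes ori: "orientation A E ori" and \<tau>: "local_triv A E \<tau>" "u \<in> fst \<tau>"
    and c: "compatible_triv A E g ori \<tau>'" "u \<in> fst \<tau>'"
  shows "ori u (map (frame E \<tau> u) [0..<rk E]) = sgn (det_of (rk E) (\<lambda>i j. transition E \<tau> \<tau>' i j u))"
proof -
  note lin = local_triv_linear[OF \<tau>(1)]
  have lin': "linear_triv E \<tau>'" using c(1) local_triv_linear unfolding compatible_triv_def by blast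
  have "ori u (map (frame E \<tau> u) [0..<rk E]) =
      sgn (det_of (rk E) (\<lambda>i j. transition E \<tau> \<tau>' i j u)) * ori u (map (frame E \<tau>' u) [0..<rk E])"
  proof (rule orientation_change[OF ori])
    show "set (map (frame E \<tau>' u) [0..<rk E]) \<subseteq> fib E u" using frame_in[OF lin' c(2)] by auto
    fix j assume j: "j < rk E"
    have "frame E \<tau> u j = (\<Sum>l<rk E. snd \<tau>' u (frame E \<tau> u j) l *\<^sub>R frame E \<tau>' u l)"
      by (rule triv_expand[OF lin' c(2) sub frame_in[OF lin \<tau>(2) j]])
    thus "map (frame E \<tau> u) [0..<rk E] ! j = (\<Sum>l<rk E. transition E \<tau> \<tau>' l j u *\<^sub>R map (frame E \<tau>' u) [0..<rk E] ! l)"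
      using j by (simp add: transition_def)
  qed simp_all
  thus ?thesis using c unfolding compatible_triv_def by simp
qed

end

context connection_bundle
begin

text \<open>The sign makes the chosen compatible trivialization replaceable by any orthonormal one, in particular
by one that splits and may have either orientation.\<close>

lemma TMQ_orthonormal:
  assumes ori: "orientation A E ori" and o: "orthonormal_triv E g \<tau>" and l: "local_triv A E \<tau>" "u \<in> fst \<tau>"
    and e: "e \<in> fib E u" and ts: "set ts \<subseteq> total_tangent A E u e"
  shows "TMQ A E g ori nabla u e ts = ori u (map (frame E \<tau> u) [0..<rk E]) * TMQ_local A E nabla \<tau> u e ts"
    and "ori u (map (frame E \<tau> u) [0..<rk E]) \<in> {1, -1}"
proof -
  let ?\<tau> = "SOME \<tau>. compatible_triv A E g ori \<tau> \<and> u \<in> fst \<tau>"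
  have c: "compatible_triv A E g ori ?\<tau>" "u \<in> fst ?\<tau>" using someI_ex[OF compatible_exists[OF ori, of u]] by blast+
  have c': "local_triv A E ?\<tau>" "orthonormal_triv E g ?\<tau>" using c(1) unfolding compatible_triv_def by blast+
  let ?d = "det_of (rk E) (\<lambda>i j. transition E \<tau> ?\<tau> i j u)"
  have "?d \<in> {1, -1}"
    by (rule det_orthogonal) (rule transition_orthogonal[OF o l c'(2) c'(1) c(2)])
  hence d: "sgn ?d = ?d" "?d \<in> {1, -1}" by auto
  have or: "ori u (map (frame E \<tau> u) [0..<rk E]) = ?d"
    using orientation_transition[OF ori l c] d(1) by simp
  show "ori u (map (frame E \<tau> u) [0..<rk E]) \<in> {1, -1}" unfolding or by (rule d(2))
  show "TMQ A E g ori nabla u e ts = ori u (map (frame E \<tau> u) [0..<rk E]) * TMQ_local A E nabla \<tau> u e ts"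
    unfolding TMQ_def or by (rule TMQ_local_change[OF o l c'(2) c'(1) c(2) e ts])
qed

end

context subbundle_setup
begin

text \<open>The positive basis of \<open>V\<close> in the definition of the complementary orientation is related to the first
\<open>rk V\<close> members of the frame by a matrix whose determinant has the sign \<open>oV\<close> of these members. Extended
by the identity, the same matrix relates the bases of \<open>E\<close>.\<close>

lemma complementary_orientation_frame:
  assumes oE: "orientation A E oE" and oV: "orientation A V oV"
    and s: "splitting_triv A E V g \<tau>" and u: "u \<in> fst \<tau>"
  shows "complementary_orientation V oE oV u (map (frame E \<tau> u) [rk V..<rk E]) =
     oV u (map (frame V (restrict_triv (rk V) \<tau>) u) [0..<rk V]) * oE u (map (frame E \<tau> u) [0..<rk E])"
proof -
  let ?k = "rk V" and ?n = "rk E" and ?\<rho> = "restrict_triv (rk V) \<tau>"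
  let ?P = "\<lambda>xs. length xs = ?k \<and> set xs \<subseteq> fib V u \<and> oV u xs = 1"
  note l = splittingD(1)[OF s]
  note lin = local_triv_linear[OF l]
  have lV: "local_triv A V ?\<rho>" "u \<in> fst ?\<rho>" using restrict_local(1)[OF s] u by (simp_all add: restrict_triv_def)
  note linV = local_triv_linear[OF lV(1)]
  define xs where "xs = (SOME xs. ?P xs)"
  obtain \<tau>V where c: "compatible_triv A V g oV \<tau>V" "u \<in> fst \<tau>V" using VB.compatible_exists[OF oV] by blast
  have "?P (map (frame V \<tau>V u) [0..<?k])"
    using c frame_in[OF local_triv_linear c(2)] unfolding compatible_triv_def by auto
  hence xs: "length xs = ?k" "set xs \<subseteq> fib V u" "oV u xs = 1" unfolding xs_def by (metis (mono_tags, lifting) someI)+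
  define P where "P = (\<lambda>i j. snd \<tau> u (xs ! j) i)"
  let ?d = "det_of ?k (\<lambda>i j. P i j)"
  have xV: "xs ! j \<in> fib V u" if "j < ?k" for j using xs(1,2) that by auto
  have P: "xs ! j = (\<Sum>i<?k. P i j *\<^sub>R frame E \<tau> u i)" if j: "j < ?k" for j
  proof -
    have "xs ! j = (\<Sum>i<?n. P i j *\<^sub>R frame E \<tau> u i)"
      unfolding P_def by (rule triv_expand[OF lin u sub V_in_E[OF xV[OF j]]])
    also have "\<dots> = (\<Sum>i<?k. P i j *\<^sub>R frame E \<tau> u i)"
      using rk_le xV[OF j] unfolding splittingD(3)[OF s u] P_def by (intro sum.mono_neutral_right) auto
    finally show ?thesis .
  qed
  have "oV u xs = sgn ?d * oV u (map (frame V ?\<rho> u) [0..<?k])"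
  proof (rule VB.orientation_change[OF oV _ _ xs(1)])
    show "set (map (frame V ?\<rho> u) [0..<?k]) \<subseteq> fib V u" using frame_in[OF linV lV(2)] by auto
    fix j assume j: "j < ?k"
    show "xs ! j = (\<Sum>l<?k. P l j *\<^sub>R map (frame V ?\<rho> u) [0..<?k] ! l)"
      unfolding P[OF j] using restrict_local(2)[OF s u] by (intro sum.cong refl) simp
  qed simp
  hence 1: "sgn ?d * oV u (map (frame V ?\<rho> u) [0..<?k]) = 1" using xs(3) by simp
  have "oE u (xs @ map (frame E \<tau> u) [?k..<?n]) =
      sgn (det_of ?n (\<lambda>i j. if j < ?k then (if i < ?k then P i j else 0) else (if i = j then 1 else 0)))
       * oE u (map (frame E \<tau> u) [0..<?n])"
  proof (rule orientation_change[OF oE])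
    show "set (map (frame E \<tau> u) [0..<?n]) \<subseteq> fib E u" using frame_in[OF lin u] by auto
    show "length (xs @ map (frame E \<tau> u) [?k..<?n]) = ?n" using xs(1) rk_le by simp
    fix j assume j: "j < ?n"
    show "(xs @ map (frame E \<tau> u) [?k..<?n]) ! j =
        (\<Sum>i<?n. (if j < ?k then (if i < ?k then P i j else 0) else (if i = j then 1 else 0)) *\<^sub>R map (frame E \<tau> u) [0..<?n] ! i)"
    proof (cases "j < ?k")
      case True
      have "(\<Sum>i<?k. P i j *\<^sub>R frame E \<tau> u i) = (\<Sum>i<?n. (if i < ?k then P i j else 0) *\<^sub>R map (frame E \<tau> u) [0..<?n] ! i)"
        using rk_le by (intro sum.mono_neutral_cong_left) auto
      thus ?thesis using P[OF True] True xs(1) by (simp add: nth_append)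
    next
      case False
      have "(\<Sum>i<?n. (if i = j then 1 else 0) *\<^sub>R map (frame E \<tau> u) [0..<?n] ! i) = (\<Sum>i<?n. if i = j then frame E \<tau> u i else 0)"
        by (intro sum.cong refl) simp
      also have "\<dots> = frame E \<tau> u j" using j by simp
      finally show ?thesis using False xs(1) j by (simp add: nth_append)
    qed
  qed simp
  also have "\<dots> = sgn ?d * oE u (map (frame E \<tau> u) [0..<?n])" unfolding det_block_id[OF rk_le] ..
  finally have 2: "complementary_orientation V oE oV u (map (frame E \<tau> u) [?k..<?n]) = sgn ?d * oE u (map (frame E \<tau> u) [0..<?n])"
    unfolding complementary_orientation_def xs_def .
  \<comment> \<open>The number \<open>sgn ?d\<close> is \<open>1\<close>, \<open>-1\<close> or \<open>0\<close>, so it equals its inverse.\<close>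
  have "sgn ?d = oV u (map (frame V ?\<rho> u) [0..<?k])" using 1 by (cases "?d > 0"; cases "?d = 0") (auto simp: sgn_if)
  thus ?thesis using 2 by simp
qed

text \<open>Both sides are evaluated in the splitting trivialization used by the fiber integral. The sign for \<open>E\<close>
then occurs twice, in the integrand and in the complementary orientation, and cancels.\<close>

theorem TMQ_fiber_integral:
  assumes oE: "orientation A E oE" and oV: "orientation A V oV"
    and e: "e \<in> fib V u" and ts: "set ts \<subseteq> total_tangent A V u e"
  shows "TMQ A V g oV nablaV u e ts = fiber_integral A E V g (complementary_orientation V oE oV) (TMQ A E g oE nabla) u e ts"
proof -
  let ?k = "rk V" and ?n = "rk E"
  define \<tau> where "\<tau> = (SOME \<tau>. splitting_triv A E V g \<tau> \<and> u \<in> fst \<tau>)"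
  have s: "splitting_triv A E V g \<tau>" and u: "u \<in> fst \<tau>"
    unfolding \<tau>_def using someI_ex[OF splitting_exists[of u]] by blast+
  let ?\<rho> = "restrict_triv ?k \<tau>"
  define pt where "pt = (\<lambda>y. e + (\<Sum>j\<in>{?k..<?n}. y j *\<^sub>R frame E \<tau> u j))"
  define L where "L = (\<lambda>y. map (\<lambda>t. tangent_vec A E u (pt y) \<tau> (fst t) (\<lambda>i. if i < ?k then snd t ?\<rho> i else 0)) ts
      @ map (\<lambda>j. tangent_vec A E u (pt y) \<tau> (\<lambda>f. 0) (\<lambda>i. if i = j then 1 else 0)) [?k..<?n])"
  define a where "a = oV u (map (frame V ?\<rho> u) [0..<?k])"
  define b where "b = oE u (map (frame E \<tau> u) [0..<?n])"
  have lV: "local_triv A V ?\<rho>" "u \<in> fst ?\<rho>" using restrict_local(1)[OF s] u by (simp_all add: restrict_triv_def)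
  note V = VC.TMQ_orthonormal(1)[OF oV restrict_orthonormal[OF s] lV e ts]
  note I = TMQ_local_integral[OF s u e ts]
  have E: "TMQ A E g oE nabla u (pt y) (L y) = b * TMQ_local A E nabla \<tau> u (pt y) (L y)" for y
    unfolding b_def pt_def L_def by (rule TMQ_orthonormal(1)[OF oE splittingD(2,1)[OF s] u I(2,3)])
  have "b \<in> {1, -1}"
    unfolding b_def by (rule TMQ_orthonormal(2)[OF oE splittingD(2,1)[OF s] u V_in_E[OF e], of "[]" ]) simp
  hence b: "b * b = 1" by auto
  have "fiber_integral A E V g (complementary_orientation V oE oV) (TMQ A E g oE nabla) u e ts =
      complementary_orientation V oE oV u (map (frame E \<tau> u) [?k..<?n]) *
      (\<integral>y. TMQ A E g oE nabla u (pt y) (L y) \<partial>(\<Pi>\<^sub>M j\<in>{?k..<?n}. lborel))"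
    unfolding fiber_integral_def Let_def \<tau>_def[symmetric] pt_def L_def ..
  also have "\<dots> = (a * b) * (b * TMQ_local A V nablaV ?\<rho> u e ts)"
    unfolding E integral_mult_right_zero complementary_orientation_frame[OF oE oV s u] a_def[symmetric] b_def[symmetric]
    using I(1) unfolding pt_def L_def by simp
  also have "\<dots> = a * TMQ_local A V nablaV ?\<rho> u e ts" using b by (simp add: mult.assoc[symmetric])
  finally show ?thesis using V unfolding a_def by simp
qed

end

theorem theorem3:
  fixes A :: "('m::{t2_space,second_countable_topology}, 'e::real_inner) chart set"
    and E V :: "('m, 'v::real_vector) vbundle"
    and g :: "'m \<Rightarrow> 'v \<Rightarrow> 'v \<Rightarrow> real"
    and nabla :: "('m, 'v) covd"
    and oE oV :: "('m, 'v) orient"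
  assumes "smooth_manifold A"
    and "vector_bundle A E"
    and "bundle_metric A E g"
    and "metric_connection A E g nabla"
    and "subbundle A V E"
    and "orientation A E oE"
    and "orientation A V oV"
  shows "\<forall>u. \<forall>e\<in>fib V u. \<forall>ts. set ts \<subseteq> total_tangent A V u e \<longrightarrow>
           TMQ A V g oV (constrained_connection E V g nabla) u e ts =
           fiber_integral A E V g (complementary_orientation V oE oV) (TMQ A E g oE nabla) u e ts"
proof -
  interpret subbundle_setup A E g nabla V
    by unfold_locales (fact assms)+
  show ?thesis using TMQ_fiber_integral[OF assms(6,7)] by blast
qed

end
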